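(* Let $\alpha\in(1,2)$, let $L^{(\alpha)}$ be the strictly $\alpha$-stable Lévy process without negative jumps, starting from one, normalized as in the context, let $T=\inf\{t>0:\ L^{(\alpha)}_t=0\}$ and $\mathcal{A}_\alpha=\int_0^T L^{(\alpha)}_s\,ds$. The density $f_{\mathcal{A}_\alpha}$ of $\mathcal{A}_\alpha$ satisfies $$f_{\mathcal{A}_\alpha}(x)\ \sim\ \kappa_\alpha\,x^{\frac{\alpha^2}{1-\alpha^2}}\,e^{-c_\alpha x^{\frac{1}{1-\alpha}}}\qquad\text{as } x\to 0+,$$ with $$\kappa_\alpha=\frac{\Gamma\left(\frac{\alpha}{\alpha+1}\right)\sqrt{\frac{\alpha+1}{\alpha-1}}}{2\pi\,(\alpha+1)^{\frac{\alpha}{\alpha^2-1}}}\qquad\text{and}\qquad c_\alpha=(\alpha-1)(\alpha+1)^{\frac{\alpha}{1-\alpha}}.$$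
   Context: For $\alpha\in(1,2)$, $\{L^{(\alpha)}_t,\ t\ge 0\}$ denotes a strictly $\alpha$-stable Lévy process without negative jumps (spectrally positive), started from $L^{(\alpha)}_0=1$, with the normalization $\mathbb{E}[e^{-\lambda (L^{(\alpha)}_1-L^{(\alpha)}_0)}]=e^{\lambda^\alpha}$ for all $\lambda\ge 0$. The random variable $\mathcal{A}_\alpha$ is absolutely continuous, and $f_{\mathcal{A}_\alpha}$ denotes the version of its density that is continuous on $(0,\infty)$. The notation $f(x)\sim g(x)$ means $f(x)/g(x)\to 1$. *)

theory Defs
  imports "HOL-Probability.Probability" "HOL-Library.Landau_Symbols"
begin

definition cadlag :: "(real \<Rightarrow> real) \<Rightarrow> bool" where
  "cadlag p \<longleftrightarrow>
     (\<forall>t\<ge>0. (p \<longlongrightarrow> p t) (at_right t)) \<and>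
     (\<forall>t>0. \<exists>l. (p \<longlongrightarrow> l) (at_left t))"

text \<open>For a cadlag path, \<open>Lim (at_left t) p\<close> is the left limit \<open>p(t-)\<close> whenever \<open>t > 0\<close>.\<close>

definition jump :: "(real \<Rightarrow> real) \<Rightarrow> real \<Rightarrow> real" where
  "jump p t = p t - Lim (at_left t) p"

text \<open>
  Processes are indexed by \<open>real\<close>, but only times \<open>t \<ge> 0\<close> are constrained.
  Since the starting point is deterministic, it need not appear in the independence condition.
  Stochastic continuity follows from stationary increments and cadlag paths.
\<close>

locale levy_process = prob_space M for M :: "'a measure" +
  fixes start :: real and L :: "real \<Rightarrow> 'a \<Rightarrow> real"
  assumes random_variable_L: "t \<ge> 0 \<Longrightarrow> random_variable borel (L t)"
    and AE_start: "AE \<omega> in M. L 0 \<omega> = start"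
    and independent_increments:
      "0 \<le> u 0 \<Longrightarrow> (\<And>i. i < n \<Longrightarrow> u i \<le> u (Suc i)) \<Longrightarrow>
         indep_vars (\<lambda>_. borel) (\<lambda>i \<omega>. L (u (Suc i)) \<omega> - L (u i) \<omega>) {..<(n :: nat)}"
    and stationary_increments:
      "0 \<le> s \<Longrightarrow> 0 \<le> h \<Longrightarrow>
         distr M borel (\<lambda>\<omega>. L (s + h) \<omega> - L s \<omega>) = distr M borel (\<lambda>\<omega>. L h \<omega> - L 0 \<omega>)"
    and AE_cadlag: "AE \<omega> in M. cadlag (\<lambda>t. L t \<omega>)"

text \<open>
  Strict stability with index \<open>\<alpha>\<close>: the processes \<open>(X (c t))\<^sub>t\<close> and \<open>(c powr (1/\<alpha>) * X t)\<^sub>t\<close>, where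
  \<open>X t = L t - L 0\<close>, have the same finite-dimensional distributions for every \<open>c > 0\<close>.
\<close>

locale strictly_stable_levy_process = levy_process M start L
  for M :: "'a measure" and start :: real and L :: "real \<Rightarrow> 'a \<Rightarrow> real" +
  fixes \<alpha> :: real
  assumes strictly_stable:
    "c > 0 \<Longrightarrow> finite J \<Longrightarrow> J \<subseteq> {0..} \<Longrightarrow>
       distr M (Pi\<^sub>M J (\<lambda>_. borel)) (\<lambda>\<omega>. \<lambda>t\<in>J. L (c * t) \<omega> - L 0 \<omega>) =
       distr M (Pi\<^sub>M J (\<lambda>_. borel)) (\<lambda>\<omega>. \<lambda>t\<in>J. c powr (1 / \<alpha>) * (L t \<omega> - L 0 \<omega>))"

locale spectrally_positive_stable_process = strictly_stable_levy_process M start L \<alpha>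
  for M :: "'a measure" and start :: real and L :: "real \<Rightarrow> 'a \<Rightarrow> real" and \<alpha> :: real +
  assumes AE_no_negative_jumps: "AE \<omega> in M. \<forall>t>0. jump (\<lambda>s. L s \<omega>) t \<ge> 0"
    and normalization:
      "l \<ge> 0 \<Longrightarrow> expectation (\<lambda>\<omega>. exp (- l * (L 1 \<omega> - L 0 \<omega>))) = exp (l powr \<alpha>)"

text \<open>Extended-real valued, so that the infimum of the empty set is \<open>\<infinity>\<close>.\<close>

definition hitting_time_zero :: "(real \<Rightarrow> 'a \<Rightarrow> real) \<Rightarrow> 'a \<Rightarrow> ereal" where
  "hitting_time_zero L \<omega> = Inf {ereal t | t. t > 0 \<and> L t \<omega> = 0}"

definition first_passage_area :: "(real \<Rightarrow> 'a \<Rightarrow> real) \<Rightarrow> 'a \<Rightarrow> real" where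
  "first_passage_area L \<omega> = (LBINT s=0..hitting_time_zero L \<omega>. L s \<omega>)"

definition kappa_const :: "real \<Rightarrow> real" where
  "kappa_const \<alpha> =
     Gamma (\<alpha> / (\<alpha> + 1)) * sqrt ((\<alpha> + 1) / (\<alpha> - 1)) /
     (2 * pi * (\<alpha> + 1) powr (\<alpha> / (\<alpha>\<^sup>2 - 1)))"

definition c_const :: "real \<Rightarrow> real" where
  "c_const \<alpha> = (\<alpha> - 1) * (\<alpha> + 1) powr (\<alpha> / (1 - \<alpha>))"

end

theory Submission
  imports Defs "HOL-Complex_Analysis.Complex_Analysis" "HOL-Real_Asymp.Real_Asymp"
begin

text \<open>Put \<open>p = \<alpha> + 1\<close>. The generalised Airy function \<open>u x = (\<integral>s. exp ((\<i>s)\<^sup>p / p - \<i>s x))\<close> satisfies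
  \<open>G u = l x u\<close>, after scaling by \<open>l\<close>, for the generator \<open>G\<close> of the process. Optional stopping for
  a time-discretised martingale and the absence of negative jumps give
  \<open>E (exp (- l A)) = u (l powr (1/p)) / u 0\<close>. Taking the Mellin transform in \<open>l\<close> produces all the
  inverse moments \<open>E A\<^sup>-\<^sup>n\<close>, and they turn out to be those of
  \<open>(4 / p) * E powr (p - 2) * B * Z U\<close>, where \<open>E\<close> is standard exponential, \<open>B\<close> is a Beta variable
  with parameters \<open>1/2\<close> and \<open>(p - 2) / (2 p)\<close>, \<open>U\<close> is uniform on \<open>(0, \<pi>)\<close>, \<open>Z\<close> is a Zolotarev-type
  function, and the three variables are independent. The product has exponential moments, so the
  inverse moments determine the law of \<open>A\<close>: its density is a mixture of Frechet densities over
  \<open>(b, t) \<in> (0,1) \<times> (0,\<pi>)\<close>. As \<open>x \<rightarrow> 0\<close> the mixture concentrates where the rate is minimal, at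
  \<open>b = 1\<close>, \<open>t = 0\<close>, and Laplace's method gives the asymptotics.\<close>

section \<open>Laplace and Gamma integrals\<close>

text \<open>Inverting the Laplace transform near \<open>x = 0\<close> would need uniform asymptotics
  of the Airy ratio in the complex plane. Inverse moments avoid this: on the line
  \<open>Re z = 1\<close> the integrals of \<open>z powr (-q) * exp (z powr p / p)\<close> obey a
  recursion in steps of \<open>p\<close>, which starts at \<open>q = 0\<close> with the same
  \<open>u 0\<close> that stands in the denominator. The three factors are read off from the result:
  \<open>Gamma (n p + 1) / fact n\<close> splits into \<open>Gamma (1 + n (p - 2))\<close>, the
  binomial coefficient of \<open>p n\<close> over \<open>2 n\<close>, and
  \<open>fact (2 n) / fact n\<close>, which duplication turns into \<open>4 ^ n\<close> times a
  Pochhammer symbol at \<open>1/2\<close>; the product of the \<open>k p - 1\<close> supplies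
  \<open>p ^ n\<close> and the symbol at \<open>1 - 1/p\<close>. Both bounds on \<open>p\<close>
  matter: \<open>p > 2\<close> makes the second Beta parameter positive, \<open>p < 3\<close> makes
  the Frechet exponent \<open>1 / (p - 2)\<close> larger than 1, hence the exponential moments. On
  the side of the paths the obstacle is that the area stops at the first exact zero, which a time
  grid does not see. It is enclosed between the passages strictly below a level \<open>a > 0\<close>
  and strictly below 0, and \<open>a\<close> is sent to 0.\<close>

lemma norm_integral_le_integral:
  fixes f :: "'a \<Rightarrow> 'b :: {banach, second_countable_topology}"
  assumes "integrable M f" "integrable M g" "\<And>x. norm (f x) \<le> g x"
  shows "norm (\<integral>x. f x \<partial>M) \<le> (\<integral>x. g x \<partial>M)"
  using assms by (intro order_trans[OF integral_norm_bound integral_mono]) auto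

text \<open>The difference quotients are dominated by means of a mean value estimate on a ball of
  half the distance to the imaginary axis. \<open>X\<close> may take both signs, so the bound needs
  exponentials with rates on both sides of \<open>Re z\<close>.\<close>

lemma laplace_transform_holomorphic:
  fixes M :: "'a measure" and X :: "'a \<Rightarrow> real"
  assumes X[measurable]: "X \<in> borel_measurable M"
    and int: "\<And>x. x > 0 \<Longrightarrow> integrable M (\<lambda>\<omega>. exp (- x * X \<omega>))"
  shows "(\<lambda>z. \<integral>\<omega>. exp (- z * complex_of_real (X \<omega>)) \<partial>M) holomorphic_on {z. Re z > 0}"
proof -
  have integ: "integrable M (\<lambda>\<omega>. exp (- z * complex_of_real (X \<omega>)))" if "Re z > 0" for z
    by (rule Bochner_Integration.integrable_bound[OF int[OF that]]) (auto simp: norm_exp_eq_Re)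
  have "((\<lambda>z. \<integral>\<omega>. exp (- z * complex_of_real (X \<omega>)) \<partial>M) has_field_derivative
          (\<integral>\<omega>. - of_real (X \<omega>) * exp (- z * complex_of_real (X \<omega>)) \<partial>M)) (at z)"
    if z: "Re z > 0" for z
    unfolding has_field_derivative_iff
  proof (subst tendsto_at_iff_sequentially, intro allI impI)
    fix w :: "nat \<Rightarrow> complex"
    assume w: "\<forall>i. w i \<in> UNIV - {z}" "w \<longlonglongrightarrow> z"
    define r where "r = Re z / 2"
    have r: "r > 0" using z by (simp add: r_def)
    \<comment> \<open>On the ball the rates lie in \<open>[r, 3 * r]\<close>, and the factor
      \<open>X\<close> in the derivative costs a further \<open>r / 2\<close> on either side.
      Multiplying out gives these four rates, all of them positive.\<close>
    define D where "D = (\<lambda>\<omega>. (2/r) * (exp (-(r/2) * X \<omega>) + exp (-(3*r/2) * X \<omega>)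
        + exp (-(5*r/2) * X \<omega>) + exp (-(7*r/2) * X \<omega>)))"
    have Dint: "integrable M D"
      unfolding D_def using r
      by (intro integrable_mult_right Bochner_Integration.integrable_add int) auto
    have bound: "norm ((exp (- v * complex_of_real (X \<omega>)) - exp (- z * complex_of_real (X \<omega>))) / (v - z)) \<le> D \<omega>"
      if v: "v \<noteq> z" "norm (v - z) < r" for v \<omega>
    proof -
      let ?x = "X \<omega>"
      have "norm (exp (- v * complex_of_real ?x) - exp (- z * complex_of_real ?x)) \<le> D \<omega> * norm (v - z)"
      proof (rule field_differentiable_bound[of "ball z r" "\<lambda>u. exp (- u * complex_of_real ?x)"
              "\<lambda>u. - complex_of_real ?x * exp (- u * complex_of_real ?x)"])
        fix u assume u: "u \<in> ball z r"
        have "\<bar>Re u - Re z\<bar> < r"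
          using u abs_Re_le_cmod[of "u - z"] by (auto simp: dist_norm norm_minus_commute)
        hence Reu: "r \<le> Re u" "Re u \<le> 3 * r" unfolding r_def by linarith+
        have e1: "exp (- Re u * ?x) \<le> exp (-r * ?x) + exp (-(3*r) * ?x)"
        proof (cases "?x \<ge> 0")
          case True
          hence "exp (- Re u * ?x) \<le> exp (-r * ?x)" using Reu by (simp add: mult_right_mono)
          thus ?thesis by (smt (verit) exp_gt_zero)
        next
          case False
          hence "exp (- Re u * ?x) \<le> exp (-(3*r) * ?x)" using Reu by (simp add: mult_right_mono_neg)
          thus ?thesis by (smt (verit) exp_gt_zero)
        qed
        have e2: "\<bar>?x\<bar> \<le> (2/r) * (exp ((r/2) * ?x) + exp (-(r/2) * ?x))"
        proof -
          have "(r/2) * \<bar>?x\<bar> \<le> exp ((r/2) * \<bar>?x\<bar>)"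
            using exp_ge_add_one_self[of "(r/2) * \<bar>?x\<bar>"] by linarith
          also have "\<dots> \<le> exp ((r/2) * ?x) + exp (-(r/2) * ?x)"
            by (cases "?x \<ge> 0") auto
          finally show ?thesis using r by (simp add: field_simps)
        qed
        have "norm (- complex_of_real ?x * exp (- u * complex_of_real ?x)) = \<bar>?x\<bar> * exp (- Re u * ?x)"
          by (simp add: norm_mult norm_exp_eq_Re)
        also have "\<dots> \<le> ((2/r) * (exp ((r/2) * ?x) + exp (-(r/2) * ?x))) * (exp (-r * ?x) + exp (-(3*r) * ?x))"
          by (intro mult_mono e1 e2) (use r in auto)
        also have "\<dots> = D \<omega>"
        proof -
          have "(exp ((r/2) * ?x) + exp (-(r/2) * ?x)) * (exp (-r * ?x) + exp (-(3*r) * ?x)) =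
            exp ((r/2) * ?x) * exp (-r * ?x) + exp (-(r/2) * ?x) * exp (-r * ?x)
            + exp ((r/2) * ?x) * exp (-(3*r) * ?x) + exp (-(r/2) * ?x) * exp (-(3*r) * ?x)"
            by (simp only: distrib_left distrib_right add_ac)
          also have "\<dots> = exp (-(r/2) * ?x) + exp (-(3*r/2) * ?x) + exp (-(5*r/2) * ?x) + exp (-(7*r/2) * ?x)"
          proof -
            have "(r/2) * ?x + -r * ?x = -(r/2) * ?x" "-(r/2) * ?x + -r * ?x = -(3*r/2) * ?x"
              "(r/2) * ?x + -(3*r) * ?x = -(5*r/2) * ?x" "-(r/2) * ?x + -(3*r) * ?x = -(7*r/2) * ?x"
              by (simp_all add: field_simps)
            thus ?thesis by (simp only: exp_add [symmetric])
          qed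
          finally show ?thesis unfolding D_def by (simp only: mult.assoc)
        qed
        finally show "norm (- complex_of_real ?x * exp (- u * complex_of_real ?x)) \<le> D \<omega>" .
      next
        fix u assume "u \<in> ball z r"
        show "((\<lambda>u. exp (- u * complex_of_real ?x)) has_field_derivative
                - complex_of_real ?x * exp (- u * complex_of_real ?x)) (at u within ball z r)"
          by (auto intro!: derivative_eq_intros)
      qed (use v r in \<open>auto simp: dist_norm norm_minus_commute\<close>)
      thus ?thesis using v by (simp add: norm_divide divide_le_eq)
    qed
    have ev: "eventually (\<lambda>i. norm (w i - z) < r \<and> Re (w i) > 0) sequentially"
    proof -
      have "eventually (\<lambda>i. dist (w i) z < r) sequentially"
        using w(2) r by (auto simp: tendsto_iff)
      moreover have "eventually (\<lambda>i. Re (w i) > 0) sequentially"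
        using order_tendstoD(1)[OF tendsto_Re[OF w(2)] z] .
      ultimately show ?thesis by eventually_elim (auto simp: dist_norm)
    qed
    then obtain n0 where n0: "\<And>i. i \<ge> n0 \<Longrightarrow> norm (w i - z) < r \<and> Re (w i) > 0"
      by (auto simp: eventually_sequentially)
    have "(\<lambda>i. \<integral>\<omega>. (exp (- w (i + n0) * complex_of_real (X \<omega>)) - exp (- z * complex_of_real (X \<omega>))) / (w (i + n0) - z) \<partial>M)
        \<longlonglongrightarrow> (\<integral>\<omega>. - of_real (X \<omega>) * exp (- z * complex_of_real (X \<omega>)) \<partial>M)"
    proof (rule integral_dominated_convergence[OF _ _ Dint])
      show "AE \<omega> in M. (\<lambda>i. (exp (- w (i + n0) * complex_of_real (X \<omega>)) - exp (- z * complex_of_real (X \<omega>))) / (w (i + n0) - z))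
              \<longlonglongrightarrow> - of_real (X \<omega>) * exp (- z * complex_of_real (X \<omega>))"
      proof (rule AE_I2)
        fix \<omega>
        have "((\<lambda>u. exp (- u * complex_of_real (X \<omega>))) has_field_derivative
                - complex_of_real (X \<omega>) * exp (- z * complex_of_real (X \<omega>))) (at z)"
          by (auto intro!: derivative_eq_intros)
        hence "((\<lambda>v. (exp (- v * complex_of_real (X \<omega>)) - exp (- z * complex_of_real (X \<omega>))) / (v - z))
              \<longlongrightarrow> - complex_of_real (X \<omega>) * exp (- z * complex_of_real (X \<omega>))) (at z)"
          by (simp add: has_field_derivative_iff)
        hence "((\<lambda>v. (exp (- v * complex_of_real (X \<omega>)) - exp (- z * complex_of_real (X \<omega>))) / (v - z)) \<circ> w)
              \<longlonglongrightarrow> - complex_of_real (X \<omega>) * exp (- z * complex_of_real (X \<omega>))"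
          using w by (subst (asm) tendsto_at_iff_sequentially) auto
        from LIMSEQ_ignore_initial_segment[OF this, of n0]
        show "(\<lambda>i. (exp (- w (i + n0) * complex_of_real (X \<omega>)) - exp (- z * complex_of_real (X \<omega>))) / (w (i + n0) - z))
              \<longlonglongrightarrow> - of_real (X \<omega>) * exp (- z * complex_of_real (X \<omega>))"
          by (simp add: o_def)
      qed
      show "AE \<omega> in M. norm ((exp (- w (i + n0) * complex_of_real (X \<omega>)) - exp (- z * complex_of_real (X \<omega>))) / (w (i + n0) - z)) \<le> D \<omega>" for i
      proof (rule AE_I2)
        fix \<omega>
        have "w (i + n0) \<noteq> z" using w(1) by blast
        moreover have "norm (w (i + n0) - z) < r" using n0[of "i + n0"] by simp
        ultimately show "norm ((exp (- w (i + n0) * complex_of_real (X \<omega>)) - exp (- z * complex_of_real (X \<omega>))) / (w (i + n0) - z)) \<le> D \<omega>"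
          by (rule bound)
      qed
    qed measurable
    moreover have "(\<integral>\<omega>. (exp (- w (i + n0) * complex_of_real (X \<omega>)) - exp (- z * complex_of_real (X \<omega>))) / (w (i + n0) - z) \<partial>M)
        = ((\<integral>\<omega>. exp (- w (i + n0) * complex_of_real (X \<omega>)) \<partial>M) - (\<integral>\<omega>. exp (- z * complex_of_real (X \<omega>)) \<partial>M)) / (w (i + n0) - z)" for i
    proof -
      have "Re (w (i + n0)) > 0" using n0[of "i + n0"] by simp
      thus ?thesis
        by (simp only: integral_divide_zero Bochner_Integration.integral_diff[OF integ integ[OF z]])
    qed
    ultimately show "((\<lambda>y. ((\<integral>\<omega>. exp (- y * complex_of_real (X \<omega>)) \<partial>M) - (\<integral>\<omega>. exp (- z * complex_of_real (X \<omega>)) \<partial>M)) / (y - z)) \<circ> w)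
        \<longlonglongrightarrow> (\<integral>\<omega>. - of_real (X \<omega>) * exp (- z * complex_of_real (X \<omega>)) \<partial>M)"
      by - (rule LIMSEQ_offset[where k = n0], simp only: o_def)
  qed
  thus ?thesis
    by (subst holomorphic_on_open) (auto simp: open_halfspace_Re_gt)
qed

text \<open>The identity theorem: the positive reals accumulate at the interior point 1. Identities
  between transforms then need checking at real arguments only.\<close>

lemma holomorphic_eq_on_right_half_plane:
  assumes "f holomorphic_on {z. Re z > 0}" "g holomorphic_on {z. Re z > 0}"
    and "\<And>x. x > 0 \<Longrightarrow> f (complex_of_real x) = g (of_real x)" and "Re z > 0"
  shows "f z = g z"
proof -
  have "1 islimpt (complex_of_real ` {0<..})"
    unfolding islimpt_sequential
  proof (intro exI conjI)
    show "\<forall>n. (\<lambda>n. complex_of_real (1 + 1 / Suc n)) n \<in> complex_of_real ` {0<..} - {1}"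
    proof
      fix n
      have "1 + 1 / real (Suc n) > 0" "1 + 1 / real (Suc n) \<noteq> 1" by (simp_all add: add_pos_pos)
      thus "complex_of_real (1 + 1 / Suc n) \<in> complex_of_real ` {0<..} - {1}"
        by (simp only: Diff_iff singleton_iff of_real_eq_1_iff) blast
    qed
    have "(\<lambda>n. complex_of_real (1 + 1 / Suc n)) \<longlonglongrightarrow> complex_of_real (1 + 0)"
      by (intro tendsto_of_real tendsto_add tendsto_const LIMSEQ_Suc[OF lim_1_over_n])
    thus "(\<lambda>n. complex_of_real (1 + 1 / Suc n)) \<longlonglongrightarrow> 1" by simp
  qed
  note lim = this
  have "(\<lambda>z. f z - g z) z = 0"
    by (rule analytic_continuation[where f = "\<lambda>z. f z - g z" and S = "{z. Re z > 0}" and \<xi> = 1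
          and U = "complex_of_real ` {0<..}"])
       (use assms lim in \<open>auto intro!: holomorphic_intros open_halfspace_Re_gt convex_connected convex_halfspace_Re_gt\<close>)
  thus ?thesis by simp
qed

lemma gamma_integral_powr_real:
  fixes r s c :: real
  assumes r: "r \<noteq> 0" and s: "s > 0" and c: "c > 0"
  shows "has_bochner_integral lborel
    (\<lambda>x. indicator {0<..} x * (x powr (r * s - 1) * exp (- c * x powr r))) (Gamma s * c powr (- s) / \<bar>r\<bar>)"
proof -
  let ?g = "\<lambda>x::real. c * x powr r" and ?f = "\<lambda>t::real. t powr (s - 1) / exp t"
  let ?g' = "\<lambda>x::real. c * (r * x powr (r - 1))"
  have img: "?g ` {0<..} = {0<..}"
  proof (intro equalityI subsetI)
    fix y :: real assume y: "y \<in> {0<..}"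
    have "y = ?g ((y / c) powr (1 / r))" using y c r by (simp add: powr_powr)
    moreover have "(y / c) powr (1 / r) \<in> {0<..}" using y c by simp
    ultimately show "y \<in> ?g ` {0<..}" by blast
  qed (use c in auto)
  have inj: "inj_on ?g {0<..}"
  proof (rule inj_onI)
    fix x y :: real assume xy: "x \<in> {0<..}" "y \<in> {0<..}" "c * x powr r = c * y powr r"
    hence "(x powr r) powr (1/r) = (y powr r) powr (1/r)" using c by simp
    thus "x = y" using xy r by (simp add: powr_powr)
  qed
  have G0: "(?f has_integral Gamma s) {0<..}"
  proof -
    have "((\<lambda>t. if t \<in> {0<..} then ?f t else 0) has_integral Gamma s) {0..}"
      by (rule has_integral_spike[of "{0}", OF _ _ Gamma_integral_real[OF s]]) auto
    thus ?thesis by (subst (asm) has_integral_restrict) auto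
  qed
  have "?f absolutely_integrable_on {0<..}"
    using G0 by (intro nonnegative_absolutely_integrable_1) (auto simp: has_integral_integrable_integral)
  moreover have "integral {0<..} ?f = Gamma s" using G0 by (rule integral_unique)
  moreover have "(?g has_field_derivative ?g' x) (at x within {0<..})" if "x \<in> {0<..}" for x
    using that by (auto intro!: derivative_eq_intros)
  ultimately have "(\<lambda>x. \<bar>?g' x\<bar> * ?f (?g x)) absolutely_integrable_on {0<..} \<and>
           integral {0<..} (\<lambda>x. \<bar>?g' x\<bar> * ?f (?g x)) = Gamma s"
    using has_absolute_integral_change_of_variables_1'[of "{0<..}" ?g ?g' ?f "Gamma s"] img inj
    by simp
  hence "((\<lambda>x. \<bar>?g' x\<bar> * ?f (?g x)) has_integral Gamma s) {0<..}"
    by (simp add: has_integral_iff set_lebesgue_integral_eq_integral(1))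
  hence "((\<lambda>x. c powr (-s) / \<bar>r\<bar> * (\<bar>?g' x\<bar> * ?f (?g x))) has_integral c powr (-s) / \<bar>r\<bar> * Gamma s) {0<..}"
    by (rule has_integral_mult_right)
  hence "((\<lambda>x. x powr (r * s - 1) * exp (- c * x powr r)) has_integral c powr (-s) / \<bar>r\<bar> * Gamma s) {0<..}"
  proof (rule has_integral_eq[rotated])
    fix x :: real assume x: "x \<in> {0<..}"
    have e1: "c powr (-s) * (c * c powr (s - 1)) = 1"
      using c by (simp add: powr_mult_base flip: powr_add)
    have e2: "x powr (r - 1) * x powr (r * (s - 1)) = x powr (r * s - 1)"
      by (simp add: algebra_simps flip: powr_add)
    have "\<bar>?g' x\<bar> * ?f (?g x) = \<bar>r\<bar> * (c * c powr (s - 1)) * (x powr (r - 1) * x powr (r * (s - 1))) * exp (- c * x powr r)"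
      using x c by (simp add: abs_mult powr_mult powr_powr exp_minus field_simps)
    hence "c powr (-s) / \<bar>r\<bar> * (\<bar>?g' x\<bar> * ?f (?g x)) =
        (c powr (-s) * (c * c powr (s - 1))) * (\<bar>r\<bar> / \<bar>r\<bar>) * (x powr (r - 1) * x powr (r * (s - 1))) * exp (- c * x powr r)"
      by (simp only: times_divide_eq_left times_divide_eq_right mult_ac)
    also have "\<dots> = x powr (r * s - 1) * exp (- c * x powr r)"
      unfolding e1 e2 using r by simp
    finally show "c powr (-s) / \<bar>r\<bar> * (\<bar>?g' x\<bar> * ?f (?g x)) = x powr (r * s - 1) * exp (- c * x powr r)" .
  qed
  hence "(\<integral>\<^sup>+x. ennreal (indicator {0<..} x * (x powr (r * s - 1) * exp (- c * x powr r))) \<partial>lborel)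
      = ennreal (c powr (-s) / \<bar>r\<bar> * Gamma s)"
    by (intro nn_integral_has_integral_lebesgue) auto
  thus ?thesis
    using s by (intro has_bochner_integral_nn_integral) (auto simp: mult_ac intro!: mult_nonneg_nonneg Gamma_real_nonneg)
qed

text \<open>Analytic continuation in \<open>c\<close> takes the place of rotating the ray of
  integration: the left side is the Laplace transform at \<open>c\<close> of \<open>x powr r\<close>
  under a weighted measure, and the real case settles positive \<open>c\<close>.\<close>

lemma gamma_integral_powr_complex:
  fixes r s :: real and c :: complex
  assumes r: "r \<noteq> 0" and s: "s > 0" and c: "Re c > 0"
  shows "has_bochner_integral lborel
    (\<lambda>x. indicator {0<..} x *\<^sub>R (of_real (x powr (r * s - 1)) * exp (- c * of_real (x powr r))))
    (of_real (Gamma s) * c powr (- of_real s) / of_real \<bar>r\<bar>)"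
proof -
  define w where "w = (\<lambda>x::real. indicator {0<..} x * x powr (r * s - 1))"
  define M where "M = density lborel (\<lambda>x. ennreal (w x))"
  have [measurable]: "w \<in> borel_measurable borel" unfolding w_def by measurable
  have w0: "w x \<ge> 0" for x by (simp add: w_def)
  have int: "integrable M (\<lambda>x. exp (- y * x powr r))" if "y > 0" for y
    unfolding M_def using w0
    by (subst integrable_density)
       (use gamma_integral_powr_real[OF r s that] in \<open>auto simp: has_bochner_integral_iff w_def mult_ac\<close>)
  have eq: "(\<integral>x. exp (- z * complex_of_real (x powr r)) \<partial>M) = of_real (Gamma s) * z powr (- of_real s) / of_real \<bar>r\<bar>"
    if "Re z > 0" for z
  proof (rule holomorphic_eq_on_right_half_plane[OF _ _ _ that])
    show "(\<lambda>z. \<integral>x. exp (- z * complex_of_real (x powr r)) \<partial>M) holomorphic_on {z. 0 < Re z}"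
      by (rule laplace_transform_holomorphic[OF _ int]) (auto simp: M_def)
    show "(\<lambda>z. of_real (Gamma s) * z powr (- of_real s) / of_real \<bar>r\<bar>) holomorphic_on {z. 0 < Re z}"
      using r by (intro holomorphic_intros) (auto simp: complex_nonpos_Reals_iff)
    fix y :: real assume y: "y > 0"
    have "(\<integral>x. exp (- of_real y * complex_of_real (x powr r)) \<partial>M) = of_real (\<integral>x. exp (- y * x powr r) \<partial>M)"
      by (subst integral_complex_of_real [symmetric]) (simp add: exp_of_real [symmetric])
    also have "(\<integral>x. exp (- y * x powr r) \<partial>M) = Gamma s * y powr (- s) / \<bar>r\<bar>"
      unfolding M_def using w0 gamma_integral_powr_real[OF r s y]
      by (subst integral_density) (auto simp: has_bochner_integral_iff w_def mult_ac)
    finally show "(\<integral>x. exp (- complex_of_real y * complex_of_real (x powr r)) \<partial>M) =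
        of_real (Gamma s) * of_real y powr (- of_real s) / of_real \<bar>r\<bar>"
      using y by (simp add: powr_of_real [symmetric])
  qed
  have i: "integrable M (\<lambda>x. exp (- c * complex_of_real (x powr r)))"
    by (rule Bochner_Integration.integrable_bound[OF int[OF c]]) (auto simp: norm_exp_eq_Re M_def)
  have "integrable lborel (\<lambda>x. w x *\<^sub>R exp (- c * complex_of_real (x powr r)))"
    using i w0 unfolding M_def by (subst (asm) integrable_density) auto
  moreover have "(\<integral>x. w x *\<^sub>R exp (- c * complex_of_real (x powr r)) \<partial>lborel) =
      of_real (Gamma s) * c powr (- of_real s) / of_real \<bar>r\<bar>"
    using eq[OF c] w0 unfolding M_def by (subst (asm) integral_density) auto
  moreover have "w x *\<^sub>R exp (- c * complex_of_real (x powr r)) =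
     indicator {0<..} x *\<^sub>R (of_real (x powr (r * s - 1)) * exp (- c * of_real (x powr r)))" for x
    by (simp add: w_def scaleR_conv_of_real)
  ultimately show ?thesis by (simp add: has_bochner_integral_iff)
qed

section \<open>The generalised Airy function\<close>

text \<open>The line is cut at 0 because the phase on the imaginary axis contains a power with
  branch point 0, where only continuity is at hand.\<close>

lemma integral_derivative_eq_0:
  fixes F f :: "real \<Rightarrow> complex"
  assumes cont: "continuous_on UNIV F"
    and der: "\<And>s. s \<noteq> 0 \<Longrightarrow> (F has_vector_derivative f s) (at s)"
    and fcont: "\<And>s. s \<noteq> 0 \<Longrightarrow> isCont f s"
    and int: "integrable lborel f"
    and lims: "(F \<longlongrightarrow> 0) at_top" "(F \<longlongrightarrow> 0) at_bot"
  shows "(\<integral>s. f s \<partial>lborel) = 0"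
proof -
  have si: "set_integrable lborel A f" if "A \<in> sets borel" for A
    using int that unfolding set_integrable_def by (intro integrable_mult_indicator) auto
  have F0: "(F \<longlongrightarrow> F 0) (at 0)"
    using cont by (simp add: continuous_on_eq_continuous_at isCont_def)
  have e0: "at_right (ereal 0) = filtermap ereal (at_right 0)" "at_left (ereal 0) = filtermap ereal (at_left 0)"
    by (simp_all add: at_right_ereal at_left_ereal)
  have eI: "at_left (\<infinity>::ereal) = filtermap ereal at_top" "at_right (-\<infinity>::ereal) = filtermap ereal at_bot"
    by (simp_all add: at_left_PInf at_right_MInf)
  have "(LBINT s=ereal 0..\<infinity>. f s) = 0 - F 0"
    by (rule interval_integral_FTC_integrable[of _ _ F])
       (use der fcont si F0 lims in \<open>auto simp: e0 eI o_def filterlim_filtermap zero_ereal_def intro: tendsto_within_subset\<close>)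
  moreover have "(LBINT s=-\<infinity>..ereal 0. f s) = F 0 - 0"
    by (rule interval_integral_FTC_integrable[of _ _ F])
       (use der fcont si F0 lims in \<open>auto simp: e0 eI o_def filterlim_filtermap zero_ereal_def intro: tendsto_within_subset\<close>)
  moreover have "(LBINT s=-\<infinity>..ereal 0. f s) + (LBINT s=ereal 0..\<infinity>. f s) = (LBINT s=-\<infinity>..\<infinity>. f s)"
    by (rule interval_integral_sum) (auto simp: interval_lebesgue_integrable_def intro!: si)
  ultimately show ?thesis
    by (simp add: interval_lebesgue_integral_def set_lebesgue_integral_def)
qed

text \<open>On the imaginary axis the real part is
  \<open>\<bar>s\<bar> powr p * cos (p * (pi / 2))\<close>, and the cosine is negative for
  \<open>2 < p < 3\<close>. Inside the strip the argument differs from a right angle by an amount of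
  order \<open>1 / norm z\<close>; this costs a term of order \<open>norm z powr (p - 1)\<close>,
  which half of the decay absorbs.\<close>

lemma Re_powr_vertical_le:
  fixes p :: real
  assumes p: "2 < p" "p < 3"
  obtains \<eta> B where "\<eta> > 0"
    "\<And>c s. 0 \<le> c \<Longrightarrow> c \<le> 1 \<Longrightarrow> Re (Complex c s powr of_real p) \<le> B - \<eta> * \<bar>s\<bar> powr p"
proof -
  define e where "e = - cos (p * (pi / 2))"
  have "cos (p * (pi / 2) - pi) > 0"
    using p pi_gt_zero by (intro cos_gt_zero_pi) (auto simp: field_simps)
  hence e: "e > 0" by (simp add: e_def cos_diff)
  \<comment> \<open>Beyond radius \<open>4 * p / e\<close> the perturbation
    \<open>2 * p * r powr (p - 1)\<close> is at most half of the main term; below that radius it is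
    at most \<open>B\<close>.\<close>
  define B where "B = 2 * p * (4 * p / e) powr (p - 1)"
  have B: "B \<ge> 0" using p by (auto simp: B_def)
  have *: "Re (Complex c s powr of_real p) \<le> B - (e/2) * \<bar>s\<bar> powr p" if c: "0 \<le> c" "c \<le> 1" for c s
  proof (cases "Complex c s = 0")
    case True
    hence "s = 0" by (simp add: complex_eq_iff)
    thus ?thesis using True B by simp
  next
    case False
    define z where "z = Complex c s"
    define r where "r = norm z"
    have z: "z \<noteq> 0" using False by (simp add: z_def)
    have r: "r > 0" using z by (simp add: r_def)
    have sr: "\<bar>s\<bar> \<le> r" using abs_Im_le_cmod[of z] by (simp add: z_def r_def)
    define t where "t = pi / 2 - \<bar>Arg z\<bar>"
    have "Re z \<ge> 0" using c by (simp add: z_def)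
    hence "\<bar>Arg z\<bar> \<le> pi / 2"
      using Arg_Re_nonneg by blast
    hence t: "0 \<le> t" "t \<le> pi / 2" by (auto simp: t_def)
    have "c = r * cos (Arg z)" using z by (metis r_def z_def Re_rcis complex.sel(1) rcis_cmod_Arg)
    also have "cos (Arg z) = sin t" by (simp add: t_def sin_diff)
    finally have ct: "c = r * sin t" .
    have "t \<le> 2 * sin t"
    proof -
      have "t / 2 \<le> tan (t / 2)"
      proof -
        have "\<bar>t / 2\<bar> < pi / 2" "t / 2 < pi / 2" using t pi_gt_zero by linarith+
        thus ?thesis using abs_tan_ge[of "t / 2"] t tan_pos_pi2_le[of "t / 2"] by linarith
      qed
      hence "t * cos (t / 2) ^ 2 \<le> 2 * tan (t / 2) * cos (t / 2) ^ 2"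
        by (intro mult_right_mono) auto
      also have "\<dots> = sin t"
        using sin_double[of "t / 2"] cos_gt_zero_pi[of "t / 2"] t pi_gt_zero by (simp add: tan_def power2_eq_square)
      finally have "t * cos (t / 2) ^ 2 \<le> sin t" .
      moreover have "1 / 2 \<le> cos (t / 2) ^ 2"
        using cos_double_cos[of "t / 2"] cos_ge_zero[of t] t by simp
      hence "t * (1 / 2) \<le> t * cos (t / 2) ^ 2" using t by (intro mult_left_mono) auto
      ultimately show ?thesis by simp
    qed
    hence "r * t \<le> r * (2 * sin t)" using r by (intro mult_left_mono) auto
    hence rt: "r * t \<le> 2" using ct c by simp
    have "Re (z powr of_real p) = r powr p * cos (p * Arg z)"
      using z by (simp add: powr_def r_def Re_exp Ln_Arg)
    also have "\<dots> \<le> r powr p * (- e + p * t)"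
    proof (intro mult_left_mono)
      have "cos (p * Arg z) = cos (p * \<bar>Arg z\<bar>)" by (simp add: abs_if)
      also have "p * \<bar>Arg z\<bar> = p * (pi/2) - p * t" by (simp add: t_def algebra_simps)
      finally have "cos (p * Arg z) = cos (p * (pi/2) - p * t)" .
      moreover
      have "\<bar>cos (p * (pi/2) - p * t) - cos (p * (pi/2))\<bar> \<le> \<bar>p * t\<bar>"
        using field_differentiable_bound[of UNIV cos "\<lambda>x::real. - sin x" 1 "p * (pi/2) - p * t" "p * (pi/2)"]
        by (auto intro!: derivative_eq_intros)
      ultimately show "cos (p * Arg z) \<le> - e + p * t" using t p by (auto simp: e_def)
    qed simp
    also have "r powr p * (- e + p * t) = - e * r powr p + p * ((r * t) * r powr (p - 1))"
    proof -
      have "r powr p = r * r powr (p - 1)" using r by (simp add: powr_mult_base)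
      thus ?thesis by (simp add: algebra_simps)
    qed
    also have "\<dots> \<le> - e * r powr p + p * (2 * r powr (p - 1))"
      using rt p by (intro add_left_mono mult_right_mono mult_left_mono) auto
    also have "\<dots> \<le> B - (e/2) * r powr p"
    proof (cases "r \<ge> 4 * p / e")
      case True
      have "p * (2 * r powr (p - 1)) = (p * 2) * r powr (p - 1)" by simp
      also have "\<dots> \<le> (e/2 * r) * r powr (p - 1)"
        using True e by (intro mult_right_mono) (auto simp: field_simps)
      also have "\<dots> = (e/2) * r powr p" using r by (simp add: powr_mult_base)
      finally show ?thesis using B by (simp add: field_simps)
    next
      case False
      have "r powr (p - 1) \<le> (4 * p / e) powr (p - 1)"
        using False r p by (intro powr_mono2) auto
      hence "p * (2 * r powr (p - 1)) \<le> B" using p by (simp add: B_def)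
      moreover have "0 \<le> e * r powr p" using e by simp
      ultimately show ?thesis by (simp add: field_simps)
    qed
    also have "\<dots> \<le> B - (e/2) * \<bar>s\<bar> powr p"
      using sr p e by (intro diff_mono mult_left_mono powr_mono2) auto
    finally show ?thesis by (simp add: z_def)
  qed
  show ?thesis by (rule that[of "e/2" B]) (use e * in auto)
qed

lemma integrable_powr_exp_powr:
  fixes \<eta> p q :: real
  assumes "\<eta> > 0" "p > 0" "q \<ge> 0"
  shows "integrable lborel (\<lambda>s. \<bar>s\<bar> powr q * exp (- \<eta> * \<bar>s\<bar> powr p))"
proof -
  let ?f = "\<lambda>x. indicator {0<..} x * (x powr q * exp (- \<eta> * x powr p))"
  have 1: "integrable lborel ?f"
    using gamma_integral_powr_real[of p "(q + 1) / p" \<eta>] assms by (simp add: has_bochner_integral_iff)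
  hence 2: "integrable lborel (\<lambda>x. ?f (0 + (-1) * x))"
    by (subst lborel_integrable_real_affine_iff) auto
  have "integrable lborel (\<lambda>x. ?f x + ?f (0 + (-1) * x))"
    using 1 2 by (rule Bochner_Integration.integrable_add)
  thus ?thesis
  proof (rule integrable_cong_AE_imp)
    have "AE x in lborel. x \<noteq> (0::real)" by (rule AE_lborel_singleton)
    thus "AE x in lborel. ?f x + ?f (0 + (-1) * x) = \<bar>x\<bar> powr q * exp (- \<eta> * \<bar>x\<bar> powr p)"
      by eventually_elim (auto simp: indicator_def)
  qed simp
qed

text \<open>In the closed left half plane every derivative of \<open>exp\<close> is bounded by 1, so
  the remainder is quadratic without an exponential factor.\<close>

lemma norm_exp_taylor1_le:
  assumes "Re z \<le> 0"
  shows "norm (exp z - 1 - z) \<le> (norm z)\<^sup>2"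
proof -
  have "norm (exp z - (\<Sum>i\<le>1. (\<lambda>i. exp) i 0 * (z - 0) ^ i / fact i)) \<le> 1 * norm (z - 0) ^ Suc 1 / fact 1"
    by (rule complex_Taylor[of "{z. Re z \<le> 0}" 1 "\<lambda>i. exp" 1 0 z])
       (use assms in \<open>auto simp: convex_halfspace_Re_le norm_exp_eq_Re intro!: derivative_eq_intros\<close>)
  thus ?thesis by (simp add: algebra_simps power2_eq_square)
qed

text \<open>The integrand of the generalised Airy function on the vertical line
  \<open>Re z = c\<close>. The line \<open>c = 0\<close> gives bounds uniform in \<open>x\<close>;
  the line \<open>c = 1\<close> stays away from the branch point and decays as \<open>x\<close>
  grows. The parameter \<open>\<kappa>\<close> is \<open>1 / (l * p)\<close> when the area is
  discounted at rate \<open>l\<close>, and \<open>1 / p\<close> after scaling.\<close>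

definition stable_phase :: "real \<Rightarrow> real \<Rightarrow> real \<Rightarrow> real \<Rightarrow> real \<Rightarrow> complex" where
  "stable_phase p \<kappa> c x s = exp (of_real \<kappa> * Complex c s powr of_real p - of_real x * Complex c s)"

definition stable_airy :: "real \<Rightarrow> real \<Rightarrow> real \<Rightarrow> real \<Rightarrow> complex" where
  "stable_airy p \<kappa> c x = (\<integral>s. stable_phase p \<kappa> c x s \<partial>lborel)"

lemma Complex_eq': "Complex c = (\<lambda>s. of_real c + \<i> * of_real s)"
  by (auto simp: complex_eq_iff)

lemma measurable_Complex [measurable]: "Complex c \<in> borel_measurable borel"
  unfolding Complex_eq' by measurable

lemma continuous_on_Complex_powr:
  assumes "c \<ge> 0" "p > 0"
  shows "continuous_on UNIV (\<lambda>s. Complex c s powr of_real p)"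
  using assms by (intro continuous_on_powr_complex) (auto simp: Complex_eq' intro!: continuous_intros)

lemma measurable_stable_phase [measurable]: "stable_phase p \<kappa> c x \<in> borel_measurable borel"
  unfolding stable_phase_def[abs_def] by measurable

lemma norm_stable_phase:
  "norm (stable_phase p \<kappa> c x s) = exp (\<kappa> * Re (Complex c s powr of_real p) - x * c)"
  by (simp add: stable_phase_def norm_exp_eq_Re)

text \<open>The constants are the same for all lines of the strip, as the shift of the contour from
  \<open>c = 0\<close> to \<open>c = 1\<close> requires.\<close>

lemma stable_phase_bound:
  fixes p \<kappa> :: real
  assumes p: "2 < p" "p < 3" and k: "\<kappa> > 0"
  obtains \<eta> K where "\<eta> > 0" "K > 0"
    "\<And>c x s. 0 \<le> c \<Longrightarrow> c \<le> 1 \<Longrightarrow> norm (stable_phase p \<kappa> c x s) \<le> K * exp (- x * c) * exp (- \<eta> * \<bar>s\<bar> powr p)"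
proof -
  obtain \<eta> B where e: "\<eta> > 0"
    and B: "\<And>c s. 0 \<le> c \<Longrightarrow> c \<le> 1 \<Longrightarrow> Re (Complex c s powr of_real p) \<le> B - \<eta> * \<bar>s\<bar> powr p"
    using Re_powr_vertical_le[OF p] by blast
  show ?thesis
  proof (rule that[of "\<kappa> * \<eta>" "exp (\<kappa> * B)"])
    fix c x s :: real assume c: "0 \<le> c" "c \<le> 1"
    have "\<kappa> * Re (Complex c s powr of_real p) - x * c \<le> \<kappa> * (B - \<eta> * \<bar>s\<bar> powr p) - x * c"
      using B[OF c, of s] k by (intro diff_right_mono mult_left_mono) auto
    also have "\<dots> = \<kappa> * B + (- x * c) + (- (\<kappa> * \<eta>) * \<bar>s\<bar> powr p)" by (simp add: algebra_simps)
    finally show "norm (stable_phase p \<kappa> c x s) \<le> exp (\<kappa> * B) * exp (- x * c) * exp (- (\<kappa> * \<eta>) * \<bar>s\<bar> powr p)"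
      unfolding norm_stable_phase exp_add [symmetric] by simp
  qed (use k e in auto)
qed

lemma integrable_powr_stable_phase:
  assumes p: "2 < p" "p < 3" and k: "\<kappa> > 0" and q: "q \<ge> 0" and c: "0 \<le> c" "c \<le> 1"
  shows "integrable lborel (\<lambda>s. \<bar>s\<bar> powr q * norm (stable_phase p \<kappa> c x s))"
proof -
  obtain \<eta> K where e: "\<eta> > 0" "K > 0"
    and *: "\<And>c x s. 0 \<le> c \<Longrightarrow> c \<le> 1 \<Longrightarrow> norm (stable_phase p \<kappa> c x s) \<le> K * exp (- x * c) * exp (- \<eta> * \<bar>s\<bar> powr p)"
    using stable_phase_bound[OF p k] by blast
  have "integrable lborel (\<lambda>s. (K * exp (- x * c)) * (\<bar>s\<bar> powr q * exp (- \<eta> * \<bar>s\<bar> powr p)))"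
    using p q e by (intro integrable_mult_right integrable_powr_exp_powr) auto
  thus ?thesis
  proof (rule Bochner_Integration.integrable_bound)
    show "AE s in lborel. norm (\<bar>s\<bar> powr q * norm (stable_phase p \<kappa> c x s)) \<le>
        norm ((K * exp (- x * c)) * (\<bar>s\<bar> powr q * exp (- \<eta> * \<bar>s\<bar> powr p)))"
    proof (rule AE_I2)
      fix s
      have "\<bar>s\<bar> powr q * norm (stable_phase p \<kappa> c x s) \<le> \<bar>s\<bar> powr q * (K * exp (- x * c) * exp (- \<eta> * \<bar>s\<bar> powr p))"
        by (intro mult_left_mono * c) auto
      thus "norm (\<bar>s\<bar> powr q * norm (stable_phase p \<kappa> c x s)) \<le>
        norm ((K * exp (- x * c)) * (\<bar>s\<bar> powr q * exp (- \<eta> * \<bar>s\<bar> powr p)))"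
        using e by (simp add: abs_mult mult_ac)
    qed
  qed measurable
qed

lemma integrable_stable_phase:
  assumes p: "2 < p" "p < 3" and k: "\<kappa> > 0" and c: "0 \<le> c" "c \<le> 1"
  shows "integrable lborel (stable_phase p \<kappa> c x)"
proof -
  have "integrable lborel (\<lambda>s. norm (stable_phase p \<kappa> c x s))"
    using integrable_powr_stable_phase[OF p k _ c, of 0 x]
  proof (rule integrable_cong_AE_imp)
    have "AE s in lborel. s \<noteq> (0::real)" by (rule AE_lborel_singleton)
    thus "AE s in lborel. \<bar>s\<bar> powr 0 * norm (stable_phase p \<kappa> c x s) = norm (stable_phase p \<kappa> c x s)"
      by eventually_elim auto
  qed auto
  thus ?thesis by (subst (asm) integrable_norm_iff) auto
qed

lemma stable_phase_derivative:
  assumes "c > 0 \<or> (c \<ge> 0 \<and> s \<noteq> 0)"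
  shows "(stable_phase p \<kappa> c x has_vector_derivative
    \<i> * ((of_real (\<kappa> * p) * Complex c s powr of_real (p - 1) - of_real x) * stable_phase p \<kappa> c x s)) (at s)"
proof -
  have ns: "Complex c s \<notin> \<real>\<^sub>\<le>\<^sub>0" using assms by (auto simp: complex_nonpos_Reals_iff)
  have 1: "(Complex c has_vector_derivative \<i>) (at s)"
    unfolding Complex_eq' by (auto intro!: derivative_eq_intros simp: has_vector_derivative_def scaleR_conv_of_real mult.commute)
  have 2: "((\<lambda>z. exp (of_real \<kappa> * z powr of_real p - of_real x * z)) has_field_derivative
      (of_real \<kappa> * (of_real p * Complex c s powr (of_real p - 1)) - of_real x) * stable_phase p \<kappa> c x s) (at (Complex c s))"
    unfolding stable_phase_def
    by (rule derivative_eq_intros has_field_derivative_powr ns refl)+ (simp add: algebra_simps)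
  show ?thesis
    using field_vector_diff_chain_at[OF 1 2] by (simp add: o_def stable_phase_def[abs_def] mult.assoc)
qed

lemma stable_phase_tendsto_0:
  assumes p: "2 < p" "p < 3" and k: "\<kappa> > 0" and c: "0 \<le> c" "c \<le> 1"
  shows "(stable_phase p \<kappa> c x \<longlongrightarrow> 0) at_top" "(stable_phase p \<kappa> c x \<longlongrightarrow> 0) at_bot"
proof -
  obtain \<eta> K where e: "\<eta> > 0" "K > 0"
    and *: "\<And>c x s. 0 \<le> c \<Longrightarrow> c \<le> 1 \<Longrightarrow> norm (stable_phase p \<kappa> c x s) \<le> K * exp (- x * c) * exp (- \<eta> * \<bar>s\<bar> powr p)"
    using stable_phase_bound[OF p k] by blast
  have t: "((\<lambda>s::real. K * exp (- x * c) * exp (- \<eta> * s powr p)) \<longlongrightarrow> 0) at_top"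
    using e p by real_asymp
  have "((\<lambda>s. K * exp (- x * c) * exp (- \<eta> * \<bar>s\<bar> powr p)) \<longlongrightarrow> 0) at_top"
    by (rule filterlim_compose[OF t filterlim_abs_real])
  thus "(stable_phase p \<kappa> c x \<longlongrightarrow> 0) at_top"
    by (rule Lim_null_comparison[rotated]) (use * c in auto)
  have "filterlim (\<lambda>s::real. \<bar>s\<bar>) at_top at_bot"
    by real_asymp
  from filterlim_compose[OF t this] have "((\<lambda>s. K * exp (- x * c) * exp (- \<eta> * \<bar>s\<bar> powr p)) \<longlongrightarrow> 0) at_bot" .
  thus "(stable_phase p \<kappa> c x \<longlongrightarrow> 0) at_bot"
    by (rule Lim_null_comparison[rotated]) (use * c in auto)
qed

lemma Complex_0_bound:
  "norm (Complex 0 s powr of_real a) = \<bar>s\<bar> powr a"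
  by (subst norm_powr_real_powr') (auto simp: complex_norm)

lemma integrable_powr_mult_stable_phase:
  assumes p: "2 < p" "p < 3" and k: "\<kappa> > 0" and q: "q \<ge> 0"
  shows "integrable lborel (\<lambda>s. Complex 0 s powr of_real q * stable_phase p \<kappa> 0 x s)"
  by (rule Bochner_Integration.integrable_bound[OF integrable_powr_stable_phase[OF p k q, of 0 x]])
     (auto simp: norm_mult Complex_0_bound abs_mult)

text \<open>This is the equation \<open>G u = \<lambda> x u\<close> for the generator \<open>G\<close> of the process, in Fourier variables.\<close>

lemma stable_airy_equation:
  assumes p: "2 < p" "p < 3" and k: "\<kappa> > 0"
  shows "of_real (\<kappa> * p) * (\<integral>s. Complex 0 s powr of_real (p - 1) * stable_phase p \<kappa> 0 x s \<partial>lborel)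
    = of_real x * stable_airy p \<kappa> 0 x"
proof -
  let ?f = "\<lambda>s. \<i> * ((of_real (\<kappa> * p) * Complex 0 s powr of_real (p - 1) - of_real x) * stable_phase p \<kappa> 0 x s)"
  have int1: "integrable lborel (\<lambda>s. Complex 0 s powr of_real (p - 1) * stable_phase p \<kappa> 0 x s)"
    using p by (intro integrable_powr_mult_stable_phase k) auto
  have int2: "integrable lborel (stable_phase p \<kappa> 0 x)"
    using p by (intro integrable_stable_phase k) auto
  have cpw: "continuous_on UNIV (\<lambda>s. Complex 0 s powr of_real a)" if "a > 0" for a
    using that by (intro continuous_on_Complex_powr) auto
  have cph: "continuous_on UNIV (stable_phase p \<kappa> 0 x)"
    unfolding stable_phase_def[abs_def] using p
    by (intro continuous_intros cpw) (auto simp: Complex_eq' intro!: continuous_intros)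
  \<comment> \<open>Differentiating the phase along the imaginary axis produces exactly the two
    terms of the equation.\<close>
  have "(\<integral>s. ?f s \<partial>lborel) = 0"
  proof (rule integral_derivative_eq_0[where F = "stable_phase p \<kappa> 0 x"])
    show "(stable_phase p \<kappa> 0 x has_vector_derivative ?f s) (at s)" if "s \<noteq> 0" for s
      using that by (intro stable_phase_derivative) auto
    have "continuous_on UNIV ?f"
      using p by (intro continuous_intros cpw cph) auto
    thus "isCont ?f s" for s by (simp add: continuous_on_eq_continuous_at)
    have "integrable lborel (\<lambda>s. \<i> * (of_real (\<kappa> * p) * (Complex 0 s powr of_real (p - 1) * stable_phase p \<kappa> 0 x s)
        - of_real x * stable_phase p \<kappa> 0 x s))"
      by (intro integrable_mult_right Bochner_Integration.integrable_diff int1 int2)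
    thus "integrable lborel ?f" by (simp add: algebra_simps)
  qed (use cph stable_phase_tendsto_0[OF p k] in auto)
  also have "?f = (\<lambda>s. \<i> * (of_real (\<kappa> * p) * (Complex 0 s powr of_real (p - 1) * stable_phase p \<kappa> 0 x s)
        - of_real x * stable_phase p \<kappa> 0 x s))" by (simp add: algebra_simps)
  also have "(\<integral>s. \<dots> s \<partial>lborel) = \<i> * (of_real (\<kappa> * p) * (\<integral>s. Complex 0 s powr of_real (p - 1) * stable_phase p \<kappa> 0 x s \<partial>lborel)
      - of_real x * stable_airy p \<kappa> 0 x)"
    using int1 int2 by (simp add: stable_airy_def)
  finally show ?thesis by simp
qed

lemma stable_airy_bounded:
  assumes p: "2 < p" "p < 3" and k: "\<kappa> > 0"
  shows "norm (stable_airy p \<kappa> 0 x) \<le> (\<integral>s. norm (stable_phase p \<kappa> 0 0 s) \<partial>lborel)"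
proof -
  have "norm (stable_airy p \<kappa> 0 x) \<le> (\<integral>s. norm (stable_phase p \<kappa> 0 x s) \<partial>lborel)"
    unfolding stable_airy_def by (rule integral_norm_bound)
  thus ?thesis by (simp add: norm_stable_phase)
qed

lemma continuous_stable_airy:
  assumes p: "2 < p" "p < 3" and k: "\<kappa> > 0"
  shows "isCont (stable_airy p \<kappa> 0) x"
  unfolding isCont_def
proof (subst tendsto_at_iff_sequentially, intro allI impI)
  fix y :: "nat \<Rightarrow> real" assume y: "y \<longlonglongrightarrow> x"
  have "(\<lambda>i. \<integral>s. stable_phase p \<kappa> 0 (y i) s \<partial>lborel) \<longlonglongrightarrow> (\<integral>s. stable_phase p \<kappa> 0 x s \<partial>lborel)"
  proof (rule integral_dominated_convergence[where w = "\<lambda>s. norm (stable_phase p \<kappa> 0 0 s)"])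
    show "integrable lborel (\<lambda>s. norm (stable_phase p \<kappa> 0 0 s))"
      using integrable_stable_phase[OF p k] by auto
    show "AE s in lborel. (\<lambda>i. stable_phase p \<kappa> 0 (y i) s) \<longlonglongrightarrow> stable_phase p \<kappa> 0 x s"
      unfolding stable_phase_def by (intro AE_I2 tendsto_intros y)
  qed (auto simp: norm_stable_phase)
  thus "(stable_airy p \<kappa> 0 \<circ> y) \<longlonglongrightarrow> stable_airy p \<kappa> 0 x" by (simp add: o_def stable_airy_def)
qed

lemma measurable_stable_airy:
  assumes p: "2 < p" "p < 3" and k: "\<kappa> > 0"
  shows "stable_airy p \<kappa> 0 \<in> borel_measurable borel"
  using continuous_stable_airy[OF p k]
  by (intro borel_measurable_continuous_onI continuous_at_imp_continuous_on) auto

text \<open>Averaging over one increment multiplies the integrand by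
  \<open>exp (h * z powr (p - 1))\<close>. The term linear in \<open>h\<close> is evaluated by
  \<open>stable_airy_equation\<close>, and the remainder is quadratic. The constant serves all
  \<open>x\<close> because on the imaginary axis the modulus of the phase does not depend on
  \<open>x\<close>; this allows the errors to be summed over many steps.\<close>

lemma stable_airy_step:
  fixes p \<kappa> :: real
  assumes p: "2 < p" "p < 3" and k: "\<kappa> > 0"
  obtains C where "C \<ge> 0" "\<And>\<nu> h x. prob_space \<nu> \<Longrightarrow> sets \<nu> = sets borel \<Longrightarrow> h \<ge> 0 \<Longrightarrow>
     (\<And>s. (\<integral>y. exp (- of_real y * Complex 0 s) \<partial>\<nu>) = exp (of_real h * Complex 0 s powr of_real (p - 1))) \<Longrightarrow>
     norm ((\<integral>y. stable_airy p \<kappa> 0 (x + y) \<partial>\<nu>) - of_real (1 + h * x / (\<kappa> * p)) * stable_airy p \<kappa> 0 x) \<le> C * h\<^sup>2"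
proof -
  define C where "C = (\<integral>s. \<bar>s\<bar> powr (2 * (p - 1)) * norm (stable_phase p \<kappa> 0 0 s) \<partial>lborel)"
  show ?thesis
  proof (rule that[of C])
    show "C \<ge> 0" unfolding C_def by (intro integral_nonneg_AE) auto
    fix \<nu> :: "real measure" and h x :: real
    assume prob: "prob_space \<nu>" and sets [measurable_cong]: "sets \<nu> = sets borel" and h: "h \<ge> 0"
      and char: "\<And>s. (\<integral>y. exp (- of_real y * Complex 0 s) \<partial>\<nu>) = exp (of_real h * Complex 0 s powr of_real (p - 1))"
    interpret \<nu>: prob_space \<nu> by fact
    interpret pair_sigma_finite \<nu> lborel
      by (intro pair_sigma_finite.intro \<nu>.sigma_finite_measure_axioms sigma_finite_lborel)
    let ?w = "\<lambda>s. Complex 0 s powr of_real (p - 1)"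
    let ?P = "stable_phase p \<kappa> 0"
    have intx: "integrable lborel (?P y)" for y
      using integrable_stable_phase[OF p k] by auto
    have split: "?P (x + y) s = ?P x s * exp (- of_real y * Complex 0 s)" for y s
      by (simp add: stable_phase_def algebra_simps flip: exp_add)
    have mP: "(\<lambda>(y, s). ?P (x + y) s) \<in> borel_measurable (\<nu> \<Otimes>\<^sub>M lborel)"
      unfolding split case_prod_beta by measurable
    have "integrable (\<nu> \<Otimes>\<^sub>M lborel) (\<lambda>(y, s). ?P (x + y) s)"
    proof (rule Fubini_integrable[OF mP])
      have "(\<lambda>y. \<integral>s. norm (?P (x + y) s) \<partial>lborel) = (\<lambda>y. \<integral>s. norm (?P 0 s) \<partial>lborel)"
        by (simp add: norm_stable_phase)
      thus "integrable \<nu> (\<lambda>y. \<integral>s. norm (case (y, s) of (y, s) \<Rightarrow> ?P (x + y) s) \<partial>lborel)" by simp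
    qed (auto intro!: intx)
    from Fubini_integral[OF this]
    have "(\<integral>y. stable_airy p \<kappa> 0 (x + y) \<partial>\<nu>) = (\<integral>s. (\<integral>y. ?P (x + y) s \<partial>\<nu>) \<partial>lborel)"
      by (simp add: stable_airy_def)
    also have "\<dots> = (\<integral>s. ?P x s * exp (of_real h * ?w s) \<partial>lborel)"
      by (simp only: split integral_mult_right_zero char)
    finally have eq1: "(\<integral>y. stable_airy p \<kappa> 0 (x + y) \<partial>\<nu>) = (\<integral>s. ?P x s * exp (of_real h * ?w s) \<partial>lborel)" .
    have int1: "integrable lborel (\<lambda>s. ?w s * ?P x s)"
      using p by (intro integrable_powr_mult_stable_phase k) auto
    \<comment> \<open>The exponent \<open>p - 1\<close> lies in \<open>(1, 2)\<close>, so powers of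
      imaginary numbers fall into the second or third quadrant and the Taylor bound applies.\<close>
    have Rew: "Re (of_real h * ?w s) \<le> 0" for s
    proof (cases "s = 0")
      case False
      have "cos ((p - 1) * (pi / 2)) \<le> 0"
      proof -
        have "cos ((p - 1) * (pi / 2) - pi) \<ge> 0"
          using p pi_gt_zero by (intro cos_ge_zero) (auto simp: field_simps)
        thus ?thesis by (simp add: cos_diff)
      qed
      moreover have "Re (?w s) = \<bar>s\<bar> powr (p - 1) * cos ((p - 1) * (pi / 2))"
      proof -
        have "Complex 0 s = \<i> * of_real s" by (simp add: complex_eq_iff)
        moreover have "Ln (\<i> * of_real s) = of_real (ln \<bar>s\<bar>) + \<i> * of_real (sgn s * (pi / 2))"
          using False by (cases "s > 0") (auto simp: Ln_times_ii Ln_of_real' sgn_if field_simps)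
        ultimately have Ln_eq: "Ln (Complex 0 s) = of_real (ln \<bar>s\<bar>) + \<i> * of_real (sgn s * (pi / 2))" by simp
        have "Complex 0 s \<noteq> 0" using False by (simp add: complex_eq_iff)
        hence "?w s = exp (of_real (p - 1) * (of_real (ln \<bar>s\<bar>) + \<i> * of_real (sgn s * (pi / 2))))"
          unfolding powr_def Ln_eq by simp
        hence "Re (?w s) = \<bar>s\<bar> powr (p - 1) * cos ((p - 1) * (sgn s * (pi / 2)))"
          using False by (simp add: powr_def Re_exp)
        moreover have "cos ((p - 1) * (sgn s * (pi / 2))) = cos ((p - 1) * (pi / 2))"
          using False by (cases "s > 0") (simp_all add: sgn_if)
        ultimately show ?thesis by simp
      qed
      ultimately show ?thesis using h by (auto intro!: mult_nonneg_nonpos)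
    qed (auto simp: zero_complex.code [symmetric])
    have bnd: "norm (?P x s * exp (of_real h * ?w s) - (?P x s + of_real h * (?w s * ?P x s)))
        \<le> h\<^sup>2 * (\<bar>s\<bar> powr (2 * (p - 1)) * norm (?P 0 s))" for s
    proof -
      have "?P x s * exp (of_real h * ?w s) - (?P x s + of_real h * (?w s * ?P x s))
          = ?P x s * (exp (of_real h * ?w s) - 1 - of_real h * ?w s)" by (simp add: algebra_simps)
      also have "norm \<dots> \<le> norm (?P x s) * (norm (of_real h * ?w s))\<^sup>2"
        unfolding norm_mult[of "?P x s"] by (intro mult_left_mono norm_exp_taylor1_le Rew) auto
      also have "norm (?P x s) = norm (?P 0 s)" by (simp add: norm_stable_phase)
      also have "(norm (of_real h * ?w s))\<^sup>2 = h\<^sup>2 * \<bar>s\<bar> powr (2 * (p - 1))"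
      proof -
        have "(\<bar>s\<bar> powr (p - 1))\<^sup>2 = \<bar>s\<bar> powr (2 * (p - 1))"
          by (simp add: power2_eq_square flip: powr_add)
        thus ?thesis unfolding norm_mult Complex_0_bound by (simp add: power_mult_distrib)
      qed
      finally show ?thesis by (simp add: mult_ac)
    qed
    have i2: "integrable lborel (\<lambda>s. h\<^sup>2 * (\<bar>s\<bar> powr (2 * (p - 1)) * norm (?P 0 s)))"
      using p by (intro integrable_mult_right integrable_powr_stable_phase k) auto
    have iE: "integrable lborel (\<lambda>s. ?P x s * exp (of_real h * ?w s))"
    proof (rule Bochner_Integration.integrable_bound[OF integrable_norm[OF intx[of x]]])
      show "AE s in lborel. norm (?P x s * exp (of_real h * ?w s)) \<le> norm (norm (?P x s))"
        using Rew by (intro AE_I2) (auto simp: norm_mult norm_exp_eq_Re intro!: mult_left_le)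
    qed measurable
    have "(\<integral>y. stable_airy p \<kappa> 0 (x + y) \<partial>\<nu>) - of_real (1 + h * x / (\<kappa> * p)) * stable_airy p \<kappa> 0 x
      = (\<integral>s. ?P x s * exp (of_real h * ?w s) \<partial>lborel) - (stable_airy p \<kappa> 0 x + of_real h * (\<integral>s. ?w s * ?P x s \<partial>lborel))"
    proof -
      have "(\<integral>s. ?w s * ?P x s \<partial>lborel) = of_real x * stable_airy p \<kappa> 0 x / of_real (\<kappa> * p)"
        using stable_airy_equation[OF p k, of x] k p by (simp add: field_simps)
      thus ?thesis unfolding eq1 by (simp add: algebra_simps add_divide_distrib)
    qed
    also have "\<dots> = (\<integral>s. ?P x s * exp (of_real h * ?w s) - (?P x s + of_real h * (?w s * ?P x s)) \<partial>lborel)"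
    proof -
      have i3: "integrable lborel (\<lambda>s. of_real h * (?w s * ?P x s))" by (rule integrable_mult_right[OF int1])
      have "(\<integral>s. ?P x s + of_real h * (?w s * ?P x s) \<partial>lborel) = stable_airy p \<kappa> 0 x + of_real h * (\<integral>s. ?w s * ?P x s \<partial>lborel)"
        unfolding Bochner_Integration.integral_add[OF intx i3] stable_airy_def by simp
      thus ?thesis
        by (simp only: Bochner_Integration.integral_diff[OF iE Bochner_Integration.integrable_add[OF intx i3]])
    qed
    finally have diff_eq: "(\<integral>y. stable_airy p \<kappa> 0 (x + y) \<partial>\<nu>) - of_real (1 + h * x / (\<kappa> * p)) * stable_airy p \<kappa> 0 x
      = (\<integral>s. ?P x s * exp (of_real h * ?w s) - (?P x s + of_real h * (?w s * ?P x s)) \<partial>lborel)" .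
    have "norm (\<integral>s. ?P x s * exp (of_real h * ?w s) - (?P x s + of_real h * (?w s * ?P x s)) \<partial>lborel)
        \<le> (\<integral>s. h\<^sup>2 * (\<bar>s\<bar> powr (2 * (p - 1)) * norm (?P 0 s)) \<partial>lborel)"
    proof (rule norm_integral_le_integral)
      have "integrable lborel (\<lambda>s. ?P x s + of_real h * (?w s * ?P x s))"
        by (rule Bochner_Integration.integrable_add[OF intx integrable_mult_right[OF int1]])
      with iE show "integrable lborel (\<lambda>s. ?P x s * exp (of_real h * ?w s) - (?P x s + of_real h * (?w s * ?P x s)))"
        by (rule Bochner_Integration.integrable_diff)
      show "integrable lborel (\<lambda>s. h\<^sup>2 * (\<bar>s\<bar> powr (2 * (p - 1)) * norm (?P 0 s)))" by (rule i2)
      show "norm (?P x s * exp (of_real h * ?w s) - (?P x s + of_real h * (?w s * ?P x s)))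
        \<le> h\<^sup>2 * (\<bar>s\<bar> powr (2 * (p - 1)) * norm (?P 0 s))" for s by (rule bnd)
    qed
    also have "\<dots> = C * h\<^sup>2" unfolding C_def integral_mult_right_zero by (rule mult.commute)
    finally show "norm ((\<integral>y. stable_airy p \<kappa> 0 (x + y) \<partial>\<nu>) - of_real (1 + h * x / (\<kappa> * p)) * stable_airy p \<kappa> 0 x) \<le> C * h\<^sup>2"
      unfolding diff_eq .
  qed
qed

section \<open>Discounted walks\<close>

text \<open>The normalization speaks of real arguments, whereas the Airy integral runs along the
  imaginary axis. Analytic continuation covers \<open>Re z > 0\<close>; the boundary is reached by
  dominated convergence along \<open>z + 1 / (n + 1)\<close>.\<close>

lemma (in spectrally_positive_stable_process) laplace_increment_complex:
  assumes \<alpha>: "\<alpha> > 0" and z: "Re z \<ge> 0"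
  shows "expectation (\<lambda>\<omega>. exp (- z * of_real (L 1 \<omega> - L 0 \<omega>))) = exp (z powr of_real \<alpha>)"
proof -
  let ?X = "\<lambda>\<omega>. L 1 \<omega> - L 0 \<omega>"
  have X[measurable]: "?X \<in> borel_measurable M"
    using random_variable_L[of 1] random_variable_L[of 0] by measurable
  \<comment> \<open>If the function were not integrable, its Bochner integral would be 0, which the
    positive value in the normalization excludes.\<close>
  have int: "integrable M (\<lambda>\<omega>. exp (- x * ?X \<omega>))" if "x \<ge> 0" for x
    using normalization[OF that] not_integrable_integral_eq by fastforce
  have pos: "expectation (\<lambda>\<omega>. exp (- z * of_real (?X \<omega>))) = exp (z powr of_real \<alpha>)" if "Re z > 0" for z
  proof (rule holomorphic_eq_on_right_half_plane[OF _ _ _ that])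
    show "(\<lambda>z. expectation (\<lambda>\<omega>. exp (- z * of_real (?X \<omega>)))) holomorphic_on {z. 0 < Re z}"
      by (rule laplace_transform_holomorphic[OF X int]) auto
    show "(\<lambda>z. exp (z powr of_real \<alpha>)) holomorphic_on {z. 0 < Re z}"
      by (intro holomorphic_intros) (auto simp: complex_nonpos_Reals_iff)
    fix x :: real assume x: "x > 0"
    have "expectation (\<lambda>\<omega>. exp (- of_real x * complex_of_real (?X \<omega>))) = of_real (expectation (\<lambda>\<omega>. exp (- x * ?X \<omega>)))"
      by (subst integral_complex_of_real [symmetric]) (simp add: exp_of_real [symmetric])
    also have "\<dots> = of_real (exp (x powr \<alpha>))"
      using normalization[of x] x by simp
    also have "\<dots> = exp (of_real x powr of_real \<alpha>)"
      using x by (simp add: powr_of_real exp_of_real)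
    finally show "expectation (\<lambda>\<omega>. exp (- complex_of_real x * of_real (?X \<omega>))) = exp (of_real x powr of_real \<alpha>)" .
  qed
  show ?thesis
  proof (cases "Re z = 0")
    case False
    thus ?thesis using pos z by simp
  next
    case True
    define w where "w = (\<lambda>n. z + of_real (1 / real (Suc n)))"
    have "w \<longlonglongrightarrow> z + of_real 0"
      unfolding w_def by (intro tendsto_intros LIMSEQ_Suc[OF lim_1_over_n])
    hence w: "w \<longlonglongrightarrow> z" by simp
    have w_pos: "Re (w n) > 0" and w_le: "Re (w n) \<le> 1" for n using True by (auto simp: w_def)
    have "(\<lambda>n. expectation (\<lambda>\<omega>. exp (- w n * of_real (?X \<omega>)))) \<longlonglongrightarrow> expectation (\<lambda>\<omega>. exp (- z * of_real (?X \<omega>)))"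
    proof (rule integral_dominated_convergence[where w = "\<lambda>\<omega>. 1 + exp (- 1 * ?X \<omega>)"])
      show "integrable M (\<lambda>\<omega>. 1 + exp (- 1 * ?X \<omega>))"
        using int[of 1] by (intro Bochner_Integration.integrable_add) auto
      show "AE \<omega> in M. (\<lambda>n. exp (- w n * of_real (?X \<omega>))) \<longlonglongrightarrow> exp (- z * of_real (?X \<omega>))"
        by (intro AE_I2 tendsto_intros w)
      show "AE \<omega> in M. norm (exp (- w n * complex_of_real (?X \<omega>))) \<le> 1 + exp (- 1 * ?X \<omega>)" for n
      proof (rule AE_I2)
        fix \<omega>
        have "exp (- Re (w n) * ?X \<omega>) \<le> 1 + exp (- 1 * ?X \<omega>)"
        proof (cases "?X \<omega> \<ge> 0")
          case True
          hence "- Re (w n) * ?X \<omega> \<le> 0" using w_pos[of n] by (simp add: mult_nonneg_nonneg)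
          hence "exp (- Re (w n) * ?X \<omega>) \<le> 1" by simp
          thus ?thesis using exp_ge_zero[of "- 1 * ?X \<omega>"] by linarith
        next
          case False
          hence "- Re (w n) * ?X \<omega> \<le> - 1 * ?X \<omega>"
            using w_le[of n] by (intro mult_right_mono_neg) auto
          hence "exp (- Re (w n) * ?X \<omega>) \<le> exp (- 1 * ?X \<omega>)" by (simp only: exp_le_cancel_iff)
          thus ?thesis by linarith
        qed
        thus "norm (exp (- w n * complex_of_real (?X \<omega>))) \<le> 1 + exp (- 1 * ?X \<omega>)"
          by (simp add: norm_exp_eq_Re)
      qed
    qed measurable
    moreover have "(\<lambda>n. exp (w n powr of_real \<alpha>)) \<longlonglongrightarrow> exp (z powr of_real \<alpha>)"
      using True \<alpha> w
      by (intro tendsto_exp tendsto_powr_complex' tendsto_const) (auto simp: complex_nonpos_Reals_iff complex_eq_iff)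
    ultimately show ?thesis
      using pos[OF w_pos] by (auto intro: LIMSEQ_unique)
  qed
qed

text \<open>Stationarity moves the increment to time 0; self-similarity with factor \<open>h\<close>
  and the index set \<open>{1}\<close> then reduces it to \<open>L 1 - L 0\<close>.\<close>

lemma (in spectrally_positive_stable_process) char_increment:
  assumes \<alpha>: "\<alpha> > 0" and t: "t \<ge> 0" and h: "h > 0"
  shows "expectation (\<lambda>\<omega>. exp (- of_real (L (t + h) \<omega> - L t \<omega>) * Complex 0 s))
    = exp (of_real h * Complex 0 s powr of_real \<alpha>)"
proof -
  have [measurable]: "L r \<in> borel_measurable M" if "r \<ge> 0" for r using random_variable_L[OF that] .
  have [measurable]: "L t \<in> borel_measurable M" "L (t + h) \<in> borel_measurable M" "L h \<in> borel_measurable M"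
    "L 0 \<in> borel_measurable M" "L 1 \<in> borel_measurable M" "L (h * 1) \<in> borel_measurable M"
    using t h by (auto intro: random_variable_L)
  let ?e = "\<lambda>y. exp (- complex_of_real y * Complex 0 s)"
  have [measurable]: "?e \<in> borel_measurable borel" by measurable
  have r1: "(\<lambda>\<omega>. \<lambda>t\<in>{1}. L (h * t) \<omega> - L 0 \<omega>) \<in> measurable M (Pi\<^sub>M {1} (\<lambda>_. borel))"
    by (rule measurable_restrict) auto
  have r2: "(\<lambda>\<omega>. \<lambda>t\<in>{1}. h powr (1 / \<alpha>) * (L t \<omega> - L 0 \<omega>)) \<in> measurable M (Pi\<^sub>M {1} (\<lambda>_. borel))"
    by (rule measurable_restrict) auto
  have r3: "(\<lambda>f. ?e (f 1)) \<in> borel_measurable (Pi\<^sub>M {1::real} (\<lambda>_. borel))"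
    by (rule measurable_compose[OF measurable_component_singleton]) auto
  have "expectation (\<lambda>\<omega>. ?e (L (t + h) \<omega> - L t \<omega>)) = (\<integral>y. ?e y \<partial>distr M borel (\<lambda>\<omega>. L (t + h) \<omega> - L t \<omega>))"
    by (rule integral_distr[symmetric]) measurable
  also have "\<dots> = (\<integral>y. ?e y \<partial>distr M borel (\<lambda>\<omega>. L h \<omega> - L 0 \<omega>))"
    using stationary_increments[OF t, of h] h by simp
  also have "\<dots> = expectation (\<lambda>\<omega>. ?e (L (h * 1) \<omega> - L 0 \<omega>))"
    by (subst integral_distr) auto
  also have "\<dots> = expectation (\<lambda>\<omega>. ?e ((\<lambda>t\<in>{1}. L (h * t) \<omega> - L 0 \<omega>) 1))"
    by simp
  also have "\<dots> = (\<integral>f. ?e (f 1) \<partial>distr M (Pi\<^sub>M {1} (\<lambda>_. borel)) (\<lambda>\<omega>. \<lambda>t\<in>{1}. L (h * t) \<omega> - L 0 \<omega>))"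
    by (rule integral_distr[OF r1 r3, symmetric])
  also have "\<dots> = (\<integral>f. ?e (f 1) \<partial>distr M (Pi\<^sub>M {1} (\<lambda>_. borel)) (\<lambda>\<omega>. \<lambda>t\<in>{1}. h powr (1 / \<alpha>) * (L t \<omega> - L 0 \<omega>)))"
    using strictly_stable[OF h, of "{1}"] by simp
  also have "\<dots> = expectation (\<lambda>\<omega>. ?e ((\<lambda>t\<in>{1}. h powr (1 / \<alpha>) * (L t \<omega> - L 0 \<omega>)) 1))"
    by (rule integral_distr[OF r2 r3])
  also have "\<dots> = expectation (\<lambda>\<omega>. exp (- (of_real (h powr (1 / \<alpha>)) * Complex 0 s) * of_real (L 1 \<omega> - L 0 \<omega>)))"
    by (simp add: mult_ac)
  also have "\<dots> = exp ((of_real (h powr (1 / \<alpha>)) * Complex 0 s) powr of_real \<alpha>)"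
    by (rule laplace_increment_complex[OF \<alpha>]) simp
  also have "(of_real (h powr (1 / \<alpha>)) * Complex 0 s) powr of_real \<alpha> = of_real h * Complex 0 s powr of_real \<alpha>"
    using h \<alpha> by (subst powr_times_real_left) (auto simp: powr_of_real powr_powr)
  finally show ?thesis .
qed

definition walk :: "real \<Rightarrow> (nat \<Rightarrow> real) \<Rightarrow> nat \<Rightarrow> real" where
  "walk x r j = x + (\<Sum>i<j. r i)"

text \<open>The factor \<open>1 / (1 + \<beta> y)\<close> replaces \<open>exp (- \<beta> y)\<close> because the one-step estimate for the Airy function
  reads \<open>E (u (y + \<xi>)) \<approx> (1 + \<beta> y) u y\<close>.\<close>

definition discount :: "real \<Rightarrow> real \<Rightarrow> (nat \<Rightarrow> real) \<Rightarrow> nat \<Rightarrow> real" where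
  "discount \<beta> x r j = (\<Prod>i<j. 1 / (1 + \<beta> * walk x r i))"

text \<open>The discounted process is frozen at its first position below \<open>a\<close>, overshoot
  included. It is a function of the increments alone, so that independence turns one step into an
  integral over a product measure.\<close>

primrec stopped_value :: "(real \<Rightarrow> complex) \<Rightarrow> real \<Rightarrow> real \<Rightarrow> real \<Rightarrow> (nat \<Rightarrow> real) \<Rightarrow> nat \<Rightarrow> complex" where
  "stopped_value u a \<beta> x r 0 = u x"
| "stopped_value u a \<beta> x r (Suc j) =
     (if \<forall>i\<le>j. walk x r i \<ge> a then of_real (discount \<beta> x r (Suc j)) * u (walk x r (Suc j))
      else stopped_value u a \<beta> x r j)"

lemma walk_restrict: "i \<le> j \<Longrightarrow> walk x (restrict r {..<j}) i = walk x r i"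
  unfolding walk_def by (intro arg_cong2[where f = "(+)"] sum.cong) auto

text \<open>The index may exceed the number of increments read by one: the discount of step
  \<open>Suc j\<close> involves positions up to \<open>j\<close> only, so it is known before the
  next increment is drawn.\<close>

lemma discount_restrict: "i \<le> Suc j \<Longrightarrow> discount \<beta> x (restrict r {..<j}) i = discount \<beta> x r i"
  unfolding discount_def by (intro prod.cong) (auto simp: walk_restrict)

lemma stopped_value_restrict: "i \<le> j \<Longrightarrow> stopped_value u a \<beta> x (restrict r {..<j}) i = stopped_value u a \<beta> x r i"
  by (induction i) (auto simp: walk_restrict discount_restrict)

lemma measurable_walk [measurable]: "i \<le> j \<Longrightarrow> (\<lambda>r. walk x r i) \<in> borel_measurable (Pi\<^sub>M {..<j} (\<lambda>_. borel))"
  unfolding walk_def by (intro borel_measurable_add borel_measurable_const borel_measurable_sum measurable_component_singleton) auto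

lemma measurable_discount [measurable]:
  "i \<le> Suc j \<Longrightarrow> (\<lambda>r. discount \<beta> x r i) \<in> borel_measurable (Pi\<^sub>M {..<j} (\<lambda>_. borel))"
  unfolding discount_def by (intro borel_measurable_prod borel_measurable_divide borel_measurable_add
    borel_measurable_const borel_measurable_times measurable_walk) auto

lemma discount_bounds:
  assumes "\<beta> \<ge> 0" "\<And>i. i < j \<Longrightarrow> walk x r i \<ge> 0"
  shows "0 \<le> discount \<beta> x r j" "discount \<beta> x r j \<le> 1"
proof -
  have "1 + \<beta> * walk x r i \<ge> 1" if "i < j" for i
    using assms(1) assms(2)[OF that] by simp
  hence *: "0 \<le> 1 / (1 + \<beta> * walk x r i) \<and> 1 / (1 + \<beta> * walk x r i) \<le> 1" if "i < j" for i
    using that by (smt (verit) divide_le_eq_1 divide_nonneg_nonneg)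
  show "0 \<le> discount \<beta> x r j" unfolding discount_def using * by (intro prod_nonneg) auto
  show "discount \<beta> x r j \<le> 1" unfolding discount_def using * by (intro prod_le_1) auto
qed

lemma norm_stopped_value_le:
  assumes "\<beta> \<ge> 0" "a \<ge> 0" "\<And>x. norm (u x) \<le> K"
  shows "norm (stopped_value u a \<beta> x r j) \<le> K"
proof (induction j)
  case (Suc j)
  show ?case
  proof (cases "\<forall>i\<le>j. walk x r i \<ge> a")
    case True
    have "norm (of_real (discount \<beta> x r (Suc j)) * u (walk x r (Suc j))) \<le> 1 * K"
    proof -
      have "walk x r i \<ge> 0" if "i < Suc j" for i using True that assms(2) by (meson less_Suc_eq_le order_trans)
      thus ?thesis unfolding norm_mult using discount_bounds[OF assms(1), of "Suc j" x r] assms(3)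
        by (intro mult_mono) auto
    qed
    thus ?thesis using True by simp
  qed (use Suc in auto)
qed (use assms in auto)

lemma stopped_value_alive:
  assumes "\<And>i. i < j \<Longrightarrow> walk x r i \<ge> a"
  shows "stopped_value u a \<beta> x r j = of_real (discount \<beta> x r j) * u (walk x r j)"
  using assms by (cases j) (auto simp: discount_def walk_def)

lemma measurable_stopped_value [measurable]:
  assumes [measurable]: "u \<in> borel_measurable borel"
  shows "i \<le> j \<Longrightarrow> (\<lambda>r. stopped_value u a \<beta> x r i) \<in> borel_measurable (Pi\<^sub>M {..<j} (\<lambda>_. borel))"
proof (induction i)
  case (Suc i)
  have [measurable]: "(\<lambda>r. walk x r k) \<in> borel_measurable (Pi\<^sub>M {..<j} (\<lambda>_. borel))" if "k \<le> Suc i" for k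
    using that Suc.prems by (intro measurable_walk) auto
  have [measurable]: "(\<lambda>r. discount \<beta> x r (Suc i)) \<in> borel_measurable (Pi\<^sub>M {..<j} (\<lambda>_. borel))"
    using Suc.prems by (intro measurable_discount) auto
  have [measurable]: "(\<lambda>r. stopped_value u a \<beta> x r i) \<in> borel_measurable (Pi\<^sub>M {..<j} (\<lambda>_. borel))"
    using Suc by simp
  have [measurable]: "Measurable.pred (Pi\<^sub>M {..<j} (\<lambda>_. borel)) (\<lambda>r. \<forall>k\<le>i. a \<le> walk x r k)"
  proof -
    have "Measurable.pred (Pi\<^sub>M {..<j} (\<lambda>_. borel)) (\<lambda>r. \<forall>k\<in>{..i}. a \<le> walk x r k)"
      by (intro pred_intros_finite) auto
    thus ?thesis by simp
  qed
  show ?case by simp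
qed simp

text \<open>Up to an error \<open>E\<close> per step the stopped process is a martingale: while the
  walk is alive, the new discount factor cancels the factor \<open>1 + \<beta> * x\<close> of the
  one-step estimate, and a discount in \<open>[0, 1]\<close> does not enlarge the error. Induction
  adds up the errors.\<close>

lemma (in prob_space) stopped_value_expectation:
  fixes \<xi> :: "nat \<Rightarrow> 'a \<Rightarrow> real" and u :: "real \<Rightarrow> complex"
  assumes ind: "indep_vars (\<lambda>_. borel) \<xi> {..<n}"
    and law: "\<And>i. i < n \<Longrightarrow> distr M borel (\<xi> i) = \<nu>"
    and u[measurable]: "u \<in> borel_measurable borel" and K: "\<And>x. norm (u x) \<le> K"
    and step: "\<And>x. norm ((\<integral>y. u (x + y) \<partial>\<nu>) - of_real (1 + \<beta> * x) * u x) \<le> E"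
    and a: "a \<ge> 0" and \<beta>: "\<beta> \<ge> 0"
  shows "norm (expectation (\<lambda>\<omega>. stopped_value u a \<beta> x (\<lambda>i. \<xi> i \<omega>) n) - u x) \<le> n * E"
proof -
  have K0: "K \<ge> 0" using K[of 0] norm_ge_zero order_trans by blast
  have E0: "E \<ge> 0" using step[of 0] norm_ge_zero order_trans by blast
  have \<xi>[measurable]: "\<xi> i \<in> borel_measurable M" if "i < n" for i
    using ind that by (auto simp: indep_vars_def)
  have res: "(\<lambda>\<omega>. \<lambda>i\<in>{..<j}. \<xi> i \<omega>) \<in> measurable M (Pi\<^sub>M {..<j} (\<lambda>_. borel))" if "j \<le> n" for j
    using that by (intro measurable_restrict) auto
  have mS: "(\<lambda>\<omega>. stopped_value u a \<beta> x (\<lambda>i. \<xi> i \<omega>) j) \<in> borel_measurable M" if "j \<le> n" for j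
    using measurable_compose[OF res[OF that] measurable_stopped_value[OF u order_refl, of a \<beta> x j]]
    by (simp add: stopped_value_restrict)
  have iS: "integrable M (\<lambda>\<omega>. stopped_value u a \<beta> x (\<lambda>i. \<xi> i \<omega>) j)" if "j \<le> n" for j
    by (rule integrable_const_bound[of _ K]) (use norm_stopped_value_le[OF \<beta> a K] mS that in auto)
  have "norm (expectation (\<lambda>\<omega>. stopped_value u a \<beta> x (\<lambda>i. \<xi> i \<omega>) j) - u x) \<le> j * E" if "j \<le> n" for j
    using that
  proof (induction j)
    case 0
    show ?case by (simp add: prob_space)
  next
    case (Suc j)
    hence j: "j < n" by simp
    define R where "R = distr M (Pi\<^sub>M {..<j} (\<lambda>_. borel)) (\<lambda>\<omega>. \<lambda>i\<in>{..<j}. \<xi> i \<omega>)"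
    have R_sets [measurable_cong]: "sets R = sets (Pi\<^sub>M {..<j} (\<lambda>_. borel))" by (simp add: R_def)
    define N where "N = distr M (Pi\<^sub>M {j} (\<lambda>_. borel)) (\<lambda>\<omega>. \<lambda>i\<in>{j}. \<xi> i \<omega>)"
    have N_sets [measurable_cong]: "sets N = sets (Pi\<^sub>M {j} (\<lambda>_. borel))" by (simp add: N_def)
    have resj: "(\<lambda>\<omega>. \<lambda>i\<in>{j}. \<xi> i \<omega>) \<in> measurable M (Pi\<^sub>M {j} (\<lambda>_. borel))"
      using j by (intro measurable_restrict) auto
    have [measurable]: "(\<lambda>f. f j) \<in> borel_measurable (Pi\<^sub>M {j} (\<lambda>_. borel))" by (rule measurable_component_singleton) simp
    interpret N: prob_space N unfolding N_def by (intro prob_space_distr resj)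
    have \<nu>_eq: "\<nu> = distr M borel (\<xi> j)" using law[OF j] by simp
    have \<nu>_sets [measurable_cong]: "sets \<nu> = sets borel" by (simp add: \<nu>_eq)
    interpret R: prob_space R unfolding R_def using res j by (intro prob_space_distr) auto
    interpret \<nu>: prob_space \<nu> unfolding \<nu>_eq using j by (intro prob_space_distr) auto
    interpret P: pair_prob_space R N ..
    have N_\<nu>: "(\<integral>f. g (f j) \<partial>N) = (\<integral>y. g y \<partial>\<nu>)" if [measurable]: "g \<in> borel_measurable borel" for g :: "real \<Rightarrow> complex"
      unfolding N_def \<nu>_eq using resj j by (subst (1 2) integral_distr) auto
    define alive where "alive = (\<lambda>r. \<forall>k\<le>j. a \<le> walk x r k)"
    \<comment> \<open>One step of the stopped process as a function of the past \<open>r\<close> and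
      the fresh increment \<open>y\<close>. It vanishes once the walk has been stopped.\<close>
    define G where "G = (\<lambda>(r, y). if alive r then of_real (discount \<beta> x r (Suc j)) * u (walk x r j + y)
       - of_real (discount \<beta> x r j) * u (walk x r j) else 0)"
    have [measurable]: "(\<lambda>r. walk x r j) \<in> borel_measurable (Pi\<^sub>M {..<j} (\<lambda>_. borel))" by (rule measurable_walk) simp
    have [measurable]: "(\<lambda>r. discount \<beta> x r j) \<in> borel_measurable (Pi\<^sub>M {..<j} (\<lambda>_. borel))"
      "(\<lambda>r. discount \<beta> x r (Suc j)) \<in> borel_measurable (Pi\<^sub>M {..<j} (\<lambda>_. borel))" by (auto intro: measurable_discount)
    have [measurable]: "Measurable.pred (Pi\<^sub>M {..<j} (\<lambda>_. borel)) alive"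
    proof -
      have "Measurable.pred (Pi\<^sub>M {..<j} (\<lambda>_. borel)) (\<lambda>r. \<forall>k\<in>{..j}. a \<le> walk x r k)"
        by (intro pred_intros_finite) (auto intro!: borel_measurable_pred_less borel_measurable_le measurable_walk)
      thus ?thesis by (simp add: alive_def)
    qed
    have dS: "discount \<beta> x r (Suc j) * (1 + \<beta> * walk x r j) = discount \<beta> x r j" if "alive r" for r
    proof -
      have "1 + \<beta> * walk x r j > 0"
        using that a \<beta> by (intro add_pos_nonneg mult_nonneg_nonneg) (auto simp: alive_def intro: order_trans)
      thus ?thesis by (simp add: discount_def)
    qed
    have db: "0 \<le> discount \<beta> x r i" "discount \<beta> x r i \<le> 1" if "alive r" "i \<le> Suc j" for r i
      using discount_bounds[OF \<beta>, of i x r] that a unfolding alive_def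
      by (smt (verit) less_Suc_eq_le order_less_le_trans)+
    have Gb: "norm (G p) \<le> 2 * K" for p
    proof (cases "alive (fst p)")
      case True
      have "norm (of_real (discount \<beta> x (fst p) i) * u y) \<le> 1 * K" if "i \<le> Suc j" for i y
        unfolding norm_mult using db[OF True that] K by (intro mult_mono) auto
      hence "norm (of_real (discount \<beta> x (fst p) (Suc j)) * u (walk x (fst p) j + snd p)
        - of_real (discount \<beta> x (fst p) j) * u (walk x (fst p) j)) \<le> K + K"
        by (intro order_trans[OF norm_triangle_ineq4] add_mono) auto
      thus ?thesis using True by (simp add: G_def case_prod_beta)
    qed (use K0 in \<open>auto simp: G_def case_prod_beta\<close>)
    have diff: "stopped_value u a \<beta> x (\<lambda>i. \<xi> i \<omega>) (Suc j) - stopped_value u a \<beta> x (\<lambda>i. \<xi> i \<omega>) j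
       = G (\<lambda>i\<in>{..<j}. \<xi> i \<omega>, \<xi> j \<omega>)" for \<omega>
    proof -
      have al: "alive (\<lambda>i\<in>{..<j}. \<xi> i \<omega>) \<longleftrightarrow> (\<forall>k\<le>j. a \<le> walk x (\<lambda>i. \<xi> i \<omega>) k)"
        by (simp add: alive_def walk_restrict)
      have w: "walk x (\<lambda>i. \<xi> i \<omega>) (Suc j) = walk x (\<lambda>i. \<xi> i \<omega>) j + \<xi> j \<omega>" by (simp add: walk_def)
      show ?thesis
        using stopped_value_alive[of j a x "\<lambda>i. \<xi> i \<omega>" u \<beta>]
        by (auto simp: G_def al walk_restrict discount_restrict w)
    qed
    have iv: "indep_var (Pi\<^sub>M {..<j} (\<lambda>_. borel)) (\<lambda>\<omega>. \<lambda>i\<in>{..<j}. \<xi> i \<omega>)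
          (Pi\<^sub>M {j} (\<lambda>_. borel)) (\<lambda>\<omega>. \<lambda>i\<in>{j}. \<xi> i \<omega>)"
      using j by (intro indep_var_restrict[OF ind]) auto
    \<comment> \<open>Independence comes for restrictions to disjoint index sets, so the fresh
      increment enters as a function on the singleton \<open>{j}\<close>.\<close>
    define G' where "G' = (\<lambda>(r, f). G (r, f j))"
    have mG': "G' \<in> borel_measurable (Pi\<^sub>M {..<j} (\<lambda>_. borel) \<Otimes>\<^sub>M Pi\<^sub>M {j} (\<lambda>_. borel))"
      unfolding G'_def G_def by measurable
    have "expectation (\<lambda>\<omega>. G (\<lambda>i\<in>{..<j}. \<xi> i \<omega>, \<xi> j \<omega>)) = expectation (\<lambda>\<omega>. G' (\<lambda>i\<in>{..<j}. \<xi> i \<omega>, \<lambda>i\<in>{j}. \<xi> i \<omega>))"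
      by (simp add: G'_def)
    also have "\<dots> = (\<integral>p. G' p \<partial>distr M (Pi\<^sub>M {..<j} (\<lambda>_. borel) \<Otimes>\<^sub>M Pi\<^sub>M {j} (\<lambda>_. borel)) (\<lambda>\<omega>. (\<lambda>i\<in>{..<j}. \<xi> i \<omega>, \<lambda>i\<in>{j}. \<xi> i \<omega>)))"
      using res[of j] resj j mG' by (intro integral_distr[symmetric]) (auto simp del: restrict_apply)
    also have "distr M (Pi\<^sub>M {..<j} (\<lambda>_. borel) \<Otimes>\<^sub>M Pi\<^sub>M {j} (\<lambda>_. borel)) (\<lambda>\<omega>. (\<lambda>i\<in>{..<j}. \<xi> i \<omega>, \<lambda>i\<in>{j}. \<xi> i \<omega>)) = R \<Otimes>\<^sub>M N"
      using iv unfolding indep_var_distribution_eq R_def N_def by simp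
    also have "(\<integral>p. G' p \<partial>(R \<Otimes>\<^sub>M N)) = (\<integral>r. (\<integral>f. G' (r, f) \<partial>N) \<partial>R)"
      using mG' Gb by (intro P.integral_fst'[symmetric] P.integrable_const_bound[of _ "2 * K"]) (auto simp: G'_def case_prod_beta)
    finally have eq: "expectation (\<lambda>\<omega>. G (\<lambda>i\<in>{..<j}. \<xi> i \<omega>, \<xi> j \<omega>)) = (\<integral>r. (\<integral>f. G' (r, f) \<partial>N) \<partial>R)" .
    have inner: "norm (\<integral>f. G' (r, f) \<partial>N) \<le> E" for r
    proof (cases "alive r")
      case True
      have iu: "integrable \<nu> (\<lambda>y. u (walk x r j + y))"
      proof (rule \<nu>.integrable_const_bound[of _ K])
        have "(\<lambda>y. u (walk x r j + y)) \<in> borel_measurable borel" by measurable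
        thus "(\<lambda>y. u (walk x r j + y)) \<in> borel_measurable \<nu>" by (simp add: \<nu>_eq)
      qed (use K in auto)
      have "(\<integral>f. G' (r, f) \<partial>N) = (\<integral>y. of_real (discount \<beta> x r (Suc j)) * u (walk x r j + y)
          - of_real (discount \<beta> x r j) * u (walk x r j) \<partial>\<nu>)"
        using True by (subst N_\<nu>[symmetric]) (auto simp: G'_def G_def)
      also have "\<dots> = of_real (discount \<beta> x r (Suc j)) * (\<integral>y. u (walk x r j + y) \<partial>\<nu>)
          - of_real (discount \<beta> x r j) * u (walk x r j)"
        using iu by (simp add: \<nu>.prob_space)
      also have "\<dots> = of_real (discount \<beta> x r (Suc j)) *
          ((\<integral>y. u (walk x r j + y) \<partial>\<nu>) - of_real (1 + \<beta> * walk x r j) * u (walk x r j))"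
        unfolding dS[OF True, symmetric] by (simp add: algebra_simps)
      also have "norm \<dots> \<le> 1 * E"
        unfolding norm_mult using db[OF True, of "Suc j"] step by (intro mult_mono) auto
      finally show ?thesis by simp
    qed (use E0 in \<open>auto simp: G'_def G_def\<close>)
    have "norm (\<integral>r. (\<integral>f. G' (r, f) \<partial>N) \<partial>R) \<le> E"
    proof -
      have "norm (\<integral>r. (\<integral>f. G' (r, f) \<partial>N) \<partial>R) \<le> (\<integral>r. E \<partial>R)"
      proof (rule norm_integral_le_integral)
        show "integrable R (\<lambda>r. \<integral>f. G' (r, f) \<partial>N)"
          using mG' Gb by (intro P.integrable_fst' P.integrable_const_bound[of _ "2 * K"]) (auto simp: G'_def case_prod_beta)
      qed (use inner in auto)
      thus ?thesis by (simp add: R.prob_space)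
    qed
    hence "norm (expectation (\<lambda>\<omega>. stopped_value u a \<beta> x (\<lambda>i. \<xi> i \<omega>) (Suc j))
        - expectation (\<lambda>\<omega>. stopped_value u a \<beta> x (\<lambda>i. \<xi> i \<omega>) j)) \<le> E"
      using Suc.prems unfolding eq[symmetric] diff[symmetric]
      by (subst (asm) Bochner_Integration.integral_diff) (auto intro!: iS simp del: stopped_value.simps)
    hence "norm (expectation (\<lambda>\<omega>. stopped_value u a \<beta> x (\<lambda>i. \<xi> i \<omega>) (Suc j)) - u x) \<le> E + j * E"
      using Suc by (intro norm_diff_triangle_le) auto
    thus ?case by (simp add: algebra_simps)
  qed
  thus ?thesis by simp
qed

section \<open>Moments of the Zolotarev function\<close>

lemma of_real_gbinomial: "of_real (x gchoose k) = (of_real x gchoose k :: complex)"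
  by (simp add: gbinomial_prod_rev)

text \<open>Orthogonality holds already on the half period, because the frequency is an integer and
  \<open>sin\<close> vanishes at multiples of \<open>pi\<close>.\<close>

lemma integral_cos_nat_diff:
  fixes j k :: nat
  shows "(LBINT t:{0..pi}. cos ((real j - real k) * t)) = (if j = k then pi else 0)"
proof (cases "j = k")
  case False
  define d where "d = real j - real k"
  have d: "d \<noteq> 0" using False by (simp add: d_def)
  have "(LBINT t. indicator {0..pi} t *\<^sub>R cos (d * t)) = sin (d * pi) / d - sin (d * 0) / d"
    by (rule integral_FTC_atLeastAtMost[where F = "\<lambda>t. sin (d * t) / d"])
       (use d in \<open>auto intro!: derivative_eq_intros continuous_intros simp: has_real_derivative_iff_has_vector_derivative [symmetric]\<close>)
  also have "sin (d * pi) = 0"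
    unfolding d_def sin_times_pi_eq_0 by simp
  finally show ?thesis using False by (simp add: set_lebesgue_integral_def d_def)
qed (simp add: set_lebesgue_integral_def)

text \<open>Extraction of a coefficient of the binomial series, which may be integrated term by term
  inside the unit disc.\<close>

lemma binomial_circle_integral_less:
  fixes r N :: real
  assumes r: "0 < r" "r < 1"
  shows "(LBINT t:{0..pi}. Re ((1 + of_real r * cis t) powr of_real N * cis (- (k * t)))) = pi * r ^ k * (N gchoose k)"
proof -
  define f where "f = (\<lambda>j t. indicator {0..pi} t *\<^sub>R ((N gchoose j) * r ^ j * cos ((real j - real k) * t)))"
  have summ: "summable (\<lambda>j. \<bar>N gchoose j\<bar> * r ^ j)"
  proof -
    have "summable (\<lambda>n. norm ((N gchoose n) * r ^ n))"
      by (rule abs_summable_in_conv_radius) (use r in \<open>auto simp: conv_radius_gchoose\<close>)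
    thus ?thesis using r by (simp add: abs_mult)
  qed
  have eq: "indicator {0..pi} t *\<^sub>R Re ((1 + of_real r * cis t) powr of_real N * cis (- (k * t))) = (\<Sum>j. f j t)" for t :: real
  proof -
    have "(\<lambda>n. (of_real N gchoose n) * (of_real r * cis t) ^ n) sums (1 + of_real r * cis t) powr of_real N"
      using r by (intro gen_binomial_complex) (auto simp: norm_mult)
    hence "(\<lambda>n. (of_real N gchoose n) * (of_real r * cis t) ^ n * cis (- (k * t))) sums ((1 + of_real r * cis t) powr of_real N * cis (- (k * t)))"
      by (rule sums_mult2)
    hence "(\<lambda>n. Re ((of_real N gchoose n) * (of_real r * cis t) ^ n * cis (- (k * t)))) sums Re ((1 + of_real r * cis t) powr of_real N * cis (- (k * t)))"
      by (rule sums_Re)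
    also have "(\<lambda>n. Re ((of_real N gchoose n) * (of_real r * cis t) ^ n * cis (- (k * t)))) = (\<lambda>n. (N gchoose n) * r ^ n * cos ((real n - real k) * t))"
    proof
      fix n
      have "(of_real N gchoose n) * (of_real r * cis t) ^ n * cis (- (k * t)) = of_real ((N gchoose n) * r ^ n) * cis ((real n - real k) * t)"
      proof -
        have "(of_real r * cis t) ^ n = of_real (r ^ n) * cis (real n * t)" by (simp add: power_mult_distrib Complex.DeMoivre)
        moreover have "cis (real n * t) * cis (- (k * t)) = cis ((real n - real k) * t)" by (simp add: cis_mult algebra_simps)
        ultimately show ?thesis by (simp add: of_real_gbinomial mult.assoc)
      qed
      thus "Re ((of_real N gchoose n) * (of_real r * cis t) ^ n * cis (- (k * t))) = (N gchoose n) * r ^ n * cos ((real n - real k) * t)" by simp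
    qed
    finally have "(\<lambda>n. indicator {0..pi} t *\<^sub>R ((N gchoose n) * r ^ n * cos ((real n - real k) * t))) sums
      (indicator {0..pi} t *\<^sub>R Re ((1 + of_real r * cis t) powr of_real N * cis (- (k * t))))"
      by (rule sums_scaleR_right)
    thus ?thesis unfolding f_def by (simp add: sums_iff)
  qed
  have fint: "integrable lborel (f j)" for j
    unfolding f_def by (intro borel_integrable_atLeastAtMost' [unfolded set_integrable_def] continuous_intros)
  have fb: "norm (f j t) \<le> indicator {0..pi} t *\<^sub>R (\<bar>N gchoose j\<bar> * r ^ j)" for j t
    using r by (auto simp: f_def abs_mult mult_left_le indicator_def)
  have "(LINT t|lborel. (\<Sum>j. f j t)) = (\<Sum>j. integral\<^sup>L lborel (f j))"
  proof (rule integral_suminf[OF fint])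
    show "AE t in lborel. summable (\<lambda>j. norm (f j t))"
    proof (rule AE_I2)
      fix t :: real
      show "summable (\<lambda>j. norm (f j t))"
        by (rule summable_comparison_test'[where N = 0 and g = "\<lambda>j. indicator {0..pi} t *\<^sub>R (\<bar>N gchoose j\<bar> * r ^ j)"])
           (use fb summable_scaleR_right[OF summ] in auto)
    qed
    show "summable (\<lambda>j. \<integral>t. norm (f j t) \<partial>lborel)"
    proof (rule summable_comparison_test'[where N = 0])
      show "summable (\<lambda>j. pi * (\<bar>N gchoose j\<bar> * r ^ j))" by (rule summable_mult[OF summ])
      fix j
      have "(\<integral>t. norm (f j t) \<partial>lborel) \<le> (\<integral>t. indicator {0..pi} t *\<^sub>R (\<bar>N gchoose j\<bar> * r ^ j) \<partial>lborel)"
        by (intro integral_mono integrable_norm fint fb) auto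
      also have "\<dots> = pi * (\<bar>N gchoose j\<bar> * r ^ j)" by simp
      finally show "norm (\<integral>t. norm (f j t) \<partial>lborel) \<le> pi * (\<bar>N gchoose j\<bar> * r ^ j)" by simp
    qed
  qed
  also have "(\<lambda>j. integral\<^sup>L lborel (f j)) = (\<lambda>j. if j = k then pi * r ^ k * (N gchoose k) else 0)"
  proof
    fix j
    have "integral\<^sup>L lborel (f j) = (N gchoose j) * r ^ j * (LBINT t:{0..pi}. cos ((real j - real k) * t))"
      unfolding set_lebesgue_integral_def f_def by (subst integral_mult_right_zero [symmetric]) (simp add: mult_ac)
    thus "integral\<^sup>L lborel (f j) = (if j = k then pi * r ^ k * (N gchoose k) else 0)"
      unfolding integral_cos_nat_diff by (simp add: mult_ac)
  qed
  also have "(\<Sum>j. if j = k then pi * r ^ k * (N gchoose k) else 0) = pi * r ^ k * (N gchoose k)"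
    using sums_single[of k "\<lambda>_. pi * r ^ k * (N gchoose k)"] by (simp add: sums_iff eq_commute)
  finally show ?thesis unfolding set_lebesgue_integral_def eq by simp
qed

text \<open>The boundary case of the coefficient formula, by dominated convergence as the radius
  tends to 1. The sign of \<open>N\<close> matters here, since \<open>1 + cis t\<close> vanishes at
  \<open>t = pi\<close>.\<close>

lemma binomial_circle_integral:
  fixes N :: real
  assumes N: "N > 0"
  shows "((\<lambda>t. Re ((1 + cis t) powr of_real N * cis (- (real k * t)))) has_integral pi * (N gchoose k)) {0..pi}"
proof -
  \<comment> \<open>The shift by 2 keeps the radii strictly between 0 and 1 from
    \<open>n = 0\<close> on.\<close>
  define r where "r = (\<lambda>n. 1 - 1 / real (n + 2))"
  have r: "0 < r n" "r n < 1" for n by (auto simp: r_def field_simps)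
  have rlim: "r \<longlonglongrightarrow> 1" unfolding r_def by real_asymp
  let ?g = "\<lambda>r t. indicator {0..pi} t *\<^sub>R Re ((1 + of_real r * cis t) powr of_real N * cis (- (real k * t)))"
  have Re_ge: "Re (1 + of_real r * cis t) \<ge> 0" if "0 \<le> r" "r \<le> 1" for r t
  proof -
    have "r * cos t \<ge> r * (-1)" using that by (intro mult_left_mono) auto
    thus ?thesis using that by simp
  qed
  have cont: "continuous_on UNIV (\<lambda>t. Re ((1 + of_real r * cis t) powr of_real N * cis (- (real k * t))))" if "0 \<le> r" "r \<le> 1" for r
    using N Re_ge[OF that] by (intro continuous_intros continuous_on_powr_complex) auto
  have meas: "?g r \<in> borel_measurable lborel" if "0 \<le> r" "r \<le> 1" for r
    using borel_measurable_continuous_onI[OF cont[OF that]] by measurable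
  have bnd: "norm (?g r t) \<le> indicator {0..pi} t *\<^sub>R (2 powr N)" if "0 \<le> r" "r \<le> 1" for r t
  proof -
    have "norm (1 + of_real r * cis t) \<le> norm (1::complex) + norm (of_real r * cis t)" by (rule norm_triangle_ineq)
    hence "norm (1 + of_real r * cis t) \<le> 2" using that by (simp add: norm_mult)
    hence "norm ((1 + of_real r * cis t) powr of_real N * cis (- (real k * t))) \<le> 2 powr N"
      using N by (simp add: norm_mult norm_powr_real_powr' powr_mono2)
    from order_trans[OF abs_Re_le_cmod this] show ?thesis
      by (cases "t \<in> {0..pi}") (simp_all del: times_complex.sel cis.sel)
  qed
  have ib: "integrable lborel (\<lambda>t. indicator {0..pi} t *\<^sub>R (2 powr N))" by simp
  have int1: "integrable lborel (?g 1)"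
    by (rule Bochner_Integration.integrable_bound[OF ib]) (use bnd[of 1] meas[of 1] in \<open>auto simp: abs_mult\<close>)
  have "(\<lambda>n. LINT t|lborel. ?g (r n) t) \<longlonglongrightarrow> (LINT t|lborel. ?g 1 t)"
  proof (rule integral_dominated_convergence[OF _ _ ib])
    show "AE t in lborel. (\<lambda>n. ?g (r n) t) \<longlonglongrightarrow> ?g 1 t"
    proof (rule AE_I2)
      fix t
      have "(\<lambda>n. (1 + of_real (r n) * cis t) powr of_real N) \<longlonglongrightarrow> (1 + of_real 1 * cis t) powr of_real N"
      proof (rule tendsto_powr_complex')
        have "Re (1 + cis t) \<ge> 0" using Re_ge[of 1 t] by simp
        thus "1 + of_real 1 * cis t \<notin> \<real>\<^sub>\<le>\<^sub>0 \<or> 1 + of_real 1 * cis t = 0 \<and> 0 < Re (complex_of_real N)"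
          using N by (auto simp: complex_nonpos_Reals_iff complex_eq_iff)
      qed (intro tendsto_intros rlim)+
      thus "(\<lambda>n. ?g (r n) t) \<longlonglongrightarrow> ?g 1 t"
        by (rule tendsto_scaleR[OF tendsto_const tendsto_Re[OF tendsto_mult[OF _ tendsto_const]]])
    qed
    show "AE t in lborel. norm (?g (r n) t) \<le> indicator {0..pi} t *\<^sub>R (2 powr N)" for n
      by (intro AE_I2 bnd less_imp_le r)
    show "?g 1 \<in> borel_measurable lborel" by (intro meas) auto
    show "?g (r n) \<in> borel_measurable lborel" for n by (intro meas less_imp_le r)
  qed
  moreover have "(LINT t|lborel. ?g (r n) t) = pi * r n ^ k * (N gchoose k)" for n
    using binomial_circle_integral_less[OF r, of n N k] by (simp add: set_lebesgue_integral_def)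
  ultimately have "(\<lambda>n. pi * r n ^ k * (N gchoose k)) \<longlonglongrightarrow> (LINT t|lborel. ?g 1 t)" by simp
  moreover have "(\<lambda>n. pi * r n ^ k * (N gchoose k)) \<longlonglongrightarrow> pi * 1 ^ k * (N gchoose k)"
    by (intro tendsto_intros rlim)
  ultimately have eq: "(LINT t|lborel. ?g 1 t) = pi * (N gchoose k)"
    using LIMSEQ_unique by fastforce
  have "(?g 1 has_integral pi * (N gchoose k)) UNIV"
    using has_integral_integral_lborel[OF int1] unfolding eq .
  also have "?g 1 = (\<lambda>t. if t \<in> {0..pi} then Re ((1 + cis t) powr of_real N * cis (- (real k * t))) else 0)"
    by (auto simp: indicator_def)
  finally show ?thesis by (simp only: has_integral_restrict_UNIV)
qed

text \<open>Raised to the power \<open>- 1 / (a - 2)\<close>, this is the function in Kanter's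
  representation of the positive stable law of index \<open>2 / a\<close>.\<close>

definition zolotarev :: "real \<Rightarrow> real \<Rightarrow> real" where
  "zolotarev a t = sin t powr a / (sin (2 / a * t) ^ 2 * sin ((1 - 2 / a) * t) powr (a - 2))"

text \<open>On the curve \<open>z = \<rho> e\<^sup>i\<^sup>t\<close> with \<open>\<rho> = sin (2t/a) / sin (t - 2t/a)\<close> the function \<open>(1 + z)\<^sup>a / z\<^sup>2\<close> is
  real and positive. The integral is therefore the contour integral of \<open>((1 + z)\<^sup>a / z\<^sup>2)\<^sup>n / z\<close>, which is
  computed on the unit circle; everything is done in the coordinate \<open>ln z\<close>, where the domain is convex.\<close>

lemma zolotarev_moment:
  fixes a :: real
  assumes a: "a > 2"
  shows "((\<lambda>t. zolotarev a t ^ n) has_integral pi * (a * n gchoose (2 * n))) {0..pi}"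
proof (cases "n = 0")
  case True
  thus ?thesis using has_integral_const_real[of "1::real" 0 pi] by simp
next
  case False
  define \<gamma> where "\<gamma> = 2 / a"
  have g: "0 < \<gamma>" "\<gamma> < 1" using a by (auto simp: \<gamma>_def)
  define N where "N = a * n"
  have N: "N > 0" using a False by (simp add: N_def)
  define H where "H = (\<lambda>z :: complex. (1 + exp z) powr of_real N * exp (- (2 * of_nat n * z)))"
  \<comment> \<open>The open strip together with the one boundary point at which both contours end.
    Adding a single boundary point keeps the set convex, which yields a primitive continuous up to
    that point.\<close>
  define S where "S = {z. \<bar>Im z\<bar> < pi} \<union> {\<i> * of_real pi}"
  have Re_ge: "Re (1 + exp z) \<ge> 0 \<or> Im (1 + exp z) \<noteq> 0" if "z \<in> S" for z
  proof (cases "Im z = 0 \<or> z = \<i> * of_real pi")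
    case True
    thus ?thesis by (auto simp: Re_exp)
  next
    case False
    hence "- pi < Im z" "Im z < pi" using that by (auto simp: S_def)
    hence "sin (Im z) \<noteq> 0" using False sin_eq_0_pi[of "Im z"] by blast
    thus ?thesis by (simp add: Im_exp)
  qed
  have "convex S"
  proof (rule convexI)
    fix x y :: complex and u v :: real
    assume xy: "x \<in> S" "y \<in> S" and uv: "0 \<le> u" "0 \<le> v" "u + v = 1"
    show "u *\<^sub>R x + v *\<^sub>R y \<in> S"
    proof (cases "u = 0 \<or> v = 0 \<or> x = y")
      case True
      thus ?thesis using xy uv by (auto simp: scaleR_add_left [symmetric])
    next
      case False
      hence uv': "u > 0" "v > 0" using uv by auto
      have b: "-pi < Im x" "Im x \<le> pi" "-pi < Im y" "Im y \<le> pi" "Im x < pi \<or> Im y < pi"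
        using xy False by (auto simp: S_def)
      have "u * Im x + v * Im y > u * (-pi) + v * (-pi)"
        using b uv' by (intro add_strict_mono mult_strict_left_mono) auto
      moreover have "u * Im x + v * Im y < u * pi + v * pi"
        using b(5)
      proof
        assume "Im x < pi"
        thus ?thesis using b uv' by (intro add_less_le_mono mult_strict_left_mono mult_left_mono) auto
      next
        assume "Im y < pi"
        thus ?thesis using b uv' by (intro add_le_less_mono mult_strict_left_mono mult_left_mono) auto
      qed
      moreover have "u * (-pi) + v * (-pi) = -pi" "u * pi + v * pi = pi"
        using uv(3) by (metis distrib_right mult_1)+
      ultimately have "\<bar>Im (u *\<^sub>R x + v *\<^sub>R y)\<bar> < pi" unfolding abs_less_iff by simp
      thus ?thesis by (simp add: S_def)
    qed
  qed
  moreover have "continuous_on S H"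
    unfolding H_def using Re_ge N by (intro continuous_intros continuous_on_powr_complex) auto
  moreover have "H field_differentiable at z" if "z \<in> interior S - {\<i> * of_real pi}" for z
  proof -
    have z: "\<bar>Im z\<bar> < pi" using that interior_subset by (auto simp: S_def)
    have "1 + exp z \<notin> \<real>\<^sub>\<le>\<^sub>0"
    proof (cases "Im z = 0")
      case True
      hence "Re (1 + exp z) > 0" by (simp add: Re_exp add_pos_pos)
      thus ?thesis by (auto simp: complex_nonpos_Reals_iff)
    next
      case False
      have "- pi < Im z" "Im z < pi" using z by (auto simp: abs_less_iff)
      hence "sin (Im z) \<noteq> 0" using False sin_eq_0_pi[of "Im z"] by blast
      thus ?thesis by (auto simp: complex_nonpos_Reals_iff Im_exp)
    qed
    hence "(\<lambda>w. w powr of_real N) field_differentiable at (1 + exp z)"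
      using has_field_derivative_powr field_differentiable_def by blast
    moreover have "(\<lambda>z. 1 + exp z) field_differentiable at z" "(\<lambda>z. exp (- (2 * of_nat n * z))) field_differentiable at z"
      unfolding field_differentiable_def by (rule exI, auto intro!: derivative_eq_intros)+
    ultimately show ?thesis unfolding H_def
      using field_differentiable_compose[of "\<lambda>z. 1 + exp z" z "\<lambda>w. w powr of_real N"]
      by (intro field_differentiable_mult) (auto simp: o_def)
  qed
  ultimately obtain P where P: "\<And>z. z \<in> S \<Longrightarrow> (P has_field_derivative H z) (at z within S)"
    using holomorphic_convex_primitive[of S "{\<i> * of_real pi}" H] by auto
  have Pc: "continuous_on S P"
    using P by (meson DERIV_continuous_on)
  have openS: "open {z. \<bar>Im z\<bar> < pi}"
  proof -
    have "{z. \<bar>Im z\<bar> < pi} = {z. Im z > - pi} \<inter> {z. Im z < pi}" by auto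
    thus ?thesis by (simp only: open_Int open_halfspace_Im_gt open_halfspace_Im_lt)
  qed
  have P_at: "(P has_field_derivative H z) (at z)" if "\<bar>Im z\<bar> < pi" for z
  proof -
    have "z \<in> interior S"
      using that openS interior_maximal[of "{z. \<bar>Im z\<bar> < pi}" S] by (auto simp: S_def)
    thus ?thesis using P[of z] at_within_interior[of z S] that by (simp add: S_def)
  qed
  have main: "((\<lambda>t. Im (H (\<zeta> t) * \<zeta>' t)) has_integral (Im (P (\<zeta> pi)) - Im (P (\<zeta> 0)))) {0..pi}"
    if c: "continuous_on {0..pi} \<zeta>" and S: "\<And>t. t \<in> {0..pi} \<Longrightarrow> \<zeta> t \<in> S"
      and I: "\<And>t. t \<in> {0<..<pi} \<Longrightarrow> \<bar>Im (\<zeta> t)\<bar> < pi"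
      and d: "\<And>t. t \<in> {0<..<pi} \<Longrightarrow> (\<zeta> has_vector_derivative \<zeta>' t) (at t)" for \<zeta> \<zeta>'
  proof (rule fundamental_theorem_of_calculus_interior)
    show "continuous_on {0..pi} (\<lambda>t. Im (P (\<zeta> t)))"
      by (intro continuous_intros continuous_on_compose2[OF Pc c]) (use S in auto)
    fix t assume t: "t \<in> {0<..<pi}"
    from field_vector_diff_chain_at[OF d[OF t] P_at[OF I[OF t]]]
    have "((\<lambda>t. P (\<zeta> t)) has_vector_derivative \<zeta>' t * H (\<zeta> t)) (at t)" by (simp add: o_def)
    from bounded_linear.has_vector_derivative[OF bounded_linear_Im this]
    show "((\<lambda>t. Im (P (\<zeta> t))) has_vector_derivative Im (H (\<zeta> t) * \<zeta>' t)) (at t)" by (simp add: mult.commute)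
  qed simp
  have circle: "((\<lambda>t. Im (H (\<i> * of_real t) * \<i>)) has_integral (Im (P (\<i> * of_real pi)) - Im (P (\<i> * of_real 0)))) {0..pi}"
  proof (rule main)
    fix t :: real
    show "((\<lambda>t. \<i> * of_real t) has_vector_derivative \<i>) (at t)"
      by (auto intro!: derivative_eq_intros simp: has_vector_derivative_def scaleR_conv_of_real mult.commute)
  qed (auto simp: S_def complex_eq_iff abs_less_iff intro!: continuous_intros)
  have H_circle: "Im (H (\<i> * of_real t) * \<i>) = Re ((1 + cis t) powr of_real N * cis (- (real (2 * n) * t)))" for t
  proof -
    have "exp (- (2 * of_nat n * (\<i> * of_real t))) = cis (- (real (2 * n) * t))"
      by (simp add: cis_conv_exp mult_ac)
    thus ?thesis by (simp add: H_def cis_conv_exp)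
  qed
  have c1: "Im (P (\<i> * of_real pi)) - Im (P 0) = pi * (N gchoose (2 * n))"
    using has_integral_unique[OF circle[unfolded H_circle] binomial_circle_integral[OF N, of "2 * n"]] by simp
  \<comment> \<open>On the real axis \<open>H\<close> is real, so the imaginary part of the
    primitive is constant there. The contours may therefore start at different real points, 0 for
    the circle and \<open>ln (\<rho> 0)\<close> for the curve.\<close>
  have const: "Im (P (of_real x)) = Im (P 0)" for x
  proof -
    have "((\<lambda>x. Im (P (of_real x))) has_real_derivative 0) (at x)" for x
    proof -
      have "(complex_of_real has_vector_derivative 1) (at x)"
        by (auto intro!: derivative_eq_intros simp: has_vector_derivative_def scaleR_conv_of_real)
      from field_vector_diff_chain_at[OF this P_at]
      have "((\<lambda>t. P (of_real t)) has_vector_derivative H (of_real x)) (at x)" by (simp add: o_def)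
      from bounded_linear.has_vector_derivative[OF bounded_linear_Im this]
      have "((\<lambda>x. Im (P (of_real x))) has_real_derivative Im (H (of_real x))) (at x)"
        by (simp add: has_real_derivative_iff_has_vector_derivative)
      moreover have "H (of_real x) = of_real ((1 + exp x) powr N * exp (- (2 * real n * x)))"
      proof -
        have "1 + exp (complex_of_real x) = of_real (1 + exp x)" by (simp add: exp_of_real)
        moreover have "exp (- (2 * of_nat n * complex_of_real x)) = of_real (exp (- (2 * real n * x)))"
          by (simp add: exp_of_real [symmetric])
        moreover have "of_real (1 + exp x) powr of_real N = complex_of_real ((1 + exp x) powr N)"
          by (rule powr_of_real) (simp add: add_nonneg_nonneg)
        ultimately show ?thesis unfolding H_def by (simp only: of_real_mult)
      qed
      ultimately show ?thesis by simp
    qed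
    hence "(\<lambda>x. Im (P (of_real x))) x = (\<lambda>x. Im (P (of_real x))) 0"
      by (intro DERIV_isconst_all) auto
    thus ?thesis by simp
  qed
  \<comment> \<open>The value at 0 is the continuous extension. At \<open>pi\<close> the two sines
    agree, so the radius is 1 and the curve ends where the circle does.\<close>
  define \<rho> where "\<rho> = (\<lambda>t. if t = 0 then \<gamma> / (1 - \<gamma>) else sin (\<gamma> * t) / sin ((1 - \<gamma>) * t))"
  define \<zeta> where "\<zeta> = (\<lambda>t. of_real (ln (\<rho> t)) + \<i> * of_real t)"
  define \<rho>' where "\<rho>' = (\<lambda>t. (\<gamma> * cos (\<gamma> * t) * sin ((1 - \<gamma>) * t) - sin (\<gamma> * t) * ((1 - \<gamma>) * cos ((1 - \<gamma>) * t))) / sin ((1 - \<gamma>) * t) ^ 2)"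
  have spos: "sin (\<gamma> * t) > 0" "sin ((1 - \<gamma>) * t) > 0" if "0 < t" "t \<le> pi" for t
  proof -
    have "\<gamma> * t < 1 * t" "(1 - \<gamma>) * t < 1 * t" using g that by (intro mult_strict_right_mono; simp)+
    hence "\<gamma> * t < pi" "(1 - \<gamma>) * t < pi" using that by linarith+
    thus "sin (\<gamma> * t) > 0" "sin ((1 - \<gamma>) * t) > 0" using g that by (auto intro!: sin_gt_zero)
  qed
  have \<rho>_pos: "\<rho> t > 0" if "0 \<le> t" "t \<le> pi" for t
    using spos[of t] g that by (auto simp: \<rho>_def)
  have \<rho>_der: "(\<rho> has_real_derivative \<rho>' t) (at t)" if "0 < t" "t \<le> pi" for t
  proof -
    have "((\<lambda>t. sin (\<gamma> * t) / sin ((1 - \<gamma>) * t)) has_real_derivative \<rho>' t) (at t)"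
      unfolding \<rho>'_def using spos[OF that]
      by (auto intro!: derivative_eq_intros simp: power2_eq_square)
    moreover have ev: "\<forall>\<^sub>F t in nhds t. sin (\<gamma> * t) / sin ((1 - \<gamma>) * t) = \<rho> t"
      by (rule eventually_mono[OF eventually_nhds_in_open[of "{0<..}" t]]) (use that in \<open>auto simp: \<rho>_def\<close>)
    ultimately show ?thesis using DERIV_cong_ev[OF refl ev refl] by simp
  qed
  have \<rho>_cont: "continuous_on {0..pi} \<rho>"
  proof (rule continuous_at_imp_continuous_on, rule)
    fix t assume t: "t \<in> {0..pi}"
    show "isCont \<rho> t"
    proof (cases "t = 0")
      case False
      thus ?thesis using t \<rho>_der[of t] by (intro DERIV_isCont) auto
    next
      case True
      have "((\<lambda>t. sin (\<gamma> * t) / sin ((1 - \<gamma>) * t)) \<longlongrightarrow> \<gamma> / (1 - \<gamma>)) (at 0)"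
        using g by real_asymp (use g in \<open>simp_all add: field_simps\<close>)
      hence "(\<rho> \<longlongrightarrow> \<gamma> / (1 - \<gamma>)) (at 0)"
        by (rule Lim_transform_eventually) (auto simp: eventually_at_filter \<rho>_def)
      thus ?thesis using True by (simp add: isCont_def \<rho>_def)
    qed
  qed
  have Im_\<zeta>: "Im (\<zeta> t) = t" for t by (simp add: \<zeta>_def)
  have curve: "((\<lambda>t. Im (H (\<zeta> t) * (of_real (\<rho>' t / \<rho> t) + \<i>))) has_integral (Im (P (\<zeta> pi)) - Im (P (\<zeta> 0)))) {0..pi}"
  proof (rule main)
    show "continuous_on {0..pi} \<zeta>"
      unfolding \<zeta>_def using \<rho>_pos by (intro continuous_intros \<rho>_cont) (force)
    show "\<zeta> t \<in> S" if "t \<in> {0..pi}" for t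
    proof (cases "t = pi")
      case True
      have "sin ((1 - \<gamma>) * pi) = sin (\<gamma> * pi)" using sin_pi_minus[of "\<gamma> * pi"] by (simp add: algebra_simps)
      thus ?thesis using True spos[of pi] by (simp add: \<zeta>_def \<rho>_def S_def)
    qed (use that in \<open>auto simp: S_def Im_\<zeta>\<close>)
    show "\<bar>Im (\<zeta> t)\<bar> < pi" if "t \<in> {0<..<pi}" for t using that by (simp add: Im_\<zeta>)
    fix t assume t: "t \<in> {0<..<pi}"
    have "((\<lambda>t. ln (\<rho> t)) has_real_derivative \<rho>' t / \<rho> t) (at t)"
      using \<rho>_der[of t] \<rho>_pos[of t] t by (auto intro!: derivative_eq_intros)
    hence "((\<lambda>t. ln (\<rho> t)) has_vector_derivative \<rho>' t / \<rho> t) (at t)"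
      by (simp add: has_real_derivative_iff_has_vector_derivative)
    from bounded_linear.has_vector_derivative[OF bounded_linear_of_real this]
    have 1: "((\<lambda>t. complex_of_real (ln (\<rho> t))) has_vector_derivative of_real (\<rho>' t / \<rho> t)) (at t)" .
    have 2: "((\<lambda>t. \<i> * of_real t) has_vector_derivative \<i>) (at t)"
      by (auto intro!: derivative_eq_intros simp: has_vector_derivative_def scaleR_conv_of_real mult.commute)
    show "(\<zeta> has_vector_derivative of_real (\<rho>' t / \<rho> t) + \<i>) (at t)"
      unfolding \<zeta>_def by (rule has_vector_derivative_add[OF 1 2])
  qed
  have "\<zeta> pi = \<i> * of_real pi"
  proof -
    have "sin ((1 - \<gamma>) * pi) = sin (\<gamma> * pi)" using sin_pi_minus[of "\<gamma> * pi"] by (simp add: algebra_simps)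
    thus ?thesis using spos[of pi] by (simp add: \<zeta>_def \<rho>_def)
  qed
  moreover have "\<zeta> 0 = of_real (ln (\<rho> 0))" by (simp add: \<zeta>_def)
  ultimately have val: "Im (P (\<zeta> pi)) - Im (P (\<zeta> 0)) = pi * (N gchoose (2 * n))"
    using c1 const by simp
  have H_curve: "H (\<zeta> t) = of_real (zolotarev a t ^ n)" if t: "t \<in> {0<..<pi}" for t
  proof -
    have s: "sin (\<gamma> * t) > 0" "sin ((1 - \<gamma>) * t) > 0" "sin t > 0" using t spos[of t] sin_gt_zero[of t] by auto
    let ?d = "sin ((1 - \<gamma>) * t)"
    have e: "exp (\<zeta> t) = of_real (\<rho> t) * cis t"
      using \<rho>_pos[of t] t by (simp add: \<zeta>_def exp_add cis_conv_exp exp_of_real)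
    have \<rho>t: "\<rho> t = sin (\<gamma> * t) / ?d" using t by (simp add: \<rho>_def)
    have "1 + exp (\<zeta> t) = of_real (sin t / ?d) * cis (\<gamma> * t)"
    proof -
      have d: "?d = sin t * cos (\<gamma> * t) - cos t * sin (\<gamma> * t)"
        using sin_diff[of t "\<gamma> * t"] by (simp add: algebra_simps)
      show ?thesis
        unfolding e \<rho>t using s(2) by (simp add: complex_eq_iff field_simps) (simp add: sin_diff algebra_simps)
    qed
    moreover have "(of_real (sin t / ?d) * cis (\<gamma> * t)) powr of_real N = of_real ((sin t / ?d) powr N) * cis (2 * n * t)"
    proof -
      have "\<gamma> * t < pi" using g t mult_strict_mono[of \<gamma> 1 t pi] by auto
      hence "Ln (cis (\<gamma> * t)) = \<i> * of_real (\<gamma> * t)"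
        using g t unfolding cis_conv_exp by (intro Ln_exp) (auto intro: less_le_trans[OF _ mult_nonneg_nonneg])
      hence "cis (\<gamma> * t) powr of_real N = cis (N * (\<gamma> * t))"
        by (simp add: powr_def cis_conv_exp mult_ac)
      \<comment> \<open>With \<open>\<gamma> = 2 / a\<close> the phase of the binomial power is
        exactly opposite to that of the factor \<open>z\<close> to the power
        \<open>- 2 * n\<close>.\<close>
      moreover have "N * (\<gamma> * t) = 2 * n * t" using a by (simp add: N_def \<gamma>_def)
      moreover have "of_real (sin t / ?d) powr of_real N = complex_of_real ((sin t / ?d) powr N)"
        by (rule powr_of_real) (use s in auto)
      moreover have "(of_real (sin t / ?d) * cis (\<gamma> * t)) powr of_real N = of_real (sin t / ?d) powr of_real N * cis (\<gamma> * t) powr of_real N"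
        by (rule powr_times_real_left) (use s in \<open>auto simp del: of_real_divide\<close>)
      ultimately show ?thesis by simp
    qed
    moreover have "exp (- (2 * of_nat n * \<zeta> t)) = of_real (1 / \<rho> t ^ (2 * n)) * cis (- (2 * n * t))"
    proof -
      have "exp (- (2 * of_nat n * \<zeta> t)) = inverse (exp (\<zeta> t) ^ (2 * n))"
        by (simp add: exp_minus exp_of_nat_mult [symmetric])
      also have "exp (\<zeta> t) ^ (2 * n) = of_real (\<rho> t ^ (2 * n)) * cis (2 * n * t)"
        unfolding e by (simp add: power_mult_distrib Complex.DeMoivre)
      finally show ?thesis by (simp add: cis_inverse divide_inverse)
    qed
    ultimately have "H (\<zeta> t) = of_real ((sin t / ?d) powr N / \<rho> t ^ (2 * n)) * (cis (2 * n * t) * cis (- (2 * n * t)))"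
      unfolding H_def by (simp add: mult_ac)
    also have "cis (2 * n * t) * cis (- (2 * n * t)) = 1" by (simp add: cis_mult)
    also have "(sin t / ?d) powr N / \<rho> t ^ (2 * n) = zolotarev a t ^ n"
    proof -
      have "(sin t / ?d) powr N = ((sin t / ?d) powr a) ^ n"
        using s by (simp add: N_def powr_powr [symmetric] powr_realpow)
      moreover have "(sin t / ?d) powr a / \<rho> t ^ 2 = zolotarev a t"
      proof -
        have "?d powr a = ?d powr (a - 2) * ?d ^ 2"
          using s powr_add[of ?d "a - 2" 2] by (simp add: powr_realpow)
        thus ?thesis using s
          by (simp add: \<rho>t zolotarev_def powr_divide power_divide \<gamma>_def field_simps)
      qed
      ultimately show ?thesis by (metis power_divide power_mult)
    qed
    finally show ?thesis by simp
  qed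
  \<comment> \<open>\<open>H\<close> is real on the curve, so only the angular part
    \<open>\<i>\<close> of the logarithmic velocity contributes to the imaginary part; the radial
    part \<open>\<rho>' / \<rho>\<close> drops out.\<close>
  have "((\<lambda>t. zolotarev a t ^ n) has_integral (Im (P (\<zeta> pi)) - Im (P (\<zeta> 0)))) {0..pi}"
  proof (rule has_integral_spike[OF _ _ curve])
    show "negligible {0, pi}" by simp
    fix t assume "t \<in> {0..pi} - {0, pi}"
    thus "zolotarev a t ^ n = Im (H (\<zeta> t) * (of_real (\<rho>' t / \<rho> t) + \<i>))"
      using H_curve[of t] by simp
  qed
  thus ?thesis unfolding val N_def .
qed

section \<open>Cadlag paths\<close>

lemma cadlag_locally_bounded:
  assumes p: "cadlag p" and t: "t \<ge> 0"
  obtains d K where "d > 0" "\<And>s. s \<ge> 0 \<Longrightarrow> \<bar>s - t\<bar> < d \<Longrightarrow> \<bar>p s\<bar> \<le> K"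
proof -
  have "(p \<longlongrightarrow> p t) (at_right t)" using p t by (auto simp: cadlag_def)
  hence "eventually (\<lambda>s. dist (p s) (p t) < 1) (at_right t)" by (rule tendstoD) simp
  then obtain b where b: "b > t" "\<And>s. t < s \<Longrightarrow> s < b \<Longrightarrow> dist (p s) (p t) < 1"
    by (auto simp: eventually_at_right_field)
  obtain c l where c: "c < t" "\<And>s. 0 \<le> s \<Longrightarrow> c < s \<Longrightarrow> s < t \<Longrightarrow> dist (p s) l < 1"
  proof (cases "t > 0")
    case True
    then obtain l where "(p \<longlongrightarrow> l) (at_left t)" using p by (auto simp: cadlag_def)
    hence "eventually (\<lambda>s. dist (p s) l < 1) (at_left t)" by (rule tendstoD) simp
    thus ?thesis using that by (auto simp: eventually_at_left_field)
  next
    case False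
    thus ?thesis using that[of "t - 1" 0] t by auto
  qed
  show ?thesis
  proof (rule that[of "min (b - t) (t - c)" "\<bar>p t\<bar> + \<bar>l\<bar> + 1"])
    fix s :: real assume s: "s \<ge> 0" "\<bar>s - t\<bar> < min (b - t) (t - c)"
    consider "s = t" | "s > t" | "s < t" by linarith
    thus "\<bar>p s\<bar> \<le> \<bar>p t\<bar> + \<bar>l\<bar> + 1"
    proof cases
      case 2
      thus ?thesis using b(2)[of s] s by (auto simp: dist_real_def)
    next
      case 3
      thus ?thesis using c(2)[of s] s by (auto simp: dist_real_def)
    qed auto
  qed (use b c in auto)
qed

text \<open>Points along which the path is unbounded would accumulate in the compact interval,
  contradicting local boundedness at the limit point.\<close>

lemma cadlag_bounded:
  assumes p: "cadlag p"
  obtains K where "K \<ge> 0" "\<And>t. 0 \<le> t \<Longrightarrow> t \<le> R \<Longrightarrow> \<bar>p t\<bar> \<le> K"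
proof -
  have "\<exists>K. \<forall>t\<in>{0..R}. \<bar>p t\<bar> \<le> K"
  proof (rule ccontr)
    assume "\<not> ?thesis"
    hence "\<forall>n. \<exists>t\<in>{0..R}. \<bar>p t\<bar> > real n" by (meson not_le)
    then obtain t where t: "\<And>n. t n \<in> {0..R}" "\<And>n. \<bar>p (t n)\<bar> > real n" by metis
    obtain l r where l: "l \<in> {0..R}" "strict_mono (r :: nat \<Rightarrow> nat)" "(t \<circ> r) \<longlonglongrightarrow> l"
      using compact_Icc[of 0 R] t(1) by (metis compact_def)
    obtain d K where d: "d > 0" "\<And>s. s \<ge> 0 \<Longrightarrow> \<bar>s - l\<bar> < d \<Longrightarrow> \<bar>p s\<bar> \<le> K"
      using cadlag_locally_bounded[OF p, of l] l by auto
    have "eventually (\<lambda>n. dist ((t \<circ> r) n) l < d) sequentially" using l(3) d(1) by (rule tendstoD)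
    moreover have "eventually (\<lambda>n. real n > K) sequentially" by real_asymp
    ultimately have "eventually (\<lambda>n. False) sequentially"
    proof eventually_elim
      case (elim n)
      have "\<bar>p (t (r n))\<bar> \<le> K" using t(1)[of "r n"] elim by (intro d(2)) (auto simp: dist_real_def)
      moreover have "real n \<le> real (r n)" using seq_suble[OF l(2), of n] by simp
      ultimately show ?case using t(2)[of "r n"] elim by linarith
    qed
    thus False by simp
  qed
  then obtain K where "\<forall>t\<in>{0..R}. \<bar>p t\<bar> \<le> K" ..
  thus ?thesis by (intro that[of "max 0 K"]) (auto simp: le_max_iff_disj)
qed

text \<open>Dyadic times are rounded up, because a cadlag path is continuous only from the
  right.\<close>

definition upper_grid :: "nat \<Rightarrow> real \<Rightarrow> real" where
  "upper_grid k s = real_of_int \<lceil>s * 2 ^ k\<rceil> / 2 ^ k"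

lemma upper_grid_bounds: "s \<le> upper_grid k s" "upper_grid k s < s + 1 / 2 ^ k"
proof -
  have "s * 2 ^ k \<le> real_of_int \<lceil>s * 2 ^ k\<rceil>" "real_of_int \<lceil>s * 2 ^ k\<rceil> < s * 2 ^ k + 1" by linarith+
  thus "s \<le> upper_grid k s" "upper_grid k s < s + 1 / 2 ^ k"
    by (simp_all add: upper_grid_def field_simps)
qed

lemma cadlag_tendsto_from_right:
  assumes p: "cadlag p" and t: "t \<ge> 0" and s: "s \<longlonglongrightarrow> t" and ge: "eventually (\<lambda>k. s k \<ge> t) sequentially"
  shows "(\<lambda>k. p (s k)) \<longlonglongrightarrow> p t"
proof (rule tendstoI)
  fix e :: real assume e: "e > 0"
  have "(p \<longlongrightarrow> p t) (at_right t)" using p t by (auto simp: cadlag_def)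
  hence "eventually (\<lambda>s. dist (p s) (p t) < e) (at_right t)" using e by (rule tendstoD)
  then obtain b where b: "b > t" "\<And>s. t < s \<Longrightarrow> s < b \<Longrightarrow> dist (p s) (p t) < e"
    by (auto simp: eventually_at_right_field)
  have "eventually (\<lambda>k. s k < b) sequentially" using s b(1) by (rule order_tendstoD)
  with ge show "eventually (\<lambda>k. dist (p (s k)) (p t) < e) sequentially"
  proof eventually_elim
    case (elim k)
    thus ?case using b(2)[of "s k"] e by (cases "s k = t") auto
  qed
qed

lemma upper_grid_tendsto: "(\<lambda>k. upper_grid k s) \<longlonglongrightarrow> s"
proof (rule tendsto_sandwich[where f = "\<lambda>_. s" and h = "\<lambda>k. s + 1 / 2 ^ k"])
  show "(\<lambda>k. s + 1 / 2 ^ k) \<longlonglongrightarrow> s" by real_asymp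
qed (auto simp: upper_grid_bounds less_imp_le)

lemma cadlag_upper_grid:
  assumes "cadlag p" "s \<ge> 0"
  shows "(\<lambda>k. p (upper_grid k s)) \<longlonglongrightarrow> p s"
  by (rule cadlag_tendsto_from_right[OF assms upper_grid_tendsto]) (auto simp: upper_grid_bounds)

lemma measurable_upper_grid [measurable]: "(\<lambda>s. p (upper_grid k s)) \<in> borel_measurable borel"
  for p :: "real \<Rightarrow> real"
proof -
  have "(\<lambda>s::real. \<lceil>s * 2 ^ k\<rceil>) \<in> measurable borel (count_space UNIV)" by measurable
  moreover have "(\<lambda>i. p (real_of_int i / 2 ^ k)) \<in> measurable (count_space UNIV) borel" by simp
  ultimately show ?thesis unfolding upper_grid_def by (rule measurable_compose)
qed

text \<open>A limit of step functions. The indicator removes negative times, on which nothing is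
  assumed about the path.\<close>

lemma cadlag_measurable:
  assumes "cadlag p"
  shows "(\<lambda>s. indicator {0..} s * p s) \<in> borel_measurable borel"
proof (rule borel_measurable_LIMSEQ_real)
  show "(\<lambda>k. indicator {0..} s * p (upper_grid k s)) \<longlonglongrightarrow> indicator {0..} s * p s" for s
    using cadlag_upper_grid[OF assms, of s] by (auto simp: indicator_def)
qed measurable

lemma cadlag_set_integrable:
  assumes p: "cadlag p" and S: "S \<subseteq> {0..R}" "S \<in> sets borel"
  shows "set_integrable lborel S p"
proof -
  obtain K where K: "\<And>t. 0 \<le> t \<Longrightarrow> t \<le> R \<Longrightarrow> \<bar>p t\<bar> \<le> K" using cadlag_bounded[OF p] by blast
  have [measurable]: "(\<lambda>s. indicator {0..} s * p s) \<in> borel_measurable borel" using cadlag_measurable[OF p] .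
  have eq: "indicator S s *\<^sub>R p s = indicator S s * (indicator {0..} s * p s)" for s
    using S by (auto simp: indicator_def)
  show ?thesis unfolding set_integrable_def
  proof (rule Bochner_Integration.integrable_bound)
    show "integrable lborel (\<lambda>s. indicator {0..R} s *\<^sub>R K)"
      by (intro integrable_scaleR_left integrable_real_indicator) (auto simp: emeasure_lborel_Icc_eq)
    show "(\<lambda>s. indicator S s *\<^sub>R p s) \<in> borel_measurable lborel"
      unfolding eq using S by measurable
    show "AE s in lborel. norm (indicator S s *\<^sub>R p s) \<le> norm (indicator {0..R} s *\<^sub>R K)"
      using K S by (intro AE_I2) (force simp: indicator_def)
  qed
qed

text \<open>Sampling at the rounded time turns the integral into a Riemann sum over right endpoints
  exactly, so convergence of Riemann sums becomes a matter of dominated convergence.\<close>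

lemma upper_grid_integral:
  fixes p :: "real \<Rightarrow> real"
  shows "integrable lborel (\<lambda>s. indicator {0<..real m / 2 ^ k} s * p (upper_grid k s)) \<and>
    (\<integral>s. indicator {0<..real m / 2 ^ k} s * p (upper_grid k s) \<partial>lborel) = (\<Sum>i<m. p (real (Suc i) / 2 ^ k) / 2 ^ k)"
proof (induction m)
  case (Suc m)
  let ?I = "{real m / 2 ^ k<..real (Suc m) / 2 ^ k}"
  have split: "(\<lambda>s. indicator {0<..real (Suc m) / 2 ^ k} s * p (upper_grid k s)) =
     (\<lambda>s. indicator {0<..real m / 2 ^ k} s * p (upper_grid k s) + indicator ?I s * p (real (Suc m) / 2 ^ k))"
  proof
    fix s
    have le: "real m / 2 ^ k \<le> real (Suc m) / 2 ^ k" by (intro divide_right_mono) auto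
    have "upper_grid k s = real (Suc m) / 2 ^ k" if "s \<in> ?I"
    proof -
      have "real m < s * 2 ^ k" "s * 2 ^ k \<le> real (Suc m)" using that by (auto simp: field_simps)
      hence "\<lceil>s * 2 ^ k\<rceil> = int (Suc m)" by (intro ceiling_unique) auto
      thus ?thesis by (simp add: upper_grid_def)
    qed
    moreover have "0 < s" if "s \<in> ?I"
    proof -
      have "0 \<le> real m / 2 ^ k" by simp
      also have "\<dots> < s" using that by simp
      finally show ?thesis .
    qed
    ultimately show "indicator {0<..real (Suc m) / 2 ^ k} s * p (upper_grid k s) =
      indicator {0<..real m / 2 ^ k} s * p (upper_grid k s) + indicator ?I s * p (real (Suc m) / 2 ^ k)"
      using le by (auto simp: indicator_def)
  qed
  have I: "integrable lborel (\<lambda>s. indicator ?I s * p (real (Suc m) / 2 ^ k))"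
  proof (intro integrable_mult_left integrable_real_indicator)
    have "real m / 2 ^ k \<le> real (Suc m) / 2 ^ k" by (intro divide_right_mono) auto
    thus "emeasure lborel ?I < \<infinity>" by (subst emeasure_lborel_Ioc) auto
  qed simp
  have len: "measure lborel ?I = 1 / 2 ^ k"
    by (subst measure_lborel_Ioc) (auto simp: field_simps)
  have "(\<integral>s. indicator ?I s * p (real (Suc m) / 2 ^ k) \<partial>lborel) = p (real (Suc m) / 2 ^ k) / 2 ^ k"
    using len by simp
  thus ?case unfolding split using Suc I by simp
qed simp

text \<open>The number of terms varies with \<open>k\<close> because it will be the index of the
  first grid time after a passage, which only converges to the passage time.\<close>

lemma cadlag_riemann_sum:
  assumes p: "cadlag p" and T: "T \<ge> 0"
    and m: "(\<lambda>k. real (m k) / 2 ^ k) \<longlonglongrightarrow> T"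
  shows "(\<lambda>k. \<Sum>i<m k. p (real (Suc i) / 2 ^ k) / 2 ^ k) \<longlonglongrightarrow> (LBINT s:{0..T}. p s)"
proof -
  obtain K where K: "K \<ge> 0" "\<And>t. 0 \<le> t \<Longrightarrow> t \<le> T + 2 \<Longrightarrow> \<bar>p t\<bar> \<le> K" using cadlag_bounded[OF p] by blast
  have "eventually (\<lambda>k. real (m k) / 2 ^ k < T + 1) sequentially" using m by (rule order_tendstoD) simp
  \<comment> \<open>Discarding finitely many \<open>k\<close> leaves one integrable bound for all
    remaining integrands.\<close>
  then obtain k0 where k0: "\<And>k. k \<ge> k0 \<Longrightarrow> real (m k) / 2 ^ k < T + 1" by (auto simp: eventually_sequentially)
  have [measurable]: "(\<lambda>s. indicator {0..} s * p s) \<in> borel_measurable borel" using cadlag_measurable[OF p] .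
  have eq: "indicator {0..T} s *\<^sub>R p s = indicator {0..T} s * (indicator {0..} s * p s)" for s
    by (auto simp: indicator_def)
  have "(\<lambda>k. \<integral>s. indicator {0<..real (m (k + k0)) / 2 ^ (k + k0)} s * p (upper_grid (k + k0) s) \<partial>lborel)
      \<longlonglongrightarrow> (\<integral>s. indicator {0..T} s *\<^sub>R p s \<partial>lborel)"
  proof (rule integral_dominated_convergence[where w = "\<lambda>s. indicator {0..T + 1} s * K"])
    show "(\<lambda>s. indicator {0..T} s *\<^sub>R p s) \<in> borel_measurable lborel" unfolding eq by measurable
    show "integrable lborel (\<lambda>s. indicator {0..T + 1} s * K)"
      by (intro integrable_mult_left integrable_real_indicator) (auto simp: emeasure_lborel_Icc_eq)
    have "AE s in lborel. s \<noteq> (0::real)" "AE s in lborel. s \<noteq> T" by (rule AE_lborel_singleton)+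
    thus "AE s in lborel. (\<lambda>k. indicator {0<..real (m (k + k0)) / 2 ^ (k + k0)} s * p (upper_grid (k + k0) s))
        \<longlonglongrightarrow> indicator {0..T} s *\<^sub>R p s"
    proof eventually_elim
      case (elim s)
      have m': "(\<lambda>k. real (m (k + k0)) / 2 ^ (k + k0)) \<longlonglongrightarrow> T" using LIMSEQ_ignore_initial_segment[OF m] .
      consider "s < 0" | "0 < s" "s < T" | "s > T" using elim by linarith
      thus ?case
      proof cases
        case 2
        have "eventually (\<lambda>k. s < real (m (k + k0)) / 2 ^ (k + k0)) sequentially"
          using m' 2 by (intro order_tendstoD) auto
        hence ev: "eventually (\<lambda>k. p (upper_grid (k + k0) s) = indicator {0<..real (m (k + k0)) / 2 ^ (k + k0)} s * p (upper_grid (k + k0) s)) sequentially"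
          by eventually_elim (use 2 in auto)
        have conv: "(\<lambda>k. p (upper_grid (k + k0) s)) \<longlonglongrightarrow> p s"
          using LIMSEQ_ignore_initial_segment[OF cadlag_upper_grid[OF p, of s]] 2 by auto
        show ?thesis using Lim_transform_eventually[OF conv ev] 2 by simp
      next
        case 3
        have "eventually (\<lambda>k. real (m (k + k0)) / 2 ^ (k + k0) < s) sequentially"
          using m' 3 by (intro order_tendstoD) auto
        hence "eventually (\<lambda>k. indicator {0<..real (m (k + k0)) / 2 ^ (k + k0)} s * p (upper_grid (k + k0) s) = 0) sequentially"
          by eventually_elim (use 3 in auto)
        thus ?thesis using 3 by (auto intro: tendsto_eventually)
      qed auto
    qed
    fix k
    show "AE s in lborel. norm (indicator {0<..real (m (k + k0)) / 2 ^ (k + k0)} s * p (upper_grid (k + k0) s)) \<le> indicator {0..T + 1} s * K"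
    proof (rule AE_I2)
      fix s :: real
      show "norm (indicator {0<..real (m (k + k0)) / 2 ^ (k + k0)} s * p (upper_grid (k + k0) s)) \<le> indicator {0..T + 1} s * K"
      proof (cases "s \<in> {0<..real (m (k + k0)) / 2 ^ (k + k0)}")
        case True
        have s: "0 < s" "s < T + 1" using True k0[of "k + k0"] by auto
        have "1 / 2 ^ (k + k0) \<le> (1::real)" by simp
        hence "\<bar>p (upper_grid (k + k0) s)\<bar> \<le> K"
          using upper_grid_bounds(1)[of s "k + k0"] upper_grid_bounds(2)[of "k + k0" s] s by (intro K) linarith+
        thus ?thesis using True s by simp
      qed (use K in auto)
    qed
  qed measurable
  hence "(\<lambda>k. \<Sum>i<m (k + k0). p (real (Suc i) / 2 ^ (k + k0)) / 2 ^ (k + k0)) \<longlonglongrightarrow> (LBINT s:{0..T}. p s)"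
    by (simp only: upper_grid_integral set_lebesgue_integral_def)
  thus ?thesis by (rule LIMSEQ_offset)
qed

text \<open>The discount samples left endpoints, the Riemann sum right endpoints; the difference
  telescopes to a boundary term of order \<open>2 ^ -k\<close>. Linearising the logarithm costs an
  error of order \<open>4 ^ -k\<close> for each of about \<open>T * 2 ^ k\<close> factors.\<close>

lemma cadlag_discount:
  assumes p: "cadlag p" and T: "T \<ge> 0" and l: "l \<ge> 0"
    and m: "(\<lambda>k. real (m k) / 2 ^ k) \<longlonglongrightarrow> T"
    and nn: "\<And>k i. i < m k \<Longrightarrow> p (real i / 2 ^ k) \<ge> 0"
  shows "(\<lambda>k. \<Prod>i<m k. 1 / (1 + l / 2 ^ k * p (real i / 2 ^ k))) \<longlonglongrightarrow> exp (- l * (LBINT s:{0..T}. p s))"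
proof -
  obtain K where K: "K \<ge> 0" "\<And>t. 0 \<le> t \<Longrightarrow> t \<le> T + 1 \<Longrightarrow> \<bar>p t\<bar> \<le> K" using cadlag_bounded[OF p] by blast
  define R where "R = (\<lambda>k. \<Sum>i<m k. p (real (Suc i) / 2 ^ k) / 2 ^ k)"
  define S where "S = (\<lambda>k. \<Sum>i<m k. l / 2 ^ k * p (real i / 2 ^ k))"
  define E where "E = (\<lambda>k. \<Sum>i<m k. ln (1 + l / 2 ^ k * p (real i / 2 ^ k)))"
  have ev: "eventually (\<lambda>k. real (m k) / 2 ^ k < T + 1) sequentially" using m by (rule order_tendstoD) simp
  have SR: "S k = l * R k + l / 2 ^ k * (p 0 - p (real (m k) / 2 ^ k))" for k
  proof -
    have "(\<Sum>i<m k. p (real i / 2 ^ k)) = (\<Sum>i<m k. p (real (Suc i) / 2 ^ k)) - (\<Sum>i<m k. p (real (Suc i) / 2 ^ k) - p (real i / 2 ^ k))"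
      by (simp add: sum_subtractf)
    also have "(\<Sum>i<m k. p (real (Suc i) / 2 ^ k) - p (real i / 2 ^ k)) = p (real (m k) / 2 ^ k) - p 0"
      using sum_lessThan_telescope[of "\<lambda>i. p (real i / 2 ^ k)" "m k"] by simp
    finally have eq: "(\<Sum>i<m k. p (real i / 2 ^ k)) = (\<Sum>i<m k. p (real (Suc i) / 2 ^ k)) - (p (real (m k) / 2 ^ k) - p 0)" .
    have "S k = l / 2 ^ k * (\<Sum>i<m k. p (real i / 2 ^ k))" by (simp add: S_def sum_distrib_left)
    also have "\<dots> = l * ((\<Sum>i<m k. p (real (Suc i) / 2 ^ k)) / 2 ^ k) + l / 2 ^ k * (p 0 - p (real (m k) / 2 ^ k))"
      unfolding eq by (simp add: field_simps)
    finally show ?thesis by (simp add: R_def sum_divide_distrib)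
  qed
  have bd: "(\<lambda>k. l / 2 ^ k * (p 0 - p (real (m k) / 2 ^ k))) \<longlonglongrightarrow> 0"
  proof (rule Lim_null_comparison)
    show "(\<lambda>k. l / 2 ^ k * (2 * K)) \<longlonglongrightarrow> 0" by real_asymp
    show "eventually (\<lambda>k. norm (l / 2 ^ k * (p 0 - p (real (m k) / 2 ^ k))) \<le> l / 2 ^ k * (2 * K)) sequentially"
      using ev
    proof eventually_elim
      case (elim k)
      have "\<bar>p 0 - p (real (m k) / 2 ^ k)\<bar> \<le> 2 * K"
        using K(2)[of 0] K(2)[of "real (m k) / 2 ^ k"] elim T by auto
      hence "l / 2 ^ k * \<bar>p 0 - p (real (m k) / 2 ^ k)\<bar> \<le> l / 2 ^ k * (2 * K)"
        using l by (intro mult_left_mono) auto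
      thus ?case using l by (simp add: abs_mult)
    qed
  qed
  have Rl: "R \<longlonglongrightarrow> (LBINT s:{0..T}. p s)" unfolding R_def by (rule cadlag_riemann_sum[OF p T m])
  have Sl: "S \<longlonglongrightarrow> l * (LBINT s:{0..T}. p s) + 0"
    unfolding SR[abs_def] by (intro tendsto_intros Rl bd)
  have "(\<lambda>k. S k - E k) \<longlonglongrightarrow> 0"
  proof (rule Lim_null_comparison)
    show "(\<lambda>k. (T + 1) * (l * K)\<^sup>2 / 2 ^ k) \<longlonglongrightarrow> 0" by real_asymp
    have "eventually (\<lambda>k. l * K / 2 ^ k \<le> 1) sequentially"
    proof -
      have "(\<lambda>k::nat. l * K / 2 ^ k) \<longlonglongrightarrow> 0" by real_asymp
      from order_tendstoD(2)[OF this, of 1] show ?thesis by (auto elim: eventually_mono)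
    qed
    with ev show "eventually (\<lambda>k. norm (S k - E k) \<le> (T + 1) * (l * K)\<^sup>2 / 2 ^ k) sequentially"
    proof eventually_elim
      case (elim k)
      have b: "\<bar>l / 2 ^ k * p (real i / 2 ^ k) - ln (1 + l / 2 ^ k * p (real i / 2 ^ k))\<bar> \<le> (l * K / 2 ^ k)\<^sup>2" if i: "i < m k" for i
      proof -
        let ?x = "l / 2 ^ k * p (real i / 2 ^ k)"
        have "real i / 2 ^ k \<le> real (m k) / 2 ^ k" using i by (intro divide_right_mono) auto
        hence "\<bar>p (real i / 2 ^ k)\<bar> \<le> K" using elim by (intro K) auto
        hence x: "0 \<le> ?x" "?x \<le> l * K / 2 ^ k"
          using nn[OF i] l by (auto intro!: mult_left_mono divide_right_mono)
        hence "?x \<le> 1" using elim by linarith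
        hence "?x - ?x\<^sup>2 \<le> ln (1 + ?x)" using x by (intro ln_one_plus_pos_lower_bound)
        moreover have "ln (1 + ?x) \<le> ?x" using x by (intro ln_add_one_self_le_self)
        moreover have "?x\<^sup>2 \<le> (l * K / 2 ^ k)\<^sup>2" using x by (intro power_mono)
        ultimately show ?thesis by linarith
      qed
      have "norm (S k - E k) \<le> (\<Sum>i<m k. (l * K / 2 ^ k)\<^sup>2)"
        unfolding S_def E_def sum_subtractf [symmetric] by (intro sum_norm_le) (use b in auto)
      also have "\<dots> = (real (m k) / 2 ^ k) * ((l * K)\<^sup>2 / 2 ^ k)" by (simp add: power2_eq_square)
      also have "\<dots> \<le> (T + 1) * ((l * K)\<^sup>2 / 2 ^ k)" using elim by (intro mult_right_mono) auto
      finally show ?case by simp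
    qed
  qed
  from tendsto_diff[OF Sl this] have El: "E \<longlonglongrightarrow> l * (LBINT s:{0..T}. p s)" by simp
  have "(\<Prod>i<m k. 1 / (1 + l / 2 ^ k * p (real i / 2 ^ k))) = exp (- E k)" for k
  proof -
    have "(\<Prod>i<m k. 1 / (1 + l / 2 ^ k * p (real i / 2 ^ k))) = (\<Prod>i<m k. exp (- ln (1 + l / 2 ^ k * p (real i / 2 ^ k))))"
    proof (intro prod.cong refl)
      fix i assume "i \<in> {..<m k}"
      hence "0 \<le> l / 2 ^ k * p (real i / 2 ^ k)" using nn l by (intro mult_nonneg_nonneg) auto
      thus "1 / (1 + l / 2 ^ k * p (real i / 2 ^ k)) = exp (- ln (1 + l / 2 ^ k * p (real i / 2 ^ k)))"
        by (simp add: exp_minus inverse_eq_divide add_pos_nonneg)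
    qed
    also have "\<dots> = exp (- E k)" by (simp add: E_def exp_sum sum_negf [symmetric])
    finally show ?thesis .
  qed
  thus ?thesis using tendsto_exp[OF tendsto_minus[OF El]] by simp
qed

text \<open>Passage strictly below \<open>a\<close> rather than arrival at \<open>a\<close>: by
  right-continuity the strict inequality persists for a short while and is seen by a fine grid. The
  infimum is meaningful only for paths that cross the level, which will be almost all of
  them.\<close>

definition hit_below :: "real \<Rightarrow> (real \<Rightarrow> real) \<Rightarrow> real" where
  "hit_below a p = Inf {t. t \<ge> 0 \<and> p t < a}"

lemma cadlag_left_limit_ge:
  assumes p: "cadlag p" and t: "t > 0" and ge: "\<And>s. 0 \<le> s \<Longrightarrow> s < t \<Longrightarrow> p s \<ge> a" and j: "jump p t \<ge> 0"
  shows "p t \<ge> a"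
proof -
  obtain l where l: "(p \<longlongrightarrow> l) (at_left t)" using p t by (auto simp: cadlag_def)
  have "eventually (\<lambda>s. p s \<ge> a) (at_left t)"
    using t ge by (subst eventually_at_left_field) (force intro: exI[of _ 0])
  hence "l \<ge> a" using l by (intro tendsto_lowerbound) auto
  moreover have "Lim (at_left t) p = l" using l by (intro tendsto_Lim) auto
  ultimately show ?thesis using j by (simp add: jump_def)
qed

text \<open>At the infimum \<open>T\<close> right-continuity gives \<open>p T \<le> a\<close>, and
  the absence of negative jumps gives \<open>p T \<ge> a\<close>: the path creeps through the level.
  The infimum is thus not a time strictly below \<open>a\<close>, hence the strict inequalities in
  the last two claims.\<close>

lemma hit_below_properties:
  assumes p: "cadlag p" and j: "\<forall>t>0. jump p t \<ge> 0" and start: "p 0 > a"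
    and hit: "\<exists>t\<ge>0. p t < a"
  shows "hit_below a p > 0" "p (hit_below a p) = a" "\<And>t. 0 \<le> t \<Longrightarrow> t \<le> hit_below a p \<Longrightarrow> p t \<ge> a"
    "\<And>e. e > hit_below a p \<Longrightarrow> \<exists>t. hit_below a p < t \<and> t < e \<and> p t < a"
    "\<And>t. t \<ge> 0 \<Longrightarrow> p t < a \<Longrightarrow> hit_below a p < t"
proof -
  define B where "B = {t. t \<ge> 0 \<and> p t < a}"
  define T where "T = hit_below a p"
  have TB: "T = Inf B" by (simp add: T_def B_def hit_below_def)
  have ne: "B \<noteq> {}" and bb: "bdd_below B" using hit by (auto simp: B_def intro!: bdd_belowI[of _ 0])
  have T0: "T \<ge> 0" unfolding TB using ne by (intro cInf_greatest) (auto simp: B_def)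
  have before: "p t \<ge> a" if "0 \<le> t" "t < T" for t
    using that cInf_lower[OF _ bb, of t] unfolding TB by (force simp: B_def)
  have acc: "\<exists>t. T \<le> t \<and> t < e \<and> p t < a \<and> t \<ge> 0" if "e > T" for e
  proof -
    have "Inf B < e" using that TB by simp
    then obtain t where "t \<in> B" "t < e" using ne bb by (meson cInf_less_iff)
    moreover have "T \<le> t" using \<open>t \<in> B\<close> bb unfolding TB by (intro cInf_lower)
    ultimately show ?thesis by (auto simp: B_def)
  qed
  have "p T \<le> a"
  proof (rule ccontr)
    assume c: "\<not> p T \<le> a"
    have "(p \<longlongrightarrow> p T) (at_right T)" using p T0 by (auto simp: cadlag_def)
    hence "eventually (\<lambda>s. p s > a) (at_right T)" using c by (intro order_tendstoD) auto
    then obtain b where "b > T" "\<And>s. T < s \<Longrightarrow> s < b \<Longrightarrow> p s > a" by (auto simp: eventually_at_right_field)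
    moreover obtain t where "T \<le> t" "t < b" "p t < a" using acc[OF \<open>b > T\<close>] by auto
    ultimately show False using c by (cases "t = T") (auto, force)
  qed
  hence Tpos: "T > 0" using start T0 by (cases "T = 0") auto
  moreover have "p T \<ge> a" using cadlag_left_limit_ge[OF p Tpos before] j Tpos by blast
  ultimately have pT: "p T = a" using \<open>p T \<le> a\<close> by simp
  show "hit_below a p > 0" "p (hit_below a p) = a" using Tpos pT by (auto simp: T_def)
  show "p t \<ge> a" if "0 \<le> t" "t \<le> hit_below a p" for t
    using before[of t] that pT by (cases "t = T") (auto simp: T_def)
  show "\<exists>t. hit_below a p < t \<and> t < e \<and> p t < a" if "e > hit_below a p" for e
    using acc[of e] that pT by (metis T_def less_irrefl order_le_less)
  show "hit_below a p < t" if "t \<ge> 0" "p t < a" for t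
    using cInf_lower[OF _ bb, of t] that pT unfolding T_def[symmetric] TB[symmetric]
    by (metis B_def less_irrefl mem_Collect_eq order_le_less)
qed

section \<open>Stopped values of sampled paths\<close>

lemma stopped_value_stop:
  assumes alive: "\<And>i. i < m \<Longrightarrow> walk x r i \<ge> a" and stop: "walk x r m < a" and n: "m \<le> n"
  shows "stopped_value u a \<beta> x r n = of_real (discount \<beta> x r m) * u (walk x r m)"
  using n
proof (induction n rule: dec_induct)
  case base
  thus ?case using alive by (rule stopped_value_alive)
next
  case (step n)
  have "\<not> (\<forall>i\<le>n. walk x r i \<ge> a)" using stop step by (auto simp: not_le)
  hence "stopped_value u a \<beta> x r (Suc n) = stopped_value u a \<beta> x r n"
    by (simp only: stopped_value.simps if_False)
  thus ?case using step.IH by simp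
qed

lemma walk_increments:
  "walk (p 0) (\<lambda>i. p (real (Suc i) / 2 ^ k) - p (real i / 2 ^ k)) j = p (real j / 2 ^ k)"
  unfolding walk_def using sum_lessThan_telescope[of "\<lambda>i. p (real i / 2 ^ k)" j] by simp

text \<open>The mesh is \<open>2 ^ -k\<close> and the horizon is \<open>k\<close>, hence
  \<open>k * 2 ^ k\<close> steps. Refining and lengthening together leaves a single limit to
  take.\<close>

definition grid_value :: "(real \<Rightarrow> complex) \<Rightarrow> real \<Rightarrow> real \<Rightarrow> (real \<Rightarrow> real) \<Rightarrow> nat \<Rightarrow> complex" where
  "grid_value u a l p k = stopped_value u a (l / 2 ^ k) (p 0)
     (\<lambda>i. p (real (Suc i) / 2 ^ k) - p (real i / 2 ^ k)) (k * 2 ^ k)"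

text \<open>The first grid time below \<open>a\<close> tends to the passage time from above. By
  right-continuity the sampled position then tends to \<open>a\<close>, so the overshoot disappears
  in the limit, while the discount tends to the exponential of the area.\<close>

lemma grid_value_hit:
  assumes p: "cadlag p" and j: "\<forall>t>0. jump p t \<ge> 0" and start: "p 0 > a" and a: "a \<ge> 0"
    and l: "l \<ge> 0" and u: "isCont u a" and hit: "\<exists>t\<ge>0. p t < a"
  shows "grid_value u a l p \<longlonglongrightarrow> of_real (exp (- l * (LBINT s:{0..hit_below a p}. p s))) * u a"
proof -
  define T where "T = hit_below a p"
  note props = hit_below_properties[OF p j start hit, folded T_def]
  define Q where "Q = (\<lambda>k m. p (real m / 2 ^ k) < a)"
  have exQ: "eventually (\<lambda>k. \<exists>m. Q k m \<and> real m / 2 ^ k < e) sequentially" if e: "e > T" for e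
  proof -
    obtain t where t: "T < t" "t < e" "p t < a" using props(4)[OF e] by auto
    have "(\<lambda>k. p (upper_grid k t)) \<longlonglongrightarrow> p t" using t props(1) by (intro cadlag_upper_grid p) auto
    hence "eventually (\<lambda>k. p (upper_grid k t) < a) sequentially" using t(3) by (rule order_tendstoD)
    moreover have "eventually (\<lambda>k. upper_grid k t < e) sequentially"
      using upper_grid_tendsto t(2) by (rule order_tendstoD)
    ultimately show ?thesis
    proof eventually_elim
      case (elim k)
      have "0 \<le> \<lceil>t * 2 ^ k\<rceil>" using t props(1) by (simp add: zero_le_ceiling less_le_trans[of "-1" 0])
      hence "upper_grid k t = real (nat \<lceil>t * 2 ^ k\<rceil>) / 2 ^ k" by (simp add: upper_grid_def)
      thus ?case using elim by (auto simp: Q_def)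
    qed
  qed
  \<comment> \<open>The default 0 makes the claim about earlier grid points vacuous when the grid
    never sees the passage, which happens for finitely many \<open>k\<close> only.\<close>
  define m where "m = (\<lambda>k. if \<exists>m. Q k m then LEAST m. Q k m else 0)"
  have below: "p (real i / 2 ^ k) \<ge> a" if "i < m k" for i k
  proof (cases "\<exists>m. Q k m")
    case True
    thus ?thesis using not_less_Least[of i "Q k"] that by (simp add: m_def Q_def not_less)
  next
    case False
    hence "m k = 0" unfolding m_def by (rule if_not_P)
    thus ?thesis using that by simp
  qed
  have mT: "real (m k) / 2 ^ k > T" "Q k (m k)" if "\<exists>m. Q k m" for k
  proof -
    show "Q k (m k)" using LeastI_ex[OF that] that by (simp add: m_def)
    thus "real (m k) / 2 ^ k > T" unfolding Q_def by (intro props(5)) auto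
  qed
  have ex: "eventually (\<lambda>k. \<exists>m. Q k m) sequentially"
    using exQ[of "T + 1"] by (auto elim: eventually_mono)
  have mlim: "(\<lambda>k. real (m k) / 2 ^ k) \<longlonglongrightarrow> T"
  proof (rule order_tendstoI)
    fix e assume "e < T"
    show "eventually (\<lambda>k. e < real (m k) / 2 ^ k) sequentially"
      using ex by eventually_elim (use mT \<open>e < T\<close> less_trans in blast)
  next
    fix e assume "T < e"
    from exQ[OF this] show "eventually (\<lambda>k. real (m k) / 2 ^ k < e) sequentially"
    proof eventually_elim
      case (elim k)
      then obtain i where i: "Q k i" "real i / 2 ^ k < e" by auto
      have "m k \<le> i" using i by (auto simp: m_def intro: Least_le)
      hence "real (m k) / 2 ^ k \<le> real i / 2 ^ k" by (intro divide_right_mono) auto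
      thus ?case using i by linarith
    qed
  qed
  have "eventually (\<lambda>k. real (m k) / 2 ^ k < T + 1) sequentially" using mlim by (rule order_tendstoD) simp
  moreover have "eventually (\<lambda>k. real k \<ge> T + 1) sequentially" by real_asymp
  ultimately have "eventually (\<lambda>k. m k \<le> k * 2 ^ k) sequentially"
  proof eventually_elim
    case (elim k)
    hence "real (m k) / 2 ^ k \<le> real k" by linarith
    hence "real (m k) \<le> real (k * 2 ^ k)" by (simp add: field_simps)
    thus ?case by (simp only: of_nat_le_iff)
  qed
  hence ev: "eventually (\<lambda>k. of_real (\<Prod>i<m k. 1 / (1 + l / 2 ^ k * p (real i / 2 ^ k))) * u (p (real (m k) / 2 ^ k))
      = grid_value u a l p k) sequentially"
    using ex
  proof eventually_elim
    case (elim k)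
    have "stopped_value u a (l / 2 ^ k) (p 0) (\<lambda>i. p (real (Suc i) / 2 ^ k) - p (real i / 2 ^ k)) (k * 2 ^ k) =
      of_real (discount (l / 2 ^ k) (p 0) (\<lambda>i. p (real (Suc i) / 2 ^ k) - p (real i / 2 ^ k)) (m k)) *
      u (walk (p 0) (\<lambda>i. p (real (Suc i) / 2 ^ k) - p (real i / 2 ^ k)) (m k))"
      by (rule stopped_value_stop) (use below mT(2)[of k] elim in \<open>auto simp: Q_def walk_increments simp del: of_nat_Suc\<close>)
    thus ?case unfolding grid_value_def discount_def walk_increments by (rule sym)
  qed
  have "(\<lambda>k. p (real (m k) / 2 ^ k)) \<longlonglongrightarrow> p T"
  proof (rule cadlag_tendsto_from_right[OF p less_imp_le[OF props(1)] mlim])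
    show "eventually (\<lambda>k. T \<le> real (m k) / 2 ^ k) sequentially"
      using ex by eventually_elim (use mT less_imp_le in blast)
  qed
  hence "(\<lambda>k. p (real (m k) / 2 ^ k)) \<longlonglongrightarrow> a" using props(2) by simp
  hence ul: "(\<lambda>k. u (p (real (m k) / 2 ^ k))) \<longlonglongrightarrow> u a" using u by (rule isCont_tendsto_compose[rotated])
  have "(\<lambda>k. \<Prod>i<m k. 1 / (1 + l / 2 ^ k * p (real i / 2 ^ k))) \<longlonglongrightarrow> exp (- l * (LBINT s:{0..T}. p s))"
    using props(1) below a by (intro cadlag_discount p l mlim) (auto intro: order_trans)
  from Lim_transform_eventually[OF tendsto_mult[OF tendsto_of_real[OF this] ul] ev]
  show ?thesis by (simp add: T_def)
qed

text \<open>A path that stays above \<open>a > 0\<close> is discounted at least at rate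
  \<open>l * a\<close>; Bernoulli's inequality bounds the product of the factors by
  \<open>1 / (1 + k * (l * a))\<close>.\<close>

lemma grid_value_no_hit:
  assumes a: "a > 0" and l: "l > 0" and u: "\<And>x. norm (u x) \<le> K" and nohit: "\<And>t. t \<ge> 0 \<Longrightarrow> p t \<ge> a"
  shows "grid_value u a l p \<longlonglongrightarrow> 0"
proof (rule Lim_null_comparison)
  have K: "K \<ge> 0" using u[of 0] norm_ge_zero order_trans by blast
  show "(\<lambda>k. K / (1 + real k * (l * a))) \<longlonglongrightarrow> 0" using l a by real_asymp
  show "eventually (\<lambda>k. norm (grid_value u a l p k) \<le> K / (1 + real k * (l * a))) sequentially"
  proof (intro always_eventually allI)
    fix k
    let ?r = "\<lambda>i. p (real (Suc i) / 2 ^ k) - p (real i / 2 ^ k)"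
    have eq: "grid_value u a l p k = of_real (discount (l / 2 ^ k) (p 0) ?r (k * 2 ^ k)) * u (p (real (k * 2 ^ k) / 2 ^ k))"
    proof -
      have "walk (p 0) ?r i \<ge> a" for i unfolding walk_increments by (intro nohit) simp
      from stopped_value_alive[where j = "k * 2 ^ k" and x = "p 0" and r = ?r and a = a and u = u and \<beta> = "l / 2 ^ k", OF this]
      show ?thesis unfolding grid_value_def walk_increments .
    qed
    have "discount (l / 2 ^ k) (p 0) ?r (k * 2 ^ k) \<le> (\<Prod>i<k * 2 ^ k. 1 / (1 + l * a / 2 ^ k))"
      unfolding discount_def walk_increments
    proof (intro prod_mono conjI)
      fix i
      have pos: "0 < 1 + l * a / 2 ^ k" using l a by (intro add_pos_pos) auto
      have "l * a / 2 ^ k \<le> l / 2 ^ k * p (real i / 2 ^ k)"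
        using nohit[of "real i / 2 ^ k"] l mult_left_mono[of a "p (real i / 2 ^ k)" "l / 2 ^ k"] by simp
      thus "1 / (1 + l / 2 ^ k * p (real i / 2 ^ k)) \<le> 1 / (1 + l * a / 2 ^ k)" "0 \<le> 1 / (1 + l / 2 ^ k * p (real i / 2 ^ k))"
        using pos by (auto intro!: divide_left_mono mult_pos_pos)
    qed
    also have "\<dots> = 1 / (1 + l * a / 2 ^ k) ^ (k * 2 ^ k)" by (simp add: power_one_over)
    also have "\<dots> \<le> 1 / (1 + real k * (l * a))"
    proof (intro divide_left_mono mult_pos_pos)
      have "1 + real (k * 2 ^ k) * (l * a / 2 ^ k) \<le> (1 + l * a / 2 ^ k) ^ (k * 2 ^ k)"
      proof (rule Bernoulli_inequality)
        have "0 \<le> l * a / 2 ^ k" using l a by simp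
        thus "- 1 \<le> l * a / 2 ^ k" by linarith
      qed
      thus "1 + real k * (l * a) \<le> (1 + l * a / 2 ^ k) ^ (k * 2 ^ k)" by simp
    qed (use l a in \<open>auto intro!: add_pos_nonneg zero_less_power\<close>)
    finally have d: "discount (l / 2 ^ k) (p 0) ?r (k * 2 ^ k) \<le> 1 / (1 + real k * (l * a))" .
    have d0: "0 \<le> discount (l / 2 ^ k) (p 0) ?r (k * 2 ^ k)"
      by (rule discount_bounds) (use l a nohit in \<open>auto simp: walk_increments intro: order_trans[of 0 a] simp del: of_nat_Suc\<close>)
    have "norm (grid_value u a l p k) \<le> 1 / (1 + real k * (l * a)) * K"
      unfolding eq norm_mult using d d0 u l a by (intro mult_mono) auto
    thus "norm (grid_value u a l p k) \<le> K / (1 + real k * (l * a))" by simp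
  qed
qed

text \<open>The area stops at the infimum of the exact zeros, which may precede the passage strictly
  below 0. That infimum lies between the passage times below \<open>a\<close> and below 0, and the
  path is nonnegative up to the latter, so the areas are ordered in the same way.\<close>

lemma first_passage_area_bounds:
  assumes p: "cadlag (\<lambda>t. L t \<omega>)" and j: "\<forall>t>0. jump (\<lambda>t. L t \<omega>) t \<ge> 0" and start: "L 0 \<omega> > a" and a: "a > 0"
    and hit: "\<exists>t\<ge>0. L t \<omega> < 0"
  shows "(LBINT s:{0..hit_below a (\<lambda>t. L t \<omega>)}. L s \<omega>) \<le> first_passage_area L \<omega>"
    "first_passage_area L \<omega> \<le> (LBINT s:{0..hit_below 0 (\<lambda>t. L t \<omega>)}. L s \<omega>)"
    "0 \<le> first_passage_area L \<omega>"
proof -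
  let ?p = "\<lambda>t. L t \<omega>"
  define T0 where "T0 = hit_below 0 ?p"
  define Ta where "Ta = hit_below a ?p"
  have hita: "\<exists>t\<ge>0. L t \<omega> < a" using hit a by force
  have s0: "L 0 \<omega> > 0" using start a by simp
  note P0 = hit_below_properties[of ?p 0, OF p j s0 hit, folded T0_def]
  note Pa = hit_below_properties[of ?p a, OF p j start hita, folded Ta_def]
  define Z where "Z = {t. t > 0 \<and> L t \<omega> = 0}"
  have T0Z: "T0 \<in> Z" using P0 by (simp add: Z_def)
  have Zge: "Ta < t" if "t \<in> Z" for t using that a by (intro Pa(5)) (auto simp: Z_def)
  define T where "T = Inf Z"
  have bb: "bdd_below Z" by (auto simp: Z_def intro!: bdd_belowI[of _ 0])
  have TT0: "T \<le> T0" unfolding T_def using T0Z bb by (rule cInf_lower)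
  have TaT: "Ta \<le> T" unfolding T_def using T0Z Zge by (intro cInf_greatest) (auto intro: less_imp_le)
  have hz: "hitting_time_zero L \<omega> = ereal T"
  proof -
    have "hitting_time_zero L \<omega> = Inf (ereal ` Z)"
      by (simp add: hitting_time_zero_def Z_def image_Collect)
    also have "\<dots> = ereal T" unfolding T_def
    proof (rule ereal_Inf'[symmetric, OF bb])
      show "Z \<noteq> {}" using T0Z by auto
    qed
    finally show ?thesis .
  qed
  have T: "T > 0" using Pa(1) TaT by simp
  have area: "first_passage_area L \<omega> = (LBINT s:{0<..<T}. L s \<omega>)"
    unfolding first_passage_area_def hz using T
    by (simp add: interval_lebesgue_integral_def zero_ereal_def einterval_eq)
  have si: "set_integrable lborel S ?p" if "S \<subseteq> {0..T0}" "S \<in> sets borel" for S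
    by (rule cadlag_set_integrable[OF p that])
  have nn: "L s \<omega> \<ge> 0" if "0 \<le> s" "s \<le> T0" for s using P0(3) that by auto
  have ae: "AE s in lborel. s \<noteq> (0::real)" "AE s in lborel. s \<noteq> Ta" by (rule AE_lborel_singleton)+
  show "(LBINT s:{0..hit_below a ?p}. L s \<omega>) \<le> first_passage_area L \<omega>"
    unfolding area Ta_def[symmetric] set_lebesgue_integral_def
  proof (rule integral_mono_AE)
    show "integrable lborel (\<lambda>s. indicator {0..Ta} s *\<^sub>R L s \<omega>)" "integrable lborel (\<lambda>s. indicator {0<..<T} s *\<^sub>R L s \<omega>)"
      unfolding set_integrable_def[symmetric] using TaT TT0 by (rule_tac [!] si) auto
    show "AE s in lborel. indicator {0..Ta} s *\<^sub>R L s \<omega> \<le> indicator {0<..<T} s *\<^sub>R L s \<omega>"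
      using ae by eventually_elim (use TaT TT0 nn in \<open>auto simp: indicator_def\<close>)
  qed
  show "first_passage_area L \<omega> \<le> (LBINT s:{0..hit_below 0 ?p}. L s \<omega>)"
    unfolding area T0_def[symmetric] set_lebesgue_integral_def
  proof (rule integral_mono)
    show "integrable lborel (\<lambda>s. indicator {0<..<T} s *\<^sub>R L s \<omega>)" "integrable lborel (\<lambda>s. indicator {0..T0} s *\<^sub>R L s \<omega>)"
      unfolding set_integrable_def[symmetric] using TT0 by (rule_tac [!] si) auto
  qed (use TT0 nn in \<open>auto simp: indicator_def\<close>)
  show "0 \<le> first_passage_area L \<omega>"
    unfolding area set_lebesgue_integral_def
    by (intro integral_nonneg_AE AE_I2) (use TT0 nn in \<open>auto simp: indicator_def\<close>)
qed

section \<open>The Laplace transform of the area\<close>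

text \<open>The substitution \<open>s = l powr (1 / p) * r\<close>, under which the coefficient
  \<open>1 / (l * p)\<close> becomes \<open>1 / p\<close>.\<close>

lemma stable_airy_scaling:
  assumes p: "2 < p" and l: "l > 0"
  shows "stable_airy p (1 / (l * p)) 0 x = of_real (l powr (1 / p)) * stable_airy p (1 / p) 0 (l powr (1 / p) * x)"
proof -
  define c where "c = l powr (1 / p)"
  have c: "c > 0" "c powr p = l" using l p by (auto simp: c_def powr_powr)
  have ph: "stable_phase p (1 / (l * p)) 0 x (0 + c * r) = stable_phase p (1 / p) 0 (c * x) r" for r
  proof -
    have e: "Complex 0 (0 + c * r) = of_real c * Complex 0 r" by (simp add: complex_eq_iff)
    have "(of_real c * Complex 0 r) powr of_real p = of_real c powr of_real p * Complex 0 r powr of_real p"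
      using c by (intro powr_times_real_left) auto
    also have "of_real c powr of_real p = complex_of_real l" using c by (simp add: powr_of_real)
    finally show ?thesis using l p unfolding stable_phase_def e by (simp add: field_simps)
  qed
  have "stable_airy p (1 / (l * p)) 0 x = \<bar>c\<bar> *\<^sub>R (\<integral>r. stable_phase p (1 / (l * p)) 0 x (0 + c * r) \<partial>lborel)"
    unfolding stable_airy_def by (rule lborel_integral_real_affine) (use c in auto)
  also have "\<dots> = of_real c * stable_airy p (1 / p) 0 (c * x)"
    unfolding ph stable_airy_def using c by (simp add: scaleR_conv_of_real)
  finally show ?thesis by (simp add: c_def)
qed

text \<open>The two half lines contribute complex conjugate Gamma integrals, proportional to
  \<open>c powr (- (1 / p))\<close> with \<open>Re c > 0\<close>. Dividing the argument by
  \<open>p\<close> keeps it in the right half plane, so the real part of the sum is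
  positive.\<close>

lemma stable_airy_0_nonzero:
  assumes p: "2 < p" "p < 3" and k: "\<kappa> > 0"
  shows "stable_airy p \<kappa> 0 0 \<noteq> 0"
proof -
  define c where "c = - of_real \<kappa> * cis (p * (pi / 2))"
  have "cos (p * (pi / 2) - pi) > 0"
    using p pi_gt_zero by (intro cos_gt_zero_pi) (auto simp: field_simps)
  hence "cos (p * (pi / 2)) < 0" by (simp add: cos_diff)
  hence c: "Re c > 0" using k by (simp add: c_def mult_less_0_iff)
  hence c': "Re (cnj c) > 0" by simp
  let ?g = "\<lambda>c x. indicator {0<..} x *\<^sub>R (of_real (x powr (p * (1 / p) - 1)) * exp (- c * of_real (x powr p)))"
  note I = gamma_integral_powr_complex[of p "1 / p", OF _ _ c] gamma_integral_powr_complex[of p "1 / p", OF _ _ c']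
  have I1: "has_bochner_integral lborel (?g c) (of_real (Gamma (1 / p)) * c powr (- of_real (1 / p)) / of_real \<bar>p\<bar>)"
    using I(1) p by simp
  have I2: "has_bochner_integral lborel (?g (cnj c)) (of_real (Gamma (1 / p)) * cnj c powr (- of_real (1 / p)) / of_real \<bar>p\<bar>)"
    using I(2) p by simp
  have pos: "stable_phase p \<kappa> 0 0 s = exp (- c * of_real (s powr p))" if "s > 0" for s
  proof -
    have "Complex 0 s = of_real s * \<i>" by (simp add: complex_eq_iff)
    also have "(of_real s * \<i>) powr of_real p = of_real s powr of_real p * \<i> powr of_real p"
      using that by (intro powr_times_real_left) auto
    also have "of_real s powr of_real p = complex_of_real (s powr p)" using that by (simp add: powr_of_real)
    also have "\<i> powr of_real p = cis (p * (pi / 2))" by (simp add: powr_def cis_conv_exp mult_ac)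
    finally show ?thesis by (simp add: stable_phase_def c_def mult_ac)
  qed
  have neg: "stable_phase p \<kappa> 0 0 s = exp (- cnj c * of_real ((- s) powr p))" if "s < 0" for s
  proof -
    have "Complex 0 s = cnj (Complex 0 (- s))" by (simp add: complex_eq_iff)
    also have "cnj (Complex 0 (- s)) powr of_real p = cnj (Complex 0 (- s) powr of_real p)"
      by (subst cnj_powr) (use that in auto)
    finally have "stable_phase p \<kappa> 0 0 s = cnj (stable_phase p \<kappa> 0 0 (- s))"
      by (simp add: stable_phase_def exp_cnj)
    thus ?thesis using pos[of "- s"] that by (simp add: exp_cnj)
  qed
  have "integrable lborel (?g (cnj c))" using I2 by (simp add: has_bochner_integral_iff)
  hence i2: "integrable lborel (\<lambda>s. ?g (cnj c) (0 + (-1) * s))" by (subst lborel_integrable_real_affine_iff) auto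
  have v2: "(\<integral>s. ?g (cnj c) (0 + (-1) * s) \<partial>lborel) = (\<integral>s. ?g (cnj c) s \<partial>lborel)"
    using lborel_integral_real_affine[of "-1" "?g (cnj c)" 0] by simp
  have "stable_airy p \<kappa> 0 0 = (\<integral>s. ?g c s + ?g (cnj c) (0 + (-1) * s) \<partial>lborel)"
    unfolding stable_airy_def
  proof (rule integral_cong_AE)
    have "AE s in lborel. s \<noteq> (0::real)" by (rule AE_lborel_singleton)
    thus "AE s in lborel. stable_phase p \<kappa> 0 0 s = ?g c s + ?g (cnj c) (0 + (-1) * s)"
    proof eventually_elim
      case (elim s)
      thus ?case using pos[of s] neg[of s] p by (cases "s > 0") auto
    qed
  qed measurable
  also have "\<dots> = (\<integral>s. ?g c s \<partial>lborel) + (\<integral>s. ?g (cnj c) s \<partial>lborel)"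
    unfolding v2[symmetric] using I1 i2 by (intro Bochner_Integration.integral_add) (auto simp: has_bochner_integral_iff)
  also have "\<dots> = of_real (Gamma (1 / p)) * c powr (- of_real (1 / p)) / of_real \<bar>p\<bar> +
      of_real (Gamma (1 / p)) * cnj c powr (- of_real (1 / p)) / of_real \<bar>p\<bar>"
    using I1 I2 by (simp only: has_bochner_integral_iff)
  also have "cnj c powr (- of_real (1 / p)) = cnj (c powr (- of_real (1 / p)))"
    using c by (subst cnj_powr) auto
  finally have eq: "Re (stable_airy p \<kappa> 0 0) = 2 * (Gamma (1 / p) * Re (c powr (- of_real (1 / p))) / p)"
    using p by (simp add: Re_divide_of_real)
  have "Re (c powr (- of_real (1 / p))) > 0"
  proof -
    have c0: "c \<noteq> 0" using c by auto
    have "\<bar>Arg c\<bar> < pi / 2" using c Arg_Re_pos by blast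
    moreover have "\<bar>Arg c / p\<bar> \<le> \<bar>Arg c\<bar>" using p mult_right_mono[of 1 p "\<bar>Arg c\<bar>"] by (simp add: abs_divide field_simps)
    ultimately have "\<bar>Arg c / p\<bar> < pi / 2" by linarith
    hence "cos (Arg c / p) > 0" by (intro cos_gt_zero_pi) linarith+
    moreover have "c powr (- of_real (1 / p)) = exp (- of_real (1 / p) * (of_real (ln (norm c)) + \<i> * of_real (Arg c)))"
      using c0 by (simp add: powr_def Ln_Arg)
    ultimately show ?thesis using c0 by (simp add: Re_exp)
  qed
  hence "Re (stable_airy p \<kappa> 0 0) > 0" unfolding eq using p by simp
  thus ?thesis by auto
qed

section \<open>Optional stopping of the process along dyadic grids\<close>

context spectrally_positive_stable_process
begin

definition increment :: "nat \<Rightarrow> 'a \<Rightarrow> nat \<Rightarrow> real" where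
  "increment k \<omega> i = L (real (Suc i) / 2 ^ k) \<omega> - L (real i / 2 ^ k) \<omega>"

text \<open>The walk starts from the constant \<open>start\<close> instead of \<open>L 0\<close>, so
  that its randomness lies in the increments alone; on almost every path the value agrees with
  \<open>grid_value\<close>.\<close>

definition value_at_stop :: "(real \<Rightarrow> complex) \<Rightarrow> real \<Rightarrow> real \<Rightarrow> nat \<Rightarrow> 'a \<Rightarrow> complex" where
  "value_at_stop u a l k \<omega> = stopped_value u a (l / 2 ^ k) start (increment k \<omega>) (k * 2 ^ k)"

lemma measurable_increment [measurable]: "(\<lambda>\<omega>. increment k \<omega> i) \<in> borel_measurable M"
  unfolding increment_def by (intro borel_measurable_diff random_variable_L) auto

lemma measurable_value_at_stop [measurable]:
  assumes "u \<in> borel_measurable borel"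
  shows "value_at_stop u a l k \<in> borel_measurable M"
proof -
  have "(\<lambda>\<omega>. restrict (increment k \<omega>) {..<k * 2 ^ k}) \<in> measurable M (Pi\<^sub>M {..<k * 2 ^ k} (\<lambda>_. borel))"
    by (rule measurable_restrict) measurable
  from measurable_compose[OF this measurable_stopped_value[OF assms order_refl, of a "l / 2 ^ k" start "k * 2 ^ k"]]
  show ?thesis by (simp add: stopped_value_restrict value_at_stop_def[abs_def])
qed

lemma AE_regular: "AE \<omega> in M. L 0 \<omega> = start \<and> cadlag (\<lambda>t. L t \<omega>) \<and> (\<forall>t>0. jump (\<lambda>t. L t \<omega>) t \<ge> 0)"
  using AE_start AE_cadlag AE_no_negative_jumps by eventually_elim auto

lemma value_at_stop_eq:
  "L 0 \<omega> = start \<Longrightarrow> value_at_stop u a l k \<omega> = grid_value u a l (\<lambda>t. L t \<omega>) k"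
  by (simp add: value_at_stop_def grid_value_def increment_def[abs_def])

text \<open>There are \<open>k * 2 ^ k\<close> steps with an error of order \<open>4 ^ -k\<close>
  each, so the total error vanishes although the horizon grows.\<close>

lemma expectation_value_at_stop:
  assumes \<alpha>: "1 < \<alpha>" "\<alpha> < 2" and a: "a \<ge> 0" and l: "l > 0"
  shows "(\<lambda>k. expectation (value_at_stop (stable_airy (\<alpha> + 1) (1 / (l * (\<alpha> + 1))) 0) a l k))
    \<longlonglongrightarrow> stable_airy (\<alpha> + 1) (1 / (l * (\<alpha> + 1))) 0 start"
proof -
  let ?p = "\<alpha> + 1" and ?\<kappa> = "1 / (l * (\<alpha> + 1))"
  let ?u = "stable_airy ?p ?\<kappa> 0"
  have p: "2 < ?p" "?p < 3" and k: "?\<kappa> > 0" using \<alpha> l by auto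
  obtain C where C: "C \<ge> 0" "\<And>\<nu> h x. prob_space \<nu> \<Longrightarrow> sets \<nu> = sets borel \<Longrightarrow> h \<ge> 0 \<Longrightarrow>
     (\<And>s. (\<integral>y. exp (- of_real y * Complex 0 s) \<partial>\<nu>) = exp (of_real h * Complex 0 s powr of_real (?p - 1))) \<Longrightarrow>
     norm ((\<integral>y. ?u (x + y) \<partial>\<nu>) - of_real (1 + h * x / (?\<kappa> * ?p)) * ?u x) \<le> C * h\<^sup>2"
    using stable_airy_step[OF p k] by blast
  have bound: "norm (expectation (value_at_stop ?u a l k) - ?u start) \<le> real (k * 2 ^ k) * (C * (1 / 2 ^ k)\<^sup>2)" for k
    unfolding value_at_stop_def increment_def[abs_def]
  proof (rule stopped_value_expectation)
    let ?h = "1 / 2 ^ k :: real"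
    have [measurable]: "L ?h \<in> borel_measurable M" "L 0 \<in> borel_measurable M" by (auto intro: random_variable_L)
    define \<nu> where "\<nu> = distr M borel (\<lambda>\<omega>. L ?h \<omega> - L 0 \<omega>)"
    show "indep_vars (\<lambda>_. borel) (\<lambda>i \<omega>. L (real (Suc i) / 2 ^ k) \<omega> - L (real i / 2 ^ k) \<omega>) {..<k * 2 ^ k}"
      by (rule independent_increments[of "\<lambda>i. real i / 2 ^ k"]) (auto intro: divide_right_mono)
    show "distr M borel (\<lambda>\<omega>. L (real (Suc i) / 2 ^ k) \<omega> - L (real i / 2 ^ k) \<omega>) = \<nu>" for i
    proof -
      have "real (Suc i) / 2 ^ k = real i / 2 ^ k + ?h" by (simp add: add_divide_distrib)
      thus ?thesis unfolding \<nu>_def using stationary_increments[of "real i / 2 ^ k" ?h] by simp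
    qed
    show "?u \<in> borel_measurable borel" by (rule measurable_stable_airy[OF p k])
    show "norm (?u x) \<le> (\<integral>s. norm (stable_phase ?p ?\<kappa> 0 0 s) \<partial>lborel)" for x by (rule stable_airy_bounded[OF p k])
    have "norm ((\<integral>y. ?u (x + y) \<partial>\<nu>) - of_real (1 + ?h * x / (?\<kappa> * ?p)) * ?u x) \<le> C * ?h\<^sup>2" for x
    proof (rule C(2))
      show "prob_space \<nu>" unfolding \<nu>_def by (rule prob_space_distr) measurable
      show "(\<integral>y. exp (- of_real y * Complex 0 s) \<partial>\<nu>) = exp (of_real ?h * Complex 0 s powr of_real (?p - 1))" for s
      proof -
        have "(\<integral>y. exp (- of_real y * Complex 0 s) \<partial>\<nu>) = expectation (\<lambda>\<omega>. exp (- of_real (L ?h \<omega> - L 0 \<omega>) * Complex 0 s))"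
          unfolding \<nu>_def by (rule integral_distr) measurable
        also have "\<dots> = exp (of_real ?h * Complex 0 s powr of_real \<alpha>)"
          using char_increment[of 0 ?h s] \<alpha> by simp
        finally show ?thesis by simp
      qed
    qed (auto simp: \<nu>_def)
    note step = this
    \<comment> \<open>The choice \<open>\<kappa> = 1 / (l * p)\<close> is made so that a step of
      length \<open>1 / 2 ^ k\<close> discounts at rate \<open>l\<close>.\<close>
    have eq: "?h * x / (?\<kappa> * ?p) = l / 2 ^ k * x" for x
    proof -
      have "?\<kappa> * ?p = 1 / l" using \<alpha> l by (simp add: divide_simps)
      thus ?thesis by (simp only:) simp
    qed
    show "norm ((\<integral>y. ?u (x + y) \<partial>\<nu>) - of_real (1 + l / 2 ^ k * x) * ?u x) \<le> C * ?h\<^sup>2" for x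
      using step[of x] unfolding eq .
  qed (use a l in auto)
  have "(\<lambda>k. expectation (value_at_stop ?u a l k) - ?u start) \<longlonglongrightarrow> 0"
  proof (rule Lim_null_comparison)
    show "eventually (\<lambda>k. norm (expectation (value_at_stop ?u a l k) - ?u start) \<le> real (k * 2 ^ k) * (C * (1 / 2 ^ k)\<^sup>2)) sequentially"
      using bound by simp
    show "(\<lambda>k. real (k * 2 ^ k) * (C * (1 / 2 ^ k)\<^sup>2)) \<longlonglongrightarrow> 0"
    proof -
      have "real (k * 2 ^ k) * (C * (1 / 2 ^ k)\<^sup>2) = C * (real k / 2 ^ k)" for k by (simp add: power2_eq_square field_simps)
      moreover have "(\<lambda>k::nat. C * (real k / 2 ^ k)) \<longlonglongrightarrow> 0" by real_asymp
      ultimately show ?thesis by simp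
    qed
  qed
  thus ?thesis by (simp add: LIM_zero_iff)
qed

text \<open>For a level \<open>a > 0\<close> the paths that never cross contribute nothing in the
  limit, whence \<open>norm (u start) \<le> norm (u a) * prob H\<close>. As \<open>l\<close> tends
  to 0, both Airy values tend after scaling to the same nonzero value at 0, which forces
  \<open>prob H = 1\<close>.\<close>

lemma AE_hits:
  assumes \<alpha>: "1 < \<alpha>" "\<alpha> < 2" and a: "0 < a" "a < start"
  shows "AE \<omega> in M. \<exists>t\<ge>0. L t \<omega> < a"
proof -
  \<comment> \<open>Rational times make the event measurable, and by right-continuity a path that is
    ever strictly below \<open>a\<close> is so at a rational time.\<close>
  define H where "H = (\<Union>q\<in>\<rat> \<inter> {0..}. {\<omega>\<in>space M. L q \<omega> < a})"
  have H[measurable]: "H \<in> sets M" unfolding H_def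
  proof (rule sets.countable_UN')
    show "countable (\<rat> \<inter> {0::real..})" using countable_rat by (rule countable_subset[rotated]) auto
    have meas: "{\<omega> \<in> space M. L q \<omega> < a} \<in> sets M" if "q \<ge> 0" for q
      using random_variable_L[OF that] by measurable
    show "(\<lambda>q. {\<omega> \<in> space M. L q \<omega> < a}) ` (\<rat> \<inter> {0..}) \<subseteq> sets M"
    proof (rule image_subsetI)
      fix q :: real assume "q \<in> \<rat> \<inter> {0..}"
      hence "q \<ge> 0" by blast
      thus "{\<omega> \<in> space M. L q \<omega> < a} \<in> sets M" by (rule meas)
    qed
  qed
  have H_iff: "\<omega> \<in> H \<longleftrightarrow> (\<exists>t\<ge>0. L t \<omega> < a)" if \<omega>: "\<omega> \<in> space M" "cadlag (\<lambda>t. L t \<omega>)" for \<omega>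
  proof
    assume "\<exists>t\<ge>0. L t \<omega> < a"
    then obtain t where t: "t \<ge> 0" "L t \<omega> < a" by auto
    have "((\<lambda>t. L t \<omega>) \<longlongrightarrow> L t \<omega>) (at_right t)" using \<omega> t by (auto simp: cadlag_def)
    hence "eventually (\<lambda>s. L s \<omega> < a) (at_right t)" using t(2) by (rule order_tendstoD)
    then obtain b where b: "b > t" "\<And>s. t < s \<Longrightarrow> s < b \<Longrightarrow> L s \<omega> < a" by (auto simp: eventually_at_right_field)
    obtain q where "q \<in> \<rat>" "t < q" "q < b" using Rats_dense_in_real[OF b(1)] by auto
    hence "q \<in> \<rat> \<inter> {0..}" "L q \<omega> < a" using b t by auto
    thus "\<omega> \<in> H" using \<omega> unfolding H_def by blast
  qed (auto simp: H_def)
  let ?p = "\<alpha> + 1"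
  have p: "2 < ?p" "?p < 3" "0 < 1 / ?p" using \<alpha> by auto
  let ?\<Phi> = "stable_airy ?p (1 / ?p) 0"
  have key: "norm (?\<Phi> (l powr (1 / ?p) * start)) \<le> norm (?\<Phi> (l powr (1 / ?p) * a)) * prob H" if l: "l > 0" for l
  proof -
    let ?u = "stable_airy ?p (1 / (l * ?p)) 0"
    have k: "1 / (l * ?p) > 0" using l \<alpha> by auto
    have [measurable]: "?u \<in> borel_measurable borel" by (rule measurable_stable_airy[OF p(1,2) k])
    define K where "K = (\<integral>s. norm (stable_phase ?p (1 / (l * ?p)) 0 0 s) \<partial>lborel)"
    have uK: "norm (?u x) \<le> K" for x unfolding K_def by (rule stable_airy_bounded[OF p(1,2) k])
    define Z where "Z = (\<lambda>\<omega>. lim (\<lambda>k. value_at_stop ?u a l k \<omega>))"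
    have Zm[measurable]: "Z \<in> borel_measurable M" unfolding Z_def by (rule borel_measurable_lim_metric) measurable
    have lims: "AE \<omega> in M. (\<lambda>k. value_at_stop ?u a l k \<omega>) \<longlonglongrightarrow> Z \<omega> \<and> norm (Z \<omega>) \<le> indicator H \<omega> * norm (?u a)"
      using AE_regular AE_space
    proof eventually_elim
      case (elim \<omega>)
      note reg = conjunct1[OF elim(1)] conjunct1[OF conjunct2[OF elim(1)]] conjunct2[OF conjunct2[OF elim(1)]]
      show ?case
      proof (cases "\<omega> \<in> H")
        case True
        hence hit: "\<exists>t\<ge>0. L t \<omega> < a" using H_iff elim reg by blast
        have s: "L 0 \<omega> > a" using reg a by simp
        note P = hit_below_properties[of "\<lambda>t. L t \<omega>", OF reg(2,3) s hit]
        have lim: "(\<lambda>k. value_at_stop ?u a l k \<omega>) \<longlonglongrightarrow>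
            of_real (exp (- l * (LBINT s:{0..hit_below a (\<lambda>t. L t \<omega>)}. L s \<omega>))) * ?u a"
          unfolding value_at_stop_eq[OF reg(1)]
          using grid_value_hit[where p = "\<lambda>t. L t \<omega>", OF reg(2,3) s less_imp_le[OF a(1)] less_imp_le[OF l] continuous_stable_airy[OF p(1,2) k] hit] .
        have "0 \<le> (LBINT s:{0..hit_below a (\<lambda>t. L t \<omega>)}. L s \<omega>)"
          unfolding set_lebesgue_integral_def
          by (intro integral_nonneg_AE AE_I2) (use P(3) a in \<open>force simp: indicator_def intro: order_trans[of 0 a]\<close>)
        hence "exp (- l * (LBINT s:{0..hit_below a (\<lambda>t. L t \<omega>)}. L s \<omega>)) \<le> 1" using l by simp
        hence "norm (of_real (exp (- l * (LBINT s:{0..hit_below a (\<lambda>t. L t \<omega>)}. L s \<omega>))) * ?u a) \<le> norm (?u a)"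
          by (simp add: norm_mult mult_left_le_one_le)
        thus ?thesis using lim True limI[OF lim] by (simp add: Z_def)
      next
        case False
        hence nohit: "\<And>t. t \<ge> 0 \<Longrightarrow> L t \<omega> \<ge> a" using H_iff elim reg by (meson not_le)
        have lim: "(\<lambda>k. value_at_stop ?u a l k \<omega>) \<longlonglongrightarrow> 0"
          unfolding value_at_stop_eq[OF reg(1)] by (rule grid_value_no_hit[where p = "\<lambda>t. L t \<omega>", OF a(1) l uK nohit])
        thus ?thesis using False limI[OF lim] by (simp add: Z_def)
      qed
    qed
    have "(\<lambda>k. expectation (value_at_stop ?u a l k)) \<longlonglongrightarrow> expectation Z"
    proof (rule integral_dominated_convergence[where w = "\<lambda>_. K"])
      show "AE \<omega> in M. norm (value_at_stop ?u a l k \<omega>) \<le> K" for k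
        unfolding value_at_stop_def using a l by (intro AE_I2 norm_stopped_value_le uK) auto
      show "AE \<omega> in M. (\<lambda>k. value_at_stop ?u a l k \<omega>) \<longlonglongrightarrow> Z \<omega>" using lims by eventually_elim auto
    qed auto
    with expectation_value_at_stop[OF \<alpha> less_imp_le[OF a(1)] l] have "expectation Z = ?u start"
      using LIMSEQ_unique by blast
    hence "norm (?u start) \<le> expectation (\<lambda>\<omega>. norm (Z \<omega>))" by (metis integral_norm_bound)
    also have "\<dots> \<le> expectation (\<lambda>\<omega>. indicator H \<omega> * norm (?u a))"
    proof (rule integral_mono_AE)
      have "AE \<omega> in M. norm (Z \<omega>) \<le> norm (?u a)" using lims
      proof eventually_elim
        case (elim \<omega>)
        have "indicator H \<omega> * norm (?u a) \<le> 1 * norm (?u a)" by (intro mult_right_mono) (auto simp: indicator_def)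
        thus ?case using elim by simp
      qed
      thus "integrable M (\<lambda>\<omega>. norm (Z \<omega>))" by (intro integrable_norm integrable_const_bound) auto
      show "integrable M (\<lambda>\<omega>. indicator H \<omega> * norm (?u a))" by (intro integrable_mult_left integrable_real_indicator) (auto simp: emeasure_eq_measure)
      show "AE \<omega> in M. norm (Z \<omega>) \<le> indicator H \<omega> * norm (?u a)" using lims by eventually_elim auto
    qed
    also have "\<dots> = norm (?u a) * prob H" by simp
    finally show ?thesis
      unfolding stable_airy_scaling[OF p(1) l] using l by (simp add: norm_mult)
  qed
  have c\<Phi>: "((\<lambda>l. norm (?\<Phi> (l powr (1 / ?p) * x))) \<longlongrightarrow> norm (?\<Phi> 0)) (at_right 0)" for x
  proof -
    have "((\<lambda>l. l powr (1 / ?p) * x) \<longlongrightarrow> 0) (at_right 0)" using p by real_asymp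
    from isCont_tendsto_compose[OF continuous_stable_airy[OF p, of 0] this] show ?thesis by (rule tendsto_norm)
  qed
  have "norm (?\<Phi> 0) \<le> norm (?\<Phi> 0) * prob H"
  proof (rule tendsto_le[OF _ tendsto_mult[OF c\<Phi> tendsto_const] c\<Phi>])
    show "eventually (\<lambda>l. norm (?\<Phi> (l powr (1 / ?p) * start)) \<le> norm (?\<Phi> (l powr (1 / ?p) * a)) * prob H) (at_right 0)"
      using eventually_at_right_less[of 0] by eventually_elim (rule key)
  qed simp
  hence "prob H \<ge> 1" using stable_airy_0_nonzero[OF p] by simp
  hence "prob H = 1" using prob_le_1[of H] by linarith
  hence "AE \<omega> in M. \<omega> \<in> H" using prob_eq_1[OF H] by simp
  with AE_space AE_cadlag show ?thesis by eventually_elim (use H_iff in auto)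
qed

end

text \<open>\<open>AE_hits\<close> works for positive levels, where the discount is bounded away
  from 1. Increments and jumps are unchanged by adding a constant, so level 0 can be treated as
  level 1 of the process \<open>L + 1\<close>.\<close>

lemma spectrally_positive_stable_process_shift:
  assumes "spectrally_positive_stable_process M x L \<alpha>"
  shows "spectrally_positive_stable_process M (x + c) (\<lambda>t \<omega>. L t \<omega> + c) \<alpha>"
proof -
  interpret spectrally_positive_stable_process M x L \<alpha> by fact
  have cad: "cadlag (\<lambda>t. p t + c)" if "cadlag p" for p
    unfolding cadlag_def
  proof (intro conjI allI impI)
    show "((\<lambda>t. p t + c) \<longlongrightarrow> p t + c) (at_right t)" if "0 \<le> t" for t
      using \<open>cadlag p\<close> that unfolding cadlag_def by (intro tendsto_intros) auto
    show "\<exists>l. ((\<lambda>t. p t + c) \<longlongrightarrow> l) (at_left t)" if t: "0 < t" for t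
    proof -
      obtain l where "(p \<longlongrightarrow> l) (at_left t)" using \<open>cadlag p\<close> t by (auto simp: cadlag_def)
      hence "((\<lambda>t. p t + c) \<longlongrightarrow> l + c) (at_left t)" by (intro tendsto_intros)
      thus ?thesis ..
    qed
  qed
  have jmp: "jump (\<lambda>t. p t + c) t = jump p t" if p: "cadlag p" and t: "t > 0" for p t
  proof -
    obtain l where l: "(p \<longlongrightarrow> l) (at_left t)" using p t by (auto simp: cadlag_def)
    hence "((\<lambda>t. p t + c) \<longlongrightarrow> l + c) (at_left t)" by (intro tendsto_intros)
    hence "Lim (at_left t) (\<lambda>t. p t + c) = l + c" by (intro tendsto_Lim) auto
    moreover have "Lim (at_left t) p = l" using l by (intro tendsto_Lim) auto
    ultimately show ?thesis by (simp add: jump_def)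
  qed
  show ?thesis
  proof unfold_locales
    show "random_variable borel (\<lambda>\<omega>. L t \<omega> + c)" if "0 \<le> t" for t
      using random_variable_L[OF that] by measurable
    show "AE \<omega> in M. L 0 \<omega> + c = x + c" using AE_start by simp
    show "indep_vars (\<lambda>_. borel) (\<lambda>i \<omega>. L (u (Suc i)) \<omega> + c - (L (u i) \<omega> + c)) {..<n}"
      if "0 \<le> u 0" "\<And>i. i < n \<Longrightarrow> u i \<le> u (Suc i)" for u n
      unfolding add_diff_cancel_right by (rule independent_increments[OF that])
    show "distr M borel (\<lambda>\<omega>. L (s + h) \<omega> + c - (L s \<omega> + c)) = distr M borel (\<lambda>\<omega>. L h \<omega> + c - (L 0 \<omega> + c))"
      if "0 \<le> s" "0 \<le> h" for s h unfolding add_diff_cancel_right by (rule stationary_increments[OF that])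
    show "AE \<omega> in M. cadlag (\<lambda>t. L t \<omega> + c)" using AE_cadlag by eventually_elim (rule cad)
    show "distr M (Pi\<^sub>M J (\<lambda>_. borel)) (\<lambda>\<omega>. \<lambda>t\<in>J. L (b * t) \<omega> + c - (L 0 \<omega> + c)) =
       distr M (Pi\<^sub>M J (\<lambda>_. borel)) (\<lambda>\<omega>. \<lambda>t\<in>J. b powr (1 / \<alpha>) * (L t \<omega> + c - (L 0 \<omega> + c)))"
      if "b > 0" "finite J" "J \<subseteq> {0..}" for b J unfolding add_diff_cancel_right by (rule strictly_stable[OF that])
    show "AE \<omega> in M. \<forall>t>0. 0 \<le> jump (\<lambda>t. L t \<omega> + c) t"
      using AE_no_negative_jumps AE_cadlag by eventually_elim (simp add: jmp)
    show "expectation (\<lambda>\<omega>. exp (- l * (L 1 \<omega> + c - (L 0 \<omega> + c)))) = exp (l powr \<alpha>)" if "0 \<le> l" for l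
      unfolding add_diff_cancel_right by (rule normalization[OF that])
  qed
qed

context spectrally_positive_stable_process
begin

lemma AE_hits_negative:
  assumes \<alpha>: "1 < \<alpha>" "\<alpha> < 2" and x: "0 < start"
  shows "AE \<omega> in M. \<exists>t\<ge>0. L t \<omega> < 0"
proof -
  interpret S: spectrally_positive_stable_process M "start + 1" "\<lambda>t \<omega>. L t \<omega> + 1" \<alpha>
    by (rule spectrally_positive_stable_process_shift) unfold_locales
  show ?thesis using S.AE_hits[OF \<alpha>, of 1] x by simp
qed

text \<open>The area up to the passage time is not known to be measurable at this point. A
  measurable version \<open>V\<close> of its exponential is therefore obtained as the limit of the
  discretised discounts.\<close>

lemma laplace_area_below:
  assumes \<alpha>: "1 < \<alpha>" "\<alpha> < 2" and a: "0 \<le> a" "a < start" and l: "l > 0"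
  obtains V where "V \<in> borel_measurable M"
    "AE \<omega> in M. V \<omega> = exp (- l * (LBINT s:{0..hit_below a (\<lambda>t. L t \<omega>)}. L s \<omega>))"
    "integrable M V"
    "of_real (expectation V) * stable_airy (\<alpha> + 1) (1 / (l * (\<alpha> + 1))) 0 a = stable_airy (\<alpha> + 1) (1 / (l * (\<alpha> + 1))) 0 start"
proof -
  let ?p = "\<alpha> + 1"
  let ?u = "stable_airy ?p (1 / (l * ?p)) 0"
  let ?A = "\<lambda>\<omega>. LBINT s:{0..hit_below a (\<lambda>t. L t \<omega>)}. L s \<omega>"
  have p: "2 < ?p" "?p < 3" and k: "1 / (l * ?p) > 0" using \<alpha> l by auto
  have [measurable]: "?u \<in> borel_measurable borel" by (rule measurable_stable_airy[OF p(1,2) k])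
  define K where "K = (\<integral>s. norm (stable_phase ?p (1 / (l * ?p)) 0 0 s) \<partial>lborel)"
  have uK: "norm (?u x) \<le> K" for x unfolding K_def by (rule stable_airy_bounded[OF p(1,2) k])
  \<comment> \<open>With \<open>u\<close> constantly 1 the stopped value is the bare
    discount.\<close>
  define V where "V = (\<lambda>\<omega>. Re (lim (\<lambda>k. value_at_stop (\<lambda>_. 1) a l k \<omega>)))"
  have Vm[measurable]: "V \<in> borel_measurable M" unfolding V_def by measurable
  have lims: "AE \<omega> in M. V \<omega> = exp (- l * ?A \<omega>) \<and> 0 \<le> ?A \<omega> \<and> (\<lambda>k. value_at_stop ?u a l k \<omega>) \<longlonglongrightarrow> of_real (V \<omega>) * ?u a"
    using AE_regular AE_hits_negative[OF \<alpha> le_less_trans[OF a]]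
  proof eventually_elim
    case (elim \<omega>)
    note reg = conjunct1[OF elim(1)] conjunct1[OF conjunct2[OF elim(1)]] conjunct2[OF conjunct2[OF elim(1)]]
    have hit: "\<exists>t\<ge>0. L t \<omega> < a" using elim(2) a by force
    have s: "L 0 \<omega> > a" using reg a by simp
    have lim1: "(\<lambda>k. value_at_stop (\<lambda>_. 1) a l k \<omega>) \<longlonglongrightarrow> of_real (exp (- l * ?A \<omega>)) * 1"
      unfolding value_at_stop_eq[OF reg(1)]
      using grid_value_hit[where p = "\<lambda>t. L t \<omega>" and u = "\<lambda>_. 1", OF reg(2,3) s a(1) less_imp_le[OF l] continuous_const hit] .
    have lim2: "(\<lambda>k. value_at_stop ?u a l k \<omega>) \<longlonglongrightarrow> of_real (exp (- l * ?A \<omega>)) * ?u a"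
      unfolding value_at_stop_eq[OF reg(1)]
      using grid_value_hit[where p = "\<lambda>t. L t \<omega>", OF reg(2,3) s a(1) less_imp_le[OF l] continuous_stable_airy[OF p(1,2) k] hit] .
    have "V \<omega> = exp (- l * ?A \<omega>)" unfolding V_def limI[OF lim1] by simp
    moreover have "0 \<le> ?A \<omega>" unfolding set_lebesgue_integral_def
      by (intro integral_nonneg_AE AE_I2)
         (use hit_below_properties(3)[of "\<lambda>t. L t \<omega>", OF reg(2,3) s hit] a in \<open>force simp: indicator_def intro: order_trans[of 0 a]\<close>)
    ultimately show ?case using lim2 by simp
  qed
  have V1: "AE \<omega> in M. norm (V \<omega>) \<le> 1" using lims by eventually_elim (use l in auto)
  have Vi: "integrable M V" by (rule integrable_const_bound[OF V1]) measurable
  have "(\<lambda>k. expectation (value_at_stop ?u a l k)) \<longlonglongrightarrow> expectation (\<lambda>\<omega>. of_real (V \<omega>) * ?u a)"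
  proof (rule integral_dominated_convergence[where w = "\<lambda>_. K"])
    show "AE \<omega> in M. norm (value_at_stop ?u a l k \<omega>) \<le> K" for k
      unfolding value_at_stop_def using a l by (intro AE_I2 norm_stopped_value_le uK) auto
    show "AE \<omega> in M. (\<lambda>k. value_at_stop ?u a l k \<omega>) \<longlonglongrightarrow> of_real (V \<omega>) * ?u a" using lims by eventually_elim auto
  qed auto
  with expectation_value_at_stop[OF \<alpha> a(1) l] have "expectation (\<lambda>\<omega>. of_real (V \<omega>) * ?u a) = ?u start"
    using LIMSEQ_unique by blast
  hence EV: "of_real (expectation V) * ?u a = ?u start" by simp
  have AV: "AE \<omega> in M. V \<omega> = exp (- l * ?A \<omega>)" using lims by eventually_elim simp
  show ?thesis by (rule that[of V, OF Vm AV Vi EV])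
qed

text \<open>The area lies between those up to the passages below \<open>e n\<close> and below 0,
  whose Laplace transforms are \<open>u start / u (e n)\<close> and \<open>u start / u 0\<close>.
  Continuity of \<open>u\<close> at 0, where it does not vanish, closes the gap, and scaling moves
  \<open>l\<close> into the argument.\<close>

lemma laplace_first_passage_area:
  assumes \<alpha>: "1 < \<alpha>" "\<alpha> < 2" and x: "0 < start" and A[measurable]: "first_passage_area L \<in> borel_measurable M" and l: "l > 0"
  shows "of_real (expectation (\<lambda>\<omega>. exp (- l * first_passage_area L \<omega>))) * stable_airy (\<alpha> + 1) (1 / (\<alpha> + 1)) 0 0
    = stable_airy (\<alpha> + 1) (1 / (\<alpha> + 1)) 0 (l powr (1 / (\<alpha> + 1)) * start)"
    and "AE \<omega> in M. first_passage_area L \<omega> \<ge> 0"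
proof -
  let ?p = "\<alpha> + 1"
  let ?u = "stable_airy ?p (1 / (l * ?p)) 0"
  have p: "2 < ?p" "?p < 3" and k: "1 / (l * ?p) > 0" using \<alpha> l by auto
  define e where "e = (\<lambda>n. start / real (n + 2))"
  have e: "0 < e n" "e n < start" for n using x by (auto simp: e_def field_simps intro!: add_pos_nonneg)
  have elim: "e \<longlonglongrightarrow> 0" unfolding e_def using x by real_asymp
  define Q where "Q = (\<lambda>a V. V \<in> borel_measurable M \<and>
    (AE \<omega> in M. V \<omega> = exp (- l * (LBINT s:{0..hit_below a (\<lambda>t. L t \<omega>)}. L s \<omega>))) \<and>
    integrable M V \<and> of_real (expectation V) * ?u a = ?u start)"
  define V where "V = (\<lambda>a. SOME V. Q a V)"
  have QV: "Q a (V a)" if a: "0 \<le> a" "a < start" for a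
  proof -
    have "\<exists>V. Q a V"
    proof (rule laplace_area_below[OF \<alpha> a l])
      fix V assume "V \<in> borel_measurable M"
        "AE \<omega> in M. V \<omega> = exp (- l * (LBINT s:{0..hit_below a (\<lambda>t. L t \<omega>)}. L s \<omega>))"
        "integrable M V" "of_real (expectation V) * ?u a = ?u start"
      hence "Q a V" unfolding Q_def by (intro conjI)
      thus "\<exists>V. Q a V" by blast
    qed
    thus ?thesis unfolding V_def by (rule someI_ex)
  qed
  note V = QV[unfolded Q_def]
  have bounds: "AE \<omega> in M. (LBINT s:{0..hit_below a (\<lambda>t. L t \<omega>)}. L s \<omega>) \<le> first_passage_area L \<omega> \<and>
      first_passage_area L \<omega> \<le> (LBINT s:{0..hit_below 0 (\<lambda>t. L t \<omega>)}. L s \<omega>) \<and> 0 \<le> first_passage_area L \<omega>"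
    if a: "0 < a" "a < start" for a
    using AE_regular AE_hits_negative[OF \<alpha> x]
  proof eventually_elim
    case (elim \<omega>)
    note reg = conjunct1[OF elim(1)] conjunct1[OF conjunct2[OF elim(1)]] conjunct2[OF conjunct2[OF elim(1)]]
    show ?case
      using first_passage_area_bounds[where L = L and \<omega> = \<omega> and a = a, OF reg(2,3) _ a(1) elim(2)] reg a by simp
  qed
  show A0: "AE \<omega> in M. first_passage_area L \<omega> \<ge> 0" using bounds[OF e, of 0] by eventually_elim auto
  define Y where "Y = expectation (\<lambda>\<omega>. exp (- l * first_passage_area L \<omega>))"
  have "AE \<omega> in M. norm (exp (- l * first_passage_area L \<omega>)) \<le> 1" using A0 by eventually_elim (use l in auto)
  hence Yi: "integrable M (\<lambda>\<omega>. exp (- l * first_passage_area L \<omega>))" by (rule integrable_const_bound) measurable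
  have low: "expectation (V 0) \<le> Y"
    unfolding Y_def
  proof (rule integral_mono_AE)
    show "AE \<omega> in M. V 0 \<omega> \<le> exp (- l * first_passage_area L \<omega>)"
      using bounds[OF e, of 0] V[of 0, THEN conjunct2, THEN conjunct1, OF order_refl x]
      by eventually_elim (use l in auto)
  qed (use V[of 0] x Yi in auto)
  have up: "Y \<le> expectation (V (e n))" for n
    unfolding Y_def
  proof (rule integral_mono_AE)
    show "AE \<omega> in M. exp (- l * first_passage_area L \<omega>) \<le> V (e n) \<omega>"
      using bounds[OF e, of n] V[of "e n", THEN conjunct2, THEN conjunct1, OF less_imp_le[OF e(1)] e(2)]
      by eventually_elim (use l in auto)
  qed (use V[of "e n"] e[of n] Yi in auto)
  have u0: "?u 0 \<noteq> 0" using stable_airy_0_nonzero[OF p k] .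
  have ul: "(\<lambda>n. ?u (e n)) \<longlonglongrightarrow> ?u 0"
    by (rule isCont_tendsto_compose[OF continuous_stable_airy[OF p k] elim])
  have ev0: "eventually (\<lambda>n. ?u (e n) \<noteq> 0) sequentially" using tendsto_imp_eventually_ne[OF ul u0] .
  have "(\<lambda>n. ?u start / ?u (e n)) \<longlonglongrightarrow> ?u start / ?u 0"
    by (intro tendsto_intros ul u0)
  moreover have "eventually (\<lambda>n. ?u start / ?u (e n) = of_real (expectation (V (e n)))) sequentially"
    using ev0 by eventually_elim (use V e in \<open>simp add: field_simps less_imp_le\<close>)
  ultimately have "(\<lambda>n. complex_of_real (expectation (V (e n)))) \<longlonglongrightarrow> ?u start / ?u 0"
    by (rule Lim_transform_eventually)
  moreover have "?u start / ?u 0 = of_real (expectation (V 0))" using V[of 0] x u0 by (simp add: field_simps)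
  ultimately have "(\<lambda>n. complex_of_real (expectation (V (e n)))) \<longlonglongrightarrow> of_real (expectation (V 0))" by simp
  hence "(\<lambda>n. expectation (V (e n))) \<longlonglongrightarrow> expectation (V 0)" by (simp only: tendsto_of_real_iff)
  hence "Y \<le> expectation (V 0)" using up by (intro LIMSEQ_le_const) auto
  hence "Y = expectation (V 0)" using low by simp
  hence "of_real Y * ?u 0 = ?u start" using V[of 0] x by simp
  thus "of_real (expectation (\<lambda>\<omega>. exp (- l * first_passage_area L \<omega>))) * stable_airy (\<alpha> + 1) (1 / (\<alpha> + 1)) 0 0
    = stable_airy (\<alpha> + 1) (1 / (\<alpha> + 1)) 0 (l powr (1 / (\<alpha> + 1)) * start)"
    unfolding stable_airy_scaling[OF p(1) l] Y_def using l by simp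
qed

end

section \<open>Inverse moments of the area\<close>

text \<open>For \<open>q \<ge> 1\<close> the power \<open>z powr (- q)\<close> is not integrable
  near 0 on the imaginary axis, while it is bounded on \<open>Re z = 1\<close>. The integrand has a
  primitive on the closed half plane, and the change of this primitive across the horizontal
  segments at height \<open>n\<close> tends to 0.\<close>

lemma stable_airy_contour_shift:
  fixes p \<kappa> :: real
  assumes p: "2 < p" "p < 3" and k: "\<kappa> > 0"
  shows "stable_airy p \<kappa> 0 x = stable_airy p \<kappa> 1 x"
proof -
  define f where "f = (\<lambda>z :: complex. exp (of_real \<kappa> * z powr of_real p - of_real x * z))"
  define S where "S = {z. Re z \<ge> 0}"
  have f_phase: "f (Complex c s) = stable_phase p \<kappa> c x s" for c s by (simp add: f_def stable_phase_def)
  have "continuous_on S f"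
    unfolding f_def S_def using p by (intro continuous_intros continuous_on_powr_complex) auto
  moreover have "convex S" unfolding S_def by (rule convex_halfspace_Re_ge)
  moreover have "f field_differentiable at z" if "z \<in> interior S - {}" for z
  proof -
    have "interior S = {z. Re z > 0}"
      using interior_halfspace_ge[of "1 :: complex" 0] by (simp add: S_def inner_complex_def)
    hence ns: "z \<notin> \<real>\<^sub>\<le>\<^sub>0" using that by (auto simp: complex_nonpos_Reals_iff)
    show ?thesis unfolding f_def field_differentiable_def
      by (rule exI) (rule derivative_eq_intros has_field_derivative_powr ns refl)+
  qed
  ultimately obtain P where P: "\<And>z. z \<in> S \<Longrightarrow> (P has_field_derivative f z) (at z within S)"
    using holomorphic_convex_primitive[of S "{}" f] by auto
  have int: "integrable lborel (stable_phase p \<kappa> c x)" if "0 \<le> c" "c \<le> 1" for c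
    by (rule integrable_stable_phase[OF p k that])
  have ftc: "(\<integral>s. indicator {-R..R} s *\<^sub>R (\<i> * stable_phase p \<kappa> c x s) \<partial>lborel) = P (Complex c R) - P (Complex c (-R))"
    if "0 \<le> c" "0 \<le> R" for c R
  proof (rule integral_FTC_atLeastAtMost)
    show "-R \<le> R" using that by simp
    fix s :: real
    have "(Complex c has_vector_derivative \<i>) (at s within {-R..R})"
      unfolding Complex_eq' by (auto intro!: derivative_eq_intros simp: has_vector_derivative_def scaleR_conv_of_real mult.commute)
    moreover have "(P has_field_derivative f (Complex c s)) (at (Complex c s) within Complex c ` {-R..R})"
      by (rule DERIV_subset[OF P]) (use that in \<open>auto simp: S_def\<close>)
    ultimately have "((P \<circ> Complex c) has_vector_derivative \<i> * f (Complex c s)) (at s within {-R..R})"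
      by (rule field_vector_diff_chain_within)
    thus "((\<lambda>s. P (Complex c s)) has_vector_derivative \<i> * stable_phase p \<kappa> c x s) (at s within {-R..R})"
      by (simp add: o_def f_phase)
  next
    show "continuous_on {-R..R} (\<lambda>s. \<i> * stable_phase p \<kappa> c x s)"
      unfolding stable_phase_def[abs_def] using p that
      by (intro continuous_intros continuous_on_subset[OF continuous_on_Complex_powr])
         (auto simp: Complex_eq' intro!: continuous_intros)
  qed
  have lim: "(\<lambda>n. P (Complex c (real n)) - P (Complex c (- real n))) \<longlonglongrightarrow> \<i> * stable_airy p \<kappa> c x"
    if c: "0 \<le> c" "c \<le> 1" for c
  proof -
    have "(\<lambda>n. \<integral>s. indicator {- real n..real n} s *\<^sub>R (\<i> * stable_phase p \<kappa> c x s) \<partial>lborel) \<longlonglongrightarrow>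
        (\<integral>s. \<i> * stable_phase p \<kappa> c x s \<partial>lborel)"
    proof (rule integral_dominated_convergence[where w = "\<lambda>s. norm (stable_phase p \<kappa> c x s)"])
      show "AE s in lborel. (\<lambda>n. indicator {- real n..real n} s *\<^sub>R (\<i> * stable_phase p \<kappa> c x s)) \<longlonglongrightarrow> \<i> * stable_phase p \<kappa> c x s"
      proof (rule AE_I2)
        fix s :: real
        have "eventually (\<lambda>n. real n \<ge> \<bar>s\<bar>) sequentially" by real_asymp
        hence "eventually (\<lambda>n. indicator {- real n..real n} s *\<^sub>R (\<i> * stable_phase p \<kappa> c x s) = \<i> * stable_phase p \<kappa> c x s) sequentially"
          by eventually_elim (auto simp: indicator_def)
        thus "(\<lambda>n. indicator {- real n..real n} s *\<^sub>R (\<i> * stable_phase p \<kappa> c x s)) \<longlonglongrightarrow> \<i> * stable_phase p \<kappa> c x s"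
          by (rule tendsto_eventually)
      qed
      show "integrable lborel (\<lambda>s. norm (stable_phase p \<kappa> c x s))" using int[OF c] by simp
    qed (auto simp: indicator_def norm_mult)
    thus ?thesis using ftc[of c] c by (simp add: stable_airy_def)
  qed
  obtain \<eta> K where e: "\<eta> > 0" "K > 0"
    and *: "\<And>c x s. 0 \<le> c \<Longrightarrow> c \<le> 1 \<Longrightarrow> norm (stable_phase p \<kappa> c x s) \<le> K * exp (- x * c) * exp (- \<eta> * \<bar>s\<bar> powr p)"
    using stable_phase_bound[OF p k] by blast
  have horiz: "norm (P (Complex 1 s) - P (Complex 0 s)) \<le> K * exp \<bar>x\<bar> * exp (- \<eta> * \<bar>s\<bar> powr p)" for s
  proof -
    have "norm (P (Complex 1 s) - P (Complex 0 s)) \<le> (K * exp \<bar>x\<bar> * exp (- \<eta> * \<bar>s\<bar> powr p)) * norm (Complex 1 s - Complex 0 s)"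
    proof (rule field_differentiable_bound[of "closed_segment (Complex 0 s) (Complex 1 s)" P f])
      fix z assume z: "z \<in> closed_segment (Complex 0 s) (Complex 1 s)"
      then obtain u where u: "0 \<le> u" "u \<le> 1" "z = Complex u s"
        by (auto simp: closed_segment_def complex_eq_iff algebra_simps)
      have "- x * u \<le> \<bar>x\<bar> * u" using u by (intro mult_right_mono) auto
      also have "\<dots> \<le> \<bar>x\<bar>" using u by (intro mult_left_le) auto
      finally have "- x * u \<le> \<bar>x\<bar>" .
      hence ex: "exp (- x * u) \<le> exp \<bar>x\<bar>" by (simp only: exp_le_cancel_iff)
      have "norm (f z) \<le> K * exp (- x * u) * exp (- \<eta> * \<bar>s\<bar> powr p)"
        unfolding u(3) f_phase by (rule *[OF u(1,2)])
      also have "\<dots> \<le> K * exp \<bar>x\<bar> * exp (- \<eta> * \<bar>s\<bar> powr p)"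
        using e ex by (intro mult_right_mono mult_left_mono) auto
      finally show "norm (f z) \<le> K * exp \<bar>x\<bar> * exp (- \<eta> * \<bar>s\<bar> powr p)" .
      show "(P has_field_derivative f z) (at z within closed_segment (Complex 0 s) (Complex 1 s))"
      proof (rule DERIV_subset[OF P])
        show "z \<in> S" using u by (simp add: S_def)
        show "closed_segment (Complex 0 s) (Complex 1 s) \<subseteq> S"
          by (rule closed_segment_subset) (auto simp: S_def convex_halfspace_Re_ge)
      qed
    qed auto
    moreover have "Complex 1 s - Complex 0 s = 1" by (simp add: complex_eq_iff)
    ultimately show ?thesis by simp
  qed
  have "(\<lambda>n. P (Complex 1 (real n)) - P (Complex 0 (real n))) \<longlonglongrightarrow> 0" "(\<lambda>n. P (Complex 1 (- real n)) - P (Complex 0 (- real n))) \<longlonglongrightarrow> 0"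
  proof -
    have t: "(\<lambda>n. K * exp \<bar>x\<bar> * exp (- \<eta> * (real n) powr p)) \<longlonglongrightarrow> 0" using e p by real_asymp
    show "(\<lambda>n. P (Complex 1 (real n)) - P (Complex 0 (real n))) \<longlonglongrightarrow> 0"
      by (rule Lim_null_comparison[OF _ t]) (use horiz[of "real n" for n] in simp)
    show "(\<lambda>n. P (Complex 1 (- real n)) - P (Complex 0 (- real n))) \<longlonglongrightarrow> 0"
      by (rule Lim_null_comparison[OF _ t]) (use horiz[of "- real n" for n] in simp)
  qed
  from tendsto_diff[OF this]
  have "(\<lambda>n. (P (Complex 1 (real n)) - P (Complex 1 (- real n))) - (P (Complex 0 (real n)) - P (Complex 0 (- real n)))) \<longlonglongrightarrow> 0"
    by (simp add: algebra_simps)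
  moreover have "(\<lambda>n. (P (Complex 1 (real n)) - P (Complex 1 (- real n))) - (P (Complex 0 (real n)) - P (Complex 0 (- real n))))
      \<longlonglongrightarrow> \<i> * stable_airy p \<kappa> 1 x - \<i> * stable_airy p \<kappa> 0 x"
    by (intro tendsto_diff lim) auto
  ultimately have "\<i> * stable_airy p \<kappa> 1 x - \<i> * stable_airy p \<kappa> 0 x = 0" by (rule LIMSEQ_unique[rotated])
  thus ?thesis by simp
qed

text \<open>For \<open>q > 0\<close> this is the Mellin transform of the Airy function at
  \<open>q\<close>, divided by \<open>Gamma q\<close>.\<close>

definition stable_airy_moment :: "real \<Rightarrow> real \<Rightarrow> complex" where
  "stable_airy_moment p q = (\<integral>s. Complex 1 s powr (- of_real q) * stable_phase p (1 / p) 1 0 s \<partial>lborel)"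

lemma norm_Complex_1_powr_le: "a \<ge> 0 \<Longrightarrow> norm (Complex 1 s powr (- of_real a)) \<le> 1"
proof -
  assume a: "a \<ge> 0"
  have "norm (Complex 1 s) \<ge> 1" using complex_Re_le_cmod[of "Complex 1 s"] by simp
  moreover have "norm (Complex 1 s powr (- of_real a)) = norm (Complex 1 s) powr (- a)"
    by (subst norm_powr_real_powr') auto
  ultimately show ?thesis using a powr_mono[of "- a" 0 "norm (Complex 1 s)"]
    by (auto simp: complex_eq_iff split: if_splits)
qed

lemma integrable_stable_airy_moment:
  assumes p: "2 < p" "p < 3" and q: "q \<ge> 0"
  shows "integrable lborel (\<lambda>s. Complex 1 s powr (- of_real q) * stable_phase p (1 / p) 1 0 s)"
proof (rule Bochner_Integration.integrable_bound)
  show "integrable lborel (\<lambda>s. norm (stable_phase p (1 / p) 1 0 s))"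
    using integrable_stable_phase[OF p, of "1 / p" 1 0] p by simp
  show "AE s in lborel. norm (Complex 1 s powr (- of_real q) * stable_phase p (1 / p) 1 0 s) \<le> norm (norm (stable_phase p (1 / p) 1 0 s))"
    using norm_Complex_1_powr_le[OF q] by (intro AE_I2) (auto simp: norm_mult intro!: mult_left_le_one_le)
qed measurable

text \<open>The derivative of \<open>z powr (1 - q) * exp (z powr p / p)\<close> is integrated along
  \<open>Re z = 1\<close>; the factor \<open>z powr (p - 1)\<close> from the exponential lowers
  \<open>q\<close> by \<open>p\<close>.\<close>

lemma stable_airy_moment_rec:
  assumes p: "2 < p" "p < 3" and q: "q \<ge> p"
  shows "of_real (q - 1) * stable_airy_moment p q = stable_airy_moment p (q - p)"
proof -
  let ?z = "\<lambda>s. Complex 1 s"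
  let ?P = "stable_phase p (1 / p) 1 0"
  have k: "1 / p > 0" using p by simp
  have ns: "?z s \<notin> \<real>\<^sub>\<le>\<^sub>0" for s by (auto simp: complex_nonpos_Reals_iff)
  have cz: "continuous_on UNIV ?z" unfolding Complex_eq' by (intro continuous_intros)
  have cp: "continuous_on UNIV (\<lambda>s. ?z s powr w)" for w :: complex
    by (intro continuous_on_powr_complex cz continuous_intros) (auto simp: complex_eq_iff)
  have cP: "continuous_on UNIV ?P"
    unfolding stable_phase_def[abs_def] by (intro continuous_intros cp cz)
  let ?f = "\<lambda>s. \<i> * (?z s powr (- of_real (q - p)) * ?P s - of_real (q - 1) * (?z s powr (- of_real q) * ?P s))"
  have "(\<integral>s. ?f s \<partial>lborel) = 0"
  proof (rule integral_derivative_eq_0[where F = "\<lambda>s. ?z s powr (- of_real (q - 1)) * ?P s"])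
    show "continuous_on UNIV (\<lambda>s. ?z s powr (- of_real (q - 1)) * ?P s)" by (intro continuous_intros cp cP)
    have "continuous_on UNIV ?f" by (intro continuous_intros cp cP)
    thus "isCont ?f s" for s by (simp add: continuous_on_eq_continuous_at)
    show "integrable lborel ?f"
      using p q by (intro integrable_mult_right Bochner_Integration.integrable_diff integrable_stable_airy_moment) auto
    fix s :: real
    have 1: "(Complex 1 has_vector_derivative \<i>) (at s)"
      unfolding Complex_eq' by (auto intro!: derivative_eq_intros simp: has_vector_derivative_def scaleR_conv_of_real mult.commute)
    have "((\<lambda>z. z powr (- of_real (q - 1))) has_field_derivative (- of_real (q - 1) * ?z s powr (- of_real (q - 1) - 1))) (at (?z s))"
      by (rule has_field_derivative_powr[OF ns])
    from field_vector_diff_chain_at[OF 1 this]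
    have 2: "((\<lambda>s. ?z s powr (- of_real (q - 1))) has_vector_derivative \<i> * (- of_real (q - 1) * ?z s powr (- of_real q))) (at s)"
      by (simp add: o_def)
    have 3: "(?P has_vector_derivative \<i> * (?z s powr of_real (p - 1) * ?P s)) (at s)"
      using stable_phase_derivative[of 1 s p "1 / p" 0] p by simp
    have 4: "?z s powr (- of_real (q - 1)) * ?z s powr of_real (p - 1) = ?z s powr (- of_real (q - p))"
      by (simp add: powr_add [symmetric] algebra_simps)
    from has_vector_derivative_mult[OF 2 3]
    have "((\<lambda>s. ?z s powr (- of_real (q - 1)) * ?P s) has_vector_derivative
       ?z s powr (- of_real (q - 1)) * (\<i> * (?z s powr of_real (p - 1) * ?P s)) + \<i> * (- of_real (q - 1) * ?z s powr (- of_real q)) * ?P s) (at s)" .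
    also have "?z s powr (- of_real (q - 1)) * (\<i> * (?z s powr of_real (p - 1) * ?P s)) + \<i> * (- of_real (q - 1) * ?z s powr (- of_real q)) * ?P s
       = \<i> * ((?z s powr (- of_real (q - 1)) * ?z s powr of_real (p - 1)) * ?P s - of_real (q - 1) * (?z s powr (- of_real q) * ?P s))"
      by (simp add: algebra_simps)
    finally show "((\<lambda>s. ?z s powr (- of_real (q - 1)) * ?P s) has_vector_derivative ?f s) (at s)" unfolding 4 .
  next
    have b: "norm (?z s powr (- of_real (q - 1)) * ?P s) \<le> norm (?P s)" for s
      using norm_Complex_1_powr_le[of "q - 1" s] p q by (auto simp: norm_mult intro!: mult_left_le_one_le)
    note l = stable_phase_tendsto_0[OF p k, of 1 0]
    show "((\<lambda>s. ?z s powr (- of_real (q - 1)) * ?P s) \<longlongrightarrow> 0) at_top"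
      by (rule Lim_null_comparison[OF always_eventually tendsto_norm_zero[OF l(1)]]) (use b in auto)
    show "((\<lambda>s. ?z s powr (- of_real (q - 1)) * ?P s) \<longlongrightarrow> 0) at_bot"
      by (rule Lim_null_comparison[OF always_eventually tendsto_norm_zero[OF l(2)]]) (use b in auto)
  qed
  moreover have "(\<integral>s. ?f s \<partial>lborel) = \<i> * (stable_airy_moment p (q - p) - of_real (q - 1) * stable_airy_moment p q)"
    using integrable_stable_airy_moment[OF p, of "q - p"] integrable_stable_airy_moment[OF p, of q] p q
    unfolding stable_airy_moment_def by (simp del: of_real_diff)
  ultimately show ?thesis by simp
qed

text \<open>At \<open>q = 0\<close> the contour integral is the Airy function at 0, by the contour
  shift. The values at multiples of \<open>p\<close> are therefore explicit multiples of it, and it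
  cancels in the ratio that gives the Laplace transform.\<close>

lemma stable_airy_moment_nat:
  assumes p: "2 < p" "p < 3"
  shows "stable_airy_moment p (real n * p) = of_real (\<Prod>k=1..n. 1 / (real k * p - 1)) * stable_airy p (1 / p) 0 0"
proof (induction n)
  case 0
  have "Complex 1 s powr 0 = 1" for s by (simp add: powr_def complex_eq_iff)
  thus ?case using stable_airy_contour_shift[OF p, of "1 / p" 0] p
    by (simp add: stable_airy_moment_def stable_airy_def)
next
  case (Suc n)
  have q: "real (Suc n) * p \<ge> p" using p by simp
  have pos: "real (Suc n) * p - 1 > 0" using q p by linarith
  have "of_real (real (Suc n) * p - 1) * stable_airy_moment p (real (Suc n) * p) = stable_airy_moment p (real n * p)"
    using stable_airy_moment_rec[OF p q] by (simp add: algebra_simps)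
  hence "stable_airy_moment p (real (Suc n) * p) = of_real (1 / (real (Suc n) * p - 1)) * stable_airy_moment p (real n * p)"
    using pos by (simp add: field_simps del: of_real_diff of_nat_Suc)
  thus ?case unfolding Suc.IH by (simp add: mult_ac)
qed

text \<open>Fubini on the shifted contour: for \<open>w\<close> with \<open>Re w = 1\<close> the
  factor \<open>exp (- w * z)\<close> has modulus \<open>exp (- z)\<close>, which makes the double
  integral absolutely convergent, and the integral over \<open>z\<close> is a complex Gamma integral
  equal to \<open>Gamma q * w powr (- q)\<close>.\<close>

lemma stable_airy_mellin:
  assumes p: "2 < p" "p < 3" and q: "q > 0"
  shows "has_bochner_integral lborel (\<lambda>z. indicator {0<..} z *\<^sub>R (of_real (z powr (q - 1)) * stable_airy p (1 / p) 0 z))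
    (of_real (Gamma q) * stable_airy_moment p q)"
proof -
  have k: "1 / p > 0" using p by simp
  let ?P = "\<lambda>z. stable_phase p (1 / p) 1 z"
  define F where "F = (\<lambda>(z, s). indicator {0<..} z *\<^sub>R (of_real (z powr (q - 1)) * ?P z s))"
  have P_split: "?P z s = exp (- Complex 1 s * of_real z) * ?P 0 s" for z s
    by (simp add: stable_phase_def exp_add [symmetric] algebra_simps)
  have F_eq: "F (z, s) = indicator {0<..} z *\<^sub>R (of_real (z powr (q - 1)) * (exp (- Complex 1 s * of_real z) * ?P 0 s))" for z s
    unfolding F_def prod.case P_split[of z s] ..
  have "F = (\<lambda>(z, s). indicator {0<..} z *\<^sub>R (of_real (z powr (q - 1)) * (exp (- Complex 1 s * of_real z) * ?P 0 s)))"
    by (rule ext) (auto simp: F_eq split: prod.split)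
  moreover have "(\<lambda>(z, s). indicator {0<..} z *\<^sub>R (of_real (z powr (q - 1)) * (exp (- Complex 1 s * of_real z) * ?P 0 s)))
      \<in> borel_measurable (lborel \<Otimes>\<^sub>M lborel)"
    unfolding case_prod_beta by measurable
  ultimately have Fm: "F \<in> borel_measurable (lborel \<Otimes>\<^sub>M lborel)" by (simp only:)
  have normF: "norm (F (z, s)) = (indicator {0<..} z * (z powr (q - 1) * exp (- 1 * z powr 1))) * norm (?P 0 s)" for z s
    by (auto simp: F_def norm_mult norm_stable_phase indicator_def exp_diff exp_minus divide_inverse)
  have iz: "integrable lborel (\<lambda>z. indicator {0<..} z * (z powr (q - 1) * exp (- 1 * z powr 1)))"
    using gamma_integral_powr_real[of 1 q 1] q by (simp add: has_bochner_integral_iff)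
  have iP: "integrable lborel (?P z)" for z using integrable_stable_phase[OF p k, of 1 z] by simp
  have Fi: "integrable (lborel \<Otimes>\<^sub>M lborel) F"
  proof (rule lborel_pair.Fubini_integrable[OF Fm])
    show "integrable lborel (\<lambda>z. \<integral>s. norm (F (z, s)) \<partial>lborel)"
      unfolding normF integral_mult_right_zero by (rule integrable_mult_left[OF iz])
    show "AE z in lborel. integrable lborel (\<lambda>s. F (z, s))"
      unfolding F_def prod.case
      by (intro AE_I2 integrable_scaleR_right integrable_mult_right iP)
  qed
  have inner_s: "(\<integral>s. F (z, s) \<partial>lborel) = indicator {0<..} z *\<^sub>R (of_real (z powr (q - 1)) * stable_airy p (1 / p) 0 z)" for z
    unfolding stable_airy_contour_shift[OF p k] by (simp add: F_def stable_airy_def)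
  have inner_z: "(\<integral>z. F (z, s) \<partial>lborel) = of_real (Gamma q) * (Complex 1 s powr (- of_real q) * ?P 0 s)" for s
  proof -
    have "(\<integral>z. F (z, s) \<partial>lborel) = (\<integral>z. (indicator {0<..} z *\<^sub>R (of_real (z powr (1 * q - 1)) * exp (- Complex 1 s * of_real (z powr 1)))) * ?P 0 s \<partial>lborel)"
      by (intro Bochner_Integration.integral_cong refl) (auto simp: F_eq indicator_def)
    also have "\<dots> = (\<integral>z. (indicator {0<..} z *\<^sub>R (of_real (z powr (1 * q - 1)) * exp (- Complex 1 s * of_real (z powr 1)))) \<partial>lborel) * ?P 0 s"
      by (rule integral_mult_left_zero)
    also have "(\<integral>z. (indicator {0<..} z *\<^sub>R (of_real (z powr (1 * q - 1)) * exp (- Complex 1 s * of_real (z powr 1)))) \<partial>lborel)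
        = of_real (Gamma q) * Complex 1 s powr (- of_real q)"
      using gamma_integral_powr_complex[of 1 q "Complex 1 s"] q by (simp add: has_bochner_integral_iff)
    finally show ?thesis by simp
  qed
  have "(\<integral>z. (\<integral>s. F (z, s) \<partial>lborel) \<partial>lborel) = (\<integral>s. (\<integral>z. F (z, s) \<partial>lborel) \<partial>lborel)"
    using lborel_pair.Fubini_integral[of "\<lambda>z s. F (z, s)"] Fi by simp
  hence "(\<integral>z. indicator {0<..} z *\<^sub>R (of_real (z powr (q - 1)) * stable_airy p (1 / p) 0 z) \<partial>lborel) = of_real (Gamma q) * stable_airy_moment p q"
    unfolding inner_s inner_z by (simp add: stable_airy_moment_def)
  moreover have "integrable lborel (\<lambda>z. indicator {0<..} z *\<^sub>R (of_real (z powr (q - 1)) * stable_airy p (1 / p) 0 z))"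
    using lborel_pair.integrable_fst'[OF Fi] unfolding inner_s .
  ultimately show ?thesis by (simp add: has_bochner_integral_iff)
qed

text \<open>\<open>Gamma n * A powr (- n) / p\<close> is the integral of
  \<open>z powr (n * p - 1) * exp (- A * z powr p)\<close> over positive \<open>z\<close>. Taking
  the expectation inside leaves the Mellin transform of the Airy ratio at \<open>n * p\<close>,
  since \<open>l = z powr p\<close> turns \<open>l powr (1 / p)\<close> into
  \<open>z\<close>.\<close>

lemma (in prob_space) inverse_moments_of_laplace:
  fixes A :: "'a \<Rightarrow> real" and n :: nat
  assumes p: "2 < p" "p < 3" and A[measurable]: "A \<in> borel_measurable M" and pos: "AE \<omega> in M. A \<omega> > 0"
    and nz: "stable_airy p (1 / p) 0 0 \<noteq> 0"
    and laplace: "\<And>l. l > 0 \<Longrightarrow> of_real (expectation (\<lambda>\<omega>. exp (- l * A \<omega>))) * stable_airy p (1 / p) 0 0 = stable_airy p (1 / p) 0 (l powr (1 / p))"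
    and n: "n > 0"
  shows "(\<integral>\<^sup>+\<omega>. ennreal (A \<omega> powr (- real n)) \<partial>M) = ennreal (p * Gamma (real n * p) / Gamma (real n) * (\<Prod>k=1..n. 1 / (real k * p - 1)))"
proof -
  define q where "q = real n * p"
  have q: "q > 0" using n p by (simp add: q_def)
  define m where "m = (\<Prod>k=1..n. 1 / (real k * p - 1))"
  have m: "m \<ge> 0" unfolding m_def
  proof (intro prod_nonneg)
    fix k assume "k \<in> {1..n}"
    hence "1 * p \<le> real k * p" using p by (intro mult_right_mono) auto
    hence "0 \<le> real k * p - 1" using p by linarith
    thus "0 \<le> 1 / (real k * p - 1)" by (rule divide_nonneg_nonneg[OF zero_le_one])
  qed
  define E where "E = (\<lambda>z. expectation (\<lambda>\<omega>. exp (- (z powr p) * A \<omega>)))"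
  have Em[measurable]: "E \<in> borel_measurable borel" unfolding E_def by measurable
  have E0: "E z \<ge> 0" for z unfolding E_def by (intro integral_nonneg_AE) auto
  have E: "of_real (E z) = stable_airy p (1 / p) 0 z / stable_airy p (1 / p) 0 0" if "z > 0" for z
    using laplace[of "z powr p"] that p nz by (simp add: E_def powr_powr field_simps)
  have "has_bochner_integral lborel (\<lambda>z. indicator {0<..} z *\<^sub>R (of_real (z powr (q - 1)) * stable_airy p (1 / p) 0 z) / stable_airy p (1 / p) 0 0)
    (of_real (Gamma q) * stable_airy_moment p q / stable_airy p (1 / p) 0 0)"
    by (intro has_bochner_integral_divide_zero stable_airy_mellin[OF p q])
  also have "(\<lambda>z. indicator {0<..} z *\<^sub>R (of_real (z powr (q - 1)) * stable_airy p (1 / p) 0 z) / stable_airy p (1 / p) 0 0)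
     = (\<lambda>z. complex_of_real (indicator {0<..} z * (z powr (q - 1) * E z)))"
    using E by (auto simp: indicator_def)
  also have "of_real (Gamma q) * stable_airy_moment p q / stable_airy p (1 / p) 0 0 = complex_of_real (Gamma q * m)"
    unfolding q_def stable_airy_moment_nat[OF p] using nz by (simp add: m_def)
  finally have hb: "has_bochner_integral lborel (\<lambda>z. indicator {0<..} z * (z powr (q - 1) * E z)) (Gamma q * m)"
    using has_bochner_integral_Re[of lborel "\<lambda>z. complex_of_real (indicator {0<..} z * (z powr (q - 1) * E z))"] by fastforce
  have "(\<integral>\<^sup>+\<omega>. ennreal (Gamma (real n) * A \<omega> powr (- real n) / p) \<partial>M)
      = (\<integral>\<^sup>+\<omega>. (\<integral>\<^sup>+z. ennreal (indicator {0<..} z * (z powr (q - 1) * exp (- A \<omega> * z powr p))) \<partial>lborel) \<partial>M)"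
  proof (rule nn_integral_cong_AE)
    show "AE \<omega> in M. ennreal (Gamma (real n) * A \<omega> powr (- real n) / p) = (\<integral>\<^sup>+z. ennreal (indicator {0<..} z * (z powr (q - 1) * exp (- A \<omega> * z powr p))) \<partial>lborel)"
      using pos
    proof eventually_elim
      case (elim \<omega>)
      have "has_bochner_integral lborel (\<lambda>z. indicator {0<..} z * (z powr (p * real n - 1) * exp (- A \<omega> * z powr p))) (Gamma (real n) * A \<omega> powr (- real n) / \<bar>p\<bar>)"
        using elim n p by (intro gamma_integral_powr_real) auto
      thus ?case using p
        by (subst nn_integral_eq_integral) (auto simp: has_bochner_integral_iff q_def mult.commute)
    qed
  qed
  also have "\<dots> = (\<integral>\<^sup>+z. (\<integral>\<^sup>+\<omega>. ennreal (indicator {0<..} z * (z powr (q - 1) * exp (- A \<omega> * z powr p))) \<partial>M) \<partial>lborel)"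
  proof -
    interpret P: pair_sigma_finite lborel M by (intro pair_sigma_finite.intro sigma_finite_lborel sigma_finite_measure_axioms)
    show ?thesis by (rule P.Fubini') measurable
  qed
  also have "\<dots> = (\<integral>\<^sup>+z. ennreal (indicator {0<..} z * (z powr (q - 1) * E z)) \<partial>lborel)"
  proof (rule nn_integral_cong)
    fix z :: real
    have "AE \<omega> in M. norm (exp (- (z powr p) * A \<omega>)) \<le> 1" using pos by eventually_elim auto
    hence ie: "integrable M (\<lambda>\<omega>. exp (- (z powr p) * A \<omega>))" by (rule integrable_const_bound) measurable
    have "(\<integral>\<^sup>+\<omega>. ennreal (indicator {0<..} z * (z powr (q - 1) * exp (- A \<omega> * z powr p))) \<partial>M)
      = (\<integral>\<^sup>+\<omega>. ennreal (indicator {0<..} z * z powr (q - 1)) * ennreal (exp (- (z powr p) * A \<omega>)) \<partial>M)"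
      by (intro nn_integral_cong) (simp add: ennreal_mult' [symmetric] mult_ac)
    also have "\<dots> = ennreal (indicator {0<..} z * z powr (q - 1)) * ennreal (E z)"
    proof -
      have "(\<integral>\<^sup>+\<omega>. ennreal (exp (- (z powr p) * A \<omega>)) \<partial>M) = ennreal (E z)"
        unfolding E_def by (rule nn_integral_eq_integral[OF ie]) auto
      moreover have "(\<lambda>\<omega>. ennreal (exp (- (z powr p) * A \<omega>))) \<in> borel_measurable M" by measurable
      ultimately show ?thesis by (simp only: nn_integral_cmult)
    qed
    finally show "(\<integral>\<^sup>+\<omega>. ennreal (indicator {0<..} z * (z powr (q - 1) * exp (- A \<omega> * z powr p))) \<partial>M) = ennreal (indicator {0<..} z * (z powr (q - 1) * E z))"
      by (simp add: ennreal_mult' [symmetric] E0 mult_ac)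
  qed
  also have "\<dots> = ennreal (Gamma q * m)"
    using hb E0 by (subst nn_integral_eq_integral) (auto simp: has_bochner_integral_iff)
  finally have eq: "(\<integral>\<^sup>+\<omega>. ennreal (Gamma (real n) * A \<omega> powr (- real n) / p) \<partial>M) = ennreal (Gamma q * m)" .
  have G: "Gamma (real n) > 0" using n by simp
  have "(\<integral>\<^sup>+\<omega>. ennreal (A \<omega> powr (- real n)) \<partial>M) = (\<integral>\<^sup>+\<omega>. ennreal (p / Gamma (real n)) * ennreal (Gamma (real n) * A \<omega> powr (- real n) / p) \<partial>M)"
    using G p by (intro nn_integral_cong) (simp add: ennreal_mult' [symmetric])
  also have "\<dots> = ennreal (p / Gamma (real n)) * ennreal (Gamma q * m)"
    by (subst nn_integral_cmult) (auto simp: eq)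
  also have "\<dots> = ennreal (p * Gamma (real n * p) / Gamma (real n) * m)"
    using G p q m by (subst ennreal_mult' [symmetric]) (auto simp: q_def)
  finally show ?thesis by (simp add: m_def)
qed

section \<open>The Zolotarev function near zero\<close>

lemma sin_minus_x_cos_nonneg:
  fixes x :: real
  assumes "0 \<le> x" "x \<le> pi"
  shows "sin x - x * cos x \<ge> 0"
proof -
  have "(\<lambda>x. sin x - x * cos x) 0 \<le> (\<lambda>x. sin x - x * cos x) x"
  proof (rule DERIV_nonneg_imp_nondecreasing[OF assms(1)])
    fix y assume y: "0 \<le> y" "y \<le> x"
    show "\<exists>d. ((\<lambda>x. sin x - x * cos x) has_real_derivative d) (at y) \<and> 0 \<le> d"
      using y assms by (intro exI[of _ "y * sin y"]) (auto intro!: derivative_eq_intros sin_ge_zero mult_nonneg_nonneg)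
  qed
  thus ?thesis by simp
qed

text \<open>The left side is the numerator of the derivative of \<open>cot_defect\<close>. It and
  its first derivative vanish at 0, and the second derivative is
  \<open>4 * sin x * (sin x - x * cos x)\<close>.\<close>

lemma sin_cubic_inequality:
  fixes x :: real
  assumes "0 \<le> x" "x \<le> pi"
  shows "x\<^sup>2 + x * sin x * cos x - 2 * sin x ^ 2 \<ge> 0"
proof -
  let ?d = "\<lambda>x::real. 2 * x - 3 * sin x * cos x + x * (cos x ^ 2 - sin x ^ 2)"
  have d: "?d y \<ge> 0" if "0 \<le> y" "y \<le> pi" for y
  proof -
    have "?d 0 \<le> ?d y"
    proof (rule DERIV_nonneg_imp_nondecreasing[OF that(1)])
      fix z assume z: "0 \<le> z" "z \<le> y"
      have "(?d has_real_derivative (2 - 3 * (cos z ^ 2 - sin z ^ 2) + (cos z ^ 2 - sin z ^ 2) - 4 * z * sin z * cos z)) (at z)"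
        by (auto intro!: derivative_eq_intros simp: power2_eq_square algebra_simps)
      also have "2 - 3 * (cos z ^ 2 - sin z ^ 2) + (cos z ^ 2 - sin z ^ 2) - 4 * z * sin z * cos z = 4 * (sin z * (sin z - z * cos z))"
        using sin_cos_squared_add[of z] by algebra
      finally have "(?d has_real_derivative 4 * (sin z * (sin z - z * cos z))) (at z)" .
      moreover have "0 \<le> 4 * (sin z * (sin z - z * cos z))"
        using z that sin_ge_zero[of z] sin_minus_x_cos_nonneg[of z] by simp
      ultimately show "\<exists>d. (?d has_real_derivative d) (at z) \<and> 0 \<le> d" by blast
    qed
    thus ?thesis by simp
  qed
  have "(\<lambda>x::real. x\<^sup>2 + x * sin x * cos x - 2 * sin x ^ 2) 0 \<le> (\<lambda>x. x\<^sup>2 + x * sin x * cos x - 2 * sin x ^ 2) x"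
  proof (rule DERIV_nonneg_imp_nondecreasing[OF assms(1)])
    fix y assume y: "0 \<le> y" "y \<le> x"
    have "((\<lambda>x. x\<^sup>2 + x * sin x * cos x - 2 * sin x ^ 2) has_real_derivative ?d y) (at y)"
      by (auto intro!: derivative_eq_intros simp: power2_eq_square algebra_simps)
    thus "\<exists>d. ((\<lambda>x. x\<^sup>2 + x * sin x * cos x - 2 * sin x ^ 2) has_real_derivative d) (at y) \<and> 0 \<le> d"
      using d[of y] y assms by auto
  qed
  thus ?thesis by simp
qed

text \<open>Minus the derivative of \<open>ln (sin x / x)\<close>, divided by \<open>x\<close>. The
  division makes the limit at 0 the positive number \<open>1 / 3\<close>.\<close>

definition cot_defect :: "real \<Rightarrow> real" where
  "cot_defect x = (1 / x - cos x / sin x) / x"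

lemma cot_defect_mono:
  assumes "0 < x" "x \<le> y" "y < pi"
  shows "cot_defect x \<le> cot_defect y"
proof (rule DERIV_nonneg_imp_nondecreasing[OF assms(2)])
  fix z assume z: "x \<le> z" "z \<le> y"
  have s: "sin z > 0" "z > 0" using z assms by (auto intro!: sin_gt_zero)
  have "(cot_defect has_real_derivative ((- (1 / z\<^sup>2) - (- sin z * sin z - cos z * cos z) / (sin z * sin z)) * z - (1 / z - cos z / sin z)) / (z * z)) (at z)"
    unfolding cot_defect_def[abs_def]
    using s by (auto intro!: derivative_eq_intros simp: power2_eq_square)
  also have "((- (1 / z\<^sup>2) - (- sin z * sin z - cos z * cos z) / (sin z * sin z)) * z - (1 / z - cos z / sin z)) / (z * z)
      = (z\<^sup>2 * (sin z ^ 2 + cos z ^ 2) + z * sin z * cos z - 2 * sin z ^ 2) / (z ^ 3 * sin z ^ 2)"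
  proof -
    have "((- (1 / z\<^sup>2) - (- u * u - v * v) / (u * u)) * z - (1 / z - v / u)) / (z * z)
      = (z\<^sup>2 * (u ^ 2 + v ^ 2) + z * u * v - 2 * u ^ 2) / (z ^ 3 * u ^ 2)" if "u > 0" for u v :: real
      using that s by (simp add: field_simps power2_eq_square power3_eq_cube)
    from this[OF s(1)] show ?thesis .
  qed
  finally have "(cot_defect has_real_derivative (z\<^sup>2 + z * sin z * cos z - 2 * sin z ^ 2) / (z ^ 3 * sin z ^ 2)) (at z)"
    by simp
  moreover have "0 \<le> (z\<^sup>2 + z * sin z * cos z - 2 * sin z ^ 2) / (z ^ 3 * sin z ^ 2)"
    using s sin_cubic_inequality[of z] z assms by (intro divide_nonneg_nonneg) auto
  ultimately show "\<exists>d. (cot_defect has_real_derivative d) (at z) \<and> 0 \<le> d" by blast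
qed

lemma cot_defect_tendsto: "(cot_defect \<longlongrightarrow> 1 / 3) (at_right 0)"
  unfolding cot_defect_def[abs_def] by real_asymp

lemma cot_defect_ge:
  assumes "0 < x" "x < pi"
  shows "cot_defect x \<ge> 1 / 3"
proof (rule tendsto_upperbound[OF cot_defect_tendsto])
  have "eventually (\<lambda>y. y < x) (at_right 0)" using assms by (auto simp: eventually_at_right_field)
  thus "eventually (\<lambda>y. cot_defect y \<le> cot_defect x) (at_right 0)"
    using eventually_at_right_less[of 0]
    by eventually_elim (use assms in \<open>auto intro: cot_defect_mono\<close>)
qed simp

text \<open>The limit of \<open>zolotarev a t\<close> as \<open>t\<close> tends to 0 from the right;
  the formula of \<open>zolotarev\<close> itself evaluates to 0 at \<open>t = 0\<close>.\<close>

definition zolotarev_0 :: "real \<Rightarrow> real" where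
  "zolotarev_0 a = 1 / ((2 / a) ^ 2 * (1 - 2 / a) powr (a - 2))"

definition log_zolotarev :: "real \<Rightarrow> real \<Rightarrow> real" where
  "log_zolotarev a t = (- a * ln (sin t) + 2 * ln (sin (2 / a * t)) + (a - 2) * ln (sin ((1 - 2 / a) * t))) / (a - 2)"

lemma sin_scaled_pos:
  assumes "a > 2" "0 < t" "t < pi"
  shows "sin t > 0" "sin (2 / a * t) > 0" "sin ((1 - 2 / a) * t) > 0" "0 < 2 / a * t" "2 / a * t < t" "0 < (1 - 2 / a) * t" "(1 - 2 / a) * t < t"
proof -
  have g: "0 < 2 / a" "2 / a < 1" using assms by auto
  show 1: "0 < 2 / a * t" "2 / a * t < t" "0 < (1 - 2 / a) * t" "(1 - 2 / a) * t < t"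
    using g assms mult_strict_right_mono[of "2/a" 1 t] mult_strict_right_mono[of "1 - 2/a" 1 t] by auto
  show "sin t > 0" "sin (2 / a * t) > 0" "sin ((1 - 2 / a) * t) > 0"
    by (rule sin_gt_zero[OF assms(2,3)] sin_gt_zero[OF 1(1) less_trans[OF 1(2) assms(3)]]
        sin_gt_zero[OF 1(3) less_trans[OF 1(4) assms(3)]])+
qed

lemma exp_log_zolotarev:
  assumes "a > 2" "0 < t" "t < pi"
  shows "zolotarev a t powr (- 1 / (a - 2)) = exp (log_zolotarev a t)" "zolotarev a t > 0"
proof -
  note s = sin_scaled_pos[OF assms]
  show pos: "zolotarev a t > 0" using s unfolding zolotarev_def by (intro divide_pos_pos mult_pos_pos) auto
  have "ln (zolotarev a t) = a * ln (sin t) - (2 * ln (sin (2 / a * t)) + (a - 2) * ln (sin ((1 - 2 / a) * t)))"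
    unfolding zolotarev_def using s by (subst ln_div) (auto simp: ln_mult ln_powr ln_realpow)
  hence "- ln (zolotarev a t) = - a * ln (sin t) + 2 * ln (sin (2 / a * t)) + (a - 2) * ln (sin ((1 - 2 / a) * t))" by simp
  hence "- ln (zolotarev a t) / (a - 2) = log_zolotarev a t"
    by (simp only: log_zolotarev_def)
  hence "- 1 / (a - 2) * ln (zolotarev a t) = log_zolotarev a t" by simp
  thus "zolotarev a t powr (- 1 / (a - 2)) = exp (log_zolotarev a t)"
    using pos by (simp add: powr_def)
qed

text \<open>The \<open>1 / t\<close> parts of the three cotangents cancel because
  \<open>- a + 2 + (a - 2) = 0\<close>, so that only their defects remain.\<close>

lemma log_zolotarev_derivative:
  assumes a: "a > 2" and t: "0 < t" "t < pi"
  shows "(log_zolotarev a has_real_derivative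
    t * (cot_defect t - (2 / a) ^ 3 * cot_defect (2 / a * t) - (1 - 2 / a) ^ 3 * cot_defect ((1 - 2 / a) * t)) / (1 - 2 / a)) (at t)"
proof -
  define g where "g = 2 / a"
  have g: "0 < g" "g < 1" using a by (auto simp: g_def)
  note s = sin_scaled_pos[OF a t, folded g_def]
  have ag: "a = 2 / g" using a by (simp add: g_def)
  let ?D = "(- a * (cos t / sin t) + 2 * (g * cos (g * t) / sin (g * t)) + (a - 2) * ((1 - g) * cos ((1 - g) * t) / sin ((1 - g) * t))) / (a - 2)"
  have d: "((\<lambda>t. ln (sin (c * t))) has_real_derivative c * cos (c * t) / sin (c * t)) (at t)" if "sin (c * t) > 0" for c
    using that by (auto intro!: derivative_eq_intros)
  have d1: "((\<lambda>t. ln (sin t)) has_real_derivative cos t / sin t) (at t)" using d[of 1] s by simp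
  have "(log_zolotarev a has_real_derivative ?D) (at t)"
    unfolding log_zolotarev_def[abs_def] g_def[symmetric]
    by (intro DERIV_cdivide DERIV_add DERIV_cmult d d1 s)
  moreover have "?D = t * (cot_defect t - g ^ 3 * cot_defect (g * t) - (1 - g) ^ 3 * cot_defect ((1 - g) * t)) / (1 - g)"
  proof -
    have 1: "t * cot_defect t = 1 / t - cos t / sin t" using t by (simp add: cot_defect_def)
    have 2: "t * (c ^ 3 * cot_defect (c * t)) = c / t - c\<^sup>2 * (cos (c * t) / sin (c * t))" if "c > 0" for c
      using t that by (simp add: cot_defect_def power2_eq_square power3_eq_cube divide_simps) (simp add: algebra_simps)
    have e1: "a / (a - 2) = 1 / (1 - g)" "2 / (a - 2) = g / (1 - g)" using g unfolding ag by (simp_all add: divide_simps)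
    have "?D = - (a / (a - 2)) * (cos t / sin t) + 2 / (a - 2) * (g * cos (g * t) / sin (g * t)) + (1 - g) * cos ((1 - g) * t) / sin ((1 - g) * t)"
      using a by (simp add: add_divide_distrib diff_divide_distrib mult.commute)
    also have "\<dots> = (- (cos t / sin t) + g\<^sup>2 * (cos (g * t) / sin (g * t)) + (1 - g)\<^sup>2 * (cos ((1 - g) * t) / sin ((1 - g) * t))) / (1 - g)"
      unfolding e1 using g by (simp add: divide_simps power2_eq_square)
    also have "- (cos t / sin t) + g\<^sup>2 * (cos (g * t) / sin (g * t)) + (1 - g)\<^sup>2 * (cos ((1 - g) * t) / sin ((1 - g) * t))
       = t * cot_defect t - t * (g ^ 3 * cot_defect (g * t)) - t * ((1 - g) ^ 3 * cot_defect ((1 - g) * t))"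
      unfolding 1 using 2[of g] 2[of "1 - g"] g by (simp add: diff_divide_distrib)
    finally show ?thesis by (simp add: algebra_simps)
  qed
  ultimately show ?thesis unfolding g_def by simp
qed

lemma log_zolotarev_tendsto:
  assumes a: "a > 2"
  shows "(log_zolotarev a \<longlongrightarrow> - 1 / (a - 2) * ln (zolotarev_0 a)) (at_right 0)"
proof -
  define g where "g = 2 / a"
  have g: "0 < g" "g < 1" using a by (auto simp: g_def)
  have lim: "((\<lambda>t. (2 * ln (sin (g * t) / sin t) + (a - 2) * ln (sin ((1 - g) * t) / sin t)) / (a - 2))
      \<longlongrightarrow> (2 * ln g + (a - 2) * ln (1 - g)) / (a - 2)) (at_right 0)"
  proof -
    have "((\<lambda>t. sin (g * t) / sin t) \<longlongrightarrow> g) (at_right 0)" using g by real_asymp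
    moreover have "((\<lambda>t. sin ((1 - g) * t) / sin t) \<longlongrightarrow> 1 - g) (at_right 0)" using g by real_asymp
    ultimately show ?thesis using g a by (intro tendsto_intros) auto
  qed
  have ev: "eventually (\<lambda>t. (2 * ln (sin (g * t) / sin t) + (a - 2) * ln (sin ((1 - g) * t) / sin t)) / (a - 2) = log_zolotarev a t) (at_right 0)"
  proof -
    have "eventually (\<lambda>t::real. t < pi) (at_right 0)" by (auto simp: eventually_at_right_field intro!: exI[of _ pi])
    thus ?thesis using eventually_at_right_less[of 0]
    proof eventually_elim
      case (elim t)
      note s = sin_scaled_pos[OF a elim(2,1), folded g_def]
      show ?case unfolding log_zolotarev_def g_def[symmetric] using s by (simp add: ln_div algebra_simps)
    qed
  qed
  have "(2 * ln g + (a - 2) * ln (1 - g)) / (a - 2) = - 1 / (a - 2) * ln (zolotarev_0 a)"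
    unfolding zolotarev_0_def g_def[symmetric] using g a
    by (simp add: ln_div ln_mult ln_realpow ln_powr add_divide_distrib diff_divide_distrib)
  thus ?thesis using Lim_transform_eventually[OF lim ev] by simp
qed

text \<open>As \<open>cot_defect\<close> increases and is at least \<open>1 / 3\<close>, the bracket
  in the derivative is at least \<open>(1 - g ^ 3 - (1 - g) ^ 3) / 3 = g * (1 - g)\<close>, which
  gives a slope of at least \<open>g * t = 2 * t / a\<close>. The bound holds on all of
  \<open>(0, pi)\<close> and will supply the dominating Gaussian.\<close>

lemma log_zolotarev_ge:
  assumes a: "a > 2" and t: "0 < t" "t < pi"
  shows "log_zolotarev a t \<ge> - 1 / (a - 2) * ln (zolotarev_0 a) + t\<^sup>2 / a"
proof -
  define g where "g = 2 / a"
  have g: "0 < g" "g < 1" using a by (auto simp: g_def)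
  have mono: "log_zolotarev a s - s\<^sup>2 / a \<le> log_zolotarev a t - t\<^sup>2 / a" if s: "0 < s" "s \<le> t" for s
  proof (rule DERIV_nonneg_imp_nondecreasing[OF s(2)])
    fix z assume z: "s \<le> z" "z \<le> t"
    hence z': "0 < z" "z < pi" using s t by auto
    note sc = sin_scaled_pos[OF a z', folded g_def]
    let ?d = "z * (cot_defect z - g ^ 3 * cot_defect (g * z) - (1 - g) ^ 3 * cot_defect ((1 - g) * z)) / (1 - g)"
    have "((\<lambda>t. log_zolotarev a t - t\<^sup>2 / a) has_real_derivative ?d - 2 * z / a) (at z)"
    proof -
      have "((\<lambda>t. t\<^sup>2 / a) has_real_derivative 2 * z / a) (at z)" using a by (auto intro!: derivative_eq_intros)
      from DERIV_diff[OF log_zolotarev_derivative[OF a z'] this] show ?thesis unfolding g_def .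
    qed
    moreover have "?d - 2 * z / a \<ge> 0"
    proof -
      have m: "cot_defect (g * z) \<le> cot_defect z" "cot_defect ((1 - g) * z) \<le> cot_defect z"
        using sc z' by (auto intro!: cot_defect_mono)
      have "3 * g * (1 - g) * cot_defect z = cot_defect z - g ^ 3 * cot_defect z - (1 - g) ^ 3 * cot_defect z"
        by (simp add: power3_eq_cube algebra_simps)
      also have "\<dots> \<le> cot_defect z - g ^ 3 * cot_defect (g * z) - (1 - g) ^ 3 * cot_defect ((1 - g) * z)"
        using m g by (intro diff_mono order_refl mult_left_mono) auto
      finally have "3 * g * (1 - g) * cot_defect z \<le> cot_defect z - g ^ 3 * cot_defect (g * z) - (1 - g) ^ 3 * cot_defect ((1 - g) * z)" .
      moreover have "3 * g * (1 - g) * (1 / 3) \<le> 3 * g * (1 - g) * cot_defect z"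
        using g cot_defect_ge[OF z'] by (intro mult_left_mono) auto
      ultimately have "g * (1 - g) \<le> cot_defect z - g ^ 3 * cot_defect (g * z) - (1 - g) ^ 3 * cot_defect ((1 - g) * z)" by linarith
      hence "z * (g * (1 - g)) / (1 - g) \<le> ?d" using g z' by (intro divide_right_mono mult_left_mono) auto
      moreover have "z * (g * (1 - g)) / (1 - g) = z * g" using g by simp
      moreover have "z * g = 2 * z / a" by (simp add: g_def)
      ultimately show ?thesis by linarith
    qed
    ultimately show "\<exists>d. ((\<lambda>t. log_zolotarev a t - t\<^sup>2 / a) has_real_derivative d) (at z) \<and> 0 \<le> d" by blast
  qed
  have "((\<lambda>s. log_zolotarev a s - s\<^sup>2 / a) \<longlongrightarrow> - 1 / (a - 2) * ln (zolotarev_0 a) - 0\<^sup>2 / a) (at_right 0)"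
    using a by (intro tendsto_intros log_zolotarev_tendsto) auto
  moreover have "eventually (\<lambda>s. log_zolotarev a s - s\<^sup>2 / a \<le> log_zolotarev a t - t\<^sup>2 / a) (at_right 0)"
  proof -
    have "eventually (\<lambda>s. s < t) (at_right 0)" using t by (auto simp: eventually_at_right_field)
    thus ?thesis using eventually_at_right_less[of 0] by eventually_elim (use mono in auto)
  qed
  ultimately have "- 1 / (a - 2) * ln (zolotarev_0 a) - 0\<^sup>2 / a \<le> log_zolotarev a t - t\<^sup>2 / a"
    by (rule tendsto_upperbound) simp
  thus ?thesis by simp
qed

text \<open>L'Hopital's rule with all three defects tending to \<open>1 / 3\<close>: the constant
  \<open>1 / a\<close> of the lower bound is sharp and determines the limiting Gaussian.\<close>

lemma log_zolotarev_second_order: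
  assumes a: "a > 2"
  shows "((\<lambda>t. (log_zolotarev a t - (- 1 / (a - 2) * ln (zolotarev_0 a))) / t\<^sup>2) \<longlongrightarrow> 1 / a) (at_right 0)"
proof -
  define g where "g = 2 / a"
  have g: "0 < g" "g < 1" using a by (auto simp: g_def)
  let ?c = "- 1 / (a - 2) * ln (zolotarev_0 a)"
  let ?d = "\<lambda>t. t * (cot_defect t - g ^ 3 * cot_defect (g * t) - (1 - g) ^ 3 * cot_defect ((1 - g) * t)) / (1 - g)"
  have ltpi: "eventually (\<lambda>t::real. 0 < t \<and> t < pi) (at_right 0)"
    by (auto simp: eventually_at_right_field intro!: exI[of _ pi])
  show ?thesis
  proof (rule lhopital_right_0[where f' = ?d and g' = "\<lambda>t. 2 * t"])
    have "((\<lambda>t. log_zolotarev a t - ?c) \<longlongrightarrow> ?c - ?c) (at_right 0)"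
      by (intro tendsto_intros log_zolotarev_tendsto a)
    thus "((\<lambda>t. log_zolotarev a t - ?c) \<longlongrightarrow> 0) (at_right 0)" by simp
    show "((\<lambda>t::real. t\<^sup>2) \<longlongrightarrow> 0) (at_right 0)" by real_asymp
    show "eventually (\<lambda>t::real. t\<^sup>2 \<noteq> 0) (at_right 0)" "eventually (\<lambda>t::real. 2 * t \<noteq> 0) (at_right 0)"
      using ltpi by (auto elim!: eventually_mono)
    show "eventually (\<lambda>t. ((\<lambda>t. log_zolotarev a t - ?c) has_real_derivative ?d t) (at t)) (at_right 0)"
      using ltpi by eventually_elim (use log_zolotarev_derivative[OF a] in \<open>auto simp: g_def intro!: derivative_eq_intros\<close>)
    show "eventually (\<lambda>t. ((\<lambda>t::real. t\<^sup>2) has_real_derivative 2 * t) (at t)) (at_right 0)"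
      by (intro always_eventually allI) (auto intro!: derivative_eq_intros)
    have sc: "((\<lambda>t. cot_defect (c * t)) \<longlongrightarrow> 1 / 3) (at_right 0)" if "c > 0" for c
    proof -
      have "filterlim (\<lambda>t. c * t) (at_right 0) (at_right (0::real))" using that by real_asymp
      from filterlim_compose[OF cot_defect_tendsto this] show ?thesis .
    qed
    have "((\<lambda>t. (cot_defect t - g ^ 3 * cot_defect (g * t) - (1 - g) ^ 3 * cot_defect ((1 - g) * t)) / (2 * (1 - g)))
        \<longlongrightarrow> (1 / 3 - g ^ 3 * (1 / 3) - (1 - g) ^ 3 * (1 / 3)) / (2 * (1 - g))) (at_right 0)"
      using g by (intro tendsto_intros cot_defect_tendsto sc) auto
    also have "(1 / 3 - g ^ 3 * (1 / 3) - (1 - g) ^ 3 * (1 / 3)) / (2 * (1 - g)) = 1 / a"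
    proof -
      have "1 / 3 - g ^ 3 * (1 / 3) - (1 - g) ^ 3 * (1 / 3) = g * (1 - g)" by (simp add: power3_eq_cube algebra_simps)
      moreover have "g * (1 - g) / (2 * (1 - g)) = g / 2" using g by (simp add: field_simps)
      ultimately have "(1 / 3 - g ^ 3 * (1 / 3) - (1 - g) ^ 3 * (1 / 3)) / (2 * (1 - g)) = g / 2" by (simp only:)
      thus ?thesis by (simp add: g_def)
    qed
    finally have lim: "((\<lambda>t. (cot_defect t - g ^ 3 * cot_defect (g * t) - (1 - g) ^ 3 * cot_defect ((1 - g) * t)) / (2 * (1 - g))) \<longlongrightarrow> 1 / a) (at_right 0)" .
    show "((\<lambda>t. ?d t / (2 * t)) \<longlongrightarrow> 1 / a) (at_right 0)"
      by (rule Lim_transform_eventually[OF lim], use ltpi in eventually_elim) (use g in \<open>simp add: field_simps\<close>)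
  qed
qed

section \<open>The density as a mixture\<close>

text \<open>With exponential moments, the characteristic function of the reciprocal is the power
  series formed from its moments. Equality of moments transfers finiteness of the exponential series
  from \<open>N\<close> to \<open>M\<close>, so it is demanded of \<open>N\<close> alone.\<close>

lemma measure_eq_from_inverse_moments:
  fixes M N :: "real measure"
  assumes M: "prob_space M" "sets M = sets borel" "AE x in M. x > 0"
    and N: "prob_space N" "sets N = sets borel" "AE x in N. x > 0"
    and moments: "\<And>n::nat. (\<integral>\<^sup>+x. ennreal ((1 / x) ^ n) \<partial>M) = (\<integral>\<^sup>+x. ennreal ((1 / x) ^ n) \<partial>N)"
    and expo: "\<And>t. t > 0 \<Longrightarrow> (\<integral>\<^sup>+x. ennreal (exp (t * (1 / x))) \<partial>N) < \<infinity>"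
  shows "M = N"
proof -
  have exp_series: "(\<integral>\<^sup>+x. ennreal (exp (t * (1 / x))) \<partial>P) = (\<Sum>n. ennreal (t ^ n / fact n) * (\<integral>\<^sup>+x. ennreal ((1 / x) ^ n) \<partial>P))"
    if P: "sets P = sets borel" "AE x in P. x > 0" and t: "t > 0" for P :: "real measure" and t :: real
  proof -
    note [measurable_cong] = P(1)
    have "(\<integral>\<^sup>+x. ennreal (exp (t * (1 / x))) \<partial>P) = (\<integral>\<^sup>+x. (\<Sum>n. ennreal (t ^ n / fact n) * ennreal ((1 / x) ^ n)) \<partial>P)"
    proof (rule nn_integral_cong_AE)
      show "AE x in P. ennreal (exp (t * (1 / x))) = (\<Sum>n. ennreal (t ^ n / fact n) * ennreal ((1 / x) ^ n))"
        using P(2)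
      proof eventually_elim
        case (elim x)
        have s: "(\<lambda>n. t ^ n / fact n * (1 / x) ^ n) sums exp (t * (1 / x))"
          using exp_converges[of "t * (1 / x)"] by (simp add: power_mult_distrib power_divide field_simps)
        have "(\<Sum>n. ennreal (t ^ n / fact n) * ennreal ((1 / x) ^ n)) = (\<Sum>n. ennreal (t ^ n / fact n * (1 / x) ^ n))"
          by (intro suminf_cong ennreal_mult[symmetric]) (use elim t in auto)
        also have "\<dots> = ennreal (exp (t * (1 / x)))"
          using s elim t by (intro suminf_ennreal_eq) auto
        finally show ?case by simp
      qed
    qed
    also have "\<dots> = (\<Sum>n. \<integral>\<^sup>+x. ennreal (t ^ n / fact n) * ennreal ((1 / x) ^ n) \<partial>P)"
      by (rule nn_integral_suminf) measurable
    also have "\<dots> = (\<Sum>n. ennreal (t ^ n / fact n) * (\<integral>\<^sup>+x. ennreal ((1 / x) ^ n) \<partial>P))"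
      by (intro suminf_cong nn_integral_cmult) measurable
    finally show ?thesis .
  qed
  have expM: "(\<integral>\<^sup>+x. ennreal (exp (t * (1 / x))) \<partial>M) < \<infinity>" if "t > 0" for t
    using expo[OF that] unfolding exp_series[OF M(2,3) that] exp_series[OF N(2,3) that] moments .
  have char_series: "char (distr P borel (\<lambda>x. 1 / x)) t = (\<Sum>n. (\<i> * of_real t) ^ n / fact n * of_real (enn2real (\<integral>\<^sup>+x. ennreal ((1 / x) ^ n) \<partial>P)))"
    if P: "prob_space P" "sets P = sets borel" "AE x in P. x > 0"
      and ex: "\<And>t. t > 0 \<Longrightarrow> (\<integral>\<^sup>+x. ennreal (exp (t * (1 / x))) \<partial>P) < \<infinity>" for P :: "real measure" and t :: real
  proof -
    note [measurable_cong] = P(2)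
    interpret P: prob_space P by fact
    \<comment> \<open>The added 1 keeps \<open>s\<close> positive for \<open>t = 0\<close>, since
      exponential moments are given at positive arguments.\<close>
    define s where "s = \<bar>t\<bar> + 1"
    have s: "s > 0" by (simp add: s_def)
    have ie: "integrable P (\<lambda>x. exp (s * (1 / x)))"
      using ex[OF s] by (intro integrableI_nonneg) auto
    define f where "f = (\<lambda>n x. (\<i> * of_real t) ^ n / fact n * of_real ((1 / x) ^ n))"
    have normf: "norm (f n x) = \<bar>t\<bar> ^ n / fact n * \<bar>1 / x\<bar> ^ n" for n x
      by (simp add: f_def norm_mult norm_divide norm_power abs_mult power_abs)
    have power_le_exp: "\<bar>t\<bar> ^ n / fact n * (1 / x) ^ n \<le> exp (s * (1 / x))" if "x > 0" for n x
    proof -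
      have "\<bar>t\<bar> ^ n / fact n * (1 / x) ^ n = (\<bar>t\<bar> * (1 / x)) ^ n / fact n"
        by (simp only: power_mult_distrib times_divide_eq_left)
      also have "\<dots> \<le> (s * (1 / x)) ^ n / fact n"
        using that by (intro divide_right_mono power_mono mult_right_mono) (auto simp: s_def)
      also have "\<dots> \<le> exp (s * (1 / x))"
      proof -
        have "(\<Sum>i\<in>{n}. (s * (1 / x)) ^ i / fact i) \<le> (\<Sum>i. (s * (1 / x)) ^ i / fact i)"
          using that s summable_exp[of "s * (1 / x)"] by (intro sum_le_suminf) (auto simp: divide_inverse mult.commute)
        also have "\<dots> = exp (s * (1 / x))" using exp_converges[of "s * (1 / x)"] by (simp add: sums_iff divide_inverse mult.commute)
        finally show ?thesis by simp
      qed
      finally show ?thesis .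
    qed
    have fi: "integrable P (f n)" for n
    proof (rule Bochner_Integration.integrable_bound[OF ie])
      show "f n \<in> borel_measurable P" unfolding f_def by measurable
      show "AE x in P. norm (f n x) \<le> norm (exp (s * (1 / x)))"
        using P(3) by eventually_elim (use power_le_exp in \<open>auto simp: normf\<close>)
    qed
    have absseries: "(\<lambda>n. \<bar>t\<bar> ^ n / fact n * (1 / x) ^ n) sums exp (\<bar>t\<bar> * (1 / x))" for x
      using exp_converges[of "\<bar>t\<bar> * (1 / x)"] by (simp add: power_mult_distrib power_divide field_simps)
    have "char (distr P borel (\<lambda>x. 1 / x)) t = (\<integral>x. iexp (t * (1 / x)) \<partial>P)"
      unfolding char_def by (subst integral_distr) auto
    also have "\<dots> = (\<integral>x. (\<Sum>n. f n x) \<partial>P)"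
    proof (intro Bochner_Integration.integral_cong refl)
      fix x
      have "(\<lambda>n. f n x) sums iexp (t * (1 / x))"
        using exp_converges[of "\<i> * of_real (t * (1 / x))"]
        by (simp add: f_def scaleR_conv_of_real power_mult_distrib power_divide field_simps)
      thus "iexp (t * (1 / x)) = (\<Sum>n. f n x)" by (simp add: sums_iff)
    qed
    also have "\<dots> = (\<Sum>n. \<integral>x. f n x \<partial>P)"
    proof (rule integral_suminf[OF fi])
      show "AE x in P. summable (\<lambda>n. norm (f n x))"
        using P(3) by eventually_elim (use absseries in \<open>auto simp: normf sums_iff\<close>)
      show "summable (\<lambda>n. \<integral>x. norm (f n x) \<partial>P)"
      proof (rule bounded_imp_summable)
        show "0 \<le> (\<integral>x. norm (f n x) \<partial>P)" for n by (intro integral_nonneg_AE) auto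
        show "(\<Sum>n\<le>m. \<integral>x. norm (f n x) \<partial>P) \<le> (\<integral>x. exp (s * (1 / x)) \<partial>P)" for m
        proof -
          have "(\<Sum>n\<le>m. \<integral>x. norm (f n x) \<partial>P) = (\<integral>x. (\<Sum>n\<le>m. norm (f n x)) \<partial>P)"
            by (intro Bochner_Integration.integral_sum[symmetric] integrable_norm fi)
          also have "\<dots> \<le> (\<integral>x. exp (s * (1 / x)) \<partial>P)"
          proof (rule integral_mono_AE[OF _ ie])
            show "integrable P (\<lambda>x. \<Sum>n\<le>m. norm (f n x))" by (intro Bochner_Integration.integrable_sum integrable_norm fi)
            show "AE x in P. (\<Sum>n\<le>m. norm (f n x)) \<le> exp (s * (1 / x))"
              using P(3)
            proof eventually_elim
              case (elim x)
              have "(\<Sum>n\<le>m. norm (f n x)) = (\<Sum>n\<le>m. \<bar>t\<bar> ^ n / fact n * (1 / x) ^ n)" using elim by (simp add: normf)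
              also have "\<dots> \<le> exp (\<bar>t\<bar> * (1 / x))"
                using absseries[of x] elim sum_le_suminf[of "\<lambda>n. \<bar>t\<bar> ^ n / fact n * (1 / x) ^ n" "{..m}"] by (auto simp: sums_iff)
              also have "\<dots> \<le> exp (s * (1 / x))" using elim by (simp add: s_def divide_right_mono)
              finally show ?case .
            qed
          qed
          finally show ?thesis .
        qed
      qed
    qed
    also have "\<dots> = (\<Sum>n. (\<i> * of_real t) ^ n / fact n * of_real (enn2real (\<integral>\<^sup>+x. ennreal ((1 / x) ^ n) \<partial>P)))"
    proof (intro suminf_cong)
      fix n
      have "(\<integral>x. f n x \<partial>P) = (\<i> * of_real t) ^ n / fact n * of_real (\<integral>x. (1 / x) ^ n \<partial>P)"
        unfolding f_def by (subst integral_mult_right_zero) (simp only: integral_complex_of_real)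
      also have "(\<integral>x. (1 / x) ^ n \<partial>P) = enn2real (\<integral>\<^sup>+x. ennreal ((1 / x) ^ n) \<partial>P)"
        by (rule integral_eq_nn_integral) (use P(3) in \<open>auto elim!: eventually_mono\<close>)
      finally show "(\<integral>x. f n x \<partial>P) = (\<i> * of_real t) ^ n / fact n * of_real (enn2real (\<integral>\<^sup>+x. ennreal ((1 / x) ^ n) \<partial>P))" .
    qed
    finally show ?thesis .
  qed
  have rd: "real_distribution (distr P borel (\<lambda>x. 1 / x))" if P: "prob_space P" "sets P = sets borel" for P :: "real measure"
  proof -
    note [measurable_cong] = P(2)
    have "prob_space (distr P borel (\<lambda>x. 1 / x))" by (rule prob_space.prob_space_distr[OF P(1)]) measurable
    thus ?thesis by (simp add: real_distribution_def real_distribution_axioms_def)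
  qed
  have "distr M borel (\<lambda>x. 1 / x) = distr N borel (\<lambda>x. 1 / x)"
  proof (rule Levy_uniqueness[OF rd[OF M(1,2)] rd[OF N(1,2)]], rule ext)
    fix t
    have "char (distr M borel (\<lambda>x. 1 / x)) t = (\<Sum>n. (\<i> * of_real t) ^ n / fact n * of_real (enn2real (\<integral>\<^sup>+x. ennreal ((1 / x) ^ n) \<partial>M)))"
      by (rule char_series[OF M]) (rule expM)
    also have "\<dots> = char (distr N borel (\<lambda>x. 1 / x)) t"
      unfolding moments by (rule char_series[OF N, symmetric]) (rule expo)
    finally show "char (distr M borel (\<lambda>x. 1 / x)) t = char (distr N borel (\<lambda>x. 1 / x)) t" .
  qed
  hence "distr (distr M borel (\<lambda>x. 1 / x)) borel (\<lambda>x. 1 / x) = distr (distr N borel (\<lambda>x. 1 / x)) borel (\<lambda>x. 1 / x)"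
    by simp
  moreover have "distr (distr P borel (\<lambda>x. 1 / x)) borel (\<lambda>x. 1 / x) = P" if P: "sets P = sets borel" for P :: "real measure"
  proof -
    note [measurable_cong] = P
    have "distr (distr P borel (\<lambda>x. 1 / x)) borel (\<lambda>x. 1 / x) = distr P borel (\<lambda>x. x)"
      by (subst distr_distr) (auto simp: o_def)
    also have "\<dots> = P" by (rule distr_id2) (simp add: P)
    finally show ?thesis .
  qed
  ultimately show ?thesis using M(2) N(2) by simp
qed

text \<open>Given \<open>B = b\<close> and \<open>U = t\<close>, the event \<open>A \<le> x\<close>
  means \<open>E \<ge> w * x powr (- 1 / (p - 2))\<close> with this value as \<open>w\<close>. The
  conditional distribution function is then
  \<open>exp (- w * x powr (- 1 / (p - 2)))\<close>.\<close>

definition mixing_rate :: "real \<Rightarrow> real \<Rightarrow> real \<Rightarrow> real" where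
  "mixing_rate p b t = (4 / p * b * zolotarev p t) powr (- 1 / (p - 2))"

definition mixing_weight :: "real \<Rightarrow> real \<Rightarrow> real \<Rightarrow> real" where
  "mixing_weight p b t = indicator {0<..<1} b * indicator {0<..<pi} t *
     (b powr (- 1 / 2) * (1 - b) powr ((p - 2) / (2 * p) - 1) / (Beta (1 / 2) ((p - 2) / (2 * p)) * pi))"

text \<open>The derivative of the distribution function
  \<open>exp (- w * x powr (- \<rho>))\<close>.\<close>

definition frechet :: "real \<Rightarrow> real \<Rightarrow> real \<Rightarrow> real" where
  "frechet \<rho> w x = indicator {0<..} x * (\<rho> * x powr (- \<rho> - 1) * (w * exp (- w * x powr (- \<rho>))))"

text \<open>With values in \<open>ennreal\<close>, Tonelli's theorem exchanges the integrals freely,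
  and every point has a definite value before finiteness is known.\<close>

definition area_density :: "real \<Rightarrow> real \<Rightarrow> ennreal" where
  "area_density p x = (\<integral>\<^sup>+b. (\<integral>\<^sup>+t. ennreal (mixing_weight p b t * frechet (1 / (p - 2)) (mixing_rate p b t) x) \<partial>lborel) \<partial>lborel)"

section \<open>Measurability and positivity of the mixture\<close>

lemma measurable_zolotarev [measurable]: "zolotarev p \<in> borel_measurable borel"
  unfolding zolotarev_def[abs_def] by measurable

lemma measurable_mixing_rate [measurable]: "(\<lambda>(b, t). mixing_rate p b t) \<in> borel_measurable (borel \<Otimes>\<^sub>M borel)"
  unfolding mixing_rate_def by measurable

lemma measurable_mixing_weight [measurable]: "(\<lambda>(b, t). mixing_weight p b t) \<in> borel_measurable (borel \<Otimes>\<^sub>M borel)"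
  unfolding mixing_weight_def by measurable

lemma measurable_frechet [measurable]: "(\<lambda>(w, x). frechet \<rho> w x) \<in> borel_measurable (borel \<Otimes>\<^sub>M borel)"
  unfolding frechet_def by measurable

lemma Beta_real_pos:
  fixes a b :: real
  assumes "a > 0" "b > 0"
  shows "Beta a b > 0"
  unfolding Beta_def using assms by (intro divide_pos_pos mult_pos_pos Gamma_real_pos add_pos_pos)

lemma mixing_weight_nonneg: "p > 2 \<Longrightarrow> mixing_weight p b t \<ge> 0"
proof -
  assume "p > 2"
  hence "(p - 2) / (2 * p) > 0" by simp
  hence "Beta (1 / 2) ((p - 2) / (2 * p)) > 0" by (intro Beta_real_pos) auto
  thus ?thesis unfolding mixing_weight_def by (intro mult_nonneg_nonneg divide_nonneg_nonneg) auto
qed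

lemma frechet_nonneg: "\<rho> > 0 \<Longrightarrow> w \<ge> 0 \<Longrightarrow> frechet \<rho> w x \<ge> 0"
  by (auto simp: frechet_def)

lemma mixing_rate_nonneg: "mixing_rate p b t \<ge> 0"
  by (simp add: mixing_rate_def)

lemma measurable_area_density [measurable]: "area_density p \<in> borel_measurable borel"
  unfolding area_density_def[abs_def] by measurable

lemma nn_integral_area_density:
  assumes p: "p > 2" and g[measurable]: "g \<in> borel_measurable borel"
  shows "(\<integral>\<^sup>+x. area_density p x * g x \<partial>lborel) =
    (\<integral>\<^sup>+b. (\<integral>\<^sup>+t. ennreal (mixing_weight p b t) * (\<integral>\<^sup>+x. ennreal (frechet (1 / (p - 2)) (mixing_rate p b t) x) * g x \<partial>lborel) \<partial>lborel) \<partial>lborel)"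
proof -
  let ?f = "\<lambda>b t x. ennreal (mixing_weight p b t * frechet (1 / (p - 2)) (mixing_rate p b t) x)"
  have "(\<integral>\<^sup>+x. area_density p x * g x \<partial>lborel) = (\<integral>\<^sup>+x. (\<integral>\<^sup>+b. (\<integral>\<^sup>+t. ?f b t x * g x \<partial>lborel) \<partial>lborel) \<partial>lborel)"
    unfolding area_density_def by (simp add: nn_integral_multc)
  also have "\<dots> = (\<integral>\<^sup>+b. (\<integral>\<^sup>+x. (\<integral>\<^sup>+t. ?f b t x * g x \<partial>lborel) \<partial>lborel) \<partial>lborel)"
    by (rule lborel_pair.Fubini') measurable
  also have "\<dots> = (\<integral>\<^sup>+b. (\<integral>\<^sup>+t. (\<integral>\<^sup>+x. ?f b t x * g x \<partial>lborel) \<partial>lborel) \<partial>lborel)"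
    by (intro nn_integral_cong lborel_pair.Fubini') measurable
  also have "\<dots> = (\<integral>\<^sup>+b. (\<integral>\<^sup>+t. ennreal (mixing_weight p b t) * (\<integral>\<^sup>+x. ennreal (frechet (1 / (p - 2)) (mixing_rate p b t) x) * g x \<partial>lborel) \<partial>lborel) \<partial>lborel)"
  proof (intro nn_integral_cong)
    fix b t :: real
    have "(\<integral>\<^sup>+x. ?f b t x * g x \<partial>lborel) = (\<integral>\<^sup>+x. ennreal (mixing_weight p b t) * (ennreal (frechet (1 / (p - 2)) (mixing_rate p b t) x) * g x) \<partial>lborel)"
      using mixing_weight_nonneg[OF p] by (intro nn_integral_cong) (simp add: ennreal_mult' mult.assoc)
    also have "\<dots> = ennreal (mixing_weight p b t) * (\<integral>\<^sup>+x. ennreal (frechet (1 / (p - 2)) (mixing_rate p b t) x) * g x \<partial>lborel)"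
      by (rule nn_integral_cmult) measurable
    finally show "(\<integral>\<^sup>+x. ?f b t x * g x \<partial>lborel) = ennreal (mixing_weight p b t) * (\<integral>\<^sup>+x. ennreal (frechet (1 / (p - 2)) (mixing_rate p b t) x) * g x \<partial>lborel)" .
  qed
  finally show ?thesis .
qed

text \<open>Under this law \<open>1 / x\<close> is distributed as
  \<open>(E / w) powr (1 / \<rho>)\<close> with \<open>E\<close> standard exponential; the integral
  is the Gamma integral with the negative exponent \<open>- \<rho>\<close>.\<close>

lemma frechet_inverse_moment:
  assumes \<rho>: "\<rho> > 0" and w: "w > 0"
  shows "(\<integral>\<^sup>+x. ennreal (frechet \<rho> w x) * ennreal ((1 / x) ^ n) \<partial>lborel) = ennreal (Gamma (1 + n / \<rho>) * w powr (- (n / \<rho>)))"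
proof -
  have s: "1 + n / \<rho> > 0" using \<rho> by (simp add: add_pos_nonneg)
  have "has_bochner_integral lborel (\<lambda>x. \<rho> * w * (indicator {0<..} x * (x powr (- \<rho> * (1 + n / \<rho>) - 1) * exp (- w * x powr (- \<rho>)))))
     (\<rho> * w * (Gamma (1 + n / \<rho>) * w powr (- (1 + n / \<rho>)) / \<bar>- \<rho>\<bar>))"
    using \<rho> w s by (intro has_bochner_integral_mult_right gamma_integral_powr_real) auto
  also have "\<rho> * w * (Gamma (1 + n / \<rho>) * w powr (- (1 + n / \<rho>)) / \<bar>- \<rho>\<bar>) = Gamma (1 + n / \<rho>) * (w * w powr (- (1 + n / \<rho>)))"
    using \<rho> by simp
  also have "w * w powr (- (1 + n / \<rho>)) = w powr (- (n / \<rho>))"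
    using w powr_mult_base[of w "- (1 + n / \<rho>)"] by simp
  also have "(\<lambda>x. \<rho> * w * (indicator {0<..} x * (x powr (- \<rho> * (1 + n / \<rho>) - 1) * exp (- w * x powr (- \<rho>))))) = (\<lambda>x. frechet \<rho> w x * (1 / x) ^ n)"
  proof
    fix x :: real
    show "\<rho> * w * (indicator {0<..} x * (x powr (- \<rho> * (1 + n / \<rho>) - 1) * exp (- w * x powr (- \<rho>)))) = frechet \<rho> w x * (1 / x) ^ n"
    proof (cases "x > 0")
      case True
      have "x powr (- \<rho> * (1 + n / \<rho>) - 1) = x powr (- \<rho> - 1) * x powr (- real n)"
        using \<rho> by (simp add: algebra_simps flip: powr_add)
      also have "x powr (- real n) = (1 / x) ^ n"
        using True by (simp add: powr_minus powr_realpow power_one_over inverse_eq_divide)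
      finally show ?thesis using True by (simp add: frechet_def)
    qed (simp add: frechet_def)
  qed
  finally have hb: "has_bochner_integral lborel (\<lambda>x. frechet \<rho> w x * (1 / x) ^ n) (Gamma (1 + n / \<rho>) * w powr (- (n / \<rho>)))" .
  have nn: "frechet \<rho> w x * (1 / x) ^ n \<ge> 0" for x using \<rho> w by (auto simp: frechet_def indicator_def)
  have "(\<integral>\<^sup>+x. ennreal (frechet \<rho> w x) * ennreal ((1 / x) ^ n) \<partial>lborel) = (\<integral>\<^sup>+x. ennreal (frechet \<rho> w x * (1 / x) ^ n) \<partial>lborel)"
  proof (rule nn_integral_cong)
    fix x :: real
    show "ennreal (frechet \<rho> w x) * ennreal ((1 / x) ^ n) = ennreal (frechet \<rho> w x * (1 / x) ^ n)"
      using \<rho> w by (cases "x > 0") (auto simp: frechet_def ennreal_mult' simp del: power_one_over)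
  qed
  also have "\<dots> = ennreal (Gamma (1 + n / \<rho>) * w powr (- (n / \<rho>)))"
    using hb nn by (subst nn_integral_eq_integral) (auto simp: has_bochner_integral_iff)
  finally show ?thesis .
qed

lemma zolotarev_nonneg:
  assumes "p > 2" "0 \<le> t" "t \<le> pi"
  shows "zolotarev p t \<ge> 0"
  unfolding zolotarev_def using assms by (auto intro!: divide_nonneg_nonneg mult_nonneg_nonneg)

text \<open>The moments factor over the independent components: the Frechet integral gives the Gamma
  factor, the \<open>b\<close> integral a quotient of Beta functions, and
  \<open>zolotarev_moment\<close> the binomial coefficient.\<close>

lemma area_density_inverse_moment:
  assumes p: "p > 2"
  shows "(\<integral>\<^sup>+x. area_density p x * ennreal ((1 / x) ^ n) \<partial>lborel) =
    ennreal (Gamma (1 + n * (p - 2)) * (4 / p) ^ n * (Beta (1 / 2 + n) ((p - 2) / (2 * p)) / Beta (1 / 2) ((p - 2) / (2 * p))) * (p * n gchoose (2 * n)))"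
proof -
  define q where "q = (p - 2) / (2 * p)"
  have q: "q > 0" using p by (simp add: q_def)
  define c where "c = Beta (1 / 2) q * pi"
  have c: "c > 0" using q by (auto simp: c_def Beta_def)
  let ?G = "Gamma (1 + n * (p - 2)) * (4 / p) ^ n"
  have G: "?G \<ge> 0" using p by (intro mult_nonneg_nonneg Gamma_real_nonneg add_pos_nonneg zero_le_power) auto
  have inner: "(\<integral>\<^sup>+x. ennreal (frechet (1 / (p - 2)) (mixing_rate p b t) x) * ennreal ((1 / x) ^ n) \<partial>lborel)
     = ennreal (?G * (b ^ n * zolotarev p t ^ n))" if "0 < b" "0 < t" "t < pi" for b t
  proof -
    have z: "4 / p * b * zolotarev p t > 0" using that p exp_log_zolotarev(2)[of p t] by simp
    hence w: "mixing_rate p b t > 0"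
      unfolding mixing_rate_def powr_gt_zero by (rule less_imp_neq[THEN not_sym])
    have "mixing_rate p b t powr (- (n / (1 / (p - 2)))) = (4 / p * b * zolotarev p t) powr real n"
    proof -
      have "- 1 / (p - 2) * (- (n / (1 / (p - 2)))) = real n" using p by simp
      thus ?thesis unfolding mixing_rate_def powr_powr by (simp only:)
    qed
    also have "\<dots> = (4 / p * b * zolotarev p t) ^ n" using z by (rule powr_realpow)
    also have "\<dots> = (4 / p) ^ n * (b ^ n * zolotarev p t ^ n)" by (simp only: power_mult_distrib mult.assoc)
    finally have e: "mixing_rate p b t powr (- (n / (1 / (p - 2)))) = (4 / p) ^ n * (b ^ n * zolotarev p t ^ n)" .
    show ?thesis
      using frechet_inverse_moment[of "1 / (p - 2)" "mixing_rate p b t" n, unfolded e] w p by (simp add: mult.assoc)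
  qed
  have "(\<integral>\<^sup>+x. area_density p x * ennreal ((1 / x) ^ n) \<partial>lborel) =
    (\<integral>\<^sup>+b. (\<integral>\<^sup>+t. ennreal (mixing_weight p b t) * (\<integral>\<^sup>+x. ennreal (frechet (1 / (p - 2)) (mixing_rate p b t) x) * ennreal ((1 / x) ^ n) \<partial>lborel) \<partial>lborel) \<partial>lborel)"
    by (rule nn_integral_area_density[OF p]) measurable
  also have "\<dots> = (\<integral>\<^sup>+b. (\<integral>\<^sup>+t. ennreal (?G / c * (indicator {0<..<1} b * (b powr (1 / 2 + n - 1) * (1 - b) powr (q - 1)))) *
       ennreal (indicator {0<..<pi} t * zolotarev p t ^ n) \<partial>lborel) \<partial>lborel)"
  proof (intro nn_integral_cong)
    fix b t :: real
    show "ennreal (mixing_weight p b t) * (\<integral>\<^sup>+x. ennreal (frechet (1 / (p - 2)) (mixing_rate p b t) x) * ennreal ((1 / x) ^ n) \<partial>lborel)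
      = ennreal (?G / c * (indicator {0<..<1} b * (b powr (1 / 2 + n - 1) * (1 - b) powr (q - 1)))) * ennreal (indicator {0<..<pi} t * zolotarev p t ^ n)"
    proof (cases "b \<in> {0<..<1} \<and> t \<in> {0<..<pi}")
      case True
      have "b powr (1 / 2 + n - 1) = b powr (- 1 / 2 + real n)" by (simp add: algebra_simps)
      also have "\<dots> = b powr (- 1 / 2) * b powr real n" by (rule powr_add)
      also have "b powr real n = b ^ n" using True by (intro powr_realpow) auto
      finally have b: "b powr (1 / 2 + n - 1) = b powr (- 1 / 2) * b ^ n" .
      have "ennreal (mixing_weight p b t) * ennreal (?G * (b ^ n * zolotarev p t ^ n)) = ennreal (mixing_weight p b t * (?G * (b ^ n * zolotarev p t ^ n)))"
        using mixing_weight_nonneg[OF p] by (simp add: ennreal_mult')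
      also have "mixing_weight p b t * (?G * (b ^ n * zolotarev p t ^ n)) = (?G / c * (b powr (1 / 2 + n - 1) * (1 - b) powr (q - 1))) * zolotarev p t ^ n"
        unfolding b using True by (simp add: mixing_weight_def c_def q_def mult_ac)
      also have "ennreal \<dots> = ennreal (?G / c * (b powr (1 / 2 + n - 1) * (1 - b) powr (q - 1))) * ennreal (zolotarev p t ^ n)"
        using G c by (intro ennreal_mult') (auto intro!: mult_nonneg_nonneg)
      finally show ?thesis using inner[of b t] True by simp
    qed (auto simp: mixing_weight_def)
  qed
  also have "\<dots> = (\<integral>\<^sup>+b. ennreal (?G / c * (indicator {0<..<1} b * (b powr (1 / 2 + n - 1) * (1 - b) powr (q - 1)))) \<partial>lborel) *
       (\<integral>\<^sup>+t. ennreal (indicator {0<..<pi} t * zolotarev p t ^ n) \<partial>lborel)"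
    by (simp add: nn_integral_cmult nn_integral_multc)
  also have "(\<integral>\<^sup>+t. ennreal (indicator {0<..<pi} t * zolotarev p t ^ n) \<partial>lborel) = ennreal (pi * (p * n gchoose (2 * n)))"
  proof -
    have "(\<integral>\<^sup>+t. ennreal (indicator {0<..<pi} t * zolotarev p t ^ n) \<partial>lborel) = (\<integral>\<^sup>+t. ennreal (indicator {0..pi} t * zolotarev p t ^ n) \<partial>lborel)"
    proof (rule nn_integral_cong_AE)
      have "AE t in lborel. t \<noteq> (0::real)" "AE t in lborel. t \<noteq> pi" by (rule AE_lborel_singleton)+
      thus "AE t in lborel. ennreal (indicator {0<..<pi} t * zolotarev p t ^ n) = ennreal (indicator {0..pi} t * zolotarev p t ^ n)"
        by eventually_elim (auto simp: indicator_def)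
    qed
    also have "\<dots> = ennreal (pi * (p * n gchoose (2 * n)))"
      by (rule nn_integral_has_integral_lebesgue[OF _ zolotarev_moment[OF p]]) (use zolotarev_nonneg[OF p] in auto)
    finally show ?thesis .
  qed
  also have "(\<integral>\<^sup>+b. ennreal (?G / c * (indicator {0<..<1} b * (b powr (1 / 2 + n - 1) * (1 - b) powr (q - 1)))) \<partial>lborel) = ennreal (?G / c * Beta (1 / 2 + n) q)"
  proof -
    have "(\<integral>\<^sup>+b. ennreal (?G / c * (indicator {0<..<1} b * (b powr (1 / 2 + n - 1) * (1 - b) powr (q - 1)))) \<partial>lborel)
      = (\<integral>\<^sup>+b. ennreal (?G / c) * ennreal (indicator {0..1} b * (b powr (1 / 2 + n - 1) * (1 - b) powr (q - 1))) \<partial>lborel)"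
    proof (rule nn_integral_cong_AE)
      have "AE b in lborel. b \<noteq> (0::real)" "AE b in lborel. b \<noteq> (1::real)" by (rule AE_lborel_singleton)+
      thus "AE b in lborel. ennreal (?G / c * (indicator {0<..<1} b * (b powr (1 / 2 + n - 1) * (1 - b) powr (q - 1)))) =
         ennreal (?G / c) * ennreal (indicator {0..1} b * (b powr (1 / 2 + n - 1) * (1 - b) powr (q - 1)))"
      proof eventually_elim
        case (elim b)
        hence "(indicator {0<..<1} b :: real) = indicator {0..1} b" by (auto simp: indicator_def)
        thus ?case using G c by (simp only: ennreal_mult' divide_nonneg_pos)
      qed
    qed
    also have "\<dots> = ennreal (?G / c) * ennreal (Beta (1 / 2 + n) q)"
    proof (subst nn_integral_cmult)
      have "(\<integral>\<^sup>+b. ennreal (indicator {0..1} b * (b powr (1 / 2 + n - 1) * (1 - b) powr (q - 1))) \<partial>lborel) = ennreal (Beta (1 / 2 + n) q)"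
        by (rule nn_integral_has_integral_lebesgue[OF _ has_integral_Beta_real]) (use q in \<open>auto simp: add_pos_nonneg\<close>)
      thus "ennreal (?G / c) * (\<integral>\<^sup>+b. ennreal (indicator {0..1} b * (b powr (1 / 2 + n - 1) * (1 - b) powr (q - 1))) \<partial>lborel) = ennreal (?G / c) * ennreal (Beta (1 / 2 + n) q)"
        by simp
    qed measurable
    also have "\<dots> = ennreal (?G / c * Beta (1 / 2 + n) q)"
      using G c by (intro ennreal_mult'[symmetric] divide_nonneg_pos)
    finally show ?thesis .
  qed
  also have "ennreal (?G / c * Beta (1 / 2 + n) q) * ennreal (pi * (p * n gchoose (2 * n))) = ennreal (?G / c * Beta (1 / 2 + n) q * (pi * (p * n gchoose (2 * n))))"
    using G c q by (intro ennreal_mult'[symmetric]) (auto intro!: mult_nonneg_nonneg divide_nonneg_nonneg Gamma_real_nonneg simp: Beta_def add_nonneg_nonneg)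
  also have "?G / c * Beta (1 / 2 + n) q * (pi * (p * n gchoose (2 * n))) = ?G * (Beta (1 / 2 + n) q / Beta (1 / 2) q) * (p * n gchoose (2 * n))"
    by (simp add: c_def)
  finally show ?thesis unfolding q_def .
qed

text \<open>The Beta parameter \<open>q\<close> is forced by \<open>1 / 2 + q = 1 - 1 / p\<close>:
  its moments are then the quotient of the Pochhammer symbols at \<open>1 / 2\<close> and
  \<open>1 - 1 / p\<close>. The factor \<open>4 / p\<close> collects what duplication and the
  product of the \<open>k * p - 1\<close> leave over.\<close>

lemma area_moment_closed_form:
  fixes p :: real
  assumes p: "p > 2" and n: "n > 0"
  shows "Gamma (1 + n * (p - 2)) * (4 / p) ^ n * (Beta (1 / 2 + n) ((p - 2) / (2 * p)) / Beta (1 / 2) ((p - 2) / (2 * p))) * (p * n gchoose (2 * n))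
    = p * Gamma (real n * p) / Gamma (real n) * (\<Prod>k=1..n. 1 / (real k * p - 1))"
proof -
  define q where "q = (p - 2) / (2 * p)"
  have q: "q > 0" "q + 1 / 2 = 1 - 1 / p" using p by (auto simp: q_def field_simps)
  have pos: "1 - 1 / p > 0" using p by simp
  have nI: "x \<notin> \<int>\<^sub>\<le>\<^sub>0" if "x > 0" for x :: real using that by (auto elim!: nonpos_Ints_cases)
  have P1: "pochhammer (1 / 2) n = Gamma (1 / 2 + n) / Gamma (1 / 2 :: real)" by (rule pochhammer_Gamma) (simp add: nI)
  have P2: "pochhammer (1 - 1 / p) n = Gamma (1 - 1 / p + n) / Gamma (1 - 1 / p)" by (rule pochhammer_Gamma) (rule nI[OF pos])
  have pp: "pochhammer (1 - 1 / p) n > 0" using pos by (rule pochhammer_pos)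
  have g1: "Gamma (1 - 1 / p) > 0" using pos by (rule Gamma_real_pos)
  have beta: "Beta (1 / 2 + n) q / Beta (1 / 2) q = pochhammer (1 / 2) n / pochhammer (1 - 1 / p) n"
  proof -
    have e: "1 / 2 + real n + q = 1 - 1 / p + n" "1 / 2 + q = 1 - 1 / p" using q(2) by linarith+
    have "Gamma q > 0" using q by simp
    thus ?thesis unfolding Beta_def e P1 P2 by (simp add: field_simps)
  qed
  have bin: "(p * n gchoose (2 * n)) = Gamma (p * n + 1) / (fact (2 * n) * Gamma (1 + n * (p - 2)))"
  proof -
    have "p * n + 1 > 0" using p by (simp add: add_nonneg_pos)
    thus ?thesis using gbinomial_Gamma[of "p * n" "2 * n"] nI[of "p * n + 1"] by (simp add: algebra_simps)
  qed
  have gp: "Gamma (1 + n * (p - 2)) > 0" using p by (intro Gamma_real_pos add_pos_nonneg) auto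
  have dbl: "(fact (2 * n) :: real) = 4 ^ n * pochhammer (1 / 2) n * fact n"
    using fact_double[of n, where 'a = real] by (simp add: power_mult)
  have ph: "pochhammer (1 / 2 :: real) n > 0" by (rule pochhammer_pos) simp
  have prod: "(\<Prod>k=1..n. 1 / (real k * p - 1)) = 1 / (p ^ n * pochhammer (1 - 1 / p) n)"
  proof -
    have "(\<Prod>k=1..n. real k * p - 1) = (\<Prod>k=1..n. p * (1 - 1 / p + (real k - 1)))"
      using p by (intro prod.cong) (auto simp: field_simps)
    also have "\<dots> = p ^ n * (\<Prod>k=1..n. 1 - 1 / p + (real k - 1))" by (simp add: prod.distrib)
    also have "(\<Prod>k=1..n. 1 - 1 / p + (real k - 1)) = (\<Prod>i<n. 1 - 1 / p + real i)"
      by (rule prod.reindex_bij_witness[of _ Suc "\<lambda>k. k - 1"]) auto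
    also have "\<dots> = pochhammer (1 - 1 / p) n" by (simp add: pochhammer_prod atLeast0LessThan)
    finally show ?thesis by (simp add: prod_dividef)
  qed
  have Gn: "Gamma (real n) = fact n / n" using n by (cases n) (simp_all add: Gamma_fact)
  have Gnp: "Gamma (p * n + 1) = p * n * Gamma (real n * p)"
    using Gamma_plus1[of "p * n"] nI[of "p * n"] p n by (simp add: mult_ac)
  show ?thesis
    unfolding q_def[symmetric] beta bin dbl prod Gn Gnp
    using gp ph pp p n by (simp add: field_simps power_divide)
qed

text \<open>The infimum of \<open>mixing_rate\<close> over the open rectangle, approached at the
  corner \<open>b = 1\<close>, \<open>t = 0\<close> and not attained; hence the limit value
  \<open>zolotarev_0\<close>.\<close>

definition min_rate :: "real \<Rightarrow> real" where
  "min_rate p = (4 / p * zolotarev_0 p) powr (- 1 / (p - 2))"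

lemma min_rate_pos: "p > 2 \<Longrightarrow> min_rate p > 0"
  by (simp add: min_rate_def zolotarev_0_def)

text \<open>Relative to the minimum the exponent is a sum of a function of \<open>b\<close> and a
  function of \<open>t\<close>, so the corner can be expanded in each variable alone.\<close>

lemma mixing_rate_eq:
  assumes p: "p > 2" and b: "0 < b" and t: "0 < t" "t < pi"
  shows "mixing_rate p b t = min_rate p * exp (- ln b / (p - 2) + (log_zolotarev p t - (- 1 / (p - 2) * ln (zolotarev_0 p))))"
proof -
  have z0: "zolotarev_0 p > 0" using p by (auto simp: zolotarev_0_def)
  have z: "zolotarev p t > 0" using exp_log_zolotarev(2)[OF p t] .
  let ?r = "- 1 / (p - 2)"
  have "mixing_rate p b t = (4 / p) powr ?r * b powr ?r * zolotarev p t powr ?r"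
    unfolding mixing_rate_def using p b z powr_mult[of "4 / p * b" "zolotarev p t" ?r] powr_mult[of "4 / p" b ?r] by simp
  also have "\<dots> = (4 / p) powr ?r * exp (- ln b / (p - 2)) * exp (log_zolotarev p t)"
  proof -
    have "b powr ?r = exp (- ln b / (p - 2))" using b by (simp add: powr_def)
    thus ?thesis by (simp only: exp_log_zolotarev(1)[OF p t])
  qed
  finally have 1: "mixing_rate p b t = (4 / p) powr ?r * exp (- ln b / (p - 2)) * exp (log_zolotarev p t)" .
  have "min_rate p = (4 / p) powr ?r * zolotarev_0 p powr ?r"
    unfolding min_rate_def by (rule powr_mult)
  also have "zolotarev_0 p powr ?r = exp (?r * ln (zolotarev_0 p))" using z0 by (simp add: powr_def)
  finally have 2: "min_rate p = (4 / p) powr ?r * exp (?r * ln (zolotarev_0 p))" .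
  have "exp (?r * ln (zolotarev_0 p)) * exp (- ln b / (p - 2) + (log_zolotarev p t - ?r * ln (zolotarev_0 p)))
    = exp (- ln b / (p - 2)) * exp (log_zolotarev p t)"
    by (simp flip: exp_add)
  thus ?thesis unfolding 1 2 by (simp only: mult.assoc)
qed

lemma mixing_exponent_ge:
  assumes p: "p > 2" and b: "0 < b" "b < 1" and t: "0 < t" "t < pi"
  shows "- ln b / (p - 2) + (log_zolotarev p t - (- 1 / (p - 2) * ln (zolotarev_0 p))) \<ge> (1 - b) / (p - 2) + t\<^sup>2 / p"
proof -
  have "ln b \<le> b - 1" using b by (intro ln_le_minus_one) auto
  hence "(1 - b) / (p - 2) \<le> - ln b / (p - 2)" using p by (intro divide_right_mono) auto
  thus ?thesis using log_zolotarev_ge[OF p t] by linarith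
qed

text \<open>The first bound gives the decay for Laplace's method, the second the exponential
  moments, and the third controls the factor \<open>b powr (- 1 / 2)\<close> of the weight near
  \<open>b = 0\<close>.\<close>

lemma mixing_rate_bounds:
  assumes p: "p > 2" and b: "0 < b" "b < 1" and t: "0 < t" "t < pi"
  shows "mixing_rate p b t \<ge> min_rate p * (1 + ((1 - b) / (p - 2) + t\<^sup>2 / p))"
    "mixing_rate p b t \<ge> min_rate p" "mixing_rate p b t \<ge> min_rate p * b powr (- 1 / (p - 2))"
proof -
  let ?E = "- ln b / (p - 2) + (log_zolotarev p t - (- 1 / (p - 2) * ln (zolotarev_0 p)))"
  note E = mixing_exponent_ge[OF p b t]
  have m: "min_rate p \<ge> 0" using min_rate_pos[OF p] by simp
  have "1 + ((1 - b) / (p - 2) + t\<^sup>2 / p) \<le> exp ?E" using E exp_ge_add_one_self[of ?E] by linarith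
  thus 1: "mixing_rate p b t \<ge> min_rate p * (1 + ((1 - b) / (p - 2) + t\<^sup>2 / p))"
    unfolding mixing_rate_eq[OF p b(1) t] using m by (intro mult_left_mono)
  have nn: "0 \<le> (1 - b) / (p - 2)" "0 \<le> t\<^sup>2 / p" using p b by auto
  have "exp 0 \<le> exp ?E" using E nn by (subst exp_le_cancel_iff) linarith
  thus "mixing_rate p b t \<ge> min_rate p"
    unfolding mixing_rate_eq[OF p b(1) t] using mult_left_mono[OF _ m, of 1 "exp ?E"] by simp
  have "exp (- ln b / (p - 2)) \<le> exp ?E"
    using log_zolotarev_ge[OF p t] nn by (subst exp_le_cancel_iff) linarith
  moreover have "b powr (- 1 / (p - 2)) = exp (- ln b / (p - 2))" using b by (simp add: powr_def)
  ultimately show "mixing_rate p b t \<ge> min_rate p * b powr (- 1 / (p - 2))"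
    unfolding mixing_rate_eq[OF p b(1) t] using m by (simp add: mult_left_mono)
qed

lemma frechet_integral:
  assumes "\<rho> > 0" "w > 0"
  shows "(\<integral>\<^sup>+x. ennreal (frechet \<rho> w x) \<partial>lborel) = 1"
  using frechet_inverse_moment[OF assms, of 0] assms by simp

lemma area_density_integral:
  assumes "p > 2"
  shows "(\<integral>\<^sup>+x. area_density p x \<partial>lborel) = 1"
proof -
  have "Beta (1 / 2) ((p - 2) / (2 * p)) > 0" using assms by (intro Beta_real_pos) auto
  thus ?thesis using area_density_inverse_moment[OF assms, of 0] by simp
qed

lemma area_density_nonpos: "x \<le> 0 \<Longrightarrow> area_density p x = 0"
  by (simp add: area_density_def frechet_def)

text \<open>The Frechet exponent outgrows a linear function of \<open>1 / x\<close>, and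
  \<open>\<rho> > 1\<close> is where \<open>p < 3\<close> enters. With \<open>y = 1 / x\<close>, the
  power term dominates beyond \<open>y0\<close>, which solves
  \<open>c * y powr (\<rho> - 1) = s\<close>.\<close>

lemma inverse_le_powr:
  fixes \<rho> c s :: real
  assumes \<rho>: "\<rho> > 1" and c: "c > 0" and s: "s > 0"
  obtains C where "\<And>x. x > 0 \<Longrightarrow> s * (1 / x) \<le> C + c * x powr (- \<rho>)"
proof -
  define y0 where "y0 = (s / c) powr (1 / (\<rho> - 1))"
  have y0: "y0 > 0" "y0 powr (\<rho> - 1) = s / c" using \<rho> c s by (auto simp: y0_def powr_powr)
  show ?thesis
  proof (rule that[of "s * y0"])
    fix x :: real assume x: "x > 0"
    define y where "y = 1 / x"
    have y: "y > 0" using x by (simp add: y_def)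
    have xy: "x powr (- \<rho>) = y * y powr (\<rho> - 1)" using x y
      by (simp add: y_def powr_mult_base powr_minus powr_divide inverse_eq_divide)
    show "s * (1 / x) \<le> s * y0 + c * x powr (- \<rho>)"
    proof (cases "y \<ge> y0")
      case True
      have "s / c \<le> y powr (\<rho> - 1)" unfolding y0(2)[symmetric] using True y0 \<rho> by (intro powr_mono2) auto
      hence "s \<le> c * y powr (\<rho> - 1)" using c by (simp add: field_simps)
      hence "s * y \<le> c * (y * y powr (\<rho> - 1))" using y mult_right_mono[of s "c * y powr (\<rho> - 1)" y] by (simp add: mult_ac)
      moreover have "0 \<le> s * y0" using s y0 by simp
      ultimately show ?thesis unfolding xy y_def[symmetric] by linarith
    next
      case False
      hence "s * y \<le> s * y0" using s by simp
      moreover have "0 \<le> c * x powr (- \<rho>)" using c by simp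
      ultimately show ?thesis unfolding y_def[symmetric] by linarith
    qed
  qed
qed

text \<open>Half of the rate pays for \<open>exp (s / x)\<close>, uniformly because all rates are at
  least \<open>min_rate p\<close>. What is left is, up to the factor \<open>2 * exp C\<close>, a
  Frechet density of rate \<open>w / 2\<close>, again of mass 1.\<close>

lemma area_density_exp_moment:
  assumes p: "2 < p" "p < 3" and s: "s > 0"
  shows "(\<integral>\<^sup>+x. area_density p x * ennreal (exp (s * (1 / x))) \<partial>lborel) < \<infinity>"
proof -
  define \<rho> where "\<rho> = 1 / (p - 2)"
  have \<rho>: "\<rho> > 1" using p by (simp add: \<rho>_def)
  have c: "min_rate p / 2 > 0" using min_rate_pos[OF p(1)] by simp
  obtain C where C: "\<And>x. x > 0 \<Longrightarrow> s * (1 / x) \<le> C + min_rate p / 2 * x powr (- \<rho>)"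
    using inverse_le_powr[OF \<rho> c s] by blast
  have inner: "(\<integral>\<^sup>+x. ennreal (frechet \<rho> w x) * ennreal (exp (s * (1 / x))) \<partial>lborel)
      \<le> ennreal (2 * exp C) * (\<integral>\<^sup>+x. ennreal (frechet \<rho> w x) * 1 \<partial>lborel)" if w: "w \<ge> min_rate p" for w
  proof -
    have w0: "w > 0" using w min_rate_pos[OF p(1)] by linarith
    have "(\<integral>\<^sup>+x. ennreal (frechet \<rho> w x) * ennreal (exp (s * (1 / x))) \<partial>lborel) \<le> (\<integral>\<^sup>+x. ennreal (2 * exp C) * ennreal (frechet \<rho> (w / 2) x) \<partial>lborel)"
    proof (rule nn_integral_mono)
      fix x :: real
      have "frechet \<rho> w x * exp (s * (1 / x)) \<le> 2 * exp C * frechet \<rho> (w / 2) x"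
      proof (cases "x > 0")
        case True
        have "exp (- w * x powr (- \<rho>)) * exp (s * (1 / x)) \<le> exp (C + - (w / 2) * x powr (- \<rho>))"
        proof -
          have "min_rate p / 2 * x powr (- \<rho>) \<le> w / 2 * x powr (- \<rho>)" using w by (intro mult_right_mono) auto
          hence "- w * x powr (- \<rho>) + s * (1 / x) \<le> C + - (w / 2) * x powr (- \<rho>)"
            using C[OF True] by (simp add: field_simps)
          thus ?thesis by (simp only: exp_add [symmetric] exp_le_cancel_iff)
        qed
        hence "exp (- w * x powr (- \<rho>)) * exp (s * (1 / x)) \<le> exp C * exp (- (w / 2) * x powr (- \<rho>))"
          by (simp only: exp_add)
        hence "(\<rho> * x powr (- \<rho> - 1) * w) * (exp (- w * x powr (- \<rho>)) * exp (s * (1 / x))) \<le> (\<rho> * x powr (- \<rho> - 1) * w) * (exp C * exp (- (w / 2) * x powr (- \<rho>)))"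
          by (rule mult_left_mono) (use \<rho> w0 in simp)
        thus ?thesis using True by (simp add: frechet_def mult_ac)
      qed (simp add: frechet_def)
      thus "ennreal (frechet \<rho> w x) * ennreal (exp (s * (1 / x))) \<le> ennreal (2 * exp C) * ennreal (frechet \<rho> (w / 2) x)"
        using frechet_nonneg[of \<rho> w x] \<rho> w0 by (simp add: ennreal_leI flip: ennreal_mult' ennreal_mult'')
    qed
    also have "\<dots> = ennreal (2 * exp C) * (\<integral>\<^sup>+x. ennreal (frechet \<rho> (w / 2) x) \<partial>lborel)"
      by (rule nn_integral_cmult) measurable
    also have "(\<integral>\<^sup>+x. ennreal (frechet \<rho> (w / 2) x) \<partial>lborel) = (\<integral>\<^sup>+x. ennreal (frechet \<rho> w x) * 1 \<partial>lborel)"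
      using frechet_integral[of \<rho>] \<rho> w0 by simp
    finally show ?thesis .
  qed
  have "(\<integral>\<^sup>+x. area_density p x * ennreal (exp (s * (1 / x))) \<partial>lborel) =
    (\<integral>\<^sup>+b. (\<integral>\<^sup>+t. ennreal (mixing_weight p b t) * (\<integral>\<^sup>+x. ennreal (frechet \<rho> (mixing_rate p b t) x) * ennreal (exp (s * (1 / x))) \<partial>lborel) \<partial>lborel) \<partial>lborel)"
    unfolding \<rho>_def by (rule nn_integral_area_density[OF p(1)]) measurable
  also have "\<dots> \<le> (\<integral>\<^sup>+b. (\<integral>\<^sup>+t. ennreal (2 * exp C) * (ennreal (mixing_weight p b t) * (\<integral>\<^sup>+x. ennreal (frechet \<rho> (mixing_rate p b t) x) * 1 \<partial>lborel)) \<partial>lborel) \<partial>lborel)"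
  proof (intro nn_integral_mono)
    fix b t :: real
    show "ennreal (mixing_weight p b t) * (\<integral>\<^sup>+x. ennreal (frechet \<rho> (mixing_rate p b t) x) * ennreal (exp (s * (1 / x))) \<partial>lborel)
      \<le> ennreal (2 * exp C) * (ennreal (mixing_weight p b t) * (\<integral>\<^sup>+x. ennreal (frechet \<rho> (mixing_rate p b t) x) * 1 \<partial>lborel))"
    proof (cases "0 < b \<and> b < 1 \<and> 0 < t \<and> t < pi")
      case True
      hence "mixing_rate p b t \<ge> min_rate p" using mixing_rate_bounds(2)[OF p(1)] by auto
      from mult_left_mono[OF inner[OF this], of "ennreal (mixing_weight p b t)"] show ?thesis by (simp add: mult_ac)
    qed (auto simp: mixing_weight_def)
  qed
  also have "\<dots> = ennreal (2 * exp C) * (\<integral>\<^sup>+b. (\<integral>\<^sup>+t. ennreal (mixing_weight p b t) * (\<integral>\<^sup>+x. ennreal (frechet \<rho> (mixing_rate p b t) x) * 1 \<partial>lborel) \<partial>lborel) \<partial>lborel)"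
    by (simp add: nn_integral_cmult)
  also have "(\<integral>\<^sup>+b. (\<integral>\<^sup>+t. ennreal (mixing_weight p b t) * (\<integral>\<^sup>+x. ennreal (frechet \<rho> (mixing_rate p b t) x) * 1 \<partial>lborel) \<partial>lborel) \<partial>lborel) = (\<integral>\<^sup>+x. area_density p x * 1 \<partial>lborel)"
    unfolding \<rho>_def by (rule nn_integral_area_density[OF p(1), symmetric]) measurable
  also have "\<dots> = 1" using area_density_integral[OF p(1)] by simp
  finally show ?thesis by (simp add: le_less_trans)
qed

lemma density_eq_area_density:
  fixes f :: "real \<Rightarrow> real"
  assumes p: "2 < p" "p < 3"
    and M: "prob_space M" and dist: "distributed M lborel A (\<lambda>x. ennreal (f x))"
    and pos: "AE \<omega> in M. A \<omega> > 0"
    and mom: "\<And>n::nat. n > 0 \<Longrightarrow> (\<integral>\<^sup>+\<omega>. ennreal (A \<omega> powr (- real n)) \<partial>M) =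
      ennreal (p * Gamma (real n * p) / Gamma (real n) * (\<Prod>k=1..n. 1 / (real k * p - 1)))"
  shows "AE x in lborel. ennreal (f x) = area_density p x"
proof -
  interpret prob_space M by fact
  have A[measurable]: "A \<in> borel_measurable M" using distributed_measurable[OF dist] by simp
  have fm[measurable]: "(\<lambda>x. ennreal (f x)) \<in> borel_measurable borel" using distributed_borel_measurable[OF dist] by simp
  have eq: "distr M borel A = density lborel (\<lambda>x. ennreal (f x))"
    using distributed_distr_eq_density[OF dist] by (simp cong: distr_cong)
  have "density lborel (\<lambda>x. ennreal (f x)) = density lborel (area_density p)"
  proof (rule measure_eq_from_inverse_moments)
    show "prob_space (density lborel (\<lambda>x. ennreal (f x)))" unfolding eq[symmetric] by (rule prob_space_distr) measurable
    have "AE x in distr M borel A. x > 0" by (subst AE_distr_iff) (use pos in auto)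
    thus "AE x in density lborel (\<lambda>x. ennreal (f x)). x > 0" unfolding eq .
    show "prob_space (density lborel (area_density p))"
      by (rule prob_spaceI) (simp add: emeasure_density area_density_integral[OF p(1)])
    show "AE x in density lborel (area_density p). x > 0"
    proof -
      have "0 < x" if "0 < area_density p x" for x
        using that area_density_nonpos[of x p] by (cases "x \<le> 0") auto
      thus ?thesis by (subst AE_density) auto
    qed
    show "(\<integral>\<^sup>+x. ennreal ((1 / x) ^ n) \<partial>density lborel (\<lambda>x. ennreal (f x))) = (\<integral>\<^sup>+x. ennreal ((1 / x) ^ n) \<partial>density lborel (area_density p))" for n :: nat
    proof -
      have R: "(\<integral>\<^sup>+x. ennreal ((1 / x) ^ n) \<partial>density lborel (area_density p)) = (\<integral>\<^sup>+x. area_density p x * ennreal ((1 / x) ^ n) \<partial>lborel)"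
        by (rule nn_integral_density) measurable
      have L: "(\<integral>\<^sup>+x. ennreal ((1 / x) ^ n) \<partial>density lborel (\<lambda>x. ennreal (f x))) = (\<integral>\<^sup>+\<omega>. ennreal ((1 / A \<omega>) ^ n) \<partial>M)"
        unfolding eq[symmetric] by (rule nn_integral_distr) measurable
      show ?thesis
      \<comment> \<open>Order 0 is the total mass and is treated apart, since the moment formula
        contains \<open>Gamma n\<close> in a denominator.\<close>
      proof (cases "n = 0")
        case True
        thus ?thesis unfolding L R by (simp add: area_density_integral[OF p(1)] emeasure_space_1)
      next
        case False
        have "(\<integral>\<^sup>+\<omega>. ennreal ((1 / A \<omega>) ^ n) \<partial>M) = (\<integral>\<^sup>+\<omega>. ennreal (A \<omega> powr (- real n)) \<partial>M)"
        proof (rule nn_integral_cong_AE)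
          show "AE \<omega> in M. ennreal ((1 / A \<omega>) ^ n) = ennreal (A \<omega> powr (- real n))"
            using pos by eventually_elim (simp add: powr_minus powr_realpow power_one_over inverse_eq_divide)
        qed
        also have "\<dots> = (\<integral>\<^sup>+x. area_density p x * ennreal ((1 / x) ^ n) \<partial>lborel)"
          unfolding area_density_inverse_moment[OF p(1)] using False mom[of n] area_moment_closed_form[OF p(1), of n] by simp
        finally show ?thesis unfolding L R .
      qed
    qed
    fix t :: real assume t: "t > 0"
    have "(\<integral>\<^sup>+x. ennreal (exp (t * (1 / x))) \<partial>density lborel (area_density p)) = (\<integral>\<^sup>+x. area_density p x * ennreal (exp (t * (1 / x))) \<partial>lborel)"
      by (rule nn_integral_density) measurable
    thus "(\<integral>\<^sup>+x. ennreal (exp (t * (1 / x))) \<partial>density lborel (area_density p)) < \<infinity>"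
      using area_density_exp_moment[OF p t] by simp
  qed auto
  thus ?thesis by (intro sigma_finite_measure.density_unique[OF sigma_finite_lborel]) measurable
qed

section \<open>Laplace asymptotics of the mixture\<close>

text \<open>The integral of \<open>limit_integrand\<close> over the quadrant: a Gamma integral in
  \<open>s\<close> times half a Gaussian integral in \<open>\<theta>\<close>, with the rate expanded
  at its minimum.\<close>

definition area_constant :: "real \<Rightarrow> real" where
  "area_constant p = min_rate p / (Beta (1 / 2) ((p - 2) / (2 * p)) * pi) *
     (Gamma ((p - 2) / (2 * p)) * (min_rate p / (p - 2)) powr (- ((p - 2) / (2 * p)))) *
     (Gamma (1 / 2) * (min_rate p / p) powr (- (1 / 2)) / 2)"

text \<open>If \<open>N * E\<close> converges, then \<open>E\<close> is of order
  \<open>1 / N\<close>, and its square is negligible against it. The application is to the relative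
  excess of the rate over its minimum, multiplied by the large parameter.\<close>

lemma tendsto_scaled_exp_minus_1:
  fixes N E :: "nat \<Rightarrow> real"
  assumes N: "filterlim N at_top sequentially" and NE: "(\<lambda>k. N k * E k) \<longlonglongrightarrow> l"
  shows "E \<longlonglongrightarrow> 0" "(\<lambda>k. N k * (exp (E k) - 1)) \<longlonglongrightarrow> l"
proof -
  have Npos: "eventually (\<lambda>k. N k > 0) sequentially" using N by (simp add: filterlim_at_top_dense)
  have inv: "(\<lambda>k. 1 / N k) \<longlonglongrightarrow> 0" using tendsto_inverse_0_at_top[OF N] by (simp add: inverse_eq_divide)
  have "(\<lambda>k. (N k * E k) * (1 / N k)) \<longlonglongrightarrow> l * 0" by (intro tendsto_mult NE inv)
  moreover have "eventually (\<lambda>k. (N k * E k) * (1 / N k) = E k) sequentially"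
    using Npos by eventually_elim auto
  ultimately show E0: "E \<longlonglongrightarrow> 0" using Lim_transform_eventually by fastforce
  have sq: "(\<lambda>k. (N k * E k) * E k) \<longlonglongrightarrow> l * 0" by (intro tendsto_mult NE E0)
  show "(\<lambda>k. N k * (exp (E k) - 1)) \<longlonglongrightarrow> l"
  proof (rule tendsto_sandwich[OF _ _ NE])
    show "eventually (\<lambda>k. N k * E k \<le> N k * (exp (E k) - 1)) sequentially"
      using Npos
    proof eventually_elim
      case (elim k)
      have "E k \<le> exp (E k) - 1" using exp_ge_add_one_self[of "E k"] by linarith
      thus ?case using elim by (intro mult_left_mono) auto
    qed
    have "eventually (\<lambda>k. E k < 1) sequentially" using E0 by (rule order_tendstoD) simp
    moreover have "eventually (\<lambda>k. E k > - 1) sequentially" using E0 by (rule order_tendstoD) simp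
    ultimately show "eventually (\<lambda>k. N k * (exp (E k) - 1) \<le> N k * E k + (N k * E k) * E k) sequentially"
      using Npos
    proof eventually_elim
      case (elim k)
      have "exp (E k) - 1 \<le> E k + (E k)\<^sup>2"
      proof (cases "E k \<ge> 0")
        case True
        thus ?thesis using exp_bound[of "E k"] elim by linarith
      next
        case False
        define y where "y = - E k"
        have y: "y > 0" using False by (simp add: y_def)
        have "exp (- y) = 1 / exp y" by (simp add: exp_minus inverse_eq_divide)
        also have "\<dots> \<le> 1 / (1 + y)" using y exp_ge_add_one_self[of y] by (intro divide_left_mono) auto
        also have "\<dots> \<le> 1 - y + y\<^sup>2"
        proof -
          have "1 \<le> 1 + y ^ 3" using y by simp
          also have "1 + y ^ 3 = (1 - y + y\<^sup>2) * (1 + y)" by (simp add: algebra_simps power2_eq_square power3_eq_cube)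
          finally show ?thesis using y by (simp add: pos_divide_le_eq)
        qed
        finally show ?thesis by (simp add: y_def)
      qed
      hence "N k * (exp (E k) - 1) \<le> N k * (E k + (E k)\<^sup>2)" using elim by (intro mult_left_mono) auto
      thus ?case by (simp add: power2_eq_square algebra_simps)
    qed
    show "(\<lambda>k. N k * E k + (N k * E k) * E k) \<longlonglongrightarrow> l" using tendsto_add[OF NE sq] by simp
  qed
qed

text \<open>The mixture at \<open>x = N powr (2 - p)\<close>, in the coordinates \<open>b = 1 - s / N\<close>, \<open>t = \<theta> / sqrt N\<close> around the
  minimum of the rate.\<close>

definition scaled_integrand :: "real \<Rightarrow> real \<Rightarrow> real \<Rightarrow> real \<Rightarrow> real" where
  "scaled_integrand p N s \<theta> = N powr ((p - 2) / (2 * p) - 1) * mixing_weight p (1 - s / N) (\<theta> / sqrt N) *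
     (mixing_rate p (1 - s / N) (\<theta> / sqrt N) * exp (- N * (mixing_rate p (1 - s / N) (\<theta> / sqrt N) - min_rate p)))"

definition limit_integrand :: "real \<Rightarrow> real \<Rightarrow> real \<Rightarrow> real" where
  "limit_integrand p s \<theta> = indicator {0<..} s * indicator {0<..} \<theta> *
     (s powr ((p - 2) / (2 * p) - 1) / (Beta (1 / 2) ((p - 2) / (2 * p)) * pi) *
      (min_rate p * exp (- min_rate p * (s / (p - 2) + \<theta>\<^sup>2 / p))))"

lemma gaussian_gamma_integral:
  assumes q: "q > 0" and a: "a > 0" and b: "b > 0"
  shows "(\<integral>\<^sup>+x. ennreal (indicator {0<..} (fst x) * (fst x powr (q - 1) * exp (- a * fst x)) *
      (indicator {0<..} (snd x) * exp (- b * (snd x)\<^sup>2))) \<partial>(lborel \<Otimes>\<^sub>M lborel))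
    = ennreal ((Gamma q * a powr (- q)) * (Gamma (1 / 2) * b powr (- (1 / 2)) / 2))"
proof -
  have 1: "(\<integral>\<^sup>+s. ennreal (indicator {0<..} s * (s powr (q - 1) * exp (- a * s))) \<partial>lborel) = ennreal (Gamma q * a powr (- q))"
  proof -
    have "has_bochner_integral lborel (\<lambda>x. indicator {0<..} x * (x powr (1 * q - 1) * exp (- a * x powr 1))) (Gamma q * a powr (- q) / \<bar>1\<bar>)"
      using q a by (intro gamma_integral_powr_real) auto
    also have "(\<lambda>x. indicator {0<..} x * (x powr (1 * q - 1) * exp (- a * x powr 1))) = (\<lambda>x. indicator {0<..} x * (x powr (q - 1) * exp (- a * x)))"
      by (auto simp: indicator_def)
    finally show ?thesis by (subst nn_integral_eq_integral) (auto simp: has_bochner_integral_iff)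
  qed
  have 2: "(\<integral>\<^sup>+s. ennreal (indicator {0<..} s * exp (- b * s\<^sup>2)) \<partial>lborel) = ennreal (Gamma (1 / 2) * b powr (- (1 / 2)) / 2)"
  proof -
    have "has_bochner_integral lborel (\<lambda>x. indicator {0<..} x * (x powr (2 * (1 / 2) - 1) * exp (- b * x powr 2))) (Gamma (1 / 2) * b powr (- (1 / 2)) / \<bar>2\<bar>)"
      using b by (intro gamma_integral_powr_real) auto
    also have "(\<lambda>x. indicator {0<..} x * (x powr (2 * (1 / 2) - 1) * exp (- b * x powr 2))) = (\<lambda>x. indicator {0<..} x * exp (- b * x\<^sup>2))"
      by (auto simp: indicator_def powr_realpow)
    finally show ?thesis by (subst nn_integral_eq_integral) (auto simp: has_bochner_integral_iff)
  qed
  have "(\<integral>\<^sup>+x. ennreal (indicator {0<..} (fst x) * (fst x powr (q - 1) * exp (- a * fst x)) *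
      (indicator {0<..} (snd x) * exp (- b * (snd x)\<^sup>2))) \<partial>(lborel \<Otimes>\<^sub>M lborel))
    = (\<integral>\<^sup>+s. (\<integral>\<^sup>+y. ennreal (indicator {0<..} s * (s powr (q - 1) * exp (- a * s)) * (indicator {0<..} y * exp (- b * y\<^sup>2))) \<partial>lborel) \<partial>lborel)"
    by (subst lborel.nn_integral_fst[symmetric]) auto
  also have "\<dots> = (\<integral>\<^sup>+s. (\<integral>\<^sup>+y. ennreal (indicator {0<..} s * (s powr (q - 1) * exp (- a * s))) * ennreal (indicator {0<..} y * exp (- b * y\<^sup>2)) \<partial>lborel) \<partial>lborel)"
    by (intro nn_integral_cong ennreal_mult) auto
  also have "\<dots> = ennreal (Gamma q * a powr (- q)) * ennreal (Gamma (1 / 2) * b powr (- (1 / 2)) / 2)"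
    using 1 2 by (simp add: nn_integral_cmult nn_integral_multc)
  also have "\<dots> = ennreal ((Gamma q * a powr (- q)) * (Gamma (1 / 2) * b powr (- (1 / 2)) / 2))"
    by (intro ennreal_mult[symmetric]) (use q in \<open>auto intro!: mult_nonneg_nonneg Gamma_real_nonneg\<close>)
  finally show ?thesis .
qed

text \<open>Outside the open quadrant the weight vanishes. Inside it, the factor
  \<open>N powr (q - 1)\<close> cancels the powers of \<open>N\<close> in
  \<open>(s / N) powr (q - 1)\<close>, and \<open>N\<close> times the exponent of the rate tends to
  \<open>s / (p - 2) + \<theta>\<^sup>2 / p\<close> by the first-order expansion in \<open>b\<close>
  and the second-order expansion in \<open>t\<close>.\<close>

lemma limit_integrand_tendsto:
  assumes p: "p > 2" and N: "filterlim N at_top sequentially" and N1: "\<And>k. N k \<ge> 1"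
  shows "(\<lambda>k. scaled_integrand p (N k) s \<theta>) \<longlonglongrightarrow> limit_integrand p s \<theta>"
proof (cases "s > 0 \<and> \<theta> > 0")
  case False
  have z: "scaled_integrand p (N k) s \<theta> = 0" for k
  proof (cases "s \<le> 0")
    case True
    hence "s / N k \<le> 0" using N1[of k] by (intro divide_nonpos_nonneg) auto
    thus ?thesis by (simp add: scaled_integrand_def mixing_weight_def)
  next
    case False
    hence "\<theta> / sqrt (N k) \<le> 0" using \<open>\<not> (s > 0 \<and> \<theta> > 0)\<close> N1[of k] by (intro divide_nonpos_nonneg) auto
    thus ?thesis by (simp add: scaled_integrand_def mixing_weight_def)
  qed
  show ?thesis unfolding z using False by (auto simp: limit_integrand_def)
next
  case True
  hence s: "s > 0" and \<theta>: "\<theta> > 0" by auto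
  define q where "q = (p - 2) / (2 * p)"
  define B where "B = Beta (1 / 2) q * pi"
  have "q > 0" using p by (simp add: q_def)
  hence B: "B > 0" unfolding B_def by (simp add: Beta_real_pos)
  define c where "c = min_rate p"
  have Npos: "N k > 0" for k using N1[of k] by linarith
  have inv: "(\<lambda>k. s / N k) \<longlonglongrightarrow> 0"
    using tendsto_mult[OF tendsto_const[of s] tendsto_inverse_0_at_top[OF N]] by (simp add: divide_inverse)
  have sqN: "filterlim (\<lambda>k. sqrt (N k)) at_top sequentially" by (rule filterlim_compose[OF sqrt_at_top N])
  have invs: "(\<lambda>k. \<theta> / sqrt (N k)) \<longlonglongrightarrow> 0"
    using tendsto_mult[OF tendsto_const[of \<theta>] tendsto_inverse_0_at_top[OF sqN]] by (simp add: divide_inverse)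
  have invs_right: "filterlim (\<lambda>k. \<theta> / sqrt (N k)) (at_right 0) sequentially"
    using invs \<theta> Npos by (intro tendsto_imp_filterlim_at_right) auto
  have ev: "eventually (\<lambda>k. s / N k < 1 \<and> \<theta> / sqrt (N k) < pi) sequentially"
    using order_tendstoD(2)[OF inv, of 1] order_tendstoD(2)[OF invs pi_gt_zero] by (auto elim: eventually_elim2)
  define E where "E = (\<lambda>k. - ln (1 - s / N k) / (p - 2) + (log_zolotarev p (\<theta> / sqrt (N k)) - (- 1 / (p - 2) * ln (zolotarev_0 p))))"
  have E1: "(\<lambda>k. N k * (- ln (1 - s / N k) / (p - 2))) \<longlonglongrightarrow> s / (p - 2)"
  proof -
    have "((\<lambda>x. x * (- ln (1 - s / x) / (p - 2))) \<longlongrightarrow> s / (p - 2)) at_top" using s p by (real_asymp simp: divide_inverse)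
    from filterlim_compose[OF this N] show ?thesis .
  qed
  have E2: "(\<lambda>k. N k * (log_zolotarev p (\<theta> / sqrt (N k)) - (- 1 / (p - 2) * ln (zolotarev_0 p)))) \<longlonglongrightarrow> \<theta>\<^sup>2 / p"
  proof -
    have "(\<lambda>k. \<theta>\<^sup>2 * ((log_zolotarev p (\<theta> / sqrt (N k)) - (- 1 / (p - 2) * ln (zolotarev_0 p))) / (\<theta> / sqrt (N k))\<^sup>2)) \<longlonglongrightarrow> \<theta>\<^sup>2 * (1 / p)"
      by (intro tendsto_mult tendsto_const filterlim_compose[OF log_zolotarev_second_order[OF p] invs_right])
    moreover have "\<theta>\<^sup>2 * (x / (\<theta> / sqrt (N k))\<^sup>2) = N k * x" for k x
      using \<theta> Npos[of k] by (simp add: power_divide)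
    ultimately show ?thesis by simp
  qed
  have NE: "(\<lambda>k. N k * E k) \<longlonglongrightarrow> s / (p - 2) + \<theta>\<^sup>2 / p"
    using tendsto_add[OF E1 E2] unfolding E_def by (simp only: distrib_left)
  note EE = tendsto_scaled_exp_minus_1[OF N NE]
  have lim: "(\<lambda>k. s powr (q - 1) * ((1 - s / N k) powr (- 1 / 2) / B) * (c * exp (E k) * exp (- (c * (N k * (exp (E k) - 1))))))
     \<longlonglongrightarrow> s powr (q - 1) * ((1 - 0) powr (- 1 / 2) / B) * (c * exp 0 * exp (- (c * (s / (p - 2) + \<theta>\<^sup>2 / p))))"
    by (intro tendsto_intros inv EE) (use B in auto)
  have "eventually (\<lambda>k. s powr (q - 1) * ((1 - s / N k) powr (- 1 / 2) / B) * (c * exp (E k) * exp (- (c * (N k * (exp (E k) - 1)))))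
     = scaled_integrand p (N k) s \<theta>) sequentially"
    using ev
  proof eventually_elim
    case (elim k)
    have r: "mixing_rate p (1 - s / N k) (\<theta> / sqrt (N k)) = c * exp (E k)"
      unfolding E_def c_def using elim \<theta> Npos[of k] by (intro mixing_rate_eq[OF p]) auto
    have w: "mixing_weight p (1 - s / N k) (\<theta> / sqrt (N k)) = (1 - s / N k) powr (- 1 / 2) * (s / N k) powr (q - 1) / B"
      unfolding mixing_weight_def B_def q_def using elim s \<theta> Npos[of k] by simp
    have ss: "s powr (q - 1) = N k powr (q - 1) * (s / N k) powr (q - 1)"
      using s Npos[of k] by (simp add: powr_divide)
    have sw: "s powr (q - 1) * ((1 - s / N k) powr (- 1 / 2) / B) = N k powr (q - 1) * ((1 - s / N k) powr (- 1 / 2) * (s / N k) powr (q - 1) / B)"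
      unfolding ss by (simp only: times_divide_eq_left times_divide_eq_right mult_ac)
    have "- N k * (c * exp (E k) - c) = - (c * (N k * (exp (E k) - 1)))" by (simp add: algebra_simps)
    thus ?case unfolding scaled_integrand_def r w q_def[symmetric] c_def[symmetric] sw by (simp only:)
  qed
  from Lim_transform_eventually[OF lim this] show ?thesis
    using s \<theta> by (simp add: limit_integrand_def q_def B_def c_def mult_ac)
qed

text \<open>The quantity \<open>N * (w - c)\<close> has two lower bounds, and their average is used.
  One half gives the decay in \<open>s\<close> and \<open>\<theta>\<close>; the other, since
  \<open>N \<ge> 1\<close>, gives \<open>exp (- w / 2)\<close> up to a constant. That factor absorbs
  \<open>w * w\<close>, one \<open>w\<close> coming from the Frechet density and one from bounding
  \<open>b powr (- 1 / 2)\<close> by \<open>w / c\<close>.\<close>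

lemma scaled_integrand_le:
  assumes p: "2 < p" "p < 3" and N: "N \<ge> 1"
  shows "scaled_integrand p N s \<theta> \<le> 8 * exp (min_rate p / 2) / (min_rate p * (Beta (1 / 2) ((p - 2) / (2 * p)) * pi)) *
     (indicator {0<..} s * (s powr ((p - 2) / (2 * p) - 1) * exp (- (min_rate p / (2 * (p - 2))) * s)) *
      (indicator {0<..} \<theta> * exp (- (min_rate p / (2 * p)) * \<theta>\<^sup>2)))"
proof -
  define q where "q = (p - 2) / (2 * p)"
  define B where "B = Beta (1 / 2) q * pi"
  define c where "c = min_rate p"
  have q: "q > 0" using p by (simp add: q_def)
  have B: "B > 0" unfolding B_def using q by (simp add: Beta_real_pos)
  have c: "c > 0" unfolding c_def using p by (intro min_rate_pos) auto
  let ?b = "1 - s / N" and ?t = "\<theta> / sqrt N"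
  let ?rhs = "8 * exp (c / 2) / (c * B) * (indicator {0<..} s * (s powr (q - 1) * exp (- (c / (2 * (p - 2))) * s)) *
      (indicator {0<..} \<theta> * exp (- (c / (2 * p)) * \<theta>\<^sup>2)))"
  have "scaled_integrand p N s \<theta> \<le> ?rhs"
  proof (cases "0 < ?b \<and> ?b < 1 \<and> 0 < ?t \<and> ?t < pi")
    case False
    hence "mixing_weight p ?b ?t = 0" by (auto simp: mixing_weight_def indicator_def)
    moreover have "0 \<le> ?rhs" using c B by (intro mult_nonneg_nonneg divide_nonneg_nonneg) auto
    ultimately show ?thesis by (simp add: scaled_integrand_def)
  next
    case True
    hence b: "0 < ?b" "?b < 1" and t: "0 < ?t" "?t < pi" by auto
    have s: "s > 0" and \<theta>: "\<theta> > 0" using True N by (auto simp: zero_less_divide_iff)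
    define w where "w = mixing_rate p ?b ?t"
    note R = mixing_rate_bounds[OF p(1) b t, folded w_def c_def]
    have w0: "w > 0" using R(2) c by linarith
    have weight: "N powr (q - 1) * mixing_weight p ?b ?t = s powr (q - 1) * ?b powr (- 1 / 2) / B"
    proof -
      have ss: "s powr (q - 1) = N powr (q - 1) * (s / N) powr (q - 1)" using s N by (simp add: powr_divide)
      have w: "mixing_weight p ?b ?t = ?b powr (- 1 / 2) * (s / N) powr (q - 1) / B"
        using True by (simp add: mixing_weight_def B_def q_def)
      show ?thesis unfolding ss w by (simp only: times_divide_eq_left times_divide_eq_right mult_ac)
    qed
    \<comment> \<open>Here \<open>p < 3\<close> gives \<open>1 / (p - 2) > 1 / 2\<close>, and the
      base lies below 1.\<close>
    have "?b powr (- 1 / 2) \<le> ?b powr (- 1 / (p - 2))"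
      using b p by (intro powr_mono') (auto simp: field_simps)
    also have "\<dots> \<le> w / c" using R(3) c by (simp add: field_simps)
    finally have bw: "?b powr (- 1 / 2) \<le> w / c" .
    have Nw: "N * (w - c) \<ge> c * (s / (p - 2) + \<theta>\<^sup>2 / p)"
    proof -
      have "N * (c * (s / N / (p - 2) + (\<theta>\<^sup>2 / N) / p)) \<le> N * (w - c)"
        using R(1) N by (intro mult_left_mono) (auto simp: power_divide algebra_simps)
      moreover have "N * (c * (s / N / (p - 2) + (\<theta>\<^sup>2 / N) / p)) = c * (s / (p - 2) + \<theta>\<^sup>2 / p)"
        using N p by (simp add: distrib_left)
      ultimately show ?thesis by linarith
    qed
    have Nw2: "N * (w - c) \<ge> w - c" using R(2) N mult_right_mono[of 1 N "w - c"] by simp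
    have "- N * (w - c) \<le> c / 2 + (- w / 2) + (- (c / (2 * (p - 2))) * s + - (c / (2 * p)) * \<theta>\<^sup>2)"
    proof -
      have "c * (s / (p - 2) + \<theta>\<^sup>2 / p) / 2 = c / (2 * (p - 2)) * s + c / (2 * p) * \<theta>\<^sup>2"
        using p by (simp add: field_simps)
      thus ?thesis using Nw Nw2 by (simp add: field_simps)
    qed
    hence ex: "exp (- N * (w - c)) \<le> exp (c / 2) * exp (- w / 2) * (exp (- (c / (2 * (p - 2))) * s) * exp (- (c / (2 * p)) * \<theta>\<^sup>2))"
      by (simp only: exp_add [symmetric] exp_le_cancel_iff)
    have w8: "w * w * exp (- w / 2) \<le> 8"
    proof -
      have "1 + w / 2 + (w / 2)\<^sup>2 / 2 \<le> exp (w / 2)" using w0 by (intro exp_lower_Taylor_quadratic) auto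
      hence "w * w \<le> 8 * exp (w / 2)" using w0 by (simp add: power2_eq_square)
      hence "w * w * exp (- w / 2) \<le> 8 * exp (w / 2) * exp (- w / 2)" by (intro mult_right_mono) auto
      thus ?thesis by (simp add: mult.assoc exp_add [symmetric])
    qed
    let ?e = "exp (- (c / (2 * (p - 2))) * s) * exp (- (c / (2 * p)) * \<theta>\<^sup>2)"
    have "scaled_integrand p N s \<theta> = s powr (q - 1) * ?b powr (- 1 / 2) / B * (w * exp (- N * (w - c)))"
      unfolding scaled_integrand_def q_def[symmetric] w_def[symmetric] c_def[symmetric] weight by simp
    also have "\<dots> \<le> s powr (q - 1) * (w / c) / B * (w * (exp (c / 2) * exp (- w / 2) * ?e))"
      using bw ex B w0 c by (intro mult_mono divide_right_mono mult_left_mono mult_nonneg_nonneg divide_nonneg_nonneg) auto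
    also have "\<dots> = s powr (q - 1) / (c * B) * exp (c / 2) * ?e * (w * w * exp (- w / 2))" by simp
    also have "\<dots> \<le> s powr (q - 1) / (c * B) * exp (c / 2) * ?e * 8"
      using w8 c B by (intro mult_left_mono mult_nonneg_nonneg divide_nonneg_nonneg) auto
    also have "\<dots> = ?rhs" using s \<theta> by simp
    finally show ?thesis .
  qed
  thus ?thesis by (simp only: q_def B_def c_def)
qed

lemma scaled_integral_tendsto:
  assumes p: "2 < p" "p < 3" and N: "filterlim N at_top sequentially" and N1: "\<And>k. N k \<ge> 1"
  shows "(\<lambda>k. \<integral>\<^sup>+s. (\<integral>\<^sup>+\<theta>. ennreal (scaled_integrand p (N k) s \<theta>) \<partial>lborel) \<partial>lborel) \<longlonglongrightarrow> ennreal (area_constant p)"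
proof -
  define q where "q = (p - 2) / (2 * p)"
  define B where "B = Beta (1 / 2) q * pi"
  define c where "c = min_rate p"
  have q: "q > 0" using p by (simp add: q_def)
  have B: "B > 0" unfolding B_def using q by (simp add: Beta_real_pos)
  have c: "c > 0" unfolding c_def using p by (intro min_rate_pos) auto
  have m[measurable]: "(\<lambda>x. scaled_integrand p M (fst x) (snd x)) \<in> borel_measurable (borel \<Otimes>\<^sub>M borel)" for M
    unfolding scaled_integrand_def by measurable
  have m2[measurable]: "(\<lambda>x. limit_integrand p (fst x) (snd x)) \<in> borel_measurable (borel \<Otimes>\<^sub>M borel)"
    unfolding limit_integrand_def by measurable
  let ?h = "\<lambda>a b x. indicator {0<..} (fst x) * (fst x powr (q - 1) * exp (- a * fst x)) * (indicator {0<..} (snd x) * exp (- b * (snd x)\<^sup>2)) :: real"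
  let ?C = "8 * exp (c / 2) / (c * B)"
  have pair: "(\<integral>\<^sup>+s. (\<integral>\<^sup>+\<theta>. ennreal (scaled_integrand p M s \<theta>) \<partial>lborel) \<partial>lborel) = (\<integral>\<^sup>+x. ennreal (scaled_integrand p M (fst x) (snd x)) \<partial>(lborel \<Otimes>\<^sub>M lborel))" for M
    by (subst lborel.nn_integral_fst[symmetric]) auto
  have "(\<lambda>k. \<integral>\<^sup>+x. ennreal (scaled_integrand p (N k) (fst x) (snd x)) \<partial>(lborel \<Otimes>\<^sub>M lborel)) \<longlonglongrightarrow> (\<integral>\<^sup>+x. ennreal (limit_integrand p (fst x) (snd x)) \<partial>(lborel \<Otimes>\<^sub>M lborel))"
  proof (rule nn_integral_dominated_convergence[where w = "\<lambda>x. ennreal ?C * ennreal (?h (c / (2 * (p - 2))) (c / (2 * p)) x)"])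
    show "AE x in lborel \<Otimes>\<^sub>M lborel. ennreal (scaled_integrand p (N k) (fst x) (snd x)) \<le> ennreal ?C * ennreal (?h (c / (2 * (p - 2))) (c / (2 * p)) x)" for k
    proof (rule AE_I2)
      fix x :: "real \<times> real"
      have "ennreal (scaled_integrand p (N k) (fst x) (snd x)) \<le> ennreal (?C * ?h (c / (2 * (p - 2))) (c / (2 * p)) x)"
        using scaled_integrand_le[OF p N1[of k], of "fst x" "snd x"] by (intro ennreal_leI) (simp only: q_def B_def c_def)
      thus "ennreal (scaled_integrand p (N k) (fst x) (snd x)) \<le> ennreal ?C * ennreal (?h (c / (2 * (p - 2))) (c / (2 * p)) x)"
        using c B by (subst (asm) ennreal_mult) auto
    qed
    have "(\<integral>\<^sup>+x. ennreal ?C * ennreal (?h (c / (2 * (p - 2))) (c / (2 * p)) x) \<partial>(lborel \<Otimes>\<^sub>M lborel)) = ennreal ?C * (\<integral>\<^sup>+x. ennreal (?h (c / (2 * (p - 2))) (c / (2 * p)) x) \<partial>(lborel \<Otimes>\<^sub>M lborel))"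
      by (rule nn_integral_cmult) measurable
    also have "\<dots> < \<infinity>" using gaussian_gamma_integral[OF q, of "c / (2 * (p - 2))" "c / (2 * p)"] c p by (simp add: ennreal_mult_less_top)
    finally show "(\<integral>\<^sup>+x. ennreal ?C * ennreal (?h (c / (2 * (p - 2))) (c / (2 * p)) x) \<partial>(lborel \<Otimes>\<^sub>M lborel)) < \<infinity>" .
    show "AE x in lborel \<Otimes>\<^sub>M lborel. (\<lambda>k. ennreal (scaled_integrand p (N k) (fst x) (snd x))) \<longlonglongrightarrow> ennreal (limit_integrand p (fst x) (snd x))"
      by (intro AE_I2 tendsto_ennrealI limit_integrand_tendsto p N N1)
  qed measurable
  also have "(\<integral>\<^sup>+x. ennreal (limit_integrand p (fst x) (snd x)) \<partial>(lborel \<Otimes>\<^sub>M lborel)) = (\<integral>\<^sup>+x. ennreal (c / B) * ennreal (?h (c / (p - 2)) (c / p) x) \<partial>(lborel \<Otimes>\<^sub>M lborel))"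
  proof (rule nn_integral_cong)
    fix x :: "real \<times> real"
    have "limit_integrand p (fst x) (snd x) = c / B * ?h (c / (p - 2)) (c / p) x"
    proof -
      have "- c * (s / (p - 2) + t\<^sup>2 / p) = - (c / (p - 2)) * s + - (c / p) * t\<^sup>2" for s t :: real
        by (simp add: algebra_simps)
      hence ex: "exp (- c * (s / (p - 2) + t\<^sup>2 / p)) = exp (- (c / (p - 2)) * s) * exp (- (c / p) * t\<^sup>2)" for s t :: real
        by (simp only: exp_add)
      show ?thesis unfolding limit_integrand_def q_def[symmetric] B_def[symmetric] c_def[symmetric] ex
        by (simp only: times_divide_eq_left times_divide_eq_right mult_ac)
    qed
    moreover have "ennreal (c / B * y) = ennreal (c / B) * ennreal y" for y using c B by (intro ennreal_mult') simp
    ultimately show "ennreal (limit_integrand p (fst x) (snd x)) = ennreal (c / B) * ennreal (?h (c / (p - 2)) (c / p) x)"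
      by (simp only:)
  qed
  also have "\<dots> = ennreal (c / B) * (\<integral>\<^sup>+x. ennreal (?h (c / (p - 2)) (c / p) x) \<partial>(lborel \<Otimes>\<^sub>M lborel))"
    by (rule nn_integral_cmult) measurable
  also have "\<dots> = ennreal (c / B) * ennreal ((Gamma q * (c / (p - 2)) powr (- q)) * (Gamma (1 / 2) * (c / p) powr (- (1 / 2)) / 2))"
    using gaussian_gamma_integral[OF q, of "c / (p - 2)" "c / p"] c p by simp
  also have "\<dots> = ennreal (area_constant p)"
    using c B q by (subst ennreal_mult[symmetric])
      (auto simp: area_constant_def q_def B_def c_def mult.assoc intro!: mult_nonneg_nonneg Gamma_real_nonneg)
  finally show ?thesis unfolding pair .
qed

text \<open>An exact change of variables for every \<open>x > 0\<close>. The Jacobian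
  \<open>N powr (- 3 / 2)\<close> and the factor \<open>N powr (1 - q)\<close> compensating the
  normalisation of \<open>scaled_integrand\<close> combine to
  \<open>N powr (- (q + 1 / 2))\<close>.\<close>

lemma area_density_scaled:
  assumes p: "p > 2" and x: "x > 0" and N: "N = x powr (- (1 / (p - 2)))"
  shows "area_density p x = ennreal (1 / (p - 2) * x powr (- (1 / (p - 2)) - 1) * N powr (- ((p - 2) / (2 * p) + 1 / 2)) * exp (- min_rate p * N)) *
    (\<integral>\<^sup>+s. (\<integral>\<^sup>+\<theta>. ennreal (scaled_integrand p N s \<theta>) \<partial>lborel) \<partial>lborel)"
proof -
  define q where "q = (p - 2) / (2 * p)"
  have N0: "N > 0" using x N by simp
  define K where "K = 1 / (p - 2) * x powr (- (1 / (p - 2)) - 1)"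
  have K: "K \<ge> 0" using p by (simp add: K_def)
  have [measurable]: "(\<lambda>(b, t). mixing_weight p b t * frechet (1 / (p - 2)) (mixing_rate p b t) x) \<in> borel_measurable (borel \<Otimes>\<^sub>M borel)" by measurable
  have point: "mixing_weight p (1 - s / N) (\<theta> / sqrt N) * frechet (1 / (p - 2)) (mixing_rate p (1 - s / N) (\<theta> / sqrt N)) x
     = (K * N powr (- (q + 1 / 2)) * exp (- min_rate p * N)) * (N * sqrt N) * scaled_integrand p N s \<theta>" for s \<theta>
  proof -
    define W where "W = mixing_weight p (1 - s / N) (\<theta> / sqrt N)"
    define w where "w = mixing_rate p (1 - s / N) (\<theta> / sqrt N)"
    have NN: "N powr (- (q + 1 / 2)) * (N * sqrt N) * N powr (q - 1) = 1"
    proof -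
      have "N * sqrt N = N powr (3 / 2)" using N0 powr_add[of N 1 "1/2"] by (simp add: powr_half_sqrt)
      thus ?thesis using N0 by (simp flip: powr_add)
    qed
    have e: "exp (- min_rate p * N) * exp (- N * (w - min_rate p)) = exp (- w * N)"
      by (simp add: algebra_simps flip: exp_add)
    have "(K * N powr (- (q + 1 / 2)) * exp (- min_rate p * N)) * (N * sqrt N) * scaled_integrand p N s \<theta>
      = K * (N powr (- (q + 1 / 2)) * (N * sqrt N) * N powr (q - 1)) * W * (w * (exp (- min_rate p * N) * exp (- N * (w - min_rate p))))"
      unfolding scaled_integrand_def W_def[symmetric] w_def[symmetric] q_def[symmetric] by (simp only: mult_ac)
    also have "\<dots> = W * frechet (1 / (p - 2)) w x"
      unfolding NN e using x by (simp add: frechet_def K_def N mult_ac)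
    finally show ?thesis by (simp add: W_def w_def)
  qed
  have sn: "scaled_integrand p N s \<theta> \<ge> 0" for s \<theta>
    unfolding scaled_integrand_def using mixing_weight_nonneg[OF p] mixing_rate_nonneg by (intro mult_nonneg_nonneg) auto
  let ?F = "\<lambda>b t. ennreal (mixing_weight p b t * frechet (1 / (p - 2)) (mixing_rate p b t) x)"
  have "area_density p x = ennreal \<bar>- 1 / N\<bar> * (\<integral>\<^sup>+s. (\<integral>\<^sup>+t. ?F (1 + (- 1 / N) * s) t \<partial>lborel) \<partial>lborel)"
    unfolding area_density_def using N0 by (intro nn_integral_real_affine) auto
  also have "\<dots> = ennreal \<bar>- 1 / N\<bar> * (\<integral>\<^sup>+s. ennreal \<bar>1 / sqrt N\<bar> * (\<integral>\<^sup>+\<theta>. ?F (1 + (- 1 / N) * s) (0 + (1 / sqrt N) * \<theta>) \<partial>lborel) \<partial>lborel)"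
  proof (intro arg_cong2[where f = "(*)"] refl nn_integral_cong)
    fix s :: real
    show "(\<integral>\<^sup>+t. ?F (1 + (- 1 / N) * s) t \<partial>lborel) = ennreal \<bar>1 / sqrt N\<bar> * (\<integral>\<^sup>+\<theta>. ?F (1 + (- 1 / N) * s) (0 + (1 / sqrt N) * \<theta>) \<partial>lborel)"
      using N0 by (intro nn_integral_real_affine) auto
  qed
  also have "\<dots> = ennreal (1 / N) * (ennreal (1 / sqrt N) * (\<integral>\<^sup>+s. (\<integral>\<^sup>+\<theta>. ?F (1 - s / N) (\<theta> / sqrt N) \<partial>lborel) \<partial>lborel))"
    using N0 by (subst nn_integral_cmult) auto
  also have "(\<integral>\<^sup>+s. (\<integral>\<^sup>+\<theta>. ?F (1 - s / N) (\<theta> / sqrt N) \<partial>lborel) \<partial>lborel) =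
      (\<integral>\<^sup>+s. (\<integral>\<^sup>+\<theta>. ennreal ((K * N powr (- (q + 1 / 2)) * exp (- min_rate p * N)) * (N * sqrt N)) * ennreal (scaled_integrand p N s \<theta>) \<partial>lborel) \<partial>lborel)"
    unfolding point using sn K N0 by (intro nn_integral_cong ennreal_mult) auto
  also have "\<dots> = ennreal ((K * N powr (- (q + 1 / 2)) * exp (- min_rate p * N)) * (N * sqrt N)) * (\<integral>\<^sup>+s. (\<integral>\<^sup>+\<theta>. ennreal (scaled_integrand p N s \<theta>) \<partial>lborel) \<partial>lborel)"
  proof -
    have [measurable]: "(\<lambda>(s, \<theta>). scaled_integrand p N s \<theta>) \<in> borel_measurable (borel \<Otimes>\<^sub>M borel)"
      unfolding scaled_integrand_def by measurable
    show ?thesis by (simp add: nn_integral_cmult)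
  qed
  also have "ennreal (1 / N) * (ennreal (1 / sqrt N) * (ennreal ((K * N powr (- (q + 1 / 2)) * exp (- min_rate p * N)) * (N * sqrt N)) * (\<integral>\<^sup>+s. (\<integral>\<^sup>+\<theta>. ennreal (scaled_integrand p N s \<theta>) \<partial>lborel) \<partial>lborel)))
     = ennreal (K * N powr (- (q + 1 / 2)) * exp (- min_rate p * N)) * (\<integral>\<^sup>+s. (\<integral>\<^sup>+\<theta>. ennreal (scaled_integrand p N s \<theta>) \<partial>lborel) \<partial>lborel)"
    using N0 K by (simp add: mult.assoc [symmetric] ennreal_mult'[symmetric])
  finally show ?thesis unfolding K_def q_def .
qed

section \<open>Closed forms of the constants\<close>

lemma min_rate_closed_form:
  assumes p: "p > 2"
  shows "min_rate p = (p - 2) * p powr (- ((p - 1) / (p - 2)))"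
proof -
  have "4 / p * zolotarev_0 p = p * (p / (p - 2)) powr (p - 2)"
  proof -
    have "1 - 2 / p = (p - 2) / p" using p by (simp add: field_simps)
    hence "1 / (1 - 2 / p) powr (p - 2) = (p / (p - 2)) powr (p - 2)"
      using p by (simp add: powr_divide)
    hence "zolotarev_0 p = p\<^sup>2 / 4 * (p / (p - 2)) powr (p - 2)"
      unfolding zolotarev_0_def using p by (simp add: field_simps)
    thus ?thesis using p by (simp add: power2_eq_square divide_simps mult_ac)
  qed
  hence "min_rate p = p powr (- 1 / (p - 2)) * (p / (p - 2)) powr ((p - 2) * (- 1 / (p - 2)))"
    unfolding min_rate_def by (simp only: powr_mult powr_powr)
  also have "(p - 2) * (- 1 / (p - 2)) = - 1" using p by simp
  also have "(p / (p - 2)) powr (- 1) = (p - 2) * p powr (- 1)"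
    using p by (simp add: powr_minus divide_inverse)
  also have "p powr (- 1 / (p - 2)) * ((p - 2) * p powr (- 1)) = (p - 2) * (p powr (- 1 / (p - 2)) * p powr (- 1))"
    by simp
  also have "p powr (- 1 / (p - 2)) * p powr (- 1) = p powr (- 1 / (p - 2) + - 1)" by (rule powr_add[symmetric])
  also have "- 1 / (p - 2) + - 1 = - ((p - 1) / (p - 2))" using p by (simp add: field_simps)
  finally show ?thesis .
qed

lemma min_rate_eq_c_const:
  assumes "\<alpha> > 1"
  shows "min_rate (\<alpha> + 1) = c_const \<alpha>"
proof -
  have "\<alpha> / (1 - \<alpha>) = - (\<alpha> / (\<alpha> - 1))" using assms by (simp add: field_simps)
  thus ?thesis unfolding c_const_def using min_rate_closed_form[of "\<alpha> + 1"] assms by simp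
qed

text \<open>\<open>Gamma q\<close> cancels against the Beta function and leaves
  \<open>Gamma ((p - 1) / p)\<close>. The powers of \<open>d\<close> combine to \<open>1 / p\<close>
  because \<open>1 - q - 1 / 2 = 1 / p\<close>.\<close>

lemma area_constant_eq_kappa_const:
  assumes \<alpha>: "\<alpha> > 1"
  shows "1 / (\<alpha> - 1) * area_constant (\<alpha> + 1) = kappa_const \<alpha>"
proof -
  define p where "p = \<alpha> + 1"
  define q where "q = (p - 2) / (2 * p)"
  define d where "d = p powr (- ((p - 1) / (p - 2)))"
  have p: "p > 2" using \<alpha> by (simp add: p_def)
  have d: "d > 0" using p by (simp add: d_def)
  have q: "q > 0" "1 / 2 + q = (p - 1) / p" "1 / 2 - q = 1 / p" using p by (auto simp: q_def field_simps)
  have G: "Gamma q > 0" "Gamma ((p - 1) / p) > 0" "Gamma (1 / 2 :: real) = sqrt pi" using q p by (auto simp: Gamma_one_half_real)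
  have c: "min_rate p = (p - 2) * d" unfolding d_def by (rule min_rate_closed_form[OF p])
  have beta: "Beta (1 / 2) q = sqrt pi * Gamma q / Gamma ((p - 1) / p)" unfolding Beta_def q(2) G(3) ..
  have e1: "(min_rate p / (p - 2)) powr (- q) = d powr (- q)" using p by (simp add: c)
  have e2: "(min_rate p / p) powr (- (1 / 2)) = sqrt (p / (p - 2)) * d powr (- (1 / 2))"
  proof -
    have "(min_rate p / p) powr (- (1 / 2)) = ((p - 2) / p) powr (- (1 / 2)) * d powr (- (1 / 2))"
      unfolding c by (simp flip: powr_mult)
    also have "((p - 2) / p) powr (- (1 / 2)) = sqrt (p / (p - 2))"
      using p by (simp add: powr_minus powr_half_sqrt real_sqrt_divide)
    finally show ?thesis .
  qed
  have "d * d powr (- q) * d powr (- (1 / 2)) = d powr (1 + - q + - (1 / 2))" using d by (simp only: powr_add powr_one)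
  also have "1 + - q + - (1 / 2) = 1 / p" using q(3) by simp
  finally have dd: "d * d powr (- q) * d powr (- (1 / 2)) = d powr (1 / p)" .
  have "area_constant p = (p - 2) * d / (sqrt pi * Gamma q / Gamma ((p - 1) / p) * pi) * (Gamma q * d powr (- q)) *
      (sqrt pi * (sqrt (p / (p - 2)) * d powr (- (1 / 2))) / 2)"
    unfolding area_constant_def q_def[symmetric] beta e1 e2 G(3) by (simp only: c)
  also have "\<dots> = (p - 2) * (Gamma ((p - 1) / p) * sqrt (p / (p - 2)) / (2 * pi) * (d * d powr (- q) * d powr (- (1 / 2))))"
  proof -
    have aux: "(p - 2) * d / (r * g / h * pi) * (g * u) * (r * (v * w) / 2) = (p - 2) * (h * v / (2 * pi) * (d * u * w))"
      if "r > 0" "g > 0" "h > 0" for r g h u v w :: real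
      using that by (simp add: field_simps)
    show ?thesis by (rule aux) (use G in auto)
  qed
  finally have "1 / (p - 2) * area_constant p = Gamma ((p - 1) / p) * sqrt (p / (p - 2)) / (2 * pi) * d powr (1 / p)"
    using p unfolding dd by simp
  also have "d powr (1 / p) = 1 / p powr ((p - 1) / (p * (p - 2)))"
  proof -
    have "d powr (1 / p) = p powr (- ((p - 1) / (p - 2)) * (1 / p))" by (simp only: d_def powr_powr)
    also have "- ((p - 1) / (p - 2)) * (1 / p) = - ((p - 1) / (p * (p - 2)))" by (simp add: mult.commute)
    finally show ?thesis by (simp add: powr_minus inverse_eq_divide)
  qed
  finally show ?thesis
    unfolding kappa_const_def by (simp add: p_def algebra_simps power2_eq_square)
qed

definition area_asymptotics :: "real \<Rightarrow> real \<Rightarrow> real" where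
  "area_asymptotics \<alpha> x = kappa_const \<alpha> * x powr (\<alpha>\<^sup>2 / (1 - \<alpha>\<^sup>2)) * exp (- c_const \<alpha> * x powr (1 / (1 - \<alpha>)))"

lemma area_constant_pos:
  assumes "p > 2"
  shows "area_constant p > 0"
proof -
  define q where "q = (p - 2) / (2 * p)"
  have "q > 0" using assms by (simp add: q_def)
  moreover have "Beta (1 / 2) q > 0"
    using \<open>q > 0\<close> by (simp add: Beta_real_pos)
  ultimately show ?thesis unfolding area_constant_def q_def[symmetric]
    using min_rate_pos[OF assms] assms
    by (intro mult_pos_pos divide_pos_pos Gamma_real_pos) (auto simp: powr_gt_zero)
qed

text \<open>For every \<open>x > 0\<close> the ratio equals
  \<open>enn2real (J x) / area_constant p\<close> exactly, so convergence of \<open>J\<close> is all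
  that is at stake. Sequences below 1 suffice, for which the large parameter
  \<open>x powr (- \<rho>)\<close> is at least 1.\<close>

lemma area_density_asymptotics:
  assumes \<alpha>: "1 < \<alpha>" "\<alpha> < 2"
  shows "((\<lambda>x. enn2real (area_density (\<alpha> + 1) x) / area_asymptotics \<alpha> x) \<longlongrightarrow> 1) (at_right 0)"
proof -
  define p where "p = \<alpha> + 1"
  define \<rho> where "\<rho> = 1 / (p - 2)"
  define J where "J = (\<lambda>x. \<integral>\<^sup>+s. (\<integral>\<^sup>+\<theta>. ennreal (scaled_integrand p (x powr (- \<rho>)) s \<theta>) \<partial>lborel) \<partial>lborel)"
  have p: "2 < p" "p < 3" and \<rho>: "\<rho> > 0" using \<alpha> by (auto simp: p_def \<rho>_def)
  have ac: "area_constant p > 0" by (rule area_constant_pos[OF p(1)])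
  have "(J \<longlongrightarrow> ennreal (area_constant p)) (at_right 0)"
  proof (rule tendsto_at_right_sequentially[of 0 1])
    fix S :: "nat \<Rightarrow> real"
    assume S: "\<And>n. 0 < S n" "\<And>n. S n < 1" "S \<longlonglongrightarrow> 0"
    have "filterlim (\<lambda>x. x powr (- \<rho>)) at_top (at_right 0)" using \<rho> by real_asymp
    moreover have "filterlim S (at_right 0) sequentially" using S by (intro tendsto_imp_filterlim_at_right) auto
    ultimately have "filterlim (\<lambda>n. S n powr (- \<rho>)) at_top sequentially" by (rule filterlim_compose)
    moreover have "S n powr (- \<rho>) \<ge> 1" for n
      using powr_mono2'[of "- \<rho>" "S n" 1] S(1)[of n] S(2)[of n] \<rho> by simp
    ultimately show "(\<lambda>n. J (S n)) \<longlonglongrightarrow> ennreal (area_constant p)"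
      unfolding J_def by (rule scaled_integral_tendsto[OF p])
  qed simp
  hence "((\<lambda>x. enn2real (J x)) \<longlongrightarrow> area_constant p) (at_right 0)" using ac by (intro tendsto_enn2real) auto
  hence "((\<lambda>x. enn2real (J x) / area_constant p) \<longlongrightarrow> area_constant p / area_constant p) (at_right 0)"
    using ac by (intro tendsto_divide tendsto_const) auto
  hence lim: "((\<lambda>x. enn2real (J x) / area_constant p) \<longlongrightarrow> 1) (at_right 0)" using ac by simp
  have "enn2real (J x) / area_constant p = enn2real (area_density p x) / area_asymptotics \<alpha> x" if x: "x > 0" for x
  proof -
    define E where "E = exp (- min_rate p * x powr (- \<rho>))"
    define P where "P = x powr (- \<rho> - 1) * (x powr (- \<rho>)) powr (- ((p - 2) / (2 * p) + 1 / 2))"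
    have EP: "E > 0" "P > 0" using x by (auto simp: E_def P_def)
    have "area_density p x = ennreal (1 / (p - 2) * x powr (- \<rho> - 1) * (x powr (- \<rho>)) powr (- ((p - 2) / (2 * p) + 1 / 2)) * E) * J x"
      unfolding J_def E_def \<rho>_def by (rule area_density_scaled[OF p(1) x refl])
    hence dens: "enn2real (area_density p x) = 1 / (p - 2) * P * E * enn2real (J x)"
      using EP p by (simp add: enn2real_mult P_def mult.assoc)
    have "P = x powr (- \<rho> - 1 + - \<rho> * - ((p - 2) / (2 * p) + 1 / 2))"
      unfolding P_def by (simp only: powr_powr powr_add)
    also have "- \<rho> - 1 + - \<rho> * - ((p - 2) / (2 * p) + 1 / 2) = \<alpha>\<^sup>2 / (1 - \<alpha>\<^sup>2)"
    proof -
      have "(p - 2) / (2 * p) + 1 / 2 = \<alpha> / (\<alpha> + 1)" using \<alpha> by (simp add: p_def field_simps)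
      moreover have "\<rho> = 1 / (\<alpha> - 1)" by (simp add: \<rho>_def p_def)
      moreover have "- (1 / (\<alpha> - 1)) - 1 + - (1 / (\<alpha> - 1)) * - (\<alpha> / (\<alpha> + 1)) = \<alpha>\<^sup>2 / (1 - \<alpha>\<^sup>2)"
      proof -
        have "1 - \<alpha>\<^sup>2 = - ((\<alpha> - 1) * (\<alpha> + 1))" by (simp add: algebra_simps power2_eq_square)
        moreover have "\<alpha> - 1 \<noteq> 0" "\<alpha> + 1 \<noteq> 0" using \<alpha> by auto
        ultimately show ?thesis by (simp add: divide_simps power2_eq_square) (simp add: algebra_simps)
      qed
      ultimately show ?thesis by (simp only:)
    qed
    finally have P: "P = x powr (\<alpha>\<^sup>2 / (1 - \<alpha>\<^sup>2))" .
    have E: "E = exp (- c_const \<alpha> * x powr (1 / (1 - \<alpha>)))"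
    proof -
      have "- \<rho> = 1 / (1 - \<alpha>)" using \<alpha> by (simp add: \<rho>_def p_def field_simps)
      thus ?thesis unfolding E_def using min_rate_eq_c_const[OF \<alpha>(1)] by (simp add: p_def)
    qed
    have "area_asymptotics \<alpha> x = 1 / (p - 2) * area_constant p * P * E"
      unfolding area_asymptotics_def P[symmetric] E[symmetric] area_constant_eq_kappa_const[OF \<alpha>(1), symmetric] by (simp add: p_def)
    thus ?thesis unfolding dens using EP p ac by (simp add: field_simps)
  qed
  hence "eventually (\<lambda>x. enn2real (J x) / area_constant p = enn2real (area_density p x) / area_asymptotics \<alpha> x) (at_right 0)"
    by (auto simp: eventually_at_filter)
  from Lim_transform_eventually[OF lim this] show ?thesis by (simp add: p_def)
qed

text \<open>The moment argument identifies the density only almost everywhere. The points near 0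
  where the continuous function strays from \<open>l\<close> by more than \<open>e / 2\<close> form
  an open set of measure zero, which is empty.\<close>

lemma tendsto_of_AE_eq:
  fixes f g :: "real \<Rightarrow> real"
  assumes f: "continuous_on {0<..} f" and eq: "AE x in lborel. f x = g x" and g: "(g \<longlongrightarrow> l) (at_right 0)"
  shows "(f \<longlongrightarrow> l) (at_right 0)"
proof (rule tendstoI)
  fix e :: real assume e: "e > 0"
  hence "eventually (\<lambda>x. dist (g x) l < e / 2) (at_right 0)" by (intro tendstoD[OF g]) auto
  then obtain d where d: "d > 0" "\<And>x. 0 < x \<Longrightarrow> x < d \<Longrightarrow> dist (g x) l < e / 2"
    by (auto simp: eventually_at_right_field)
  define U where "U = {x \<in> {0<..<d}. e / 2 < dist (f x) l}"
  have "continuous_on {0<..<d} (\<lambda>x. dist (f x) l)"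
    by (intro continuous_intros continuous_on_subset[OF f]) auto
  hence "open ((\<lambda>x. dist (f x) l) -` {e / 2<..} \<inter> {0<..<d})"
    by (intro continuous_on_open_vimage[THEN iffD1, rule_format]) auto
  also have "(\<lambda>x. dist (f x) l) -` {e / 2<..} \<inter> {0<..<d} = U" by (auto simp: U_def)
  finally have U: "open U" .
  have "AE x in lborel. x \<notin> U" using eq by eventually_elim (use d(2) in \<open>force simp: U_def\<close>)
  moreover have "U \<in> sets lborel" using U by simp
  ultimately have "U \<in> null_sets lborel" by (subst AE_iff_null_sets) auto
  hence "negligible U" by (simp add: negligible_iff_null_sets null_sets_completionI)
  hence "U = {}" using open_not_negligible[OF U] by blast
  hence "dist (f x) l < e" if "0 < x" "x < d" for x using that e by (force simp: U_def)
  thus "eventually (\<lambda>x. dist (f x) l < e) (at_right 0)"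
    using d(1) by (auto simp: eventually_at_right_field)
qed

theorem corollary4:
  fixes M :: "'a measure" and L :: "real \<Rightarrow> 'a \<Rightarrow> real" and \<alpha> :: real and f :: "real \<Rightarrow> real"
  assumes "1 < \<alpha>" and "\<alpha> < 2"
    and "spectrally_positive_stable_process M 1 L \<alpha>"
    and "distributed M lborel (first_passage_area L) (\<lambda>x. ennreal (f x))"
    and "\<And>x. f x \<ge> 0"
    and "continuous_on {0<..} f"
  shows "f \<sim>[at_right 0]
    (\<lambda>x. kappa_const \<alpha> * x powr (\<alpha>\<^sup>2 / (1 - \<alpha>\<^sup>2)) * exp (- c_const \<alpha> * x powr (1 / (1 - \<alpha>))))"
proof -
  interpret spectrally_positive_stable_process M 1 L \<alpha> by fact
  have p: "2 < \<alpha> + 1" "\<alpha> + 1 < 3" using assms(1,2) by auto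
  let ?A = "first_passage_area L"
  have A: "?A \<in> borel_measurable M" using distributed_measurable[OF assms(4)] by simp
  note laplace = laplace_first_passage_area[OF assms(1,2) zero_less_one A]
  \<comment> \<open>A law with a density has no atom at 0. Together with nonnegativity this makes
    the area positive almost surely, so that negative powers of it make sense.\<close>
  have "AE x in density lborel (\<lambda>x. ennreal (f x)). x \<noteq> 0"
    using AE_lborel_singleton[of 0] distributed_borel_measurable[OF assms(4)] by (subst AE_density) auto
  hence "AE x in distr M lborel ?A. x \<noteq> 0"
    unfolding distributed_distr_eq_density[OF assms(4)] .
  hence "AE \<omega> in M. ?A \<omega> \<noteq> 0" by (subst (asm) AE_distr_iff) (use A in auto)
  moreover have "AE \<omega> in M. ?A \<omega> \<ge> 0" by (rule laplace(2)[OF zero_less_one])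
  ultimately have pos: "AE \<omega> in M. ?A \<omega> > 0" by eventually_elim auto
  have nz: "stable_airy (\<alpha> + 1) (1 / (\<alpha> + 1)) 0 0 \<noteq> 0"
    by (rule stable_airy_0_nonzero[OF p]) (use p in simp)
  have "AE x in lborel. ennreal (f x) = area_density (\<alpha> + 1) x"
  proof (rule density_eq_area_density[OF p prob_space_axioms assms(4) pos])
    fix n :: nat assume "n > 0"
    thus "(\<integral>\<^sup>+\<omega>. ennreal (?A \<omega> powr (- real n)) \<partial>M) = ennreal ((\<alpha> + 1) * Gamma (real n * (\<alpha> + 1)) / Gamma (real n) * (\<Prod>k=1..n. 1 / (real k * (\<alpha> + 1) - 1)))"
      by (intro inverse_moments_of_laplace[OF p A pos nz]) (use laplace(1) in simp_all)
  qed
  hence ae: "AE x in lborel. f x / area_asymptotics \<alpha> x = enn2real (area_density (\<alpha> + 1) x) / area_asymptotics \<alpha> x"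
  proof eventually_elim
    case (elim x)
    thus ?case using assms(5)[of x] by (metis enn2real_ennreal)
  qed
  have h: "area_asymptotics \<alpha> x > 0" if "x > 0" for x
    using that assms(1) area_constant_pos[OF p(1)]
    unfolding area_asymptotics_def area_constant_eq_kappa_const[OF assms(1), symmetric] by simp
  have "continuous_on {0<..} (area_asymptotics \<alpha>)"
    unfolding area_asymptotics_def[abs_def] by (intro continuous_intros) auto
  hence "continuous_on {0<..} (\<lambda>x. f x / area_asymptotics \<alpha> x)"
    using h by (intro continuous_on_divide assms(6)) (auto simp: less_le)
  hence "((\<lambda>x. f x / area_asymptotics \<alpha> x) \<longlongrightarrow> 1) (at_right 0)"
    using ae area_density_asymptotics[OF assms(1,2)] by (rule tendsto_of_AE_eq)
  hence "f \<sim>[at_right 0] area_asymptotics \<alpha>"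
    by (rule asymp_equivI')
  thus ?thesis by (simp only: area_asymptotics_def[abs_def])
qed

end
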